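(* Let $u$ be a weak solution of the Euler-$\alpha$ equations with $u\in L^3((0,T);B^s_{3,\infty}(\mathbb{T}^3))$ with $s>1$. Then $u$ conserves energy, which means that $$\|u(\cdot,t_1)\|_{H^1}=\|u(\cdot,t_2)\|_{H^1}$$ for almost every $t_1,t_2\in(0,T)$.
   Context: Fix $\alpha>0$, $T>0$; $\mathbb{T}^3$ is the flat three-dimensional torus; repeated indices are summed; $\mathcal{D}$ denotes smooth compactly supported functions; $B^s_{3,\infty}$ is the usual Besov space. The $H^1$ norm used is $\|u\|_{H^1}^2=\|u\|_{L^2}^2+\alpha^2\|\nabla u\|_{L^2}^2$. The (inviscid) Euler-$\alpha$ equations are $\partial_t v+\nabla\cdot(u\otimes v)+\sum_{j=1}^3 v_j\nabla u_j+\nabla p=0$, $v=u-\alpha^2\Delta u$, $\nabla\cdot u=\nabla\cdot v=0$. A pair $u\in L^\infty((0,T);H^1(\mathbb{T}^3))$ (vector-valued), $p\in L^\infty((0,T);L^1(\mathbb{T}^3))$ (scalar) is a weak solution if for all $\psi\in\mathcal{D}(\mathbb{T}^3\times(0,T);\mathbb{R}^3)$ and $\chi\in\mathcal{D}(\mathbb{T}^3\times(0,T);\mathbb{R})$ $$\begin{aligned}&\int_0^T\!\!\int_{\mathbb{T}^3}\Big[u\cdot\partial_t\psi+\alpha^2\nabla u:\nabla\partial_t\psi+u_iu_j\partial_i\psi_j+\alpha^2\partial_ku_i\partial_ku_j\partial_i\psi_j+\alpha^2u_i\partial_ku_j\partial_i\partial_k\psi_j\\&\quad-u_j\partial_iu_j\psi_i-\alpha^2\partial_ku_j\partial_iu_j\partial_k\psi_i+\tfrac12\alpha^2\partial_ku_j\partial_ku_j\partial_i\psi_i+p\,\nabla\cdot\psi\Big]dx\,dt=0,\end{aligned}$$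 and $\int_0^T\int_{\mathbb{T}^3}u_i\partial_i\chi\,dx\,dt=0$, with $\int_{\mathbb{T}^3}p(x,t)\,dx=0$. *)

theory Defs
  imports "HOL-Analysis.Analysis"
begin

(* The flat torus is T^3 = R^3 / Z^3. Functions on it are Z^3-periodic functions on R^3,
   integrated over the unit cube. Elements of Lebesgue spaces are represented by functions
   (not by classes modulo null sets); nothing below depends on the representative. *)

type_synonym vec3 = "real ^ 3"

abbreviation torus :: "vec3 measure" where
  "torus \<equiv> lebesgue_on (cbox 0 1)"

definition periodic :: "(vec3 \<Rightarrow> 'b) \<Rightarrow> bool" where
  "periodic f \<longleftrightarrow> (\<forall>x i. f (x + axis i 1) = f x)"

definition Lp :: "real \<Rightarrow> (vec3 \<Rightarrow> 'b::{second_countable_topology,banach}) set" where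
  "Lp p = {f. periodic f \<and> f \<in> borel_measurable torus \<and>
              integrable torus (\<lambda>x. norm (f x) powr p)}"

definition Lp_norm :: "real \<Rightarrow> (vec3 \<Rightarrow> 'b::{second_countable_topology,banach}) \<Rightarrow> real" where
  "Lp_norm p f = (LINT x|torus. norm (f x) powr p) powr (1 / p)"

definition dderiv :: "'a \<Rightarrow> ('a::euclidean_space \<Rightarrow> 'b::real_normed_vector) \<Rightarrow> 'a \<Rightarrow> 'b" where
  "dderiv v f z = frechet_derivative f (at z) v"

(* C^infinity: all iterated directional derivatives exist and are (Frechet) differentiable *)
definition smooth :: "('a::euclidean_space \<Rightarrow> 'b::real_normed_vector) \<Rightarrow> bool" where
  "smooth f \<longleftrightarrow> (\<forall>vs. foldr dderiv vs f differentiable_on UNIV)"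

definition is_weak_deriv :: "3 \<Rightarrow> (vec3 \<Rightarrow> real) \<Rightarrow> (vec3 \<Rightarrow> real) \<Rightarrow> bool" where
  "is_weak_deriv k f g \<longleftrightarrow> f \<in> Lp 1 \<and> g \<in> Lp 1 \<and>
     (\<forall>\<phi>. smooth \<phi> \<and> periodic \<phi> \<longrightarrow>
        (LINT x|torus. f x * dderiv (axis k 1) \<phi> x) = - (LINT x|torus. g x * \<phi> x))"

(* weak_deriv k j f is the weak derivative of the j-th component of f in direction k;
   it is determined up to a null set whenever it exists *)
definition weak_deriv :: "3 \<Rightarrow> 3 \<Rightarrow> (vec3 \<Rightarrow> vec3) \<Rightarrow> vec3 \<Rightarrow> real" where
  "weak_deriv k j f = (SOME g. is_weak_deriv k (\<lambda>x. f x $ j) g)"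

definition H1 :: "(vec3 \<Rightarrow> vec3) set" where
  "H1 = {f \<in> Lp 2. \<forall>k j. \<exists>g \<in> Lp 2. is_weak_deriv k (\<lambda>x. f x $ j) g}"

definition H1_norm :: "real \<Rightarrow> (vec3 \<Rightarrow> vec3) \<Rightarrow> real" where
  "H1_norm \<alpha> f = sqrt ((LINT x|torus. (norm (f x))\<^sup>2)
     + \<alpha>\<^sup>2 * (LINT x|torus. (\<Sum>k\<in>UNIV. \<Sum>j\<in>UNIV. (weak_deriv k j f x)\<^sup>2)))"

(* The Besov space B^s_{p,infinity}, s > 0, defined through the L^p modulus of smoothness
   of order m, where m is the least integer greater than s. *)

definition difference :: "vec3 \<Rightarrow> (vec3 \<Rightarrow> 'b::ab_group_add) \<Rightarrow> vec3 \<Rightarrow> 'b" where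
  "difference h f x = f (x + h) - f x"

definition besov_quotient ::
    "real \<Rightarrow> real \<Rightarrow> (vec3 \<Rightarrow> 'b::{second_countable_topology,banach}) \<Rightarrow> vec3 \<Rightarrow> real" where
  "besov_quotient s p f h =
     Lp_norm p ((difference h ^^ (nat \<lfloor>s\<rfloor> + 1)) f) / norm h powr s"

definition Besov_inf :: "real \<Rightarrow> real \<Rightarrow> (vec3 \<Rightarrow> 'b::{second_countable_topology,banach}) set" where
  "Besov_inf s p = {f \<in> Lp p. bdd_above (besov_quotient s p f ` (- {0}))}"

definition Besov_inf_norm ::
    "real \<Rightarrow> real \<Rightarrow> (vec3 \<Rightarrow> 'b::{second_countable_topology,banach}) \<Rightarrow> real" where
  "Besov_inf_norm s p f = Lp_norm p f + (SUP h\<in>- {0}. besov_quotient s p f h)"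

(* Bochner spaces over (0,T) with values in a function space X normed by N. Strong measurability
   is a.e. approximability in norm by X-valued simple functions. *)

abbreviation time :: "real \<Rightarrow> real measure" where
  "time T \<equiv> lebesgue_on {0<..<T}"

definition strongly_measurable ::
    "real \<Rightarrow> ('a \<Rightarrow> 'b::ab_group_add) set \<Rightarrow> (('a \<Rightarrow> 'b) \<Rightarrow> real) \<Rightarrow> (real \<Rightarrow> 'a \<Rightarrow> 'b) \<Rightarrow> bool" where
  "strongly_measurable T X N f \<longleftrightarrow> (AE t in time T. f t \<in> X) \<and>
     (\<exists>s :: nat \<Rightarrow> real \<Rightarrow> 'a \<Rightarrow> 'b.
        (\<forall>n. simple_function (time T) (s n) \<and> s n ` {0<..<T} \<subseteq> X) \<and>
        (AE t in time T. (\<lambda>n. N (\<lambda>x. s n t x - f t x)) \<longlonglongrightarrow> 0))"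

definition Bochner_Lp ::
    "real \<Rightarrow> real \<Rightarrow> ('a \<Rightarrow> 'b::ab_group_add) set \<Rightarrow> (('a \<Rightarrow> 'b) \<Rightarrow> real) \<Rightarrow> (real \<Rightarrow> 'a \<Rightarrow> 'b) set" where
  "Bochner_Lp p T X N =
     {f. strongly_measurable T X N f \<and> integrable (time T) (\<lambda>t. N (f t) powr p)}"

definition Bochner_Linf ::
    "real \<Rightarrow> ('a \<Rightarrow> 'b::ab_group_add) set \<Rightarrow> (('a \<Rightarrow> 'b) \<Rightarrow> real) \<Rightarrow> (real \<Rightarrow> 'a \<Rightarrow> 'b) set" where
  "Bochner_Linf T X N =
     {f. strongly_measurable T X N f \<and> (\<exists>C. AE t in time T. N (f t) \<le> C)}"

(* D(T^3 x (0,T)): smooth functions of (x,t), periodic in x, supported in T^3 x K for a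
   compact subset K of (0,T), and extended by zero to all times *)
definition test_functions :: "real \<Rightarrow> (vec3 \<times> real \<Rightarrow> 'b::real_normed_vector) set" where
  "test_functions T = {\<psi>. smooth \<psi> \<and> (\<forall>t. periodic (\<lambda>x. \<psi> (x, t))) \<and>
     (\<exists>K. compact K \<and> K \<subseteq> {0<..<T} \<and> (\<forall>x t. t \<notin> K \<longrightarrow> \<psi> (x, t) = 0))}"

definition dx :: "3 \<Rightarrow> (vec3 \<times> real \<Rightarrow> 'b::real_normed_vector) \<Rightarrow> vec3 \<times> real \<Rightarrow> 'b" where
  "dx i = dderiv (axis i 1, 0)"

definition dt :: "(vec3 \<times> real \<Rightarrow> 'b::real_normed_vector) \<Rightarrow> vec3 \<times> real \<Rightarrow> 'b" where
  "dt = dderiv (0, 1)"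

definition weak_integrand ::
    "real \<Rightarrow> (real \<Rightarrow> vec3 \<Rightarrow> vec3) \<Rightarrow> (real \<Rightarrow> vec3 \<Rightarrow> real) \<Rightarrow>
     (vec3 \<times> real \<Rightarrow> vec3) \<Rightarrow> real \<Rightarrow> vec3 \<Rightarrow> real" where
  "weak_integrand \<alpha> u p \<psi> t x =
    (let U = (\<lambda>i. u t x $ i); D = (\<lambda>k j. weak_deriv k j (u t) x); z = (x, t) in
       (\<Sum>i\<in>UNIV. U i * dt \<psi> z $ i)
     + \<alpha>\<^sup>2 * (\<Sum>k\<in>UNIV. \<Sum>j\<in>UNIV. D k j * dx k (dt \<psi>) z $ j)
     + (\<Sum>i\<in>UNIV. \<Sum>j\<in>UNIV. U i * U j * dx i \<psi> z $ j)
     + \<alpha>\<^sup>2 * (\<Sum>i\<in>UNIV. \<Sum>j\<in>UNIV. \<Sum>k\<in>UNIV. D k i * D k j * dx i \<psi> z $ j)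
     + \<alpha>\<^sup>2 * (\<Sum>i\<in>UNIV. \<Sum>j\<in>UNIV. \<Sum>k\<in>UNIV. U i * D k j * dx i (dx k \<psi>) z $ j)
     - (\<Sum>i\<in>UNIV. \<Sum>j\<in>UNIV. U j * D i j * \<psi> z $ i)
     - \<alpha>\<^sup>2 * (\<Sum>i\<in>UNIV. \<Sum>j\<in>UNIV. \<Sum>k\<in>UNIV. D k j * D i j * dx k \<psi> z $ i)
     + 1/2 * \<alpha>\<^sup>2 * (\<Sum>i\<in>UNIV. \<Sum>j\<in>UNIV. \<Sum>k\<in>UNIV. D k j * D k j * dx i \<psi> z $ i)
     + p t x * (\<Sum>i\<in>UNIV. dx i \<psi> z $ i))"

definition euler_alpha_weak_solution ::
    "real \<Rightarrow> real \<Rightarrow> (real \<Rightarrow> vec3 \<Rightarrow> vec3) \<Rightarrow> (real \<Rightarrow> vec3 \<Rightarrow> real) \<Rightarrow> bool" where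
  "euler_alpha_weak_solution \<alpha> T u p \<longleftrightarrow>
     u \<in> Bochner_Linf T H1 (H1_norm \<alpha>) \<and>
     p \<in> Bochner_Linf T (Lp 1) (Lp_norm 1) \<and>
     (\<forall>\<psi> \<in> test_functions T. (LINT t|time T. LINT x|torus. weak_integrand \<alpha> u p \<psi> t x) = 0) \<and>
     (\<forall>\<eta> \<in> test_functions T.
        (LINT t|time T. LINT x|torus. (\<Sum>i\<in>UNIV. u t x $ i * dx i \<eta> (x, t))) = 0) \<and>
     (AE t in time T. (LINT x|torus. p t x) = 0)"

end

theory Submission imports Defs begin

text \<open>
The energy of a weak solution is followed mode by mode and then recovered by summation with a kernel.
Testing the weak formulation with \<open>\<eta>(t) cos (a + 2 \<pi> k \<bullet> x)\<close> in a coordinate direction shows that every Fourier mode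
of \<open>u - \<alpha>\<^sup>2 \<Delta> u\<close> has an integrable weak time derivative. It is therefore absolutely continuous, and its square obeys
the product rule (\<open>weak_derivative_square\<close>, \<open>mode_budget\<close>). Since modes are regular in time, the solution is smoothed in
space only. Linear combinations of the squares give, for every trigonometric kernel \<open>S\<close>, a balance (\<open>trig_budget\<close>)
between \<open>energy \<alpha> S\<close>, which pairs \<open>u\<close> and its gradient with their convolutions by \<open>S\<close>, and the time integral of
\<open>flux \<alpha> S\<close>, the nonlinear terms tested with the convolution of \<open>u\<close> by \<open>S\<close>.

The kernels are the de la Vallee Poussin kernels \<open>vp m\<close>, products of normalized powers of \<open>cos\<^sup>2\<close>. They are trigonometric,
nonnegative and even, and their moments are explicit. As \<open>m\<close> grows, the energy tends to the square of the \<open>H1\<close> norm, so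
it remains to show that the flux tends to zero in \<open>L\<^sup>1\<close> of time (\<open>vp_flux_estimates\<close>).

A Marchaud inequality (\<open>marchaud\<close>) turns Besov regularity of order \<open>s > 1\<close> into a bound \<open>C * norm h\<close> for the cubic
norm of the increment of \<open>u\<close> by \<open>h\<close>; by duality the weak gradient then has a finite cubic norm (\<open>weak_deriv_L3\<close>).
All terms of the flux but one are trilinear in \<open>u\<close>, its gradient and convolutions of these by \<open>vp m\<close>. They are bounded by
Hoelder's inequality and converge, because translations are continuous in the cubic norm. The limits cancel in pairs, and
the pressure and the term with \<open>|\<nabla>u|\<^sup>2\<close> vanish by incompressibility. The remaining term transports the gradient and has a
second derivative on the smoothed field, that is, a derivative of the kernel. This derivative is odd. Antisymmetrizing
moves an increment onto the transporting velocity (\<open>transport_antisymmetric\<close>), and this increment, of order \<open>norm h\<close>,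
compensates for the singularity of the kernel: the first moment of its gradient is bounded uniformly in \<open>m\<close>.
Incompressibility removes the part that does not tend to zero (\<open>transport_limit\<close>). The flux is thus dominated by a
multiple of the cube of the Besov norm, which is integrable in time, and dominated convergence finishes the argument.

Integrals over the torus do not see null sets, but convolutions involve all translates at once. For this reason the fields
at a fixed time are replaced by periodic Borel functions that agree with them off a Lebesgue null set.
\<close>

section \<open>Integration of periodic functions\<close>

definition int_vec :: "vec3 set" where
  "int_vec = {k. \<forall>i. k $ i \<in> \<int>}"

lemma int_vec_uminus: "k \<in> int_vec \<Longrightarrow> - k \<in> int_vec"
  by (simp add: int_vec_def)

lemma int_vec_add: "k \<in> int_vec \<Longrightarrow> l \<in> int_vec \<Longrightarrow> k + l \<in> int_vec"
  by (simp add: int_vec_def)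

lemma int_vec_diff: "k \<in> int_vec \<Longrightarrow> l \<in> int_vec \<Longrightarrow> k - l \<in> int_vec"
  by (simp add: int_vec_def)

lemma periodic_axis_int:
  fixes f :: "vec3 \<Rightarrow> 'b"
  assumes "periodic f"
  shows "f (x + of_int n *\<^sub>R axis i 1) = f x"
proof (induction n arbitrary: x rule: int_induct[where k=0])
  case base
  then show ?case by simp
next
  case (step1 n)
  have "f (x + of_int (n + 1) *\<^sub>R axis i 1) = f ((x + of_int n *\<^sub>R axis i 1) + axis i 1)"
    by (simp add: algebra_simps)
  then show ?case using step1 assms unfolding periodic_def by metis
next
  case (step2 n)
  have "f (x + of_int (n - 1) *\<^sub>R axis i 1) = f ((x + of_int (n - 1) *\<^sub>R axis i 1) + axis i 1)"
    using assms unfolding periodic_def by metis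
  also have "(x + of_int (n - 1) *\<^sub>R axis i 1) + axis i 1 = x + of_int n *\<^sub>R axis i 1"
    by (simp add: algebra_simps)
  finally show ?case using step2 by simp
qed

lemma periodic_int_vec:
  fixes f :: "vec3 \<Rightarrow> 'b"
  assumes f: "periodic f" and k: "k \<in> int_vec"
  shows "f (x + k) = f x"
proof -
  obtain n where n: "\<And>i. k $ i = of_int (n i)"
    using k unfolding int_vec_def Ints_def by (auto simp: image_iff) metis
  have "k = of_int (n 1) *\<^sub>R axis 1 1 + of_int (n 2) *\<^sub>R axis 2 1 + of_int (n 3) *\<^sub>R axis 3 1"
    by (auto simp: vec_eq_iff forall_3 n axis_def)
  then have "f (x + k) = f (((x + of_int (n 1) *\<^sub>R axis 1 1) + of_int (n 2) *\<^sub>R axis 2 1)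
      + of_int (n 3) *\<^sub>R axis 3 1)"
    by (simp only: add.assoc)
  then show ?thesis by (simp only: periodic_axis_int[OF f])
qed

lemma periodic_iff_int_vec:
  "periodic f \<longleftrightarrow> (\<forall>x. \<forall>k\<in>int_vec. f (x + k) = f x)"
proof
  assume "\<forall>x. \<forall>k\<in>int_vec. f (x + k) = f x"
  moreover have "axis i 1 \<in> int_vec" for i :: 3
    by (simp add: int_vec_def axis_def)
  ultimately show "periodic f" by (simp add: periodic_def)
qed (simp add: periodic_int_vec)

lemma periodic_shift:
  fixes f :: "vec3 \<Rightarrow> 'b"
  assumes "periodic f" shows "periodic (\<lambda>x. f (x + h))"
  using assms unfolding periodic_def by (metis add.assoc add.commute)

lemma periodic_shift_diff:
  fixes f :: "vec3 \<Rightarrow> 'b"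
  assumes "periodic f" shows "periodic (\<lambda>x. f (x - h))"
  using periodic_shift[OF assms, of "-h"] by simp

lemma periodic_reflect:
  fixes f :: "vec3 \<Rightarrow> 'b"
  assumes "periodic f" shows "periodic (\<lambda>x. f (a - x))"
  unfolding periodic_iff_int_vec
proof (intro allI ballI)
  fix x k assume k: "k \<in> int_vec"
  have "f (a - (x + k)) = f ((a - x) + - k)" by (simp add: algebra_simps)
  then show "f (a - (x + k)) = f (a - x)"
    using periodic_int_vec[OF assms int_vec_uminus[OF k]] by metis
qed

definition frac_vec :: "vec3 \<Rightarrow> vec3" where
  "frac_vec x = (\<chi> i. frac (x $ i))"

definition floor_vec :: "vec3 \<Rightarrow> vec3" where
  "floor_vec x = (\<chi> i. of_int \<lfloor>x $ i\<rfloor>)"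

lemma floor_vec_int: "floor_vec x \<in> int_vec"
  by (simp add: floor_vec_def int_vec_def)

lemma frac_vec_eq: "frac_vec x = x + - floor_vec x"
  by (simp add: vec_eq_iff frac_vec_def floor_vec_def frac_def)

lemma frac_vec_cube: "frac_vec x \<in> cbox 0 1"
  by (simp add: mem_box_cart frac_vec_def less_imp_le[OF frac_lt_1])

lemma periodic_frac_vec:
  fixes f :: "vec3 \<Rightarrow> 'b"
  assumes "periodic f" shows "f (frac_vec x) = f x"
  using periodic_int_vec[OF assms int_vec_uminus[OF floor_vec_int]] frac_vec_eq by metis

lemma borel_frac_vec [measurable]: "frac_vec \<in> borel_measurable borel"
proof -
  have "(\<lambda>x::vec3. \<Sum>i\<in>UNIV. (x $ i - of_int \<lfloor>x $ i\<rfloor>) *\<^sub>R axis i (1::real)) \<in> borel_measurable borel"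
    by measurable
  moreover have "frac_vec = (\<lambda>x. \<Sum>i\<in>UNIV. (x $ i - of_int \<lfloor>x $ i\<rfloor>) *\<^sub>R axis i (1::real))"
    by (auto simp: fun_eq_iff vec_eq_iff frac_vec_def frac_def sum_3 axis_def forall_3)
  ultimately show ?thesis by simp
qed

lemma countable_int_vec: "countable int_vec"
proof -
  have "int_vec \<subseteq> range (\<lambda>n::int^3. \<chi> i. of_int (n $ i))"
  proof
    fix k assume "k \<in> int_vec"
    then obtain n where "\<And>i. k $ i = of_int (n i)"
      unfolding int_vec_def Ints_def by (auto simp: image_iff) metis
    then have "k = (\<chi> i. of_int ((\<chi> i. n i) $ i))" by (simp add: vec_eq_iff)
    then show "k \<in> range (\<lambda>n::int^3. \<chi> i. of_int (n $ i))" by blast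
  qed
  then show ?thesis by (rule countable_subset) simp
qed

abbreviation half_cube :: "vec3 set" where
  "half_cube \<equiv> {x. \<forall>i. 0 \<le> x $ i \<and> x $ i < 1}"

lemma half_cube_borel [measurable]: "half_cube \<in> sets borel"
  by measurable

lemma half_cube_frac: "x - k \<in> half_cube \<and> k \<in> int_vec \<longleftrightarrow> k = floor_vec x"
proof
  assume a: "x - k \<in> half_cube \<and> k \<in> int_vec"
  have "k $ i = of_int \<lfloor>x $ i\<rfloor>" for i
  proof -
    have "k $ i \<in> \<int>" using a by (simp add: int_vec_def)
    then obtain n where n: "k $ i = of_int n" by (elim Ints_cases)
    have "0 \<le> x $ i - k $ i" "x $ i - k $ i < 1" using a by simp_all
    then have "\<lfloor>x $ i\<rfloor> = n" unfolding n by linarith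
    then show ?thesis by (simp add: n)
  qed
  then show "k = floor_vec x"
    by (simp add: vec_eq_iff floor_vec_def)
next
  assume k: "k = floor_vec x"
  have "0 \<le> x $ i - of_int \<lfloor>x $ i\<rfloor> \<and> x $ i - of_int \<lfloor>x $ i\<rfloor> < 1" for i
    by linarith
  then show "x - k \<in> half_cube \<and> k \<in> int_vec"
    using k floor_vec_int by (simp add: floor_vec_def)
qed

lemma sum_half_cube: "(\<integral>\<^sup>+k. indicator half_cube (x - k) \<partial>count_space int_vec) = 1"
proof -
  have "(\<integral>\<^sup>+k. indicator half_cube (x - k) \<partial>count_space int_vec)
      = (\<integral>\<^sup>+k. indicator {floor_vec x} k \<partial>count_space int_vec)"
    by (intro nn_integral_cong) (use half_cube_frac[of x] in \<open>auto simp: indicator_def\<close>)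
  also have "\<dots> = 1"
    by (subst nn_integral_indicator) (auto simp: floor_vec_int)
  finally show ?thesis .
qed

lemma nn_integral_lborel_shift:
  fixes f :: "'a::euclidean_space \<Rightarrow> ennreal"
  assumes [measurable]: "f \<in> borel_measurable borel"
  shows "(\<integral>\<^sup>+x. f (x + c) \<partial>lborel) = (\<integral>\<^sup>+x. f x \<partial>lborel)"
proof -
  have "(\<integral>\<^sup>+x. f x \<partial>lborel) = (\<integral>\<^sup>+x. f x \<partial>distr lborel borel ((+) c))"
    by (simp add: lborel_distr_plus)
  also have "\<dots> = (\<integral>\<^sup>+x. f (c + x) \<partial>lborel)"
    by (subst nn_integral_distr) auto
  finally show ?thesis by (simp add: add.commute)
qed

text \<open>Cut \<open>half_cube + h\<close> into its intersections with the integer translates of \<open>half_cube\<close>,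
  and move each piece back; the pieces tile the cube again.\<close>

lemma nn_integral_half_cube_shift:
  fixes f :: "vec3 \<Rightarrow> ennreal"
  assumes [measurable]: "f \<in> borel_measurable borel" and f: "periodic f"
  shows "(\<integral>\<^sup>+x. f (x + h) * indicator half_cube x \<partial>lborel) = (\<integral>\<^sup>+x. f x * indicator half_cube x \<partial>lborel)"
    (is "?l = ?r")
proof -
  have [measurable]: "(\<lambda>x. indicator half_cube (x - k) :: ennreal) \<in> borel_measurable borel" for k
    by measurable
  have "?l = (\<integral>\<^sup>+x. f ((x - h) + h) * indicator half_cube (x - h) \<partial>lborel)"
    using nn_integral_lborel_shift[of "\<lambda>x. f (x + h) * indicator half_cube x" "-h"] by simp
  also have "\<dots> = (\<integral>\<^sup>+x. (\<integral>\<^sup>+k. f x * indicator half_cube (x - h) * indicator half_cube (x - k) \<partial>count_space int_vec) \<partial>lborel)"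
    by (simp add: nn_integral_cmult sum_half_cube)
  also have "\<dots> = (\<integral>\<^sup>+k. (\<integral>\<^sup>+x. f x * indicator half_cube (x - h) * indicator half_cube (x - k) \<partial>lborel) \<partial>count_space int_vec)"
    by (rule nn_integral_count_space_nn_integral[OF countable_int_vec]) measurable
  also have "\<dots> = (\<integral>\<^sup>+k. (\<integral>\<^sup>+x. f x * indicator half_cube (x + k - h) * indicator half_cube x \<partial>lborel) \<partial>count_space int_vec)"
  proof (rule nn_integral_cong)
    fix k assume "k \<in> space (count_space int_vec)"
    then have k: "k \<in> int_vec" by simp
    have "(\<integral>\<^sup>+x. f x * indicator half_cube (x - h) * indicator half_cube (x - k) \<partial>lborel)
       = (\<integral>\<^sup>+x. f (x + k) * indicator half_cube (x + k - h) * indicator half_cube (x + k - k) \<partial>lborel)"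
      by (rule nn_integral_lborel_shift[symmetric]) measurable
    then show "(\<integral>\<^sup>+x. f x * indicator half_cube (x - h) * indicator half_cube (x - k) \<partial>lborel)
       = (\<integral>\<^sup>+x. f x * indicator half_cube (x + k - h) * indicator half_cube x \<partial>lborel)"
      by (simp add: periodic_int_vec[OF f k])
  qed
  also have "\<dots> = (\<integral>\<^sup>+x. (\<integral>\<^sup>+k. f x * indicator half_cube x * indicator half_cube (x + k - h) \<partial>count_space int_vec) \<partial>lborel)"
    by (subst nn_integral_count_space_nn_integral[OF countable_int_vec]) (auto simp: ac_simps)
  also have "\<dots> = (\<integral>\<^sup>+x. f x * indicator half_cube x * (\<integral>\<^sup>+k. indicator half_cube (x + k - h) \<partial>count_space int_vec) \<partial>lborel)"
    by (simp add: nn_integral_cmult)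
  also have "\<dots> = ?r"
  proof (intro nn_integral_cong)
    fix x
    have "(\<integral>\<^sup>+k. indicator half_cube (x + k - h) \<partial>count_space int_vec)
       = (\<integral>\<^sup>+k. (indicator half_cube (x + - k - h)::ennreal) \<partial>count_space int_vec)"
      by (rule nn_integral_bij_count_space[symmetric, where g=uminus and f="\<lambda>k. indicator half_cube (x + k - h)"])
         (auto simp: bij_betw_def inj_on_def image_iff int_vec_uminus, metis int_vec_uminus minus_minus)
    also have "\<dots> = 1"
      using sum_half_cube[of "x - h"] by (simp add: algebra_simps)
    finally show "f x * indicator half_cube x * (\<integral>\<^sup>+k. indicator half_cube (x + k - h) \<partial>count_space int_vec) = f x * indicator half_cube x"
      by simp
  qed
  finally show ?thesis .
qed

lemma AE_half_cube: "AE x in lborel. indicator half_cube x = (indicator (cbox 0 1) x :: ennreal)"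
proof -
  have n: "cbox 0 1 - box 0 (1::vec3) \<in> null_sets lborel"
    using negligible_frontier_interval[of 0 "1::vec3"]
    by (simp add: negligible_iff_null_sets null_sets_completion_iff)
  show ?thesis
  proof (rule AE_I'[OF n])
    have "half_cube \<subseteq> cbox (0::vec3) 1" "box (0::vec3) 1 \<subseteq> half_cube"
      by (auto simp: mem_box_cart less_imp_le)
    then show "{x \<in> space lborel. indicator half_cube x \<noteq> (indicator (cbox 0 1) x :: ennreal)} \<subseteq> cbox 0 1 - box 0 (1::vec3)"
      unfolding indicator_def by (auto split: if_splits)
  qed
qed

lemma measurable_torus:
  "f \<in> borel_measurable borel \<Longrightarrow> f \<in> borel_measurable torus"
  by (simp add: borel_measurable_if_I measurable_completion measurable_restrict_space1)

lemma nn_integral_torus: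
  assumes [measurable]: "f \<in> borel_measurable borel"
  shows "(\<integral>\<^sup>+x. f x \<partial>torus) = (\<integral>\<^sup>+x. f x * indicator half_cube x \<partial>lborel)"
proof -
  have "(\<integral>\<^sup>+x. f x \<partial>torus) = (\<integral>\<^sup>+x. f x * indicator (cbox 0 1) x \<partial>lborel)"
    by (subst nn_integral_restrict_space) (auto simp: nn_integral_completion)
  also have "\<dots> = (\<integral>\<^sup>+x. f x * indicator half_cube x \<partial>lborel)"
    by (rule nn_integral_cong_AE) (use AE_half_cube in \<open>auto\<close>)
  finally show ?thesis .
qed

lemma nn_integral_torus_shift:
  fixes f :: "vec3 \<Rightarrow> ennreal"
  assumes [measurable]: "f \<in> borel_measurable borel" and "periodic f"
  shows "(\<integral>\<^sup>+x. f (x + h) \<partial>torus) = (\<integral>\<^sup>+x. f x \<partial>torus)"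
proof -
  have "(\<integral>\<^sup>+x. f (x + h) \<partial>torus) = (\<integral>\<^sup>+x. f (x + h) * indicator half_cube x \<partial>lborel)"
    by (rule nn_integral_torus[of "\<lambda>x. f (x + h)"]) simp
  also have "\<dots> = (\<integral>\<^sup>+x. f x * indicator half_cube x \<partial>lborel)"
    by (rule nn_integral_half_cube_shift[of f h]) fact+
  also have "\<dots> = (\<integral>\<^sup>+x. f x \<partial>torus)"
    by (rule nn_integral_torus[of f, symmetric]) simp
  finally show ?thesis .
qed

lemma lborel_distr_reflect: "lborel = distr lborel borel (\<lambda>x::vec3. 1 - x)"
proof -
  have "lborel = density (distr lborel borel (\<lambda>x::vec3. 1 + (-1) *\<^sub>R x)) (\<lambda>_. \<bar>- 1 :: real\<bar> ^ DIM(vec3))"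
    by (rule lborel_affine) simp
  also have "\<dots> = distr lborel borel (\<lambda>x::vec3. 1 - x)"
    by (simp add: density_1)
  finally show ?thesis .
qed

lemma nn_integral_cube_reflect:
  fixes f :: "vec3 \<Rightarrow> ennreal"
  assumes f [measurable]: "f \<in> borel_measurable borel"
  shows "(\<integral>\<^sup>+x. f (1 - x) \<partial>torus) = (\<integral>\<^sup>+x. f x \<partial>torus)"
proof -
  let ?F = "\<lambda>x. f x * indicator (cbox 0 1) x"
  have ind: "indicator (cbox 0 1) (1 - x) = (indicator (cbox 0 1) x :: ennreal)" for x :: vec3
    by (simp add: indicator_def mem_box_cart) meson
  have nt: "(\<integral>\<^sup>+x. g x \<partial>torus) = (\<integral>\<^sup>+x. g x * indicator (cbox 0 1) x \<partial>lborel)" for g :: "vec3 \<Rightarrow> ennreal"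
    by (subst nn_integral_restrict_space) (auto simp: nn_integral_completion)
  have "(\<integral>\<^sup>+x. f x \<partial>torus) = nn_integral lborel ?F"
    by (rule nt)
  also have "\<dots> = nn_integral (distr lborel borel (\<lambda>x::vec3. 1 - x)) ?F"
    by (rule arg_cong[where f="\<lambda>M. nn_integral M ?F", OF lborel_distr_reflect])
  also have "\<dots> = (\<integral>\<^sup>+x. ?F (1 - x) \<partial>lborel)"
  proof (rule nn_integral_distr)
    show "?F \<in> borel_measurable (distr lborel borel (\<lambda>x::vec3. 1 - x))" by simp
  qed simp
  also have "\<dots> = (\<integral>\<^sup>+x. f (1 - x) \<partial>torus)"
    by (simp only: nt ind)
  finally show ?thesis ..
qed

lemma nn_integral_torus_reflect:
  fixes f :: "vec3 \<Rightarrow> ennreal"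
  assumes f: "f \<in> borel_measurable borel" "periodic f"
  shows "(\<integral>\<^sup>+x. f (a - x) \<partial>torus) = (\<integral>\<^sup>+x. f x \<partial>torus)"
proof -
  have m: "(\<lambda>x. f (c - x)) \<in> borel_measurable borel" for c
    by (rule measurable_compose[OF _ f(1)]) simp
  have "(\<integral>\<^sup>+x. f (a - x) \<partial>torus) = (\<integral>\<^sup>+x. f (a - (x + (a - 1))) \<partial>torus)"
    by (rule nn_integral_torus_shift[of "\<lambda>x. f (a - x)" "a - 1", symmetric])
       (rule m, rule periodic_reflect[OF f(2)])
  also have "\<dots> = (\<integral>\<^sup>+x. f (1 - x) \<partial>torus)"
    by (simp add: diff_diff_eq2 algebra_simps)
  also have "\<dots> = (\<integral>\<^sup>+x. f x \<partial>torus)"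
    by (rule nn_integral_cube_reflect[OF f(1)])
  finally show ?thesis .
qed

lemma periodic_comp:
  fixes f :: "vec3 \<Rightarrow> 'b"
  shows "periodic f \<Longrightarrow> periodic (\<lambda>x. g (f x))"
  by (simp add: periodic_def)

lemma periodic_comp2:
  fixes f :: "vec3 \<Rightarrow> 'b" and g :: "vec3 \<Rightarrow> 'c"
  shows "periodic f \<Longrightarrow> periodic g \<Longrightarrow> periodic (\<lambda>x. F (f x) (g x))"
  by (simp add: periodic_def)

text \<open>The positive and the negative part of a real function are nonnegative functions, to which the hypothesis applies.\<close>

lemma integral_torus_transfer:
  fixes f :: "vec3 \<Rightarrow> real"
  assumes nn: "\<And>f :: vec3 \<Rightarrow> ennreal. f \<in> borel_measurable borel \<Longrightarrow> periodic f \<Longrightarrow>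
      (\<integral>\<^sup>+x. f (\<theta> x) \<partial>torus) = (\<integral>\<^sup>+x. f x \<partial>torus)"
    and [measurable]: "\<theta> \<in> borel_measurable borel"
    and [measurable]: "f \<in> borel_measurable borel" and f: "periodic f"
  shows "integrable torus (\<lambda>x. f (\<theta> x)) \<longleftrightarrow> integrable torus f"
    and "(LINT x|torus. f (\<theta> x)) = (LINT x|torus. f x)"
proof -
  have n: "(\<integral>\<^sup>+x. ennreal (F (f (\<theta> x))) \<partial>torus) = (\<integral>\<^sup>+x. ennreal (F (f x)) \<partial>torus)"
    if [measurable]: "F \<in> borel_measurable borel" for F
    by (rule nn[of "\<lambda>x. ennreal (F (f x))"]) (use f in \<open>auto intro: periodic_comp[where g="\<lambda>x. ennreal (F x)"]\<close>)
  show *: "integrable torus (\<lambda>x. f (\<theta> x)) \<longleftrightarrow> integrable torus f"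
    unfolding integrable_iff_bounded using n[of norm] measurable_torus[of f]
      measurable_torus[OF measurable_compose[OF assms(2,3)]] by simp
  show "(LINT x|torus. f (\<theta> x)) = (LINT x|torus. f x)"
  proof (cases "integrable torus f")
    case True
    then show ?thesis
      using n[of "\<lambda>x. x"] n[of "\<lambda>x. -x"] * by (simp add: real_lebesgue_integral_def)
  next
    case False
    then show ?thesis using * by (simp add: not_integrable_integral_eq)
  qed
qed

text \<open>The class of functions to which changes of variables, convolutions and Fubini's theorem apply without further
  measurability conditions.\<close>

definition pborel :: "(vec3 \<Rightarrow> real) \<Rightarrow> bool" where
  "pborel f \<longleftrightarrow> periodic f \<and> f \<in> borel_measurable borel"

lemma pborelD [dest]: "pborel f \<Longrightarrow> periodic f" "pborel f \<Longrightarrow> f \<in> borel_measurable borel"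
  by (auto simp: pborel_def)

lemma torus_shift:
  assumes "pborel f"
  shows "integrable torus (\<lambda>x. f (x + h)) \<longleftrightarrow> integrable torus f"
    and "(LINT x|torus. f (x + h)) = (LINT x|torus. f x)"
  using integral_torus_transfer[OF nn_integral_torus_shift, of h f] assms by auto

lemma torus_shift_diff:
  assumes "pborel f"
  shows "integrable torus (\<lambda>x. f (x - h)) \<longleftrightarrow> integrable torus f"
    and "(LINT x|torus. f (x - h)) = (LINT x|torus. f x)"
  using torus_shift[OF assms, of "-h"] by simp_all

lemma torus_reflect:
  assumes "pborel f"
  shows "integrable torus (\<lambda>x. f (a - x)) \<longleftrightarrow> integrable torus f"
    and "(LINT x|torus. f (a - x)) = (LINT x|torus. f x)"
  using integral_torus_transfer[OF nn_integral_torus_reflect, of a f] assms by auto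

lemma finite_measure_torus: "finite_measure torus"
  by (rule finite_measureI) (use emeasure_lborel_cbox_finite[of 0 "1::vec3"] in \<open>simp add: emeasure_restrict_space less_top\<close>)

interpretation torus: finite_measure torus
  by (rule finite_measure_torus)

interpretation torus2: pair_sigma_finite torus torus
  by unfold_locales

lemma measure_torus: "measure torus (space torus) = 1"
  by (simp add: measure_restrict_space content_cbox_cart interval_ne_empty_cart)

text \<open>Lebesgue measurable functions do not lift to Borel functions on the product of two tori, where convolutions live.
  A Borel version on the cube is extended by composition with \<open>frac_vec\<close>. The exceptional set lies in the
  countably many integer translates of a null set.\<close>

lemma borel_representative:
  fixes f :: "vec3 \<Rightarrow> real"
  assumes f: "periodic f" "f \<in> borel_measurable torus"
  obtains g N where "pborel g" "N \<in> null_sets lborel" "\<And>x. x \<notin> N \<Longrightarrow> f x = g x"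
proof -
  have "(\<lambda>x. if x \<in> cbox 0 1 then f x else 0) \<in> borel_measurable lebesgue"
    using f by (simp add: borel_measurable_if)
  then obtain g where g: "g \<in> borel_measurable lborel"
      "AE x in lborel. (if x \<in> cbox 0 1 then f x else 0) = g x"
    using completion_ex_borel_measurable_real by blast
  then obtain N where N: "N \<in> null_sets lborel"
      "\<And>x. x \<notin> N \<Longrightarrow> (if x \<in> cbox 0 1 then f x else 0) = g x"
    by (auto elim!: AE_E3)
  define N' where "N' = {x. frac_vec x \<in> N}"
  have Nb [measurable]: "N \<in> sets borel" using N by (simp add: null_sets_def)
  have "(\<Union>k\<in>int_vec. (+) k ` N) \<in> null_sets lborel"
  proof (rule null_sets_UN'[OF countable_int_vec])
    fix k :: vec3
    have "(+) k ` N = {x. x - k \<in> N}" by (force simp: image_iff)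
    then show "(+) k ` N \<in> null_sets lborel"
      using null_sets_translation[OF N(1), of k] by simp
  qed
  moreover have "N' \<subseteq> (\<Union>k\<in>int_vec. (+) k ` N)"
  proof
    fix x assume "x \<in> N'"
    then have "frac_vec x \<in> N" "x = floor_vec x + frac_vec x"
      by (simp_all add: N'_def frac_vec_eq)
    then show "x \<in> (\<Union>k\<in>int_vec. (+) k ` N)" using floor_vec_int by blast
  qed
  moreover have "N' \<in> sets borel" unfolding N'_def by measurable
  ultimately have N': "N' \<in> null_sets lborel"
    by (metis null_sets_subset sets_lborel)
  show thesis
  proof (rule that)
    have "frac_vec (x + axis i 1) = frac_vec x" for x i
      by (auto simp: vec_eq_iff frac_vec_def axis_def frac_1_eq)
    then show "pborel (\<lambda>x. g (frac_vec x))"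
      using g(1) by (auto simp: pborel_def periodic_def)
    show "f x = g (frac_vec x)" if "x \<notin> N'" for x
      using N(2)[of "frac_vec x"] that frac_vec_cube[of x] periodic_frac_vec[OF f(1), of x]
      by (simp add: N'_def)
  qed (rule N')
qed

lemma null_AE_torus:
  assumes N: "N \<in> null_sets lborel" shows "AE x in torus. x + h \<notin> N"
proof -
  have "{x. x + h \<in> N} \<in> null_sets lebesgue"
    using null_sets_translation[OF N, of "-h"] by (simp add: null_sets_completionI)
  then have "AE x in lebesgue. x + h \<notin> N"
    by (rule AE_I') auto
  then show ?thesis
    by (subst AE_restrict_space_iff) auto
qed

section \<open>Convolutions and continuity of translations\<close>

lemma measurable_torus_pair:
  "f \<in> borel_measurable (borel \<Otimes>\<^sub>M borel) \<Longrightarrow> f \<in> borel_measurable (torus \<Otimes>\<^sub>M torus)"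
proof -
  assume f: "f \<in> borel_measurable (borel \<Otimes>\<^sub>M borel)"
  have [measurable]: "(\<lambda>x. x) \<in> torus \<rightarrow>\<^sub>M borel"
    using measurable_torus[of "\<lambda>x. x"] by simp
  have "(\<lambda>p. (fst p, snd p)) \<in> torus \<Otimes>\<^sub>M torus \<rightarrow>\<^sub>M borel \<Otimes>\<^sub>M borel"
  proof (rule measurable_Pair)
    show "fst \<in> torus \<Otimes>\<^sub>M torus \<rightarrow>\<^sub>M borel"
      by (rule measurable_compose[OF measurable_fst]) measurable
    show "snd \<in> torus \<Otimes>\<^sub>M torus \<rightarrow>\<^sub>M borel"
      by (rule measurable_compose[OF measurable_snd]) measurable
  qed
  from measurable_compose[OF this f] show ?thesis by simp
qed

lemma borel_pair_shift:
  fixes f :: "vec3 \<Rightarrow> 'b::topological_space"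
  assumes [measurable]: "f \<in> borel_measurable borel"
  shows "(\<lambda>p. f (fst p - snd p)) \<in> borel_measurable (borel \<Otimes>\<^sub>M borel)"
  by measurable

lemma pborel_comp:
  assumes "pborel f" "g \<in> borel_measurable borel"
  shows "pborel (\<lambda>x. g (f x))"
  using assms by (auto simp: pborel_def intro: periodic_comp measurable_compose)

lemma integrable_pair_shift:
  assumes f: "pborel f" "integrable torus f"
  shows "integrable (torus \<Otimes>\<^sub>M torus) (\<lambda>p. f (fst p - snd p))"
proof (rule torus2.Fubini_integrable)
  have fb: "f \<in> borel_measurable borel" using f by auto
  show "(\<lambda>p. f (fst p - snd p)) \<in> borel_measurable (torus \<Otimes>\<^sub>M torus)"
    by (rule measurable_torus_pair, rule borel_pair_shift[OF fb])
  have r: "(LINT h|torus. norm (f (x - h))) = (LINT h|torus. norm (f h))" for x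
    by (rule torus_reflect(2)[of "\<lambda>h. norm (f h)"])
       (use pborel_comp[OF f(1), of norm] in simp)
  show "integrable torus (\<lambda>x. LINT h|torus. norm (f (fst (x, h) - snd (x, h))))"
    using torus.integrable_const by (simp only: r fst_conv snd_conv)
  show "AE x in torus. integrable torus (\<lambda>h. f (fst (x, h) - snd (x, h)))"
    using torus_reflect(1)[OF f(1)] f(2) by simp
qed

lemma integrable_pair_fst:
  fixes f :: "vec3 \<Rightarrow> real"
  assumes f: "f \<in> borel_measurable borel" "integrable torus f"
  shows "integrable (torus \<Otimes>\<^sub>M torus) (\<lambda>p. f (fst p))"
proof (rule torus2.Fubini_integrable)
  show "(\<lambda>p. f (fst p)) \<in> borel_measurable (torus \<Otimes>\<^sub>M torus)"
    by (rule measurable_torus_pair) (use f in measurable)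
qed (use f in auto)

definition conv :: "(vec3 \<Rightarrow> real) \<Rightarrow> (vec3 \<Rightarrow> real) \<Rightarrow> vec3 \<Rightarrow> real" where
  "conv S w x = (LINT y|torus. S (x - y) * w y)"

lemma conv_commute:
  assumes S: "pborel S" and w: "pborel w"
  shows "conv S w x = (LINT h|torus. S h * w (x - h))"
proof -
  have "pborel (\<lambda>h. S h * w (x - h))"
    using S w unfolding pborel_def
    by (intro conjI periodic_comp2[where F="(*)"] periodic_reflect borel_measurable_times measurable_compose[where f="\<lambda>h. x - h" and g=w])
       auto
  from torus_reflect(2)[OF this, of x] show ?thesis by (simp add: conv_def)
qed

text \<open>The change of order of integration on which every estimate below rests: the inner integral
  over \<open>x\<close> on the right only sees the translation by \<open>h\<close>.\<close>

lemma conv_Fubini: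
  assumes S: "pborel S" and w: "pborel w" and a: "a \<in> borel_measurable borel"
    and A: "A \<in> borel_measurable borel" "integrable torus A" and B: "pborel B" "integrable torus B"
    and bound: "\<And>x h. \<bar>S h * a x * w (x - h)\<bar> \<le> A x + B (x - h)"
  shows "integrable (torus \<Otimes>\<^sub>M torus) (\<lambda>p. S (snd p) * a (fst p) * w (fst p - snd p))"
    and "(LINT x|torus. a x * conv S w x) = (LINT h|torus. S h * (LINT x|torus. a x * w (x - h)))"
    and "integrable torus (\<lambda>x. a x * conv S w x)"
    and "integrable torus (\<lambda>h. S h * (LINT x|torus. a x * w (x - h)))"
proof -
  have [measurable]: "S \<in> borel_measurable borel" "w \<in> borel_measurable borel" "a \<in> borel_measurable borel"
    using S w a by auto
  let ?F = "\<lambda>p. S (snd p) * a (fst p) * w (fst p - snd p)"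
  show I: "integrable (torus \<Otimes>\<^sub>M torus) ?F"
  proof (rule Bochner_Integration.integrable_bound)
    show "integrable (torus \<Otimes>\<^sub>M torus) (\<lambda>p. A (fst p) + B (fst p - snd p))"
      by (intro Bochner_Integration.integrable_add integrable_pair_fst integrable_pair_shift A B)
    show "?F \<in> borel_measurable (torus \<Otimes>\<^sub>M torus)"
      by (rule measurable_torus_pair) measurable
    show "AE p in torus \<Otimes>\<^sub>M torus. norm (?F p) \<le> norm (A (fst p) + B (fst p - snd p))"
      using bound by (auto intro!: AE_I2 order_trans[OF _ abs_ge_self])
  qed
  have c: "a x * conv S w x = (LINT h|torus. S h * a x * w (x - h))" for x
    unfolding conv_commute[OF S w] by (simp flip: integral_mult_right_zero add: ac_simps)
  have s: "S h * (LINT x|torus. a x * w (x - h)) = (LINT x|torus. S h * a x * w (x - h))" for h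
    by (simp flip: integral_mult_right_zero add: ac_simps)
  show "(LINT x|torus. a x * conv S w x) = (LINT h|torus. S h * (LINT x|torus. a x * w (x - h)))"
    unfolding c s using torus2.Fubini_integral[of "\<lambda>x h. S h * a x * w (x - h)"] I
    by (simp add: case_prod_beta')
  show "integrable torus (\<lambda>x. a x * conv S w x)"
    unfolding c using torus2.integrable_fst'[OF I] by simp
  show "integrable torus (\<lambda>h. S h * (LINT x|torus. a x * w (x - h)))"
    unfolding s using torus2.integrable_snd[of "\<lambda>x h. S h * a x * w (x - h)"] I
    by (simp add: case_prod_beta')
qed

definition PL :: "nat \<Rightarrow> (vec3 \<Rightarrow> real) \<Rightarrow> bool" where
  "PL n f \<longleftrightarrow> pborel f \<and> integrable torus (\<lambda>x. \<bar>f x\<bar> ^ n)"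

lemma pborel_shift_diff: "pborel f \<Longrightarrow> pborel (\<lambda>x. f (x - h))"
  by (auto simp: pborel_def intro: periodic_shift_diff measurable_compose[where f="\<lambda>x. x - h" and g=f])

lemma pborel_add: "pborel f \<Longrightarrow> pborel g \<Longrightarrow> pborel (\<lambda>x. f x + g x)"
  by (auto simp: pborel_def intro: periodic_comp2)

lemma pborel_diff: "pborel f \<Longrightarrow> pborel g \<Longrightarrow> pborel (\<lambda>x. f x - g x)"
  by (auto simp: pborel_def intro: periodic_comp2)

lemma pborel_mult: "pborel f \<Longrightarrow> pborel g \<Longrightarrow> pborel (\<lambda>x. f x * g x)"
  by (auto simp: pborel_def intro: periodic_comp2)

lemma pborel_const: "pborel (\<lambda>x. c)"
  by (auto simp: pborel_def periodic_def)

lemma pborel_power_abs: "pborel f \<Longrightarrow> pborel (\<lambda>x. \<bar>f x\<bar> ^ n)"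
  by (rule pborel_comp) auto

lemma PL_shift:
  assumes "PL n f"
  shows "PL n (\<lambda>x. f (x - h))" and "(LINT x|torus. \<bar>f (x - h)\<bar> ^ n) = (LINT x|torus. \<bar>f x\<bar> ^ n)"
proof -
  have p: "pborel f" "pborel (\<lambda>x. f (x - h))" "integrable torus (\<lambda>x. \<bar>f x\<bar> ^ n)"
    using assms pborel_shift_diff[of f h] unfolding PL_def by blast+
  show "PL n (\<lambda>x. f (x - h))"
    unfolding PL_def using p torus_shift_diff(1)[OF pborel_power_abs[OF p(1), of n], of h] by blast
  show "(LINT x|torus. \<bar>f (x - h)\<bar> ^ n) = (LINT x|torus. \<bar>f x\<bar> ^ n)"
    by (rule torus_shift_diff(2)[OF pborel_power_abs[OF p(1), of n], of h])
qed

lemma abs_power_add3: "\<bar>a + b + c :: real\<bar> ^ n \<le> 3 ^ n * (\<bar>a\<bar> ^ n + \<bar>b\<bar> ^ n + \<bar>c\<bar> ^ n)"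
proof -
  define m where "m = max \<bar>a\<bar> (max \<bar>b\<bar> \<bar>c\<bar>)"
  have "\<bar>a + b + c\<bar> \<le> 3 * m" unfolding m_def by linarith
  then have "\<bar>a + b + c\<bar> ^ n \<le> (3 * m) ^ n" by (intro power_mono) auto
  also have "m ^ n \<le> \<bar>a\<bar> ^ n + \<bar>b\<bar> ^ n + \<bar>c\<bar> ^ n"
    unfolding m_def max_def by auto
  then have "(3 * m) ^ n \<le> 3 ^ n * (\<bar>a\<bar> ^ n + \<bar>b\<bar> ^ n + \<bar>c\<bar> ^ n)"
    by (simp add: power_mult_distrib)
  finally show ?thesis .
qed

lemma PL_add:
  assumes "PL n f" "PL n g" shows "PL n (\<lambda>x. f x + g x)"
  unfolding PL_def
proof
  show p: "pborel (\<lambda>x. f x + g x)" using assms by (auto simp: PL_def intro: pborel_add)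
  show "integrable torus (\<lambda>x. \<bar>f x + g x\<bar> ^ n)"
  proof (rule Bochner_Integration.integrable_bound)
    show "integrable torus (\<lambda>x. 3 ^ n * (\<bar>f x\<bar> ^ n + \<bar>g x\<bar> ^ n + \<bar>0\<bar> ^ n))"
      using assms by (auto simp: PL_def)
    show "(\<lambda>x. \<bar>f x + g x\<bar> ^ n) \<in> borel_measurable torus"
      using pborel_power_abs[OF p] by (intro measurable_torus) auto
    show "AE x in torus. norm (\<bar>f x + g x\<bar> ^ n) \<le> norm (3 ^ n * (\<bar>f x\<bar> ^ n + \<bar>g x\<bar> ^ n + \<bar>0\<bar> ^ n))"
      using abs_power_add3[of _ _ 0 n] by (intro AE_I2) (auto intro!: order_trans[OF _ abs_ge_self])
  qed
qed

lemma PL_cmult: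
  assumes "PL n f" shows "PL n (\<lambda>x. c * f x)"
  using assms pborel_mult[OF pborel_const] by (auto simp: PL_def abs_mult power_mult_distrib)

lemma PL_diff:
  assumes "PL n f" "PL n g" shows "PL n (\<lambda>x. f x - g x)"
  using PL_add[OF assms(1) PL_cmult[OF assms(2), of "-1"]] by simp

lemma PL_bounded:
  assumes "pborel f" "\<And>x. \<bar>f x\<bar> \<le> C" shows "PL n f"
  unfolding PL_def
proof
  show "integrable torus (\<lambda>x. \<bar>f x\<bar> ^ n)"
    using assms by (intro torus.integrable_const_bound[of _ "C ^ n"] measurable_torus AE_I2)
      (auto intro: power_mono pborel_power_abs)
qed fact

lemma pow_le_add: "m \<le> n \<Longrightarrow> (a::real) \<ge> 0 \<Longrightarrow> a ^ m \<le> 1 + a ^ n"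
  by (cases "a \<le> 1") (auto intro: order_trans[OF power_le_one] order_trans[OF power_increasing])

lemma PL_mono:
  assumes "PL n f" "m \<le> n" shows "PL m f"
  unfolding PL_def
proof
  show p: "pborel f" using assms by (auto simp: PL_def)
  show "integrable torus (\<lambda>x. \<bar>f x\<bar> ^ m)"
  proof (rule Bochner_Integration.integrable_bound)
    show "integrable torus (\<lambda>x. 1 + \<bar>f x\<bar> ^ n)" using assms by (auto simp: PL_def)
    show "(\<lambda>x. \<bar>f x\<bar> ^ m) \<in> borel_measurable torus"
      using pborel_power_abs[OF p] by (intro measurable_torus) auto
    show "AE x in torus. norm (\<bar>f x\<bar> ^ m) \<le> norm (1 + \<bar>f x\<bar> ^ n)"
      using pow_le_add[OF assms(2)] by (intro AE_I2) (auto intro!: order_trans[OF _ abs_ge_self])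
  qed
qed

lemma PL_integrable: "PL 1 f \<Longrightarrow> integrable torus f"
  unfolding PL_def by (rule integrable_norm_cancel) (auto intro: measurable_torus)


lemma norm_le_cube: "x \<in> cbox 0 (1::vec3) \<Longrightarrow> norm x \<le> 3"
proof -
  assume x: "x \<in> cbox 0 (1::vec3)"
  have "\<bar>x $ i\<bar> \<le> 1" for i
    using x by (smt (verit) mem_box_cart(2) one_index zero_index)
  then have "norm x \<le> (\<Sum>i\<in>(UNIV::3 set). 1 :: real)"
    by (intro order_trans[OF norm_le_l1_cart] sum_mono)
  then show ?thesis by simp
qed

lemma nn_integral_torus_shift_le:
  assumes [measurable]: "F \<in> borel_measurable borel" and h: "norm h \<le> 1"
  shows "(\<integral>\<^sup>+x. F (x - h) \<partial>torus) \<le> (\<integral>\<^sup>+x. F x * indicator (cball (0::vec3) 5) x \<partial>lborel)"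
proof -
  have sub: "x + h \<in> cbox 0 1 \<Longrightarrow> x \<in> cball 0 5" for x :: vec3
    using norm_le_cube[of "x + h"] h norm_triangle_ineq4[of "x + h" h] by simp
  have "(\<integral>\<^sup>+x. F (x - h) \<partial>torus) = (\<integral>\<^sup>+x. F (x - h) * indicator (cbox 0 1) x \<partial>lborel)"
    by (subst nn_integral_restrict_space) (auto simp: nn_integral_completion)
  also have "\<dots> = (\<integral>\<^sup>+x. F (x + h - h) * indicator (cbox 0 1) (x + h) \<partial>lborel)"
    by (rule nn_integral_lborel_shift[of "\<lambda>x. F (x - h) * indicator (cbox 0 1) x" h, symmetric]) simp
  also have "\<dots> \<le> (\<integral>\<^sup>+x. F x * indicator (cball (0::vec3) 5) x \<partial>lborel)"
    by (rule nn_integral_mono) (use sub in \<open>auto simp: indicator_def\<close>)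
  finally show ?thesis .
qed

text \<open>A bounded measurable function is an \<open>L\<^sup>1\<close> limit of continuous functions on a ball containing the
  cube and its small translates; for the continuous approximant uniform continuity suffices.\<close>

lemma L1_translation_bounded:
  assumes f: "pborel f" "\<And>x. \<bar>f x\<bar> \<le> R" and e: "e > 0"
  obtains d where "d > 0" "\<And>h. norm h < d \<Longrightarrow> (LINT x|torus. \<bar>f (x - h) - f x\<bar>) \<le> e"
proof -
  have fb [measurable]: "f \<in> borel_measurable borel" using f by auto
  let ?B = "cball (0::vec3) 5"
  have "f measurable_on UNIV"
    by (rule lebesgue_measurable_imp_measurable_on_real) (auto intro: measurable_completion)
  then obtain N g where N: "negligible N" and gc: "\<And>n::nat. continuous_on UNIV (g n)"
      and gl: "\<And>x. x \<notin> N \<Longrightarrow> (\<lambda>n. g n x) \<longlonglongrightarrow> f x"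
    unfolding measurable_on_def by auto
  define c where "c = (\<lambda>n x. max (- R) (min R (g n x)))"
  have R: "R \<ge> 0" using f(2)[of 0] by linarith
  have cc: "continuous_on UNIV (c n)" for n
    unfolding c_def by (intro continuous_intros gc)
  have cb: "\<bar>c n x\<bar> \<le> R" for n x using R by (auto simp: c_def)
  have [measurable]: "c n \<in> borel_measurable borel" for n
    by (rule borel_measurable_continuous_onI[OF cc])
  have cl: "(\<lambda>n. c n x) \<longlonglongrightarrow> f x" if "x \<notin> N" for x
  proof -
    have "(\<lambda>n. c n x) \<longlonglongrightarrow> max (- R) (min R (f x))"
      unfolding c_def by (intro tendsto_intros gl that)
    moreover have "max (- R) (min R (f x)) = f x" using f(2)[of x] by (auto simp: abs_le_iff)
    ultimately show ?thesis by simp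
  qed
  have "AE x in lebesgue. (\<lambda>n. c n x) \<longlonglongrightarrow> f x"
    using N cl by (intro AE_I'[of N]) (auto simp: negligible_iff_null_sets)
  then have AEl: "AE x in lborel. (\<lambda>n. c n x) \<longlonglongrightarrow> f x"
    by (simp add: AE_completion_iff)
  have iB: "(indicator ?B :: _ \<Rightarrow> ennreal) \<in> borel_measurable borel"
    by (rule borel_measurable_indicator) simp
  let ?D = "\<lambda>n x. ennreal \<bar>f x - c n x\<bar>"
  have "(\<lambda>n. \<integral>\<^sup>+x. ?D n x * indicator ?B x \<partial>lborel) \<longlonglongrightarrow> nn_integral lborel (\<lambda>x::vec3. 0)"
  proof (rule nn_integral_dominated_convergence[where w="\<lambda>x. ennreal (2 * R) * indicator ?B x"])
    show "(\<integral>\<^sup>+x. ennreal (2 * R) * indicator ?B x \<partial>lborel) < \<infinity>"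
      using emeasure_bounded_finite[of ?B] R
      by (subst nn_integral_cmult_indicator) (auto simp: ennreal_mult_less_top)
    show "AE x in lborel. ?D n x * indicator ?B x \<le> ennreal (2 * R) * indicator ?B x" for n
      by (intro AE_I2 mult_right_mono ennreal_leI) (use cb[of n] f(2) in \<open>auto simp: abs_le_iff, (smt (verit))+\<close>)
    show "AE x in lborel. (\<lambda>n. ?D n x * indicator ?B x) \<longlonglongrightarrow> 0"
      using AEl
    proof eventually_elim
      case (elim x)
      have "(\<lambda>n. \<bar>f x - c n x\<bar>) \<longlonglongrightarrow> 0"
        using tendsto_rabs_zero[OF LIM_zero[OF elim]] by (simp add: abs_minus_commute)
      then have "(\<lambda>n. ?D n x) \<longlonglongrightarrow> 0" using tendsto_ennrealI by force
      then show ?case by (auto simp: indicator_def)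
    qed
  qed (use iB in simp_all)
  then have "(\<lambda>n. \<integral>\<^sup>+x. ?D n x * indicator ?B x \<partial>lborel) \<longlonglongrightarrow> 0" by simp
  then have "\<forall>\<^sub>F n in sequentially. (\<integral>\<^sup>+x. ?D n x * indicator ?B x \<partial>lborel) < ennreal (e / 3)"
    by (rule order_tendstoD(2)) (use e in simp)
  then obtain n where n: "(\<integral>\<^sup>+x. ?D n x * indicator ?B x \<partial>lborel) < ennreal (e / 3)"
    by (auto simp: eventually_sequentially)
  have "uniformly_continuous_on (cball 0 10) (c n)"
    by (rule compact_uniformly_continuous[OF continuous_on_subset[OF cc]]) auto
  then obtain d where d: "d > 0" and du: "\<And>x y. x \<in> cball 0 10 \<Longrightarrow> y \<in> cball 0 10 \<Longrightarrow> dist y x < d \<Longrightarrow> dist (c n y) (c n x) < e / 3"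
    using e unfolding uniformly_continuous_on_def by (metis divide_pos_pos zero_less_numeral)
  show thesis
  proof (rule that[of "min d 1"])
    show "min d 1 > 0" using d by simp
    fix h :: vec3 assume h: "norm h < min d 1"
    have fi: "integrable torus (\<lambda>x. \<bar>F x - G x\<bar>)"
      if [measurable]: "F \<in> borel_measurable borel" "G \<in> borel_measurable borel"
        and b: "\<And>x. \<bar>F x\<bar> \<le> R" "\<And>x. \<bar>G x\<bar> \<le> R" for F G
    proof (intro torus.integrable_const_bound[of _ "2 * R"] measurable_torus AE_I2)
      show "norm \<bar>F x - G x\<bar> \<le> 2 * R" for x using b[of x] by simp
    qed measurable
    have i1: "integrable torus (\<lambda>x. \<bar>f (x - k) - c n (x - k)\<bar>)" for k
      by (rule fi) (use f(2) cb in simp_all)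
    have i2: "integrable torus (\<lambda>x. \<bar>c n (x - h) - c n x\<bar>)"
      by (rule fi) (use cb in simp_all)
    have i3: "integrable torus (\<lambda>x. \<bar>f (x - h) - f x\<bar>)"
      by (rule fi) (use f(2) in simp_all)
    have b1: "(LINT x|torus. \<bar>f (x - k) - c n (x - k)\<bar>) \<le> e / 3" if k: "norm k \<le> 1" for k
    proof -
      have "ennreal (LINT x|torus. \<bar>f (x - k) - c n (x - k)\<bar>) = (\<integral>\<^sup>+x. ?D n (x - k) \<partial>torus)"
        by (rule nn_integral_eq_integral[symmetric, OF i1]) simp
      also have "\<dots> \<le> (\<integral>\<^sup>+x. ?D n x * indicator ?B x \<partial>lborel)"
        by (rule nn_integral_torus_shift_le[OF _ k]) simp
      also have "\<dots> \<le> ennreal (e / 3)" using n by simp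
      finally show ?thesis using e by (simp add: ennreal_le_iff)
    qed
    have "\<bar>c n (x - h) - c n x\<bar> \<le> e / 3" if "x \<in> cbox 0 1" for x
    proof -
      have "x \<in> cball 0 10" "x - h \<in> cball 0 10" "dist (x - h) x < d"
        using norm_le_cube[OF that] h norm_triangle_ineq4[of x h] by (simp_all add: dist_norm norm_minus_commute)
      then show ?thesis using du by (fastforce simp: dist_real_def)
    qed
    then have "(LINT x|torus. \<bar>c n (x - h) - c n x\<bar>) \<le> (LINT x|torus. e / 3)"
      by (intro integral_mono i2) auto
    then have b2: "(LINT x|torus. \<bar>c n (x - h) - c n x\<bar>) \<le> e / 3"
      using measure_torus by simp
    have "(LINT x|torus. \<bar>f (x - h) - f x\<bar>) \<le> (LINT x|torus. \<bar>f (x - h) - c n (x - h)\<bar> + \<bar>c n (x - h) - c n x\<bar> + \<bar>f (x - 0) - c n (x - 0)\<bar>)"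
      by (intro integral_mono Bochner_Integration.integrable_add i1 i2 i3) simp
    also have "\<dots> = (LINT x|torus. \<bar>f (x - h) - c n (x - h)\<bar>) + (LINT x|torus. \<bar>c n (x - h) - c n x\<bar>) + (LINT x|torus. \<bar>f (x - 0) - c n (x - 0)\<bar>)"
      using i1[of h] i1[of 0] i2 by simp
    also have "\<dots> \<le> e / 3 + e / 3 + e / 3"
      using b1[of h] b1[of 0] b2 h by simp
    finally show "(LINT x|torus. \<bar>f (x - h) - f x\<bar>) \<le> e" by simp
  qed
qed

text \<open>Truncation reduces the general case to bounded functions.\<close>

lemma Ln_translation:
  assumes f: "PL n f" and n: "n \<ge> 1" and e: "e > 0"
  obtains d where "d > 0" "\<And>h. norm h < d \<Longrightarrow> (LINT x|torus. \<bar>f (x - h) - f x\<bar> ^ n) \<le> e"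
proof -
  have fp: "pborel f" and fi: "integrable torus (\<lambda>x. \<bar>f x\<bar> ^ n)" using f by (auto simp: PL_def)
  define c where "c = (\<lambda>k::nat. \<lambda>x. max (- real k) (min (real k) (f x)))"
  have cp: "pborel (c k)" for k
    unfolding c_def by (rule pborel_comp[OF fp]) measurable
  have cb: "\<bar>c k x\<bar> \<le> real k" for k x by (auto simp: c_def)
  have cf: "\<bar>f x - c k x\<bar> \<le> \<bar>f x\<bar>" for k x by (auto simp: c_def)
  have fc: "pborel (\<lambda>x. f x - c k x)" for k by (rule pborel_diff[OF fp cp])
  have "(\<lambda>k. LINT x|torus. \<bar>f x - c k x\<bar> ^ n) \<longlonglongrightarrow> (LINT x|torus. 0)"
  proof (rule integral_dominated_convergence[OF _ _ fi])
    show "(\<lambda>x. \<bar>f x - c k x\<bar> ^ n) \<in> borel_measurable torus" for k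
      using pborel_power_abs[OF fc] by (intro measurable_torus) auto
    show "AE x in torus. norm (\<bar>f x - c k x\<bar> ^ n) \<le> \<bar>f x\<bar> ^ n" for k
      by (intro AE_I2) (auto intro!: power_mono cf)
    show "AE x in torus. (\<lambda>k. \<bar>f x - c k x\<bar> ^ n) \<longlonglongrightarrow> 0"
    proof (intro AE_I2 tendsto_eventually)
      fix x
      obtain K where K: "\<bar>f x\<bar> \<le> real K" using real_arch_simple by blast
      then have "\<bar>f x - c k x\<bar> ^ n = 0" if "k \<ge> K" for k
        using n that by (auto simp: c_def)
      then show "\<forall>\<^sub>F k in sequentially. \<bar>f x - c k x\<bar> ^ n = 0"
        by (auto simp: eventually_sequentially)
    qed
  qed simp
  then have "(\<lambda>k. LINT x|torus. \<bar>f x - c k x\<bar> ^ n) \<longlonglongrightarrow> 0" by simp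
  then have "\<forall>\<^sub>F k in sequentially. (LINT x|torus. \<bar>f x - c k x\<bar> ^ n) < e / (3 * 3 ^ n)"
    by (rule order_tendstoD(2)) (use e in simp)
  then obtain k where k: "(LINT x|torus. \<bar>f x - c k x\<bar> ^ n) < e / (3 * 3 ^ n)"
    by (auto simp: eventually_sequentially)
  define M where "M = (2 * real k) ^ (n - 1) + 1"
  have M: "M > 0" by (simp add: M_def add_nonneg_pos)
  obtain d where d: "d > 0" "\<And>h. norm h < d \<Longrightarrow> (LINT x|torus. \<bar>c k (x - h) - c k x\<bar>) \<le> e / (3 * 3 ^ n * M)"
    using L1_translation_bounded[OF cp cb, of "e / (3 * 3 ^ n * M)" k] e M by auto
  show thesis
  proof (rule that[OF d(1)])
    fix h :: vec3 assume h: "norm h < d"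
    let ?c = "c k"
    have PLc: "PL m ?c" for m by (rule PL_bounded[OF cp cb])
    have PLf: "PL n (\<lambda>x. f x - ?c x)" by (rule PL_diff[OF f PLc])
    have i0: "integrable torus (\<lambda>x. \<bar>f (x - h) - f x\<bar> ^ n)"
      using PL_diff[OF PL_shift(1)[OF f] f] by (simp add: PL_def)
    have i1: "integrable torus (\<lambda>x. \<bar>f (x - h) - ?c (x - h)\<bar> ^ n)" "integrable torus (\<lambda>x. \<bar>f x - ?c x\<bar> ^ n)"
      using PL_shift(1)[OF PLf] PLf by (simp_all add: PL_def)
    have i2: "integrable torus (\<lambda>x. M * \<bar>?c (x - h) - ?c x\<bar>)"
      using PL_diff[OF PL_shift(1)[OF PLc] PLc, of 1 h] by (simp add: PL_def)
    have cM: "\<bar>?c (x - h) - ?c x\<bar> ^ n \<le> M * \<bar>?c (x - h) - ?c x\<bar>" for x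
    proof -
      let ?y = "\<bar>?c (x - h) - ?c x\<bar>"
      have "?y \<le> 2 * real k" using cb[of k x] cb[of k "x - h"] by linarith
      then have "?y ^ (n - 1) \<le> (2 * real k) ^ (n - 1)" by (intro power_mono) auto
      then have "?y ^ (n - 1) * ?y \<le> M * ?y" by (intro mult_right_mono) (auto simp: M_def)
      moreover have "?y ^ (n - 1) * ?y = ?y ^ n" using n by (metis power_minus_mult zero_less_one less_le_trans)
      ultimately show ?thesis by simp
    qed
    have "(LINT x|torus. \<bar>f (x - h) - f x\<bar> ^ n) \<le> (LINT x|torus. 3 ^ n * (\<bar>f (x - h) - ?c (x - h)\<bar> ^ n + M * \<bar>?c (x - h) - ?c x\<bar> + \<bar>f x - ?c x\<bar> ^ n))"
    proof (intro integral_mono i0)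
      show "integrable torus (\<lambda>x. 3 ^ n * (\<bar>f (x - h) - ?c (x - h)\<bar> ^ n + M * \<bar>?c (x - h) - ?c x\<bar> + \<bar>f x - ?c x\<bar> ^ n))"
        using i1 i2 by simp
      fix x
      have "\<bar>f (x - h) - f x\<bar> ^ n = \<bar>(f (x - h) - ?c (x - h)) + (?c (x - h) - ?c x) + (?c x - f x)\<bar> ^ n" by simp
      also have "\<dots> \<le> 3 ^ n * (\<bar>f (x - h) - ?c (x - h)\<bar> ^ n + \<bar>?c (x - h) - ?c x\<bar> ^ n + \<bar>?c x - f x\<bar> ^ n)"
        by (rule abs_power_add3)
      also have "\<dots> \<le> 3 ^ n * (\<bar>f (x - h) - ?c (x - h)\<bar> ^ n + M * \<bar>?c (x - h) - ?c x\<bar> + \<bar>f x - ?c x\<bar> ^ n)"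
        using cM[of x] by (intro mult_left_mono add_mono) (auto simp: abs_minus_commute)
      finally show "\<bar>f (x - h) - f x\<bar> ^ n \<le> 3 ^ n * (\<bar>f (x - h) - ?c (x - h)\<bar> ^ n + M * \<bar>?c (x - h) - ?c x\<bar> + \<bar>f x - ?c x\<bar> ^ n)" .
    qed
    also have "\<dots> = 3 ^ n * ((LINT x|torus. \<bar>f (x - h) - ?c (x - h)\<bar> ^ n) + M * (LINT x|torus. \<bar>?c (x - h) - ?c x\<bar>) + (LINT x|torus. \<bar>f x - ?c x\<bar> ^ n))"
      using i1 i2 by simp
    also have "(LINT x|torus. \<bar>f (x - h) - ?c (x - h)\<bar> ^ n) = (LINT x|torus. \<bar>f x - ?c x\<bar> ^ n)"
      by (rule PL_shift(2)[OF PLf])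
    also have "3 ^ n * ((LINT x|torus. \<bar>f x - ?c x\<bar> ^ n) + M * (LINT x|torus. \<bar>?c (x - h) - ?c x\<bar>) + (LINT x|torus. \<bar>f x - ?c x\<bar> ^ n))
      \<le> 3 ^ n * (e / (3 * 3 ^ n) + M * (e / (3 * 3 ^ n * M)) + e / (3 * 3 ^ n))"
      using k d(2)[OF h] M by (intro mult_left_mono add_mono) auto
    also have "\<dots> = e" using M by (simp add: field_simps)
    finally show "(LINT x|torus. \<bar>f (x - h) - f x\<bar> ^ n) \<le> e" .
  qed
qed

section \<open>The de la Vallee Poussin kernel\<close>

definition unit_int :: "(real \<Rightarrow> real) \<Rightarrow> real" where
  "unit_int f = (\<integral>y. f y * indicator {0..1} y \<partial>lborel)"

lemma unit_integrable:
  fixes f :: "real \<Rightarrow> real"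
  assumes "continuous_on UNIV f"
  shows "integrable lborel (\<lambda>y. f y * indicator {0..1::real} y)"
proof -
  have "set_integrable lborel {0..1} f"
    by (rule borel_integrable_atLeastAtMost') (rule continuous_on_subset[OF assms], simp)
  then show ?thesis by (simp add: set_integrable_def mult.commute)
qed

lemma unit_int_FTC:
  assumes "\<And>x. (F has_real_derivative f x) (at x)" "continuous_on UNIV f"
  shows "unit_int f = F 1 - F 0"
  unfolding unit_int_def using assms by (intro integral_FTC_Icc_real) (auto simp: continuous_on_eq_continuous_at)

lemma unit_int_cmult: "unit_int (\<lambda>x. c * f x) = c * unit_int f"
  unfolding unit_int_def by (simp add: mult.assoc)

lemma unit_int_diff:
  "continuous_on UNIV f \<Longrightarrow> continuous_on UNIV g \<Longrightarrow> unit_int (\<lambda>x. f x - g x) = unit_int f - unit_int g"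
  unfolding unit_int_def using unit_integrable[of f] unit_integrable[of g] by (simp add: left_diff_distrib)

lemma unit_int_mono:
  assumes "continuous_on UNIV f" "continuous_on UNIV g" "\<And>x. 0 \<le> x \<Longrightarrow> x \<le> 1 \<Longrightarrow> f x \<le> g x"
  shows "unit_int f \<le> unit_int g"
  unfolding unit_int_def using assms by (intro integral_mono unit_integrable) (auto simp: indicator_def)

lemma unit_int_nonneg:
  assumes "\<And>x. 0 \<le> x \<Longrightarrow> x \<le> 1 \<Longrightarrow> 0 \<le> f x"
  shows "0 \<le> unit_int f"
  unfolding unit_int_def using assms by (intro integral_nonneg_AE AE_I2) (auto simp: indicator_def)

lemma prod_Basis_vec3:
  fixes F :: "vec3 \<Rightarrow> 'a::comm_monoid_mult"
  shows "(\<Prod>b\<in>Basis. F b) = (\<Prod>i\<in>(UNIV::3 set). F (axis i (1::real)))"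
proof -
  have "Basis = (\<lambda>i::3. axis i (1::real)) ` UNIV" by (auto simp: Basis_vec_def)
  moreover have "inj (\<lambda>i::3. axis i (1::real))" by (auto simp: inj_def axis_eq_axis)
  ultimately have "(\<Prod>b\<in>Basis. F b) = prod (F \<circ> (\<lambda>i::3. axis i (1::real))) UNIV"
    using prod.reindex[of "\<lambda>i::3. axis i (1::real)" UNIV F] by simp
  then show ?thesis by (simp only: o_def)
qed

lemma torus_prod:
  fixes f :: "3 \<Rightarrow> real \<Rightarrow> real"
  assumes c: "\<And>i. continuous_on UNIV (f i)" and nn: "\<And>i y. 0 \<le> f i y"
  shows "integrable torus (\<lambda>x. \<Prod>i\<in>UNIV. f i (x $ i))"
    and "(LINT x|torus. (\<Prod>i\<in>UNIV. f i (x $ i))) = (\<Prod>i\<in>UNIV. unit_int (f i))"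
proof -
  have [measurable]: "f i \<in> borel_measurable borel" for i
    by (rule borel_measurable_continuous_onI[OF c])
  have m: "(\<lambda>x::vec3. \<Prod>i\<in>UNIV. f i (x $ i)) \<in> borel_measurable borel" by measurable
  define g where "g = (\<lambda>b::vec3. \<lambda>y. ennreal (f (THE i. b = axis i 1) y * indicator {0..1} y))"
  have the: "(THE j. axis i (1::real) = axis j 1) = i" for i :: 3
    by (auto simp: axis_eq_axis)
  have "(\<integral>\<^sup>+x. ennreal (\<Prod>i\<in>UNIV. f i (x $ i)) \<partial>torus) = (\<integral>\<^sup>+x. ennreal (\<Prod>i\<in>UNIV. f i (x $ i)) * indicator (cbox 0 1) x \<partial>lborel)"
    by (subst nn_integral_restrict_space) (auto simp: nn_integral_completion)
  also have "\<dots> = (\<integral>\<^sup>+x. (\<Prod>b\<in>Basis. g b (x \<bullet> b)) \<partial>lborel)"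
  proof (rule nn_integral_cong)
    fix x :: vec3
    have "(\<Prod>b\<in>Basis. g b (x \<bullet> b)) = (\<Prod>i\<in>UNIV. ennreal (f i (x $ i) * indicator {0..1} (x $ i)))"
      unfolding prod_Basis_vec3 g_def the by (simp add: inner_axis)
    also have "\<dots> = ennreal (\<Prod>i\<in>UNIV. f i (x $ i) * indicator {0..1} (x $ i))"
      by (rule prod_ennreal) (use nn in \<open>auto simp: indicator_def\<close>)
    also have "(\<Prod>i\<in>UNIV. f i (x $ i) * indicator {0..1} (x $ i)) = (\<Prod>i\<in>UNIV. f i (x $ i)) * indicator (cbox 0 1) x"
    proof (cases "x \<in> cbox 0 1")
      case True
      then have "indicator {0..1} (x $ i) = (1::real)" for i
        by (simp add: mem_box_cart indicator_def)
      then show ?thesis using True by simp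
    next
      case False
      then obtain i where "x $ i \<notin> {0..1}" by (auto simp: mem_box_cart)
      then have "(\<Prod>i\<in>UNIV. f i (x $ i) * indicator {0..1} (x $ i)) = 0"
        by (intro prod_zero bexI[of _ i]) auto
      then show ?thesis using False by simp
    qed
    finally show "ennreal (\<Prod>i\<in>UNIV. f i (x $ i)) * indicator (cbox 0 1) x = (\<Prod>b\<in>Basis. g b (x \<bullet> b))"
      by (simp add: indicator_def)
  qed
  also have "\<dots> = (\<Prod>b\<in>Basis. (\<integral>\<^sup>+y. g b y \<partial>lborel))"
    by (rule nn_integral_lborel_prod) (auto simp: g_def)
  also have "\<dots> = (\<Prod>i\<in>UNIV. ennreal (unit_int (f i)))"
    unfolding prod_Basis_vec3 g_def the unit_int_def
    by (intro prod.cong refl nn_integral_eq_integral unit_integrable c) (use nn in auto)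
  also have "\<dots> = ennreal (\<Prod>i\<in>UNIV. unit_int (f i))"
    by (rule prod_ennreal) (use nn in \<open>auto intro: unit_int_nonneg\<close>)
  finally have e: "(\<integral>\<^sup>+x. ennreal (\<Prod>i\<in>UNIV. f i (x $ i)) \<partial>torus) = ennreal (\<Prod>i\<in>UNIV. unit_int (f i))" .
  show "integrable torus (\<lambda>x. \<Prod>i\<in>UNIV. f i (x $ i))"
    by (rule integrableI_nonneg) (use e nn m in \<open>auto intro: measurable_torus prod_nonneg\<close>)
  show "(LINT x|torus. (\<Prod>i\<in>UNIV. f i (x $ i))) = (\<Prod>i\<in>UNIV. unit_int (f i))"
    by (rule integral_eq_nn_integral[THEN trans])
       (use e nn m in \<open>auto intro!: measurable_torus prod_nonneg unit_int_nonneg enn2real_ennreal\<close>)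
qed

definition cosint :: "nat \<Rightarrow> real" where
  "cosint n = unit_int (\<lambda>y. cos (pi * y) ^ (2 * n))"

lemma cosint_0: "cosint 0 = 1"
  by (simp add: cosint_def unit_int_def)

text \<open>Integration by parts: the derivative of \<open>sin (pi * y) * cos (pi * y) ^ (2 * n + 1)\<close> has integral zero over a
  period.\<close>

lemma cosint_Suc: "(2 * real n + 2) * cosint (Suc n) = (2 * real n + 1) * cosint n"
proof -
  let ?f = "\<lambda>y. pi * ((2 * real n + 2) * cos (pi * y) ^ (2 * Suc n) - (2 * real n + 1) * cos (pi * y) ^ (2 * n))"
  have "unit_int ?f = sin (pi * 1) * cos (pi * 1) ^ (2 * n + 1) - sin (pi * 0) * cos (pi * 0) ^ (2 * n + 1)"
  proof (rule unit_int_FTC)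
    fix y :: real
    have s: "sin (pi * y) ^ 2 = 1 - cos (pi * y) ^ 2" by (simp add: sin_squared_eq)
    have "((\<lambda>y. cos (pi * y) ^ (2 * n + 1)) has_real_derivative (real (2 * n + 1) * (- (pi * sin (pi * y)) * cos (pi * y) ^ (2 * n)))) (at y)"
      by (rule DERIV_cong[OF DERIV_power[where n="2 * n + 1" and f="\<lambda>y. cos (pi * y)" and D="- (pi * sin (pi * y))"]])
         (auto intro!: derivative_eq_intros)
    moreover have "((\<lambda>y. sin (pi * y)) has_real_derivative (pi * cos (pi * y))) (at y)"
      by (auto intro!: derivative_eq_intros)
    ultimately have "((\<lambda>y. sin (pi * y) * cos (pi * y) ^ (2 * n + 1)) has_real_derivative
        (pi * cos (pi * y) * cos (pi * y) ^ (2 * n + 1) + real (2 * n + 1) * (- (pi * sin (pi * y)) * cos (pi * y) ^ (2 * n)) * sin (pi * y))) (at y)"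
      by (intro DERIV_mult)
    also have "pi * cos (pi * y) * cos (pi * y) ^ (2 * n + 1) + real (2 * n + 1) * (- (pi * sin (pi * y)) * cos (pi * y) ^ (2 * n)) * sin (pi * y)
       = pi * (cos (pi * y) ^ (2 * Suc n) - (2 * real n + 1) * cos (pi * y) ^ (2 * n) * (sin (pi * y))\<^sup>2)"
      by (simp add: algebra_simps power2_eq_square)
    also have "\<dots> = ?f y" unfolding s by (simp add: algebra_simps power2_eq_square)
    finally show "((\<lambda>y. sin (pi * y) * cos (pi * y) ^ (2 * n + 1)) has_real_derivative ?f y) (at y)" .
  qed (intro continuous_intros)
  then have "unit_int ?f = 0" by simp
  moreover have "unit_int ?f = pi * ((2 * real n + 2) * cosint (Suc n) - (2 * real n + 1) * cosint n)"
    unfolding cosint_def by (subst unit_int_cmult, subst unit_int_diff) (auto intro!: continuous_intros simp: unit_int_cmult)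
  ultimately show ?thesis by simp
qed

lemma cosint_pos: "cosint n > 0"
proof (induction n)
  case (Suc n)
  then have "(2 * real n + 2) * cosint (Suc n) > 0"
    unfolding cosint_Suc by (intro mult_pos_pos) auto
  then show ?case by (simp add: zero_less_mult_iff)
qed (simp add: cosint_0)

lemma cosint_neq_0 [simp]: "cosint n \<noteq> 0"
  using cosint_pos[of n] by simp

text \<open>This is the half of Wallis' product that matters: \<open>cosint n\<close> decays no faster than \<open>1 / sqrt n\<close>, which keeps
  the normalized moments of the kernel under control.\<close>

lemma cosint_lower: "1 \<le> (4 * real n + 1) * (cosint n)\<^sup>2"
proof (induction n)
  case (Suc n)
  have "(2 * real n + 2)\<^sup>2 * (4 * real n + 1) \<le> (2 * real n + 1)\<^sup>2 * (4 * real (Suc n) + 1)"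
    by (simp add: power2_eq_square algebra_simps)
  then have "(2 * real n + 2)\<^sup>2 * ((4 * real n + 1) * (cosint n)\<^sup>2) \<le> (4 * real (Suc n) + 1) * ((2 * real n + 1) * cosint n)\<^sup>2"
    using mult_right_mono[of _ _ "(cosint n)\<^sup>2"] by (fastforce simp: power_mult_distrib ac_simps)
  also have "\<dots> = (2 * real n + 2)\<^sup>2 * ((4 * real (Suc n) + 1) * (cosint (Suc n))\<^sup>2)"
    unfolding cosint_Suc[symmetric] by (simp add: power_mult_distrib ac_simps)
  finally have "(4 * real n + 1) * (cosint n)\<^sup>2 \<le> (4 * real (Suc n) + 1) * (cosint (Suc n))\<^sup>2"
    by (simp add: add_nonneg_eq_0_iff)
  with Suc show ?case by linarith
qed (simp add: cosint_0)

definition sincosint :: "nat \<Rightarrow> real" where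
  "sincosint n = unit_int (\<lambda>y. sin (pi * y) * cos (pi * y) ^ (2 * n))"

lemma sincosint: "sincosint n = 2 / (pi * (2 * real n + 1))"
proof -
  have "sincosint n = (- (cos (pi * 1) ^ (2 * n + 1)) / (pi * (2 * real n + 1))) - (- (cos (pi * 0) ^ (2 * n + 1)) / (pi * (2 * real n + 1)))"
    unfolding sincosint_def
  proof (rule unit_int_FTC)
    fix y :: real
    have "((\<lambda>y. - (cos (pi * y) ^ (2 * n + 1)) / (pi * (2 * real n + 1))) has_real_derivative
       (- (real (2 * n + 1) * (- (pi * sin (pi * y)) * cos (pi * y) ^ (2 * n))) / (pi * (2 * real n + 1)))) (at y)"
      by (intro DERIV_cdivide DERIV_minus DERIV_cong[OF DERIV_power[where n="2 * n + 1" and f="\<lambda>y. cos (pi * y)" and D="- (pi * sin (pi * y))"]])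
         (auto intro!: derivative_eq_intros)
    also have "- (real (2 * n + 1) * (- (pi * sin (pi * y)) * cos (pi * y) ^ (2 * n))) / (pi * (2 * real n + 1))
       = sin (pi * y) * cos (pi * y) ^ (2 * n)"
      by (simp add: divide_simps add_nonneg_eq_0_iff)
    finally show "((\<lambda>y. - (cos (pi * y) ^ (2 * n + 1)) / (pi * (2 * real n + 1))) has_real_derivative (sin (pi * y) * cos (pi * y) ^ (2 * n))) (at y)" .
  qed (intro continuous_intros)
  then show ?thesis by (simp add: divide_simps)
qed

lemma unit_int_cong:
  "(\<And>x. 0 \<le> x \<Longrightarrow> x \<le> 1 \<Longrightarrow> f x = g x) \<Longrightarrow> unit_int f = unit_int g"
  unfolding unit_int_def by (intro Bochner_Integration.integral_cong) (auto simp: indicator_def)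

text \<open>The powers of \<open>cos\<^sup>2\<close> are normalized by their integral. Indexing the exponent by \<open>Suc m\<close> keeps the
  exponent \<open>2 * m + 1\<close> of the derivative free of truncated subtraction.\<close>

definition vp1 :: "nat \<Rightarrow> real \<Rightarrow> real" where
  "vp1 m y = cos (pi * y) ^ (2 * Suc m) / cosint (Suc m)"

definition dvp1 :: "nat \<Rightarrow> real \<Rightarrow> real" where
  "dvp1 m y = - (real (2 * Suc m) * pi * sin (pi * y) * cos (pi * y) ^ (2 * m + 1)) / cosint (Suc m)"

lemma dvp1_deriv: "(vp1 m has_real_derivative dvp1 m y) (at y)"
proof -
  have "((\<lambda>y. cos (pi * y) ^ (2 * Suc m)) has_real_derivative (real (2 * Suc m) * (- (pi * sin (pi * y)) * cos (pi * y) ^ (2 * m + 1)))) (at y)"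
    by (rule DERIV_cong[OF DERIV_power[where n="2 * Suc m" and f="\<lambda>y. cos (pi * y)" and D="- (pi * sin (pi * y))"]])
       (auto intro!: derivative_eq_intros)
  then have "((\<lambda>y. cos (pi * y) ^ (2 * Suc m) / cosint (Suc m)) has_real_derivative
      (real (2 * Suc m) * (- (pi * sin (pi * y)) * cos (pi * y) ^ (2 * m + 1))) / cosint (Suc m)) (at y)"
    by (rule DERIV_cdivide)
  then show ?thesis unfolding vp1_def[abs_def] dvp1_def by (simp add: mult_ac del: power_Suc)
qed

lemma vp1_nonneg: "0 \<le> vp1 m y"
  using cosint_pos[of "Suc m"] unfolding vp1_def power_mult by (intro divide_nonneg_pos) auto

lemma vp1_cont: "continuous_on A (vp1 m)"
  unfolding vp1_def[abs_def] using cosint_pos[of "Suc m"] by (intro continuous_intros) simp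

lemma dvp1_cont: "continuous_on A (dvp1 m)"
  unfolding dvp1_def[abs_def] using cosint_pos[of "Suc m"] by (intro continuous_intros) simp

lemma unit_int_vp1: "unit_int (vp1 m) = 1"
  using unit_int_cmult[of "1 / cosint (Suc m)" "\<lambda>y. cos (pi * y) ^ (2 * Suc m)"] cosint_pos[of "Suc m"]
  by (simp add: vp1_def[abs_def] cosint_def del: power_Suc)

abbreviation abs_sin :: "real \<Rightarrow> real" where
  "abs_sin y \<equiv> \<bar>sin (pi * y)\<bar>"

lemma abs_sin_unit: "0 \<le> y \<Longrightarrow> y \<le> 1 \<Longrightarrow> abs_sin y = sin (pi * y)"
  by (simp add: sin_ge_zero mult_left_le)

lemma power_double_Suc: "x ^ (2 * Suc k) = x\<^sup>2 * x ^ (2 * k)" for x :: real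
  by (simp add: power2_eq_square)

lemma sin_sq: "(sin x)\<^sup>2 = 1 - (cos x)\<^sup>2" for x :: real
  by (simp add: sin_squared_eq)

lemma unit_int_sin_vp1: "unit_int (\<lambda>y. abs_sin y * vp1 m y) = 2 / (pi * (2 * real m + 3) * cosint (Suc m))"
proof -
  have "unit_int (\<lambda>y. abs_sin y * vp1 m y) = unit_int (\<lambda>y. 1 / cosint (Suc m) * (sin (pi * y) * cos (pi * y) ^ (2 * Suc m)))"
    by (rule unit_int_cong) (simp add: vp1_def abs_sin_unit)
  also have "\<dots> = 1 / cosint (Suc m) * sincosint (Suc m)"
    unfolding unit_int_cmult sincosint_def ..
  finally show ?thesis by (simp add: sincosint algebra_simps)
qed

lemma unit_int_sin2_vp1: "unit_int (\<lambda>y. (abs_sin y)\<^sup>2 * vp1 m y) = 1 / (2 * real m + 4)"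
proof -
  let ?I = "cosint (Suc m)"
  have "unit_int (\<lambda>y. (abs_sin y)\<^sup>2 * vp1 m y) = unit_int (\<lambda>y. 1 / ?I * (cos (pi * y) ^ (2 * Suc m) - cos (pi * y) ^ (2 * Suc (Suc m))))"
    unfolding vp1_def power2_abs sin_sq power_double_Suc[of _ "Suc m"]
    by (rule unit_int_cong) (simp add: algebra_simps diff_divide_distrib del: power_Suc)
  also have "\<dots> = 1 / ?I * (?I - cosint (Suc (Suc m)))"
    unfolding unit_int_cmult cosint_def by (subst unit_int_diff) (auto intro!: continuous_intros simp del: power_Suc)
  also have "cosint (Suc (Suc m)) = (2 * real m + 3) / (2 * real m + 4) * ?I"
    using cosint_Suc[of "Suc m"] by (simp add: field_simps)
  also have "1 / ?I * (?I - (2 * real m + 3) / (2 * real m + 4) * ?I) = 1 / (2 * real m + 4)"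
    using cosint_pos[of "Suc m"] by (simp add: field_simps)
  finally show ?thesis .
qed

lemma dvp1_bound: "\<bar>dvp1 m y\<bar> \<le> 2 * real (Suc m) * pi / cosint (Suc m) * (abs_sin y * cos (pi * y) ^ (2 * m))"
proof -
  have "\<bar>cos (pi * y) ^ (2 * m + 1)\<bar> \<le> cos (pi * y) ^ (2 * m)"
    using mult_left_le_one_le[of "\<bar>cos (pi * y)\<bar> ^ (2 * m)" "\<bar>cos (pi * y)\<bar>"]
    by (simp add: abs_mult power_abs power_even_abs)
  moreover have "\<bar>dvp1 m y\<bar> = 2 * real (Suc m) * pi / cosint (Suc m) * (abs_sin y * \<bar>cos (pi * y) ^ (2 * m + 1)\<bar>)"
    using cosint_pos[of "Suc m"] by (simp add: dvp1_def abs_mult abs_divide)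
  moreover have "0 \<le> 2 * real (Suc m) * pi / cosint (Suc m)"
    using cosint_pos[of "Suc m"] by simp
  ultimately show ?thesis by (simp only: mult_left_mono abs_ge_zero)
qed

lemma unit_int_dvp1: "unit_int (\<lambda>y. \<bar>dvp1 m y\<bar>) \<le> 4 / cosint (Suc m)"
proof -
  define K where "K = 2 * real (Suc m) * pi / cosint (Suc m)"
  note dvp1_bound' = dvp1_bound[of m, folded K_def]
  have "unit_int (\<lambda>y. \<bar>dvp1 m y\<bar>) \<le> unit_int (\<lambda>y. K * (abs_sin y * cos (pi * y) ^ (2 * m)))"
    by (rule unit_int_mono) (auto intro!: continuous_intros dvp1_cont dvp1_bound')
  also have "\<dots> = K * unit_int (\<lambda>y. sin (pi * y) * cos (pi * y) ^ (2 * m))"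
    unfolding unit_int_cmult by (rule arg_cong[where f="(*) K"], rule unit_int_cong) (simp add: abs_sin_unit)
  also have "\<dots> = K * (2 / (pi * (2 * real m + 1)))"
    by (simp only: sincosint flip: sincosint_def)
  also have "\<dots> = 4 / cosint (Suc m) * (real (Suc m) / (2 * real m + 1))"
    using cosint_pos[of "Suc m"] by (simp add: K_def divide_simps)
  also have "\<dots> \<le> 4 / cosint (Suc m) * 1"
    using cosint_pos[of "Suc m"] by (intro mult_left_mono) auto
  finally show ?thesis by simp
qed

lemma unit_int_sin_dvp1: "unit_int (\<lambda>y. abs_sin y * \<bar>dvp1 m y\<bar>) \<le> 2 * pi"
proof -
  define K where "K = 2 * real (Suc m) * pi / cosint (Suc m)"
  note dvp1_bound' = dvp1_bound[of m, folded K_def]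
  have "unit_int (\<lambda>y. abs_sin y * \<bar>dvp1 m y\<bar>) \<le> unit_int (\<lambda>y. K * (cos (pi * y) ^ (2 * m) - cos (pi * y) ^ (2 * Suc m)))"
  proof (rule unit_int_mono)
    fix y
    have "abs_sin y * \<bar>dvp1 m y\<bar> \<le> abs_sin y * (K * (abs_sin y * cos (pi * y) ^ (2 * m)))"
      by (intro mult_left_mono dvp1_bound') auto
    also have "\<dots> = K * ((sin (pi * y))\<^sup>2 * cos (pi * y) ^ (2 * m))"
      by (simp add: power2_eq_square mult_ac)
    also have "\<dots> = K * (cos (pi * y) ^ (2 * m) - cos (pi * y) ^ (2 * Suc m))"
      unfolding sin_sq power_double_Suc by (simp add: algebra_simps)
    finally show "abs_sin y * \<bar>dvp1 m y\<bar> \<le> K * (cos (pi * y) ^ (2 * m) - cos (pi * y) ^ (2 * Suc m))" .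
  qed (auto intro!: continuous_intros dvp1_cont)
  also have "\<dots> = K * (cosint m - cosint (Suc m))"
    unfolding unit_int_cmult cosint_def by (subst unit_int_diff) (auto intro!: continuous_intros simp del: power_Suc)
  also have "cosint m = (2 * real m + 2) / (2 * real m + 1) * cosint (Suc m)"
    using cosint_Suc[of m] by (simp add: field_simps)
  also have "K * ((2 * real m + 2) / (2 * real m + 1) * cosint (Suc m) - cosint (Suc m)) = 2 * pi * (real (Suc m) / (2 * real m + 1))"
    using cosint_pos[of "Suc m"] by (simp add: K_def divide_simps) (simp add: algebra_simps)
  also have "\<dots> \<le> 2 * pi * 1"
    by (intro mult_left_mono) auto
  finally show ?thesis by simp
qed

lemma unit_int_sin2_dvp1: "unit_int (\<lambda>y. (abs_sin y)\<^sup>2 * \<bar>dvp1 m y\<bar>) \<le> 8 / (cosint (Suc m) * (2 * real m + 3))"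
proof -
  define K where "K = 2 * real (Suc m) * pi / cosint (Suc m)"
  note dvp1_bound' = dvp1_bound[of m, folded K_def]
  have "unit_int (\<lambda>y. (abs_sin y)\<^sup>2 * \<bar>dvp1 m y\<bar>) \<le> unit_int (\<lambda>y. K * (sin (pi * y) * cos (pi * y) ^ (2 * m) - sin (pi * y) * cos (pi * y) ^ (2 * Suc m)))"
  proof (rule unit_int_mono)
    fix y :: real assume y: "0 \<le> y" "y \<le> 1"
    have "(abs_sin y)\<^sup>2 * \<bar>dvp1 m y\<bar> \<le> (abs_sin y)\<^sup>2 * (K * (abs_sin y * cos (pi * y) ^ (2 * m)))"
      by (intro mult_left_mono dvp1_bound') auto
    also have "\<dots> = K * (sin (pi * y) * ((sin (pi * y))\<^sup>2 * cos (pi * y) ^ (2 * m)))"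
      unfolding abs_sin_unit[OF y] by (simp add: power2_eq_square mult_ac)
    also have "\<dots> = K * (sin (pi * y) * cos (pi * y) ^ (2 * m) - sin (pi * y) * cos (pi * y) ^ (2 * Suc m))"
      unfolding sin_sq power_double_Suc by (simp add: algebra_simps)
    finally show "(abs_sin y)\<^sup>2 * \<bar>dvp1 m y\<bar> \<le> K * (sin (pi * y) * cos (pi * y) ^ (2 * m) - sin (pi * y) * cos (pi * y) ^ (2 * Suc m))" .
  qed (auto intro!: continuous_intros dvp1_cont)
  also have "\<dots> = K * (sincosint m - sincosint (Suc m))"
    unfolding unit_int_cmult sincosint_def by (subst unit_int_diff) (auto intro!: continuous_intros simp del: power_Suc)
  also have "\<dots> = 8 / (cosint (Suc m) * (2 * real m + 3)) * (real (Suc m) / (2 * real m + 1))"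
    using cosint_pos[of "Suc m"] by (simp add: K_def sincosint divide_simps)
  also have "\<dots> \<le> 8 / (cosint (Suc m) * (2 * real m + 3)) * 1"
    using cosint_pos[of "Suc m"] by (intro mult_left_mono) auto
  finally show ?thesis by simp
qed

lemma inverse_cosint: "1 / (cosint (Suc m) * (2 * real m + 3)) \<le> 2 / sqrt (real m + 2)"
proof -
  let ?I = "cosint (Suc m)"
  have I: "?I > 0" by (rule cosint_pos)
  have "1 \<le> (4 * real m + 5) * ?I\<^sup>2" using cosint_lower[of "Suc m"] by (simp add: add.commute)
  also have "\<dots> \<le> (2 * sqrt (real m + 2) * ?I)\<^sup>2"
    by (simp add: power_mult_distrib mult_right_mono)
  finally have "1 \<le> 2 * sqrt (real m + 2) * ?I"
    using I by (intro power2_le_imp_le[of 1]) auto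
  then have "1 / ?I \<le> 2 * sqrt (real m + 2)" using I by (simp add: field_simps)
  then have "1 / ?I / (2 * real m + 3) \<le> 2 * sqrt (real m + 2) / (real m + 2)"
    using I by (intro frac_le) auto
  also have "\<dots> = 2 / sqrt (real m + 2)"
    using real_div_sqrt[of "real m + 2"] by (simp add: field_simps)
  finally show ?thesis by simp
qed

lemma inverse_cosint_sq: "1 / ((cosint (Suc m))\<^sup>2 * (2 * real m + 3)) \<le> 2"
proof -
  let ?I = "cosint (Suc m)"
  have "1 \<le> (4 * real m + 5) * ?I\<^sup>2" using cosint_lower[of "Suc m"] by (simp add: add.commute)
  also have "\<dots> \<le> 2 * (?I\<^sup>2 * (2 * real m + 3))" by (simp add: algebra_simps)
  finally show ?thesis using cosint_pos[of "Suc m"] by (simp add: divide_le_eq)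
qed

lemma inverse_sqrt_tendsto: "(\<lambda>m. 2 / sqrt (real m + 2)) \<longlonglongrightarrow> 0"
proof -
  have "filterlim (\<lambda>m. real m + 2) at_top sequentially"
    by (rule filterlim_at_top_mono[OF filterlim_real_sequentially]) simp
  then have "filterlim (\<lambda>m. sqrt (real m + 2)) at_top sequentially"
    by (rule filterlim_compose[OF sqrt_at_top])
  then show ?thesis
    by (intro tendsto_divide_0[OF tendsto_const] filterlim_at_top_imp_at_infinity)
qed

definition vp :: "nat \<Rightarrow> vec3 \<Rightarrow> real" where
  "vp m h = (\<Prod>i\<in>UNIV. vp1 m (h $ i))"

definition dvp :: "3 \<Rightarrow> nat \<Rightarrow> vec3 \<Rightarrow> real" where
  "dvp i m h = (\<Prod>j\<in>UNIV. (if j = i then dvp1 m else vp1 m) (h $ j))"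

text \<open>A periodic substitute for the distance to the integer lattice.\<close>

definition rho :: "vec3 \<Rightarrow> real" where
  "rho h = (\<Sum>i\<in>UNIV. abs_sin (h $ i))"

lemma sin_cos_shift: "sin (pi * (y + 1)) = - sin (pi * y)" "cos (pi * (y + 1)) = - cos (pi * y)"
  by (simp_all add: distrib_left)

lemma vp1_periodic: "vp1 m (y + 1) = vp1 m y"
  unfolding vp1_def sin_cos_shift by simp

lemma dvp1_periodic: "dvp1 m (y + 1) = dvp1 m y"
  unfolding dvp1_def sin_cos_shift by simp

lemma abs_sin_periodic: "abs_sin (y + 1) = abs_sin y"
  unfolding sin_cos_shift by simp

lemma periodic_component:
  fixes f :: "real \<Rightarrow> real"
  assumes "\<And>y. f (y + 1) = f y"
  shows "f ((x + axis j 1) $ i) = f (x $ i)"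
  using assms by (cases "i = j") (simp_all add: axis_def)

lemma vp_pborel: "pborel (vp m)"
  unfolding pborel_def
proof
  show "periodic (vp m)"
    unfolding periodic_def vp_def by (simp only: periodic_component[of "vp1 m", OF vp1_periodic]) simp
  have [measurable]: "vp1 m \<in> borel_measurable borel"
    by (rule borel_measurable_continuous_onI[OF vp1_cont])
  have "(\<lambda>h::vec3. \<Prod>i\<in>UNIV. vp1 m (h $ i)) \<in> borel_measurable borel" by measurable
  then show "vp m \<in> borel_measurable borel" by (simp add: vp_def[abs_def])
qed

lemma dvp_pborel: "pborel (dvp i m)"
  unfolding pborel_def
proof
  have "(if j = i then dvp1 m else vp1 m) (y + 1) = (if j = i then dvp1 m else vp1 m) y" for j y
    using vp1_periodic[of m y] dvp1_periodic[of m y] by simp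
  note p = periodic_component[of "if _ = i then dvp1 m else vp1 m", OF this]
  show "periodic (dvp i m)"
    unfolding periodic_def dvp_def by (simp only: p) simp
  have [measurable]: "vp1 m \<in> borel_measurable borel" "dvp1 m \<in> borel_measurable borel"
    by (rule borel_measurable_continuous_onI[OF vp1_cont], rule borel_measurable_continuous_onI[OF dvp1_cont])
  have "(\<lambda>h::vec3. \<Prod>j\<in>UNIV. (if j = i then dvp1 m else vp1 m) (h $ j)) \<in> borel_measurable borel"
    by (rule borel_measurable_prod) (auto intro: measurable_compose[where f="\<lambda>h. h $ _"])
  then show "dvp i m \<in> borel_measurable borel" by (simp add: dvp_def[abs_def])
qed

lemma rho_pborel: "pborel rho"
  unfolding pborel_def
proof
  show "periodic rho"
    unfolding periodic_def rho_def by (simp only: periodic_component[of abs_sin, OF abs_sin_periodic]) simp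
  have "(\<lambda>h::vec3. \<Sum>i\<in>UNIV. abs_sin (h $ i)) \<in> borel_measurable borel" by measurable
  then show "rho \<in> borel_measurable borel" by (simp add: rho_def[abs_def])
qed

lemma vp_nonneg: "0 \<le> vp m h"
  unfolding vp_def by (intro prod_nonneg) (simp add: vp1_nonneg)

lemma rho_nonneg: "0 \<le> rho h"
  unfolding rho_def by (intro sum_nonneg) simp

lemma rho_le: "rho h \<le> 3"
  unfolding rho_def sum_3 using abs_sin_le_one[of "pi * h $ 1"] abs_sin_le_one[of "pi * h $ 2"] abs_sin_le_one[of "pi * h $ 3"]
  by linarith

lemma vp_moment1:
  assumes c: "continuous_on UNIV f" and nn: "\<And>y. 0 \<le> f y"
  shows "integrable torus (\<lambda>x. \<Prod>j\<in>UNIV. (if j = k then f else vp1 m) (x $ j))"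
    and "(LINT x|torus. (\<Prod>j\<in>UNIV. (if j = k then f else vp1 m) (x $ j))) = unit_int f"
proof -
  have c': "continuous_on UNIV (if j = k then f else vp1 m)" for j using c vp1_cont by simp
  have n': "0 \<le> (if j = k then f else vp1 m) y" for j y using nn vp1_nonneg by simp
  show "integrable torus (\<lambda>x. \<Prod>j\<in>UNIV. (if j = k then f else vp1 m) (x $ j))"
    by (rule torus_prod(1)[OF c' n'])
  have "(LINT x|torus. (\<Prod>j\<in>UNIV. (if j = k then f else vp1 m) (x $ j))) = (\<Prod>j\<in>UNIV. unit_int (if j = k then f else vp1 m))"
    by (rule torus_prod(2)[OF c' n'])
  also have "\<dots> = (\<Prod>j\<in>UNIV. if j = k then unit_int f else 1)"
    by (intro prod.cong) (auto simp: unit_int_vp1)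
  finally show "(LINT x|torus. (\<Prod>j\<in>UNIV. (if j = k then f else vp1 m) (x $ j))) = unit_int f" by simp
qed

lemma vp_moment2:
  assumes ik: "i \<noteq> k" and c: "continuous_on UNIV f" "continuous_on UNIV g" and nn: "\<And>y. 0 \<le> f y" "\<And>y. 0 \<le> g y"
  shows "integrable torus (\<lambda>x. \<Prod>j\<in>UNIV. (if j = i then f else if j = k then g else vp1 m) (x $ j))"
    and "(LINT x|torus. (\<Prod>j\<in>UNIV. (if j = i then f else if j = k then g else vp1 m) (x $ j))) = unit_int f * unit_int g"
proof -
  let ?F = "\<lambda>j. if j = i then f else if j = k then g else vp1 m"
  have c': "continuous_on UNIV (?F j)" for j using c vp1_cont by simp
  have n': "0 \<le> ?F j y" for j y using nn vp1_nonneg by simp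
  show "integrable torus (\<lambda>x. \<Prod>j\<in>UNIV. ?F j (x $ j))"
    by (rule torus_prod(1)[OF c' n'])
  have "(LINT x|torus. (\<Prod>j\<in>UNIV. ?F j (x $ j))) = (\<Prod>j\<in>UNIV. unit_int (?F j))"
    by (rule torus_prod(2)[OF c' n'])
  also have "\<dots> = (\<Prod>j\<in>UNIV. (if j = i then unit_int f else 1) * (if j = k then unit_int g else 1))"
    by (intro prod.cong) (use ik in \<open>auto simp: unit_int_vp1\<close>)
  also have "\<dots> = unit_int f * unit_int g" by (simp add: prod.distrib)
  finally show "(LINT x|torus. (\<Prod>j\<in>UNIV. ?F j (x $ j))) = unit_int f * unit_int g" .
qed

lemma vp_integral: "integrable torus (vp m)" "(LINT h|torus. vp m h) = 1"
  using vp_moment1[where f="vp1 m" and k=1 and m=m, OF vp1_cont vp1_nonneg] by (simp_all add: vp_def[abs_def] unit_int_vp1)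

lemma prod_mult_delta3:
  fixes F :: "3 \<Rightarrow> real"
  shows "(\<Prod>j\<in>UNIV. F j) * a = (\<Prod>j\<in>UNIV. if j = k then a * F j else F j)"
proof -
  have "(\<Prod>j\<in>UNIV. if j = k then a * F j else F j) = (\<Prod>j\<in>UNIV. (if j = k then a else 1) * F j)"
    by (intro prod.cong) auto
  also have "\<dots> = a * (\<Prod>j\<in>UNIV. F j)" by (simp add: prod.distrib)
  finally show ?thesis by simp
qed

lemma vp_abs_sin:
  "vp m h * abs_sin (h $ k) ^ n = (\<Prod>j\<in>UNIV. (if j = k then (\<lambda>y. abs_sin y ^ n * vp1 m y) else vp1 m) (h $ j))"
  unfolding vp_def prod_mult_delta3[of _ _ k] by (intro prod.cong) auto

lemma dvp_abs_sin_same: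
  "\<bar>dvp i m h\<bar> * abs_sin (h $ i) ^ n = (\<Prod>j\<in>UNIV. (if j = i then (\<lambda>y. abs_sin y ^ n * \<bar>dvp1 m y\<bar>) else vp1 m) (h $ j))"
  unfolding dvp_def abs_prod prod_mult_delta3[of _ _ i] by (intro prod.cong) (auto simp: vp1_nonneg)

lemma dvp_abs_sin_diff:
  assumes "i \<noteq> k"
  shows "\<bar>dvp i m h\<bar> * abs_sin (h $ k) ^ n = (\<Prod>j\<in>UNIV. (if j = i then (\<lambda>y. \<bar>dvp1 m y\<bar>) else if j = k then (\<lambda>y. abs_sin y ^ n * vp1 m y) else vp1 m) (h $ j))"
  unfolding dvp_def abs_prod prod_mult_delta3[of _ _ k] using assms by (intro prod.cong) (auto simp: vp1_nonneg)

lemma vp_rho: "integrable torus (\<lambda>h. vp m h * rho h)" "(LINT h|torus. vp m h * rho h) \<le> 6 / sqrt (real m + 2)"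
proof -
  have c: "continuous_on UNIV (\<lambda>y. abs_sin y * vp1 m y)" by (intro continuous_intros vp1_cont)
  have nn: "0 \<le> abs_sin y * vp1 m y" for y by (simp add: vp1_nonneg)
  have i: "integrable torus (\<lambda>h. vp m h * abs_sin (h $ k))" and
    e: "(LINT h|torus. vp m h * abs_sin (h $ k)) = unit_int (\<lambda>y. abs_sin y * vp1 m y)" for k
    using vp_moment1[OF c nn, of k m] vp_abs_sin[of m _ k 1, unfolded power_one_right] by simp_all
  have r: "vp m h * rho h = (\<Sum>k\<in>UNIV. vp m h * abs_sin (h $ k))" for h
    by (simp add: rho_def sum_distrib_left)
  show "integrable torus (\<lambda>h. vp m h * rho h)" unfolding r by (intro Bochner_Integration.integrable_sum i)
  have "(LINT h|torus. vp m h * rho h) = 3 * unit_int (\<lambda>y. abs_sin y * vp1 m y)"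
    unfolding r by (subst Bochner_Integration.integral_sum) (simp_all add: i e)
  also have "\<dots> = 3 * (2 / pi * (1 / (cosint (Suc m) * (2 * real m + 3))))"
    unfolding unit_int_sin_vp1 by (simp add: mult_ac)
  also have "\<dots> \<le> 3 * (1 * (2 / sqrt (real m + 2)))"
    using pi_ge_two cosint_pos[of "Suc m"] inverse_cosint[of m] by (intro mult_left_mono mult_mono) auto
  finally show "(LINT h|torus. vp m h * rho h) \<le> 6 / sqrt (real m + 2)" by simp
qed

lemma dvp_moment:
  fixes n :: nat
  shows "integrable torus (\<lambda>h. \<bar>dvp i m h\<bar> * abs_sin (h $ k) ^ n)"
    and "(LINT h|torus. \<bar>dvp i m h\<bar> * abs_sin (h $ k) ^ n) = (if k = i then unit_int (\<lambda>y. abs_sin y ^ n * \<bar>dvp1 m y\<bar>)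
       else unit_int (\<lambda>y. \<bar>dvp1 m y\<bar>) * unit_int (\<lambda>y. abs_sin y ^ n * vp1 m y))"
proof -
  have c: "continuous_on UNIV (\<lambda>y. abs_sin y ^ n * vp1 m y)" "continuous_on UNIV (\<lambda>y. abs_sin y ^ n * \<bar>dvp1 m y\<bar>)"
     "continuous_on UNIV (\<lambda>y. \<bar>dvp1 m y\<bar>)"
    by (intro continuous_intros vp1_cont dvp1_cont)+
  have nn: "0 \<le> abs_sin y ^ n * vp1 m y" "0 \<le> abs_sin y ^ n * \<bar>dvp1 m y\<bar>" "0 \<le> \<bar>dvp1 m y\<bar>" for y
    by (simp_all add: vp1_nonneg)
  show "integrable torus (\<lambda>h. \<bar>dvp i m h\<bar> * abs_sin (h $ k) ^ n)"
  proof (cases "k = i")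
    case True
    then show ?thesis using vp_moment1(1)[OF c(2) nn(2), of i m] by (simp add: dvp_abs_sin_same)
  next
    case False
    then show ?thesis using vp_moment2(1)[OF _ c(3) c(1) nn(3) nn(1), of i k m] by (simp add: dvp_abs_sin_diff)
  qed
  show "(LINT h|torus. \<bar>dvp i m h\<bar> * abs_sin (h $ k) ^ n) = (if k = i then unit_int (\<lambda>y. abs_sin y ^ n * \<bar>dvp1 m y\<bar>)
       else unit_int (\<lambda>y. \<bar>dvp1 m y\<bar>) * unit_int (\<lambda>y. abs_sin y ^ n * vp1 m y))"
  proof (cases "k = i")
    case True
    then show ?thesis using vp_moment1(2)[OF c(2) nn(2), of i m] by (simp add: dvp_abs_sin_same)
  next
    case False
    then show ?thesis using vp_moment2(2)[OF _ c(3) c(1) nn(3) nn(1), of i k m] by (simp add: dvp_abs_sin_diff)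
  qed
qed

text \<open>One factor \<open>rho\<close> absorbs the derivative. The constant does not depend on \<open>m\<close>; this uniformity is what allows
  the transport term to be estimated with Lipschitz increments.\<close>

lemma dvp_rho: "integrable torus (\<lambda>h. \<bar>dvp i m h\<bar> * rho h)" "(LINT h|torus. \<bar>dvp i m h\<bar> * rho h) \<le> 60"
proof -
  have r: "\<bar>dvp i m h\<bar> * rho h = (\<Sum>k\<in>UNIV. \<bar>dvp i m h\<bar> * abs_sin (h $ k) ^ 1)" for h
    by (simp add: rho_def sum_distrib_left)
  show "integrable torus (\<lambda>h. \<bar>dvp i m h\<bar> * rho h)" unfolding r by (intro Bochner_Integration.integrable_sum dvp_moment)
  have b: "(LINT h|torus. \<bar>dvp i m h\<bar> * abs_sin (h $ k) ^ 1) \<le> 20" for k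
  proof (cases "k = i")
    case True
    have "unit_int (\<lambda>y. abs_sin y * \<bar>dvp1 m y\<bar>) \<le> 20"
      using unit_int_sin_dvp1[of m] pi_less_4 by simp
    then show ?thesis unfolding dvp_moment using True by simp
  next
    case False
    let ?I = "cosint (Suc m)"
    have "unit_int (\<lambda>y. \<bar>dvp1 m y\<bar>) * unit_int (\<lambda>y. abs_sin y * vp1 m y) \<le> 4 / ?I * (2 / (pi * (2 * real m + 3) * ?I))"
      unfolding unit_int_sin_vp1 using cosint_pos[of "Suc m"] by (intro mult_right_mono unit_int_dvp1) auto
    also have "\<dots> = 8 / pi * (1 / (?I\<^sup>2 * (2 * real m + 3)))"
      by (simp add: power2_eq_square mult_ac)
    also have "\<dots> \<le> 8 * 2"
      using pi_ge_two cosint_pos[of "Suc m"] inverse_cosint_sq[of m] by (intro mult_mono) (auto simp: field_simps)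
    finally show ?thesis unfolding dvp_moment using False by simp
  qed
  have "(LINT h|torus. \<bar>dvp i m h\<bar> * rho h) = (\<Sum>k\<in>UNIV. (LINT h|torus. \<bar>dvp i m h\<bar> * abs_sin (h $ k) ^ 1))"
    unfolding r by (intro Bochner_Integration.integral_sum dvp_moment)
  also have "\<dots> \<le> (\<Sum>k\<in>(UNIV::3 set). 20)" by (intro sum_mono b)
  finally show "(LINT h|torus. \<bar>dvp i m h\<bar> * rho h) \<le> 60" by simp
qed

text \<open>With a second factor \<open>rho\<close> there is decay: the gradient of the kernel concentrates at the lattice even
  after multiplication by \<open>rho\<close>.\<close>

lemma dvp_rho2: "integrable torus (\<lambda>h. \<bar>dvp i m h\<bar> * (rho h)\<^sup>2)" "(LINT h|torus. \<bar>dvp i m h\<bar> * (rho h)\<^sup>2) \<le> 144 / sqrt (real m + 2)"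
proof -
  let ?s = "\<lambda>h. \<Sum>k\<in>UNIV. \<bar>dvp i m h\<bar> * abs_sin (h $ k) ^ 2"
  have r: "\<bar>dvp i m h\<bar> * (rho h)\<^sup>2 \<le> 3 * ?s h" for h
  proof -
    have "(a + b + c)\<^sup>2 \<le> 3 * (a\<^sup>2 + b\<^sup>2 + c\<^sup>2)" for a b c :: real
      using sum_squares_ge_zero[of "a - b" "b - c"] sum_squares_ge_zero[of "a - c" 0] by (simp add: power2_eq_square algebra_simps)
    then have "(rho h)\<^sup>2 \<le> 3 * (\<Sum>k\<in>UNIV. abs_sin (h $ k) ^ 2)"
      unfolding rho_def sum_3 by blast
    from mult_left_mono[OF this, of "\<bar>dvp i m h\<bar>"] show ?thesis
      by (simp add: sum_distrib_left mult_ac)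
  qed
  have si: "integrable torus ?s" by (intro Bochner_Integration.integrable_sum dvp_moment)
  show ii: "integrable torus (\<lambda>h. \<bar>dvp i m h\<bar> * (rho h)\<^sup>2)"
  proof (rule Bochner_Integration.integrable_bound)
    show "integrable torus (\<lambda>h. 3 * ?s h)" using si by simp
    have "pborel (\<lambda>h. \<bar>dvp i m h\<bar> * (rho h)\<^sup>2)"
      by (intro pborel_mult pborel_comp[OF dvp_pborel] pborel_comp[OF rho_pborel]) auto
    then show "(\<lambda>h. \<bar>dvp i m h\<bar> * (rho h)\<^sup>2) \<in> borel_measurable torus"
      by (intro measurable_torus) auto
    show "AE h in torus. norm (\<bar>dvp i m h\<bar> * (rho h)\<^sup>2) \<le> norm (3 * ?s h)"
    proof (intro AE_I2)
      fix h
      have "0 \<le> \<bar>dvp i m h\<bar> * (rho h)\<^sup>2" by simp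
      then show "norm (\<bar>dvp i m h\<bar> * (rho h)\<^sup>2) \<le> norm (3 * ?s h)"
        using r[of h] unfolding real_norm_def by linarith
    qed
  qed
  have b: "(LINT h|torus. \<bar>dvp i m h\<bar> * abs_sin (h $ k) ^ 2) \<le> 16 / sqrt (real m + 2)" for k
  proof (cases "k = i")
    case True
    have "unit_int (\<lambda>y. (abs_sin y)\<^sup>2 * \<bar>dvp1 m y\<bar>) \<le> 16 / sqrt (real m + 2)"
      using unit_int_sin2_dvp1[of m] inverse_cosint[of m] by simp
    then show ?thesis unfolding dvp_moment using True by simp
  next
    case False
    let ?I = "cosint (Suc m)"
    have "unit_int (\<lambda>y. \<bar>dvp1 m y\<bar>) * unit_int (\<lambda>y. (abs_sin y)\<^sup>2 * vp1 m y) \<le> 4 / ?I * (1 / (2 * real m + 4))"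
      unfolding unit_int_sin2_vp1 by (intro mult_right_mono unit_int_dvp1) auto
    also have "\<dots> \<le> 4 / ?I * (1 / (2 * real m + 3))"
      using cosint_pos[of "Suc m"] by (intro mult_left_mono frac_le) auto
    also have "\<dots> \<le> 8 / sqrt (real m + 2)" using inverse_cosint[of m] by simp
    also have "\<dots> \<le> 16 / sqrt (real m + 2)" by (intro divide_right_mono) auto
    finally show ?thesis unfolding dvp_moment using False by simp
  qed
  have "(LINT h|torus. \<bar>dvp i m h\<bar> * (rho h)\<^sup>2) \<le> (LINT h|torus. 3 * ?s h)"
    using si by (intro integral_mono ii r) simp
  also have "\<dots> = 3 * (\<Sum>k\<in>UNIV. (LINT h|torus. \<bar>dvp i m h\<bar> * abs_sin (h $ k) ^ 2))"
    by (simp only: integral_mult_right_zero Bochner_Integration.integral_sum[OF dvp_moment(1)])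
  also have "\<dots> \<le> 3 * (\<Sum>k\<in>(UNIV::3 set). 16 / sqrt (real m + 2))" by (intro mult_left_mono sum_mono b) auto
  finally show "(LINT h|torus. \<bar>dvp i m h\<bar> * (rho h)\<^sup>2) \<le> 144 / sqrt (real m + 2)" by simp
qed

lemma sin_ge_linear: "0 \<le> y \<Longrightarrow> y \<le> 1 / 2 \<Longrightarrow> 2 * y \<le> sin (pi * y)"
proof -
  assume y: "0 \<le> y" "y \<le> 1 / 2"
  have "convex_on {0..pi/2} (\<lambda>x. - sin x)"
  proof (rule f''_ge0_imp_convex)
    show "((\<lambda>x. - sin x) has_real_derivative - cos x) (at x)" for x :: real
      by (auto intro!: derivative_eq_intros)
    show "((\<lambda>x. - cos x) has_real_derivative sin x) (at x)" for x :: real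
      by (auto intro!: derivative_eq_intros)
    show "0 \<le> sin x" if "x \<in> {0..pi/2}" for x :: real
      using that by (intro sin_ge_zero) auto
  qed simp
  from convex_onD[OF this, of "2 * y" 0 "pi / 2"] y show ?thesis by (simp add: mult.commute)
qed

lemma abs_sin_abs: "abs_sin \<bar>y\<bar> = abs_sin y"
  by (cases "y \<ge> 0") simp_all

text \<open>Reduction to the nearest lattice point, where \<open>sin (pi * y) \<ge> 2 * y\<close> holds on \<open>{0..1/2}\<close>.\<close>

lemma rho_lattice: obtains k where "k \<in> int_vec" "norm (h - k) \<le> rho h"
proof -
  define k :: vec3 where "k = (\<chi> i. of_int (round (h $ i)))"
  have "\<bar>h $ i - k $ i\<bar> \<le> abs_sin (h $ i)" for i
  proof -
    let ?y = "h $ i - k $ i"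
    have y: "\<bar>?y\<bar> \<le> 1 / 2"
      using of_int_round_abs_le[of "h $ i"] by (simp add: k_def abs_minus_commute)
    let ?z = "pi * of_int (round (h $ i))"
    have "sin ?z = 0" by (rule sin_npi_int)
    then have "\<bar>cos ?z\<bar> = 1" using sin_cos_squared_add[of ?z] by (simp add: abs_square_eq_1)
    moreover have "pi * h $ i = pi * ?y + ?z" by (simp add: k_def algebra_simps)
    ultimately have "abs_sin (h $ i) = abs_sin ?y"
      using \<open>sin ?z = 0\<close> by (simp only: sin_add abs_mult mult_zero_right add_0_right mult_1_right)
    also have "\<dots> = abs_sin \<bar>?y\<bar>" by (rule abs_sin_abs[symmetric])
    finally have e: "abs_sin (h $ i) = abs_sin \<bar>?y\<bar>" .
    have "\<bar>?y\<bar> \<le> 2 * \<bar>?y\<bar>" by simp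
    also have "\<dots> \<le> sin (pi * \<bar>?y\<bar>)" using sin_ge_linear[of "\<bar>?y\<bar>"] y by simp
    also have "\<dots> \<le> abs_sin \<bar>?y\<bar>" by (rule abs_ge_self)
    finally show ?thesis unfolding e .
  qed
  then have "norm (h - k) \<le> rho h"
    unfolding rho_def by (intro order_trans[OF norm_le_l1_cart] sum_mono) auto
  moreover have "k \<in> int_vec" by (simp add: int_vec_def k_def)
  ultimately show thesis using that by blast
qed

lemma integral_abs_le:
  fixes f g :: "'a \<Rightarrow> real"
  assumes "integrable M f" "integrable M g" "\<And>x. \<bar>f x\<bar> \<le> g x"
  shows "\<bar>integral\<^sup>L M f\<bar> \<le> integral\<^sup>L M g"
proof -
  have "integrable M (\<lambda>x. \<bar>f x\<bar>)" using assms(1) by (rule integrable_abs)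
  then have "(\<integral>x. \<bar>f x\<bar> \<partial>M) \<le> integral\<^sup>L M g"
    using assms(2,3) by (intro integral_mono)
  then show ?thesis using integral_abs_bound[of M f] by linarith
qed

lemma inverse_sqrt_small:
  assumes "(r::real) > 0" obtains N where "\<And>m. m \<ge> N \<Longrightarrow> r / 2 + c * (2 / sqrt (real m + 2)) < r"
proof -
  have "(\<lambda>m. r / 2 + c * (2 / sqrt (real m + 2))) \<longlonglongrightarrow> r / 2 + c * 0"
    by (intro tendsto_intros inverse_sqrt_tendsto)
  then have "\<forall>\<^sub>F m in sequentially. r / 2 + c * (2 / sqrt (real m + 2)) < r"
    by (rule order_tendstoD(2)) (use assms in simp)
  then show thesis using that by (auto simp: eventually_sequentially)
qed

text \<open>Functions of the translation vector that stay bounded and tend to zero at the origin; moduli of continuity in the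
  cubic norm are of this kind.\<close>

definition vanishing :: "(vec3 \<Rightarrow> real) \<Rightarrow> bool" where
  "vanishing H \<longleftrightarrow> pborel H \<and> (\<exists>C. \<forall>h. \<bar>H h\<bar> \<le> C) \<and> (\<forall>e>0. \<exists>d>0. \<forall>h. norm h < d \<longrightarrow> \<bar>H h\<bar> \<le> e)"

lemma vanishing_bound:
  assumes "vanishing H" "e > 0"
  obtains B where "B \<ge> 0" "\<And>h. \<bar>H h\<bar> \<le> e + B * rho h"
proof -
  obtain C d where C: "\<And>h. \<bar>H h\<bar> \<le> C" and d: "d > 0" "\<And>h. norm h < d \<Longrightarrow> \<bar>H h\<bar> \<le> e"
    using assms unfolding vanishing_def by meson
  have p: "periodic H" using assms by (auto simp: vanishing_def)
  have C0: "C \<ge> 0" using C[of 0] by linarith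
  show thesis
  proof (rule that[of "C / d"])
    fix h
    obtain k where k: "k \<in> int_vec" "norm (h - k) \<le> rho h" by (rule rho_lattice)
    show "\<bar>H h\<bar> \<le> e + C / d * rho h"
    proof (cases "norm (h - k) < d")
      case True
      have "H (h - k) = H h" using periodic_int_vec[OF p int_vec_uminus[OF k(1)], of h] by simp
      then have "\<bar>H h\<bar> \<le> e" using d(2)[OF True] by simp
      moreover have "0 \<le> C / d * rho h" using C0 d(1) rho_nonneg[of h] by simp
      ultimately show ?thesis by linarith
    next
      case False
      then have "C / d * d \<le> C / d * rho h" using k(2) C0 d(1) by (intro mult_left_mono) auto
      then show ?thesis using C[of h] assms(2) d(1) by simp
    qed
  qed (use C0 d in simp)
qed

text \<open>The kernels concentrate at the lattice: against a bounded function \<open>\<le> e + B * rho\<close> the first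
  moment controls the integral.\<close>

lemma vp_bounded_integrable:
  assumes H: "pborel H" "\<And>h. \<bar>H h\<bar> \<le> C"
  shows "integrable torus (\<lambda>h. vp m h * H h)"
proof (rule Bochner_Integration.integrable_bound)
  show "integrable torus (\<lambda>h. C * vp m h)" using vp_integral by simp
  show "(\<lambda>h. vp m h * H h) \<in> borel_measurable torus"
    using pborel_mult[OF vp_pborel H(1)] by (intro measurable_torus) auto
  have "\<bar>vp m h * H h\<bar> \<le> \<bar>C * vp m h\<bar>" for h
    using mult_left_mono[OF H(2)[of h] vp_nonneg[of m h]] H(2)[of h] vp_nonneg[of m h]
    by (simp add: abs_mult mult.commute)
  then show "AE h in torus. norm (vp m h * H h) \<le> norm (C * vp m h)" by simp
qed

lemma vp_average_le:
  assumes H: "pborel H" "\<And>h. \<bar>H h\<bar> \<le> C"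
  shows "\<bar>LINT h|torus. vp m h * H h\<bar> \<le> C"
proof -
  have "\<bar>LINT h|torus. vp m h * H h\<bar> \<le> (LINT h|torus. C * vp m h)"
  proof (rule integral_abs_le)
    show "integrable torus (\<lambda>h. vp m h * H h)" by (rule vp_bounded_integrable[OF H])
    show "\<bar>vp m h * H h\<bar> \<le> C * vp m h" for h
      using mult_left_mono[OF H(2)[of h] vp_nonneg[of m h]] vp_nonneg[of m h]
      by (simp add: abs_mult mult.commute)
  qed (use vp_integral in simp)
  then show ?thesis using vp_integral by simp
qed

lemma vp_approx:
  assumes H: "vanishing H"
  shows "(\<lambda>m. LINT h|torus. vp m h * H h) \<longlonglongrightarrow> 0"
proof (rule LIMSEQ_I)
  fix r :: real assume r: "r > 0"
  obtain B where B: "B \<ge> 0" "\<And>h. \<bar>H h\<bar> \<le> r / 2 + B * rho h"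
    using vanishing_bound[OF H, of "r / 2"] r by auto
  obtain C where C: "\<And>h. \<bar>H h\<bar> \<le> C" and p: "pborel H" using H by (auto simp: vanishing_def)
  have b: "\<bar>LINT h|torus. vp m h * H h\<bar> \<le> r / 2 + (3 * B) * (2 / sqrt (real m + 2))" for m
  proof -
    have "\<bar>LINT h|torus. vp m h * H h\<bar> \<le> (LINT h|torus. r / 2 * vp m h + B * (vp m h * rho h))"
    proof (rule integral_abs_le)
      show "integrable torus (\<lambda>h. vp m h * H h)" by (rule vp_bounded_integrable[OF p C])
      show "integrable torus (\<lambda>h. r / 2 * vp m h + B * (vp m h * rho h))"
        using vp_integral vp_rho by simp
      show "\<bar>vp m h * H h\<bar> \<le> r / 2 * vp m h + B * (vp m h * rho h)" for h
        using mult_left_mono[OF B(2)[of h] vp_nonneg[of m h]] vp_nonneg[of m h]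
        by (simp add: abs_mult algebra_simps)
    qed
    also have "\<dots> = r / 2 + B * (LINT h|torus. vp m h * rho h)"
      using vp_integral vp_rho by simp
    also have "\<dots> \<le> r / 2 + B * (6 / sqrt (real m + 2))"
      using vp_rho(2)[of m] B(1) by (intro add_left_mono mult_left_mono)
    finally show ?thesis by (simp add: mult_ac)
  qed
  obtain N where "\<And>m. m \<ge> N \<Longrightarrow> r / 2 + (3 * B) * (2 / sqrt (real m + 2)) < r"
    using inverse_sqrt_small[OF r] by blast
  then have "norm ((LINT h|torus. vp m h * H h) - 0) < r" if "m \<ge> N" for m
    using b[of m] that by fastforce
  then show "\<exists>no. \<forall>m\<ge>no. norm ((LINT h|torus. vp m h * H h) - 0) < r" by blast
qed

lemma dvp_rho_integrable:
  assumes G: "pborel G" "\<And>h. \<bar>G h\<bar> \<le> C * rho h"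
  shows "integrable torus (\<lambda>h. dvp i m h * G h)" "\<bar>LINT h|torus. dvp i m h * G h\<bar> \<le> 60 * C"
proof -
  have C: "C \<ge> 0"
  proof (rule ccontr)
    assume "\<not> C \<ge> 0"
    moreover have "rho (axis 1 (1/2)) > 0" unfolding rho_def sum_3 by (simp add: axis_def)
    ultimately have "C * rho (axis 1 (1/2)) < 0" by (simp add: mult_neg_pos)
    with G(2)[of "axis 1 (1/2)"] show False by linarith
  qed
  have le: "\<bar>dvp i m h * G h\<bar> \<le> C * (\<bar>dvp i m h\<bar> * rho h)" for h
    using mult_left_mono[OF G(2)[of h], of "\<bar>dvp i m h\<bar>"] by (simp add: abs_mult mult_ac)
  show I: "integrable torus (\<lambda>h. dvp i m h * G h)"
  proof (rule Bochner_Integration.integrable_bound)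
    show "integrable torus (\<lambda>h. C * (\<bar>dvp i m h\<bar> * rho h))" using dvp_rho by simp
    show "(\<lambda>h. dvp i m h * G h) \<in> borel_measurable torus"
      using pborel_mult[OF dvp_pborel G(1)] by (intro measurable_torus) auto
    show "AE h in torus. norm (dvp i m h * G h) \<le> norm (C * (\<bar>dvp i m h\<bar> * rho h))"
      unfolding real_norm_def by (intro AE_I2 order_trans[OF le abs_ge_self])
  qed
  have "\<bar>LINT h|torus. dvp i m h * G h\<bar> \<le> (LINT h|torus. C * (\<bar>dvp i m h\<bar> * rho h))"
    by (rule integral_abs_le)
       (use I le dvp_rho in auto)
  also have "\<dots> \<le> C * 60" using dvp_rho(2)[of i m] C by (simp add: mult_left_mono)
  finally show "\<bar>LINT h|torus. dvp i m h * G h\<bar> \<le> 60 * C" by simp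
qed

lemma dvp_approx:
  assumes H: "vanishing H" and G: "pborel G" "\<And>h. \<bar>G h\<bar> \<le> rho h * \<bar>H h\<bar>"
  shows "(\<lambda>m. LINT h|torus. dvp i m h * G h) \<longlonglongrightarrow> 0"
proof (rule LIMSEQ_I)
  fix r :: real assume r: "r > 0"
  obtain B where B: "B \<ge> 0" "\<And>h. \<bar>H h\<bar> \<le> r / 120 + B * rho h"
    using vanishing_bound[OF H, of "r / 120"] r by auto
  obtain C where C: "\<And>h. \<bar>H h\<bar> \<le> C" using H by (auto simp: vanishing_def)
  have GC: "\<bar>G h\<bar> \<le> C * rho h" for h
    using G(2)[of h] mult_left_mono[OF C[of h] rho_nonneg[of h]] by (simp add: mult.commute)
  have b: "\<bar>LINT h|torus. dvp i m h * G h\<bar> \<le> r / 2 + (72 * B) * (2 / sqrt (real m + 2))" for m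
  proof -
    have "\<bar>LINT h|torus. dvp i m h * G h\<bar> \<le> (LINT h|torus. r / 120 * (\<bar>dvp i m h\<bar> * rho h) + B * (\<bar>dvp i m h\<bar> * (rho h)\<^sup>2))"
    proof (rule integral_abs_le)
      show "integrable torus (\<lambda>h. dvp i m h * G h)" by (rule dvp_rho_integrable[OF G(1) GC])
      show "integrable torus (\<lambda>h. r / 120 * (\<bar>dvp i m h\<bar> * rho h) + B * (\<bar>dvp i m h\<bar> * (rho h)\<^sup>2))"
        using dvp_rho dvp_rho2 by simp
      fix h
      have "\<bar>dvp i m h * G h\<bar> \<le> \<bar>dvp i m h\<bar> * (rho h * (r / 120 + B * rho h))"
        unfolding abs_mult using mult_left_mono[OF B(2)[of h] rho_nonneg[of h]] G(2)[of h]
        by (intro mult_left_mono) auto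
      then show "\<bar>dvp i m h * G h\<bar> \<le> r / 120 * (\<bar>dvp i m h\<bar> * rho h) + B * (\<bar>dvp i m h\<bar> * (rho h)\<^sup>2)"
        by (simp add: algebra_simps power2_eq_square)
    qed
    also have "\<dots> = r / 120 * (LINT h|torus. \<bar>dvp i m h\<bar> * rho h) + B * (LINT h|torus. \<bar>dvp i m h\<bar> * (rho h)\<^sup>2)"
      using dvp_rho dvp_rho2 by simp
    also have "\<dots> \<le> r / 120 * 60 + B * (144 / sqrt (real m + 2))"
      using dvp_rho(2)[of i m] dvp_rho2(2)[of i m] B(1) r by (intro add_mono mult_left_mono) auto
    finally show ?thesis by (simp add: mult_ac)
  qed
  obtain N where "\<And>m. m \<ge> N \<Longrightarrow> r / 2 + (72 * B) * (2 / sqrt (real m + 2)) < r"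
    using inverse_sqrt_small[OF r] by blast
  then have "norm ((LINT h|torus. dvp i m h * G h) - 0) < r" if "m \<ge> N" for m
    using b[of m] that by fastforce
  then show "\<exists>no. \<forall>m\<ge>no. norm ((LINT h|torus. dvp i m h * G h) - 0) < r" by blast
qed

section \<open>Smooth functions and trigonometric kernels\<close>

lemma dderiv_eq:
  "(f has_derivative f') (at z) \<Longrightarrow> dderiv v f z = f' v"
  unfolding dderiv_def using frechet_derivative_at[of f f' z] by simp

text \<open>Smoothness quantifies over all iterated directional derivatives, so it is proved by exhibiting a set of
  differentiable functions that contains the given one and is closed under directional derivatives.\<close>

lemma smooth_coinduct:
  assumes f: "f \<in> C" and d: "\<And>g. g \<in> C \<Longrightarrow> g differentiable_on UNIV"
    and D: "\<And>g v. g \<in> C \<Longrightarrow> dderiv v g \<in> C"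
  shows "smooth f"
proof -
  have "foldr dderiv vs f \<in> C" for vs by (induction vs) (auto intro: f D)
  then show ?thesis unfolding smooth_def using d by blast
qed

lemma smooth_differentiable: "smooth f \<Longrightarrow> f differentiable (at x)"
  unfolding smooth_def by (metis UNIV_I differentiable_on_eq_differentiable_at foldr_Nil id_apply open_UNIV)

lemma smooth_has_derivative: "smooth f \<Longrightarrow> (f has_derivative (\<lambda>v. dderiv v f x)) (at x)"
  using smooth_differentiable[of f x] by (simp add: dderiv_def frechet_derivative_works)

lemma smooth_dderiv: "smooth f \<Longrightarrow> smooth (dderiv v f)"
proof -
  assume f: "smooth f"
  have "foldr dderiv vs (dderiv v f) = foldr dderiv (vs @ [v]) f" for vs by simp
  then show ?thesis using f unfolding smooth_def by metis
qed

lemma smooth_continuous: "smooth f \<Longrightarrow> continuous_on A f"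
  by (meson continuous_at_imp_continuous_on differentiable_imp_continuous_within smooth_differentiable)

lemma differentiable_UNIV_I: "(\<And>x. (f has_derivative f' x) (at x)) \<Longrightarrow> f differentiable_on UNIV"
  unfolding differentiable_on_def using differentiableI by blast

lemma smooth_const: "smooth (\<lambda>x. c)"
proof (rule smooth_coinduct[where C="range (\<lambda>c x. c)"])
  fix g :: "'a \<Rightarrow> 'b" and v assume "g \<in> range (\<lambda>c x. c)"
  then obtain c where g: "g = (\<lambda>x. c)" by blast
  show "g differentiable_on UNIV" unfolding g by simp
  have "dderiv v g = (\<lambda>x. 0)" unfolding g by (rule ext) (rule dderiv_eq[OF has_derivative_const])
  then show "dderiv v g \<in> range (\<lambda>c x. c)" by blast
qed blast

lemma dderiv_linear: "smooth f \<Longrightarrow> linear (\<lambda>v. dderiv v f x)"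
  using smooth_has_derivative has_derivative_linear by blast

text \<open>Products alone are not closed under differentiation; their finite sums are. This set serves as the invariant for
  \<open>smooth_coinduct\<close>.\<close>

inductive_set smooth_alg :: "('a::euclidean_space \<Rightarrow> real) set" where
  smooth_alg_prod: "smooth f \<Longrightarrow> smooth g \<Longrightarrow> (\<lambda>x. f x * g x) \<in> smooth_alg"
| smooth_alg_add: "a \<in> smooth_alg \<Longrightarrow> b \<in> smooth_alg \<Longrightarrow> (\<lambda>x. a x + b x) \<in> smooth_alg"

lemma smooth_alg_step:
  "a \<in> smooth_alg \<Longrightarrow> a differentiable_on UNIV \<and> dderiv v a \<in> smooth_alg"
proof (induction rule: smooth_alg.induct)
  case (smooth_alg_prod f g)
  have h: "((\<lambda>x. f x * g x) has_derivative (\<lambda>v. f x * dderiv v g x + dderiv v f x * g x)) (at x)" for x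
    by (rule has_derivative_mult[OF smooth_has_derivative smooth_has_derivative]) fact+
  have "dderiv v (\<lambda>x. f x * g x) = (\<lambda>x. f x * dderiv v g x + dderiv v f x * g x)"
    by (rule ext) (rule dderiv_eq[OF h])
  then show ?case
    using differentiable_UNIV_I[OF h] smooth_alg_prod smooth_dderiv
    by (auto intro!: smooth_alg.intros)
next
  case (smooth_alg_add a b)
  then have "a differentiable (at x)" "b differentiable (at x)" for x
    by (auto simp: differentiable_on_eq_differentiable_at)
  then have h: "((\<lambda>x. a x + b x) has_derivative (\<lambda>v. dderiv v a x + dderiv v b x)) (at x)" for x
    unfolding dderiv_def frechet_derivative_works by (intro has_derivative_add)
  have "dderiv v (\<lambda>x. a x + b x) = (\<lambda>x. dderiv v a x + dderiv v b x)"
    by (rule ext) (rule dderiv_eq[OF h])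
  then show ?case
    using differentiable_UNIV_I[OF h] smooth_alg_add by (auto intro!: smooth_alg.intros)
qed

lemma smooth_alg_smooth: "a \<in> smooth_alg \<Longrightarrow> smooth a"
  by (rule smooth_coinduct[where C=smooth_alg]) (use smooth_alg_step in blast)+

lemma smooth_mult: "smooth f \<Longrightarrow> smooth g \<Longrightarrow> smooth (\<lambda>x. f x * g x :: real)"
  by (rule smooth_alg_smooth) (rule smooth_alg_prod)

lemma smooth_cmult: "smooth f \<Longrightarrow> smooth (\<lambda>x. c * f x :: real)"
  by (rule smooth_mult[OF smooth_const])

lemma smooth_add:
  fixes f g :: "'a::euclidean_space \<Rightarrow> real"
  assumes "smooth f" "smooth g" shows "smooth (\<lambda>x. f x + g x)"
proof -
  have "(\<lambda>x. f x * 1) \<in> smooth_alg" "(\<lambda>x. g x * 1) \<in> smooth_alg"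
    by (intro smooth_alg_prod assms smooth_const)+
  from smooth_alg_smooth[OF smooth_alg_add[OF this]] show ?thesis by simp
qed

lemma smooth_scaleR:
  fixes f :: "'a::euclidean_space \<Rightarrow> real"
  assumes "smooth f" shows "smooth (\<lambda>x. f x *\<^sub>R e)"
proof (rule smooth_coinduct[where C="{\<lambda>x. f x *\<^sub>R e |f. smooth f}"])
  fix g :: "'a \<Rightarrow> 'b" and v assume "g \<in> {\<lambda>x. f x *\<^sub>R e |f. smooth f}"
  then obtain f where f: "smooth f" and g: "g = (\<lambda>x. f x *\<^sub>R e)" by blast
  have h: "(g has_derivative (\<lambda>v. dderiv v f x *\<^sub>R e)) (at x)" for x
    unfolding g by (rule has_derivative_scaleR_left[OF smooth_has_derivative[OF f]])
  show "g differentiable_on UNIV" by (rule differentiable_UNIV_I[OF h])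
  have "dderiv v g = (\<lambda>x. dderiv v f x *\<^sub>R e)" by (rule ext) (rule dderiv_eq[OF h])
  then show "dderiv v g \<in> {\<lambda>x. f x *\<^sub>R e |f. smooth f}" using smooth_dderiv[OF f] by blast
qed (use assms in blast)

lemma dderiv_scaleR: "smooth f \<Longrightarrow> dderiv v (\<lambda>x. f x *\<^sub>R e) = (\<lambda>x. dderiv v f x *\<^sub>R e)" for f :: "'a::euclidean_space \<Rightarrow> real"
  by (rule ext, rule dderiv_eq, rule has_derivative_scaleR_left[OF smooth_has_derivative])

lemma dderiv_mult: "smooth f \<Longrightarrow> smooth g \<Longrightarrow> dderiv v (\<lambda>x. f x * g x :: real) = (\<lambda>x. f x * dderiv v g x + dderiv v f x * g x)"
  by (rule ext, rule dderiv_eq, rule has_derivative_mult[OF smooth_has_derivative smooth_has_derivative])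

lemma dderiv_add: "smooth f \<Longrightarrow> smooth g \<Longrightarrow> dderiv v (\<lambda>x. f x + g x) = (\<lambda>x. dderiv v f x + dderiv v g x)"
  by (rule ext, rule dderiv_eq, rule has_derivative_add[OF smooth_has_derivative smooth_has_derivative])

lemma dderiv_cmult: "smooth f \<Longrightarrow> dderiv v (\<lambda>x. c * f x :: real) = (\<lambda>x. c * dderiv v f x)"
  by (rule ext, rule dderiv_eq, rule has_derivative_mult_right[OF smooth_has_derivative])

lemma has_derivative_cos_inner:
  "((\<lambda>y. c * cos (a + b \<bullet> y)) has_derivative (\<lambda>v. c * (b \<bullet> v) * cos (a + pi / 2 + b \<bullet> y))) (at y)"
proof -
  have "cos (a + pi / 2 + b \<bullet> y) = - sin (a + b \<bullet> y)"
    using minus_sin_cos_eq[of "a + b \<bullet> y"] by (simp add: algebra_simps)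
  then show ?thesis by (auto intro!: derivative_eq_intros simp: algebra_simps)
qed

lemma dderiv_cos_inner: "dderiv v (\<lambda>y. c * cos (a + b \<bullet> y)) = (\<lambda>y. c * (b \<bullet> v) * cos (a + pi / 2 + b \<bullet> y))"
  by (rule ext) (rule dderiv_eq[OF has_derivative_cos_inner])

lemma smooth_cos_inner:
  fixes b :: "'a::euclidean_space"
  shows "smooth (\<lambda>y. c * cos (a + b \<bullet> y))"
proof (rule smooth_coinduct[where C="{\<lambda>y. c * cos (a + b \<bullet> y) |a c. True}"])
  fix g v assume "g \<in> {\<lambda>y. c * cos (a + b \<bullet> y) |a c. True}"
  then obtain a c where g: "g = (\<lambda>y. c * cos (a + b \<bullet> y))" by blast
  show "g differentiable_on UNIV" unfolding g by (rule differentiable_UNIV_I[OF has_derivative_cos_inner])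
  show "dderiv v g \<in> {\<lambda>y. c * cos (a + b \<bullet> y) |a c. True}"
    unfolding g dderiv_cos_inner by blast
qed blast

lemma smooth_snd:
  fixes f :: "real \<Rightarrow> real"
  assumes "smooth f" shows "smooth (\<lambda>z::vec3 \<times> real. f (snd z))"
    and "dderiv w (\<lambda>z::vec3 \<times> real. f (snd z)) = (\<lambda>z. dderiv (snd w) f (snd z))"
proof -
  have h: "((\<lambda>z::vec3 \<times> real. f (snd z)) has_derivative (\<lambda>v. dderiv (snd v) f (snd z))) (at z)" if "smooth f" for f :: "real \<Rightarrow> real" and z
    by (rule has_derivative_compose[OF has_derivative_snd[OF has_derivative_ident] smooth_has_derivative[OF that]])
  have e: "dderiv w (\<lambda>z::vec3 \<times> real. f (snd z)) = (\<lambda>z. dderiv (snd w) f (snd z))" if "smooth f" for f :: "real \<Rightarrow> real" and w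
    by (rule ext) (rule dderiv_eq[OF h[OF that]])
  show "dderiv w (\<lambda>z::vec3 \<times> real. f (snd z)) = (\<lambda>z. dderiv (snd w) f (snd z))" by (rule e) fact
  show "smooth (\<lambda>z::vec3 \<times> real. f (snd z))"
  proof (rule smooth_coinduct[where C="{\<lambda>z. f (snd z) |f. smooth f}"])
    fix g :: "vec3 \<times> real \<Rightarrow> real" and v assume "g \<in> {\<lambda>z. f (snd z) |f. smooth f}"
    then obtain f where f: "smooth f" and g: "g = (\<lambda>z. f (snd z))" by blast
    show "g differentiable_on UNIV" unfolding g by (rule differentiable_UNIV_I[OF h[OF f]])
    show "dderiv v g \<in> {\<lambda>z. f (snd z) |f. smooth f}" unfolding g e[OF f] using smooth_dderiv[OF f] by blast
  qed (use assms in blast)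
qed

lemma smooth_fst:
  fixes f :: "vec3 \<Rightarrow> real"
  assumes "smooth f" shows "smooth (\<lambda>z::vec3 \<times> real. f (fst z))"
    and "dderiv w (\<lambda>z::vec3 \<times> real. f (fst z)) = (\<lambda>z. dderiv (fst w) f (fst z))"
proof -
  have h: "((\<lambda>z::vec3 \<times> real. f (fst z)) has_derivative (\<lambda>v. dderiv (fst v) f (fst z))) (at z)" if "smooth f" for f :: "vec3 \<Rightarrow> real" and z
    by (rule has_derivative_compose[OF has_derivative_fst[OF has_derivative_ident] smooth_has_derivative[OF that]])
  have e: "dderiv w (\<lambda>z::vec3 \<times> real. f (fst z)) = (\<lambda>z. dderiv (fst w) f (fst z))" if "smooth f" for f :: "vec3 \<Rightarrow> real" and w
    by (rule ext) (rule dderiv_eq[OF h[OF that]])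
  show "dderiv w (\<lambda>z::vec3 \<times> real. f (fst z)) = (\<lambda>z. dderiv (fst w) f (fst z))" by (rule e) fact
  show "smooth (\<lambda>z::vec3 \<times> real. f (fst z))"
  proof (rule smooth_coinduct[where C="{\<lambda>z. f (fst z) |f. smooth f}"])
    fix g :: "vec3 \<times> real \<Rightarrow> real" and v assume "g \<in> {\<lambda>z. f (fst z) |f. smooth f}"
    then obtain f where f: "smooth f" and g: "g = (\<lambda>z. f (fst z))" by blast
    show "g differentiable_on UNIV" unfolding g by (rule differentiable_UNIV_I[OF h[OF f]])
    show "dderiv v g \<in> {\<lambda>z. f (fst z) |f. smooth f}" unfolding g e[OF f] using smooth_dderiv[OF f] by blast
  qed (use assms in blast)
qed

lemma smooth_reflect:
  fixes f :: "vec3 \<Rightarrow> real"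
  assumes "smooth f" shows "smooth (\<lambda>y. f (x - y))"
    and "dderiv w (\<lambda>y. f (x - y)) = (\<lambda>y. - dderiv w f (x - y))"
proof -
  have h: "((\<lambda>y. c * f (x - y)) has_derivative (\<lambda>v. - c * dderiv v f (x - y))) (at y)" if "smooth f" for f :: "vec3 \<Rightarrow> real" and y c
  proof -
    have "((\<lambda>y. x - y) has_derivative (\<lambda>v. - v)) (at y)" by (auto intro!: derivative_eq_intros)
    from has_derivative_mult_right[OF has_derivative_compose[OF this smooth_has_derivative[OF that]], of c]
    show ?thesis using linear_neg[OF dderiv_linear[OF that]] by simp
  qed
  have e: "dderiv w (\<lambda>y. c * f (x - y)) = (\<lambda>y. - c * dderiv w f (x - y))" if "smooth f" for f :: "vec3 \<Rightarrow> real" and w c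
    by (rule ext) (rule dderiv_eq[OF h[OF that]])
  show "dderiv w (\<lambda>y. f (x - y)) = (\<lambda>y. - dderiv w f (x - y))" using e[OF assms, of w 1] by simp
  show "smooth (\<lambda>y. f (x - y))"
  proof (rule smooth_coinduct[where C="{\<lambda>y. c * f (x - y) |f c. smooth f}"])
    fix g :: "vec3 \<Rightarrow> real" and v assume "g \<in> {\<lambda>y. c * f (x - y) |f c. smooth f}"
    then obtain f c where f: "smooth f" and g: "g = (\<lambda>y. c * f (x - y))" by blast
    show "g differentiable_on UNIV" unfolding g by (rule differentiable_UNIV_I[OF h[OF f]])
    show "dderiv v g \<in> {\<lambda>y. c * f (x - y) |f c. smooth f}" unfolding g e[OF f] using smooth_dderiv[OF f] by blast
  qed (use assms in \<open>auto intro!: exI[of _ f] exI[of _ 1]\<close>)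
qed

definition smooth_periodic :: "(vec3 \<Rightarrow> real) \<Rightarrow> bool" where
  "smooth_periodic S \<longleftrightarrow> smooth S \<and> periodic S"

lemma smooth_periodic_dderiv: "smooth_periodic S \<Longrightarrow> smooth_periodic (dderiv v S)"
proof -
  assume S: "smooth_periodic S"
  have "dderiv v S (x + axis i 1) = dderiv v S x" for x i
  proof -
    have "(S has_derivative (\<lambda>v. dderiv v S (x + axis i 1))) (at (x + axis i 1))"
      using S by (intro smooth_has_derivative) (simp add: smooth_periodic_def)
    then have "((\<lambda>y. S (y + axis i 1)) has_derivative (\<lambda>v. dderiv v S (x + axis i 1))) (at x)"
      by (rule has_derivative_compose[rotated]) (auto intro!: derivative_eq_intros)
    moreover have "(\<lambda>y. S (y + axis i 1)) = S" using S by (auto simp: smooth_periodic_def periodic_def)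
    ultimately show ?thesis using dderiv_eq by metis
  qed
  then show ?thesis using S smooth_dderiv by (auto simp: smooth_periodic_def periodic_def)
qed

lemma smooth_periodic_pborel: "smooth_periodic S \<Longrightarrow> pborel S"
  unfolding smooth_periodic_def pborel_def using smooth_continuous borel_measurable_continuous_onI by blast

lemma smooth_periodic_bounded:
  assumes S: "smooth_periodic S" obtains M where "M > 0" "\<And>x. \<bar>S x\<bar> \<le> M"
proof -
  have "compact (S ` cbox 0 1)"
    using S by (intro compact_continuous_image smooth_continuous) (auto simp: smooth_periodic_def)
  then obtain M where M: "M > 0" "\<And>x. x \<in> cbox 0 1 \<Longrightarrow> \<bar>S x\<bar> \<le> M"
    by (auto simp: bounded_pos dest!: compact_imp_bounded)
  have "\<bar>S x\<bar> \<le> M" for x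
    using M(2)[OF frac_vec_cube[of x]] periodic_frac_vec[of S x] S by (simp add: smooth_periodic_def)
  then show thesis using that M(1) by blast
qed

lemma smooth_periodic_reflect: "smooth_periodic S \<Longrightarrow> smooth_periodic (\<lambda>y. S (x - y))"
  unfolding smooth_periodic_def using smooth_reflect(1) periodic_reflect by blast

text \<open>The cosines of differences suffice: they are the kernels that act on each pair of a cosine and a sine mode by the same
  factor. The class is closed under products, by \<open>trig_mult\<close>, and hence contains all \<open>vp m\<close>.\<close>

inductive trig :: "(vec3 \<Rightarrow> real) \<Rightarrow> bool" where
  trig_cos: "k \<in> int_vec \<Longrightarrow> trig (\<lambda>h. cos (2 * pi * (k \<bullet> h)))"
| trig_add: "trig S \<Longrightarrow> trig S' \<Longrightarrow> trig (\<lambda>h. S h + S' h)"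
| trig_cmult: "trig S \<Longrightarrow> trig (\<lambda>h. c * S h)"

lemma trig_mult_cos: "trig S \<Longrightarrow> k \<in> int_vec \<Longrightarrow> trig (\<lambda>h. cos (2 * pi * (k \<bullet> h)) * S h)"
proof (induction rule: trig.induct)
  case (trig_cos l)
  have "trig (\<lambda>h. 1 / 2 * cos (2 * pi * ((k + l) \<bullet> h)) + 1 / 2 * cos (2 * pi * ((k - l) \<bullet> h)))"
    by (intro trig.intros int_vec_add int_vec_diff trig_cos)
  moreover have "1 / 2 * cos (2 * pi * ((k + l) \<bullet> h)) + 1 / 2 * cos (2 * pi * ((k - l) \<bullet> h))
      = cos (2 * pi * (k \<bullet> h)) * cos (2 * pi * (l \<bullet> h))" for h
    by (simp add: inner_add_left inner_diff_left distrib_left right_diff_distrib cos_add cos_diff)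
  ultimately show ?case by simp
next
  case (trig_add S S')
  then show ?case using trig.trig_add by (simp add: distrib_left)
next
  case (trig_cmult S c)
  then have "trig (\<lambda>h. c * (cos (2 * pi * (k \<bullet> h)) * S h))" by (intro trig.trig_cmult)
  then show ?case by (simp add: mult_ac)
qed

lemma trig_mult: "trig S \<Longrightarrow> trig S' \<Longrightarrow> trig (\<lambda>h. S h * S' h)"
proof (induction rule: trig.induct)
  case (trig_add S S'')
  then show ?case using trig.trig_add by (simp add: distrib_right)
next
  case (trig_cmult S c)
  then have "trig (\<lambda>h. c * (S h * S' h))" by (intro trig.trig_cmult)
  then show ?case by (simp add: mult_ac)
qed (rule trig_mult_cos)

lemma trig_one: "trig (\<lambda>h. 1)"
  using trig_cos[of 0] by (simp add: int_vec_def)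

lemma trig_power: "trig S \<Longrightarrow> trig (\<lambda>h. S h ^ n)"
  by (induction n) (auto intro: trig_mult trig_one)

lemma trig_vp: "trig (vp m)"
proof -
  have c: "trig (\<lambda>h. cos (pi * h $ i) ^ 2)" for i
  proof -
    have "trig (\<lambda>h. 1 / 2 * 1 + 1 / 2 * cos (2 * pi * (axis i 1 \<bullet> h)))"
      by (intro trig.intros trig_one) (simp add: int_vec_def axis_def)
    moreover have "1 / 2 * 1 + 1 / 2 * cos (2 * pi * (axis i 1 \<bullet> h)) = cos (pi * h $ i) ^ 2" for h :: vec3
      using cos_double_cos[of "pi * h $ i"] by (simp add: inner_axis' mult.assoc field_simps)
    ultimately show ?thesis by simp
  qed
  have "trig (\<lambda>h. 1 / cosint (Suc m) * (cos (pi * h $ i) ^ 2) ^ Suc m)" for i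
    by (intro trig_cmult trig_power c)
  then have v: "trig (\<lambda>h. vp1 m (h $ i))" for i
    unfolding vp1_def power_mult by (simp del: power_Suc)
  have "trig (\<lambda>h. vp1 m (h $ 1) * vp1 m (h $ 2) * vp1 m (h $ 3))"
    by (intro trig_mult v)
  moreover have "vp m = (\<lambda>h. vp1 m (h $ 1) * vp1 m (h $ 2) * vp1 m (h $ 3))"
    unfolding vp_def UNIV_3 by (simp add: fun_eq_iff mult_ac)
  ultimately show ?thesis by simp
qed

lemma cos_int_vec: "k \<in> int_vec \<Longrightarrow> l \<in> int_vec \<Longrightarrow> cos (a + 2 * pi * (k \<bullet> (x + l))) = cos (a + 2 * pi * (k \<bullet> x))"
proof -
  assume "k \<in> int_vec" "l \<in> int_vec"
  then have "k \<bullet> l \<in> \<int>" by (auto simp: inner_vec_def int_vec_def intro!: Ints_sum)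
  then obtain n where "k \<bullet> l = of_int n" by (elim Ints_cases)
  then have "a + 2 * pi * (k \<bullet> (x + l)) = (a + 2 * pi * (k \<bullet> x)) + 2 * pi * of_int n"
    by (simp add: inner_add_right algebra_simps)
  then show ?thesis using cos.plus_of_int[of "a + 2 * pi * (k \<bullet> x)" n] by (simp only: mult_ac of_real_eq_id id_apply)
qed

lemma smooth_periodic_cos: "k \<in> int_vec \<Longrightarrow> smooth_periodic (\<lambda>x. cos (a + 2 * pi * (k \<bullet> x)))"
  unfolding smooth_periodic_def periodic_iff_int_vec
  using smooth_cos_inner[of 1 a "(2 * pi) *\<^sub>R k"] cos_int_vec by auto

lemma trig_smooth_periodic: "trig S \<Longrightarrow> smooth_periodic S"
proof (induction rule: trig.induct)
  case (trig_cos k)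
  then show ?case using smooth_periodic_cos[of k 0] by simp
qed (auto simp: smooth_periodic_def intro: smooth_add smooth_cmult periodic_comp2[where F="(+)"] periodic_comp[where g="(*) _"])

lemma dderiv_vp: "dderiv (axis i 1) (vp m) = dvp i m"
proof
  fix h :: vec3
  have d: "((\<lambda>h. vp1 m (h $ j)) has_derivative (\<lambda>v. v $ j * dvp1 m (h $ j))) (at h)" for j
  proof -
    have "((\<lambda>h. h $ j) has_derivative (\<lambda>v. v $ j)) (at h)"
      by (rule bounded_linear.has_derivative[OF bounded_linear_vec_nth has_derivative_ident])
    from has_derivative_compose[OF this dvp1_deriv[of m "h $ j", unfolded has_field_derivative_def]]
    show ?thesis by (simp add: mult.commute)
  qed
  have "((\<lambda>h. \<Prod>j\<in>UNIV. vp1 m (h $ j)) has_derivative (\<lambda>v. \<Sum>j\<in>UNIV. v $ j * dvp1 m (h $ j) * (\<Prod>l\<in>UNIV - {j}. vp1 m (h $ l)))) (at h)"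
    by (rule has_derivative_prod[OF d])
  then have "dderiv (axis i 1) (vp m) h = (\<Sum>j\<in>UNIV. axis i 1 $ j * dvp1 m (h $ j) * (\<Prod>l\<in>UNIV - {j}. vp1 m (h $ l)))"
    unfolding vp_def[abs_def] by (rule dderiv_eq)
  also have "\<dots> = (\<Sum>j\<in>UNIV. if j = i then dvp1 m (h $ j) * (\<Prod>l\<in>UNIV - {j}. vp1 m (h $ l)) else 0)"
    by (intro sum.cong) (auto simp: axis_def)
  also have "\<dots> = dvp i m h"
    unfolding dvp_def by (subst prod.remove[of UNIV i]) (auto intro!: prod.cong)
  finally show "dderiv (axis i 1) (vp m) h = dvp i m h" .
qed

section \<open>Trilinear estimates\<close>

definition n3 :: "(vec3 \<Rightarrow> real) \<Rightarrow> real" where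
  "n3 f = root 3 (LINT x|torus. \<bar>f x\<bar> ^ 3)"

lemma n3_nonneg: "0 \<le> n3 f"
  unfolding n3_def by (intro real_root_ge_zero integral_nonneg_AE) auto

lemma n3_cube: "n3 f ^ 3 = (LINT x|torus. \<bar>f x\<bar> ^ 3)"
  unfolding n3_def by (intro real_root_pow_pos2) (auto intro: integral_nonneg_AE)

lemma n3_le: "(LINT x|torus. \<bar>f x\<bar> ^ 3) \<le> K ^ 3 \<Longrightarrow> 0 \<le> K \<Longrightarrow> n3 f \<le> K"
  using power_mono_iff[of "n3 f" K 3] n3_nonneg by (simp add: n3_cube)

lemma n3_cmult: "n3 (\<lambda>x. c * f x) = \<bar>c\<bar> * n3 f"
  unfolding n3_def by (simp add: abs_mult power_mult_distrib real_root_mult odd_real_root_power_cancel)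

lemma n3_shift: "PL 3 f \<Longrightarrow> n3 (\<lambda>x. f (x - h)) = n3 f"
  unfolding n3_def by (simp add: PL_shift(2)[of 3 f h])

lemma PL_one: "PL n (\<lambda>x. 1)"
  by (rule PL_bounded[OF pborel_const, of 1 1]) simp

lemma PL_pborel: "PL n f \<Longrightarrow> pborel f"
  by (simp add: PL_def)

lemma abs_mult3_le: "\<bar>a * b * c :: real\<bar> \<le> \<bar>a\<bar> ^ 3 + \<bar>b\<bar> ^ 3 + \<bar>c\<bar> ^ 3"
proof -
  define m where "m = max \<bar>a\<bar> (max \<bar>b\<bar> \<bar>c\<bar>)"
  have "\<bar>a * b * c\<bar> \<le> m * m * m"
    unfolding abs_mult m_def by (intro mult_mono) auto
  also have "\<dots> = m ^ 3" by (simp add: power3_eq_cube)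
  also have "\<dots> \<le> \<bar>a\<bar> ^ 3 + \<bar>b\<bar> ^ 3 + \<bar>c\<bar> ^ 3"
    unfolding m_def max_def by auto
  finally show ?thesis .
qed

lemma integrable_mult3:
  assumes "PL 3 a" "PL 3 b" "PL 3 c"
  shows "integrable torus (\<lambda>x. a x * b x * c x)"
proof (rule Bochner_Integration.integrable_bound)
  show "integrable torus (\<lambda>x. \<bar>a x\<bar> ^ 3 + \<bar>b x\<bar> ^ 3 + \<bar>c x\<bar> ^ 3)" using assms by (simp add: PL_def)
  show "(\<lambda>x. a x * b x * c x) \<in> borel_measurable torus"
    using pborel_mult[OF pborel_mult] assms by (intro measurable_torus) (auto simp: PL_def)
  show "AE x in torus. norm (a x * b x * c x) \<le> norm (\<bar>a x\<bar> ^ 3 + \<bar>b x\<bar> ^ 3 + \<bar>c x\<bar> ^ 3)"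
    unfolding real_norm_def by (intro AE_I2 order_trans[OF abs_mult3_le abs_ge_self])
qed

lemma young3:
  fixes a b c :: real
  assumes "0 \<le> a" "0 \<le> b" "0 \<le> c" shows "a * b * c \<le> (a ^ 3 + b ^ 3 + c ^ 3) / 3"
proof -
  have "a ^ 3 + b ^ 3 + c ^ 3 - 3 * (a * b * c) = (a + b + c) * ((a - b)\<^sup>2 + (b - c)\<^sup>2 + (a - c)\<^sup>2) / 2"
    by (simp add: power2_eq_square power3_eq_cube field_simps)
  also have "\<dots> \<ge> 0" using assms by simp
  finally show ?thesis by simp
qed

lemma n3_eq_0:
  assumes "PL 3 f" "n3 f = 0" shows "AE x in torus. f x = 0"
proof -
  have "(LINT x|torus. \<bar>f x\<bar> ^ 3) = 0" using n3_cube[of f] assms(2) by simp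
  then have "AE x in torus. \<bar>f x\<bar> ^ 3 = 0"
    by (subst (asm) integral_nonneg_eq_0_iff_AE) (use assms(1) in \<open>auto simp: PL_def\<close>)
  then show ?thesis by simp
qed

text \<open>Hoelder's inequality for three factors, from Young's inequality by normalization.\<close>

lemma holder3:
  assumes a: "PL 3 a" and b: "PL 3 b" and c: "PL 3 c"
  shows "(LINT x|torus. \<bar>a x * b x * c x\<bar>) \<le> n3 a * n3 b * n3 c"
proof (cases "n3 a = 0 \<or> n3 b = 0 \<or> n3 c = 0")
  case True
  then have "AE x in torus. a x = 0 \<or> b x = 0 \<or> c x = 0"
    using n3_eq_0[OF a] n3_eq_0[OF b] n3_eq_0[OF c] by auto
  then have "AE x in torus. \<bar>a x * b x * c x\<bar> = 0" by auto
  then have "(LINT x|torus. \<bar>a x * b x * c x\<bar>) = 0" by (rule integral_eq_zero_AE)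
  then show ?thesis using n3_nonneg by simp
next
  case False
  then have p: "n3 a > 0" "n3 b > 0" "n3 c > 0" using n3_nonneg by (metis less_eq_real_def)+
  let ?P = "n3 a * n3 b * n3 c"
  have "(LINT x|torus. \<bar>a x * b x * c x\<bar>) \<le> (LINT x|torus. ?P / 3 * (\<bar>a x\<bar> ^ 3 / n3 a ^ 3 + \<bar>b x\<bar> ^ 3 / n3 b ^ 3 + \<bar>c x\<bar> ^ 3 / n3 c ^ 3))"
  proof (rule integral_mono)
    show "integrable torus (\<lambda>x. \<bar>a x * b x * c x\<bar>)" by (rule integrable_abs[OF integrable_mult3[OF a b c]])
    show "integrable torus (\<lambda>x. ?P / 3 * (\<bar>a x\<bar> ^ 3 / n3 a ^ 3 + \<bar>b x\<bar> ^ 3 / n3 b ^ 3 + \<bar>c x\<bar> ^ 3 / n3 c ^ 3))"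
      using a b c by (auto simp: PL_def)
    fix x
    have "?P * ((\<bar>a x\<bar> / n3 a) * (\<bar>b x\<bar> / n3 b) * (\<bar>c x\<bar> / n3 c)) \<le> ?P * (((\<bar>a x\<bar> / n3 a) ^ 3 + (\<bar>b x\<bar> / n3 b) ^ 3 + (\<bar>c x\<bar> / n3 c) ^ 3) / 3)"
      using p by (intro mult_left_mono young3) auto
    then show "\<bar>a x * b x * c x\<bar> \<le> ?P / 3 * (\<bar>a x\<bar> ^ 3 / n3 a ^ 3 + \<bar>b x\<bar> ^ 3 / n3 b ^ 3 + \<bar>c x\<bar> ^ 3 / n3 c ^ 3)"
      using p by (simp add: abs_mult power_divide)
  qed
  also have "\<dots> = ?P / 3 * ((LINT x|torus. \<bar>a x\<bar> ^ 3) / n3 a ^ 3 + (LINT x|torus. \<bar>b x\<bar> ^ 3) / n3 b ^ 3 + (LINT x|torus. \<bar>c x\<bar> ^ 3) / n3 c ^ 3)"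
    using a b c by (simp add: PL_def)
  also have "\<dots> = ?P" unfolding n3_cube[symmetric] using p by simp
  finally show ?thesis .
qed

lemma holder3':
  assumes "PL 3 a" "PL 3 b" "PL 3 c"
  shows "\<bar>LINT x|torus. a x * b x * c x\<bar> \<le> n3 a * n3 b * n3 c"
  using holder3[OF assms] integral_abs_bound[of torus "\<lambda>x. a x * b x * c x"] by linarith

lemma pborel_integral:
  assumes F: "(\<lambda>p. F (fst p) (snd p)) \<in> borel_measurable (borel \<Otimes>\<^sub>M borel)" and p: "\<And>x. periodic (F x)"
  shows "pborel (\<lambda>h. LINT x|torus. F x h)"
  unfolding pborel_def
proof
  show "periodic (\<lambda>h. LINT x|torus. F x h)" using p by (simp add: periodic_def)
  have [measurable]: "(\<lambda>x. x) \<in> torus \<rightarrow>\<^sub>M borel" using measurable_torus[of "\<lambda>x. x"] by simp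
  have s: "(\<lambda>p. (snd p, fst p)) \<in> borel \<Otimes>\<^sub>M torus \<rightarrow>\<^sub>M borel \<Otimes>\<^sub>M borel"
  proof (rule measurable_Pair)
    show "snd \<in> borel \<Otimes>\<^sub>M torus \<rightarrow>\<^sub>M borel"
      by (rule measurable_compose[OF measurable_snd]) measurable
  qed (rule measurable_fst)
  have "(\<lambda>p. F (snd p) (fst p)) \<in> borel_measurable (borel \<Otimes>\<^sub>M torus)"
    using measurable_compose[OF s F] by simp
  then show "(\<lambda>h. LINT x|torus. F x h) \<in> borel_measurable borel"
    by (intro torus.borel_measurable_lebesgue_integral) (simp add: case_prod_beta')
qed

lemma periodic_shift_arg:
  fixes w :: "vec3 \<Rightarrow> real"
  assumes "periodic w" shows "periodic (\<lambda>h. w (x - h))"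
  by (rule periodic_reflect[OF assms])

lemma n3_translation:
  assumes "PL 3 w" "e > 0"
  obtains d where "d > 0" "\<And>h. norm h < d \<Longrightarrow> n3 (\<lambda>x. w (x - h) - w x) \<le> e"
proof -
  obtain d where d: "d > 0" "\<And>h. norm h < d \<Longrightarrow> (LINT x|torus. \<bar>w (x - h) - w x\<bar> ^ 3) \<le> e ^ 3"
    using Ln_translation[OF assms(1), of "e ^ 3"] assms(2) by auto
  show thesis by (rule that[OF d(1)]) (use d(2) assms(2) in \<open>auto intro: n3_le\<close>)
qed

lemma vanishingI:
  assumes "pborel H" "\<And>h. \<bar>H h\<bar> \<le> C * n3 (\<lambda>x. w (x - h) - w x)" "C \<ge> 0" "PL 3 w"
    and B: "\<And>h. \<bar>H h\<bar> \<le> B"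
  shows "vanishing H"
  unfolding vanishing_def
proof (intro conjI allI impI)
  fix e :: real assume e: "e > 0"
  obtain d where d: "d > 0" "\<And>h. norm h < d \<Longrightarrow> n3 (\<lambda>x. w (x - h) - w x) \<le> e / (C + 1)"
    using n3_translation[OF assms(4), of "e / (C + 1)"] e assms(3) by auto
  have "\<bar>H h\<bar> \<le> e" if "norm h < d" for h
  proof -
    have "\<bar>H h\<bar> \<le> C * (e / (C + 1))"
      using assms(2)[of h] mult_left_mono[OF d(2)[OF that] assms(3)] by linarith
    also have "\<dots> \<le> e" using assms(3) e by (simp add: field_simps)
    finally show ?thesis .
  qed
  then show "\<exists>d>0. \<forall>h. norm h < d \<longrightarrow> \<bar>H h\<bar> \<le> e" using d(1) by blast
qed (use assms in auto)

lemma borel_pair_mult3: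
  fixes a b w :: "vec3 \<Rightarrow> real"
  assumes [measurable]: "a \<in> borel_measurable borel" "b \<in> borel_measurable borel" "w \<in> borel_measurable borel"
  shows "(\<lambda>p. a (fst p) * b (fst p) * w (fst p - snd p)) \<in> borel_measurable (borel \<Otimes>\<^sub>M borel)"
  by measurable

lemma corr_pborel:
  assumes "PL 3 a" "PL 3 b" "PL 3 w"
  shows "pborel (\<lambda>h. LINT x|torus. a x * b x * w (x - h))"
proof (rule pborel_integral[of "\<lambda>x h. a x * b x * w (x - h)"])
  show "(\<lambda>p. a (fst p) * b (fst p) * w (fst p - snd p)) \<in> borel_measurable (borel \<Otimes>\<^sub>M borel)"
    by (rule borel_pair_mult3) (use assms in \<open>auto simp: PL_def\<close>)
  fix x show "periodic (\<lambda>h. a x * b x * w (x - h))"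
    by (rule periodic_comp[where g="\<lambda>z. a x * b x * z"], rule periodic_shift_arg) (use assms in \<open>auto simp: PL_def\<close>)
qed

lemma corr_bound:
  assumes "PL 3 a" "PL 3 b" "PL 3 w"
  shows "\<bar>LINT x|torus. a x * b x * w (x - h)\<bar> \<le> n3 a * n3 b * n3 w"
  using holder3'[OF assms(1,2) PL_shift(1)[OF assms(3), of h]] by (simp add: n3_shift[OF assms(3)])

text \<open>A convolution inside a trilinear integral becomes an average over translations \<open>h\<close> of triple correlations. All
  estimates below are estimates of correlations, uniform or vanishing in \<open>h\<close>.\<close>

lemma conv3:
  assumes S: "smooth_periodic S" and a: "PL 3 a" and b: "PL 3 b" and w: "PL 3 w"
  shows "(LINT x|torus. a x * b x * conv S w x) = (LINT h|torus. S h * (LINT x|torus. a x * b x * w (x - h)))"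
    and "integrable torus (\<lambda>x. a x * b x * conv S w x)"
proof -
  obtain M where M: "M > 0" "\<And>x. \<bar>S x\<bar> \<le> M" using smooth_periodic_bounded[OF S] by metis
  have p: "pborel a" "pborel b" "pborel w" using a b w by (auto simp: PL_def)
  have pa: "(\<lambda>x. a x * b x) \<in> borel_measurable borel" using pborel_mult[OF p(1,2)] by auto
  have A: "(\<lambda>x. M * (\<bar>a x\<bar> ^ 3 + \<bar>b x\<bar> ^ 3)) \<in> borel_measurable borel" "integrable torus (\<lambda>x. M * (\<bar>a x\<bar> ^ 3 + \<bar>b x\<bar> ^ 3))"
    using pborelD(2)[OF pborel_mult[OF pborel_const pborel_add[OF pborel_power_abs[OF p(1)] pborel_power_abs[OF p(2)]]]] a b
    by (auto simp: PL_def)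
  have B: "pborel (\<lambda>x. M * \<bar>w x\<bar> ^ 3)" "integrable torus (\<lambda>x. M * \<bar>w x\<bar> ^ 3)"
    using pborel_mult[OF pborel_const pborel_power_abs[OF p(3)]] w by (auto simp: PL_def)
  have bd: "\<bar>S h * (a x * b x) * w (x - h)\<bar> \<le> M * (\<bar>a x\<bar> ^ 3 + \<bar>b x\<bar> ^ 3) + M * \<bar>w (x - h)\<bar> ^ 3" for x h
  proof -
    have "\<bar>S h * (a x * b x) * w (x - h)\<bar> = \<bar>S h\<bar> * \<bar>a x * b x * w (x - h)\<bar>" by (simp add: abs_mult mult_ac)
    also have "\<dots> \<le> M * (\<bar>a x\<bar> ^ 3 + \<bar>b x\<bar> ^ 3 + \<bar>w (x - h)\<bar> ^ 3)"
      using M by (intro mult_mono abs_mult3_le) auto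
    finally show ?thesis by (simp add: algebra_simps)
  qed
  note F = conv_Fubini[OF smooth_periodic_pborel[OF S] p(3) pa A B bd]
  show "(LINT x|torus. a x * b x * conv S w x) = (LINT h|torus. S h * (LINT x|torus. a x * b x * w (x - h)))"
    "integrable torus (\<lambda>x. a x * b x * conv S w x)"
    using F(2,3) by simp_all
qed

lemma corr_diff:
  assumes "PL 3 a" "PL 3 b" "PL 3 w"
  shows "(LINT x|torus. a x * b x * w (x - h)) - (LINT x|torus. a x * b x * w x) = (LINT x|torus. a x * b x * (w (x - h) - w x))"
  using integrable_mult3[OF assms(1,2) PL_shift(1)[OF assms(3), of h]] integrable_mult3[OF assms]
  by (simp add: right_diff_distrib flip: Bochner_Integration.integral_diff)

lemma vp_smooth_periodic: "smooth_periodic (vp m)"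
  by (rule trig_smooth_periodic[OF trig_vp])

lemma dvp_smooth_periodic: "smooth_periodic (dvp i m)"
  using smooth_periodic_dderiv[OF vp_smooth_periodic] by (metis dderiv_vp)

lemma vp_conv_bound:
  assumes "PL 3 a" "PL 3 b" "PL 3 w"
  shows "\<bar>LINT x|torus. a x * b x * conv (vp m) w x\<bar> \<le> n3 a * n3 b * n3 w"
  unfolding conv3(1)[OF vp_smooth_periodic assms]
  by (rule vp_average_le[OF corr_pborel[OF assms] corr_bound[OF assms]])

lemma vp_limit_from_vanishing:
  assumes P: "pborel P" "\<And>h. \<bar>P h\<bar> \<le> B" and v: "vanishing (\<lambda>h. P h - c)"
  shows "(\<lambda>m. LINT h|torus. vp m h * P h) \<longlonglongrightarrow> c"
proof -
  have "(LINT h|torus. vp m h * P h) = (LINT h|torus. vp m h * (P h - c)) + c" for m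
    using vp_bounded_integrable[OF P, of m] vp_integral(1)[of m] vp_integral(2)[of m]
    by (simp add: right_diff_distrib)
  then show ?thesis using tendsto_add[OF vp_approx[OF v] tendsto_const[of c]] by simp
qed

text \<open>The correlation with the translate of \<open>w\<close> differs from its value at \<open>h = 0\<close> by a function that vanishes at the
  origin, so the averages against \<open>vp m\<close> converge to that value.\<close>

lemma vp_conv_limit:
  assumes "PL 3 a" "PL 3 b" "PL 3 w"
  shows "(\<lambda>m. LINT x|torus. a x * b x * conv (vp m) w x) \<longlonglongrightarrow> (LINT x|torus. a x * b x * w x)"
  unfolding conv3(1)[OF vp_smooth_periodic assms]
proof (rule vp_limit_from_vanishing[OF corr_pborel[OF assms] corr_bound[OF assms]])
  show "vanishing (\<lambda>h. (LINT x|torus. a x * b x * w (x - h)) - (LINT x|torus. a x * b x * w x))"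
  proof (rule vanishingI[where w=w and C="n3 a * n3 b" and B="2 * (n3 a * n3 b * n3 w)"])
    show "pborel (\<lambda>h. (LINT x|torus. a x * b x * w (x - h)) - (LINT x|torus. a x * b x * w x))"
      by (rule pborel_diff[OF corr_pborel[OF assms] pborel_const])
    show "\<bar>(LINT x|torus. a x * b x * w (x - h)) - (LINT x|torus. a x * b x * w x)\<bar> \<le> n3 a * n3 b * n3 (\<lambda>x. w (x - h) - w x)" for h
      unfolding corr_diff[OF assms]
      by (rule holder3'[OF assms(1,2) PL_diff[OF PL_shift(1)[OF assms(3)] assms(3)]])
    show "\<bar>(LINT x|torus. a x * b x * w (x - h)) - (LINT x|torus. a x * b x * w x)\<bar> \<le> 2 * (n3 a * n3 b * n3 w)" for h
      using corr_bound[OF assms, of h] corr_bound[OF assms, of 0] by simp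
  qed (use n3_nonneg assms in auto)
qed

text \<open>Here only the continuity of translations in \<open>L\<^sup>1\<close> is available, so the other factor has to be bounded.\<close>

lemma vp_conv_limit_bounded:
  assumes b: "pborel b" "\<And>x. \<bar>b x\<bar> \<le> C" and w: "PL 1 w"
  shows "(\<lambda>m. LINT x|torus. b x * conv (vp m) w x) \<longlonglongrightarrow> (LINT x|torus. b x * w x)"
proof -
  have wp: "pborel w" and wi: "integrable torus (\<lambda>x. \<bar>w x\<bar>)" using w by (auto simp: PL_def)
  have C: "C \<ge> 0" using b(2)[of 0] by linarith
  have [measurable]: "b \<in> borel_measurable borel" "w \<in> borel_measurable borel" using b wp by auto
  have bi: "integrable torus (\<lambda>x. b x * f x)" if f: "PL 1 f" for f
  proof (rule Bochner_Integration.integrable_bound)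
    show "integrable torus (\<lambda>x. C * \<bar>f x\<bar>)" using f by (simp add: PL_def)
    show "(\<lambda>x. b x * f x) \<in> borel_measurable torus"
      using pborel_mult[OF b(1)] f by (intro measurable_torus) (auto simp: PL_def)
    show "AE x in torus. norm (b x * f x) \<le> norm (C * \<bar>f x\<bar>)"
      using b(2) C by (auto simp: abs_mult intro!: mult_right_mono)
  qed
  have bb: "\<bar>LINT x|torus. b x * f x\<bar> \<le> C * (LINT x|torus. \<bar>f x\<bar> ^ 1)" if f: "PL 1 f" for f
  proof -
    have "\<bar>LINT x|torus. b x * f x\<bar> \<le> (LINT x|torus. C * \<bar>f x\<bar>)"
      by (rule integral_abs_le[OF bi[OF f]]) (use f b(2) in \<open>auto simp: PL_def abs_mult intro!: mult_right_mono\<close>)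
    then show ?thesis by simp
  qed
  have Pp: "pborel (\<lambda>h. LINT x|torus. b x * w (x - h))"
  proof (rule pborel_integral[of "\<lambda>x h. b x * w (x - h)"])
    fix x show "periodic (\<lambda>h. b x * w (x - h))"
      by (rule periodic_comp[where g="\<lambda>z. b x * z"], rule periodic_shift_arg) (use wp in auto)
  qed measurable
  have Pb: "\<bar>LINT x|torus. b x * w (x - h)\<bar> \<le> C * (LINT x|torus. \<bar>w x\<bar> ^ 1)" for h
    using bb[OF PL_shift(1)[OF w, of h]] PL_shift(2)[OF w, of h] by simp
  have e: "(LINT x|torus. b x * conv (vp m) w x) = (LINT h|torus. vp m h * (LINT x|torus. b x * w (x - h)))" for m
  proof -
    obtain M where M: "M > 0" "\<And>x. \<bar>vp m x\<bar> \<le> M" using smooth_periodic_bounded[OF vp_smooth_periodic] by metis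
    show ?thesis
    proof (rule conv_Fubini(2)[OF vp_pborel wp, where A="\<lambda>_. 0" and B="\<lambda>x. M * C * \<bar>w x\<bar>"])
      show "pborel (\<lambda>x. M * C * \<bar>w x\<bar>)" by (rule pborel_comp[OF wp]) measurable
      show "\<bar>vp m h * b x * w (x - h)\<bar> \<le> 0 + M * C * \<bar>w (x - h)\<bar>" for x h
        unfolding abs_mult using M b(2) C by (auto intro!: mult_mono)
    qed (use wi in auto)
  qed
  show ?thesis unfolding e
  proof (rule vp_limit_from_vanishing[OF Pp Pb])
    show "vanishing (\<lambda>h. (LINT x|torus. b x * w (x - h)) - (LINT x|torus. b x * w x))"
      unfolding vanishing_def
    proof (intro conjI)
      show "pborel (\<lambda>h. (LINT x|torus. b x * w (x - h)) - (LINT x|torus. b x * w x))"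
        by (rule pborel_diff[OF Pp pborel_const])
      have "\<bar>(LINT x|torus. b x * w (x - h)) - (LINT x|torus. b x * w x)\<bar> \<le> 2 * (C * (LINT x|torus. \<bar>w x\<bar> ^ 1))" for h
        using Pb[of h] Pb[of 0] by simp
      then show "\<exists>B. \<forall>h. \<bar>(LINT x|torus. b x * w (x - h)) - (LINT x|torus. b x * w x)\<bar> \<le> B" by blast
      show "\<forall>e>0. \<exists>d>0. \<forall>h. norm h < d \<longrightarrow> \<bar>(LINT x|torus. b x * w (x - h)) - (LINT x|torus. b x * w x)\<bar> \<le> e"
      proof (intro allI impI)
      fix e :: real assume e: "e > 0"
      obtain d where d: "d > 0" "\<And>h. norm h < d \<Longrightarrow> (LINT x|torus. \<bar>w (x - h) - w x\<bar> ^ 1) \<le> e / (C + 1)"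
        using Ln_translation[OF w, of "e / (C + 1)"] e C by auto
      have "\<bar>(LINT x|torus. b x * w (x - h)) - (LINT x|torus. b x * w x)\<bar> \<le> e" if "norm h < d" for h
      proof -
        have "(LINT x|torus. b x * w (x - h)) - (LINT x|torus. b x * w x) = (LINT x|torus. b x * (w (x - h) - w x))"
          using bi[OF PL_shift(1)[OF w, of h]] bi[OF w] by (simp add: right_diff_distrib)
        then have "\<bar>(LINT x|torus. b x * w (x - h)) - (LINT x|torus. b x * w x)\<bar> \<le> C * (e / (C + 1))"
          using bb[OF PL_diff[OF PL_shift(1)[OF w] w], of h] mult_left_mono[OF d(2)[OF that] C] by simp
        also have "\<dots> \<le> e" using C e by (simp add: field_simps)
        finally show ?thesis .
      qed
      then show "\<exists>d>0. \<forall>h. norm h < d \<longrightarrow> \<bar>(LINT x|torus. b x * w (x - h)) - (LINT x|torus. b x * w x)\<bar> \<le> e"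
        using d(1) by blast
      qed
    qed
  qed
qed

text \<open>The hypothesis says that all mollifications vanish; pairing them with \<open>sgn g\<close> yields the integral of \<open>\<bar>g\<bar>\<close> in
  the limit.\<close>

lemma fundamental_lemma:
  assumes g: "PL 1 g" and z: "\<And>\<phi>. smooth_periodic \<phi> \<Longrightarrow> (LINT x|torus. g x * \<phi> x) = 0"
  shows "AE x in torus. g x = 0"
proof -
  have gp: "pborel g" and gi: "integrable torus (\<lambda>x. \<bar>g x\<bar>)" using g by (auto simp: PL_def)
  have "conv (vp m) g x = 0" for m x
    using z[OF smooth_periodic_reflect[OF vp_smooth_periodic[of m], of x]] by (simp add: conv_def mult.commute)
  moreover have "(\<lambda>m. LINT x|torus. sgn (g x) * conv (vp m) g x) \<longlonglongrightarrow> (LINT x|torus. sgn (g x) * g x)"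
    by (rule vp_conv_limit_bounded[OF _ _ g, of _ 1]) (auto simp: abs_sgn_eq intro!: pborel_comp[OF gp])
  ultimately have "(LINT x|torus. \<bar>g x\<bar>) = 0"
    by (simp add: LIMSEQ_const_iff mult.commute flip: abs_sgn)
  then show ?thesis
    by (subst (asm) integral_nonneg_eq_0_iff_AE) (use gi in auto)
qed

lemma vp_even: "vp m (- h) = vp m h"
  by (simp add: vp_def vp1_def)

lemma dvp_odd: "dvp i m (- h) = - dvp i m h"
proof -
  have s: "smooth (vp m)" using vp_smooth_periodic by (simp add: smooth_periodic_def)
  have e: "(\<lambda>y. vp m (0 - y)) = vp m" using vp_even by (simp add: fun_eq_iff)
  have "dvp i m h = - dvp i m (0 - h)"
    using fun_cong[OF smooth_reflect(2)[OF s, of "axis i 1" 0], of h] unfolding e dderiv_vp by simp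
  then show ?thesis by simp
qed

lemma odd_integral:
  assumes S: "pborel S" "\<And>h. S (- h) = - S h" and P: "pborel P"
  shows "(LINT h|torus. S h * P (- h)) = - (LINT h|torus. S h * P h)"
  using torus_reflect(2)[OF pborel_mult[OF S(1) P], of 0] by (simp add: S(2))

lemma bounded_mult_integrable:
  assumes "pborel S" "\<And>h. \<bar>S h\<bar> \<le> M" "pborel P" "\<And>h. \<bar>P h\<bar> \<le> B"
  shows "integrable torus (\<lambda>h. S h * P h)"
proof (intro torus.integrable_const_bound[of _ "M * B"] measurable_torus AE_I2)
  show "norm (S h * P h) \<le> M * B" for h
    unfolding real_norm_def abs_mult
    using assms(2,4) order_trans[OF abs_ge_zero assms(2)] by (intro mult_mono) auto
qed (use pborel_mult[OF assms(1,3)] in auto)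

lemma n3_increment_rho:
  assumes v: "pborel v" and L: "\<And>h. n3 (\<lambda>x. v (x - h) - v x) \<le> K * norm h" and K: "K \<ge> 0"
  shows "n3 (\<lambda>x. v (x - h) - v x) \<le> K * rho h"
proof -
  obtain k where k: "k \<in> int_vec" "norm (h - k) \<le> rho h" by (rule rho_lattice)
  have "v (x - (h - k)) = v (x - h)" for x
    using periodic_int_vec[OF pborelD(1)[OF v] k(1), of "x - h"] by (simp add: algebra_simps)
  then have "n3 (\<lambda>x. v (x - h) - v x) = n3 (\<lambda>x. v (x - (h - k)) - v x)" by simp
  also have "\<dots> \<le> K * norm (h - k)" by (rule L)
  also have "\<dots> \<le> K * rho h" using k(2) K by (intro mult_left_mono)
  finally show ?thesis .
qed

text \<open>As \<open>dvp i m\<close> is odd, antisymmetrizing in \<open>h\<close> moves one difference onto the transporting field \<open>v\<close>; this difference pays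
  for the singularity of the kernel.\<close>

lemma transport_antisymmetric:
  assumes v: "PL 3 v" and w: "PL 3 w"
  shows "(LINT x|torus. v x * w x * conv (dvp i m) w x)
     = - (LINT h|torus. dvp i m h * (LINT x|torus. (v (x - h) - v x) * w x * w (x - h))) / 2"
proof -
  let ?S = "dvp i m"
  define P where "P = (\<lambda>h. LINT x|torus. v x * w x * w (x - h))"
  have vp: "pborel v" and wp: "pborel w" using v w by (auto simp: PL_def)
  obtain M where M: "M > 0" "\<And>x. \<bar>?S x\<bar> \<le> M" using smooth_periodic_bounded[OF dvp_smooth_periodic] by metis
  have Pp: "pborel P" unfolding P_def by (rule corr_pborel[OF v w w])
  have Pm: "pborel (\<lambda>h. P (- h))"
    using Pp periodic_reflect[of P 0] by (auto simp: pborel_def intro: measurable_compose[of uminus])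
  have Pb: "\<bar>P h\<bar> \<le> n3 v * n3 w * n3 w" for h unfolding P_def by (rule corr_bound[OF v w w])
  have d: "P h - P (- h) = - (LINT x|torus. (v (x - h) - v x) * w x * w (x - h))" for h
  proof -
    have wh: "pborel (\<lambda>x. w (x - - h))" by (rule pborel_shift_diff[OF wp])
    have "P (- h) = (LINT x|torus. (\<lambda>x. v x * w x * w (x - - h)) (x - h))"
      unfolding P_def by (rule torus_shift_diff(2)[symmetric]) (intro pborel_mult vp wp wh)
    also have "\<dots> = (LINT x|torus. v (x - h) * w (x - h) * w x)" by simp
    finally have "P h - P (- h) = (LINT x|torus. v x * w x * w (x - h) - v (x - h) * w (x - h) * w x)"
      unfolding P_def using integrable_mult3[OF v w PL_shift(1)[OF w, of h]]
        integrable_mult3[OF PL_shift(1)[OF v, of h] PL_shift(1)[OF w, of h] w] by simp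
    also have "\<dots> = (LINT x|torus. - ((v (x - h) - v x) * w x * w (x - h)))"
      by (rule Bochner_Integration.integral_cong) (auto simp: algebra_simps)
    finally show ?thesis by simp
  qed
  have "2 * (LINT h|torus. ?S h * P h) = (LINT h|torus. ?S h * P h) - (LINT h|torus. ?S h * P (- h))"
    using odd_integral[OF dvp_pborel dvp_odd Pp, of i m] by simp
  also have "\<dots> = (LINT h|torus. ?S h * (P h - P (- h)))"
    using bounded_mult_integrable[OF dvp_pborel M(2) Pp Pb] bounded_mult_integrable[OF dvp_pborel M(2) Pm Pb]
    by (simp add: right_diff_distrib)
  also have "\<dots> = - (LINT h|torus. ?S h * (LINT x|torus. (v (x - h) - v x) * w x * w (x - h)))"
    unfolding d by simp
  finally show ?thesis
    unfolding conv3(1)[OF dvp_smooth_periodic v w w] P_def by simp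
qed

lemma borel_pair_diff3:
  fixes v w z :: "vec3 \<Rightarrow> real"
  assumes [measurable]: "v \<in> borel_measurable borel" "w \<in> borel_measurable borel" "z \<in> borel_measurable borel"
  shows "(\<lambda>p. (v (fst p - snd p) - v (fst p)) * w (fst p) * w (fst p - snd p)) \<in> borel_measurable (borel \<Otimes>\<^sub>M borel)"
    and "(\<lambda>p. (v (fst p - snd p) - v (fst p)) * w (fst p) * (w (fst p - snd p) - w (fst p))) \<in> borel_measurable (borel \<Otimes>\<^sub>M borel)"
    and "(\<lambda>p. \<bar>w (fst p - snd p) - w (fst p)\<bar> ^ 3) \<in> borel_measurable (borel \<Otimes>\<^sub>M borel)"
  by measurable

text \<open>The increment of \<open>v\<close> contributes \<open>K * rho\<close>, and half the first moment of the kernel derivative, at most 30, is the constant.\<close>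

lemma transport_bound:
  assumes v: "PL 3 v" and w: "PL 3 w" and L: "\<And>h. n3 (\<lambda>x. v (x - h) - v x) \<le> K * norm h" and K: "K \<ge> 0"
  shows "\<bar>LINT x|torus. v x * w x * conv (dvp i m) w x\<bar> \<le> 30 * (K * n3 w * n3 w)"
proof -
  have vp: "pborel v" and wp: "pborel w" using v w by (auto simp: PL_def)
  define G where "G = (\<lambda>h. LINT x|torus. (v (x - h) - v x) * w x * w (x - h))"
  have Gp: "pborel G" unfolding G_def
  proof (rule pborel_integral[of "\<lambda>x h. (v (x - h) - v x) * w x * w (x - h)"])
    fix x show "periodic (\<lambda>h. (v (x - h) - v x) * w x * w (x - h))"
      by (rule periodic_comp2[where F="\<lambda>a b. (a - v x) * w x * b"]) (use vp wp in \<open>auto intro: periodic_shift_arg\<close>)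
  qed (rule borel_pair_diff3; use vp wp in auto)
  have "\<bar>G h\<bar> \<le> K * n3 w * n3 w * rho h" for h
  proof -
    have "\<bar>G h\<bar> \<le> n3 (\<lambda>x. v (x - h) - v x) * n3 w * n3 w"
      unfolding G_def using holder3'[OF PL_diff[OF PL_shift(1)[OF v] v] w PL_shift(1)[OF w], of h h]
      by (simp add: n3_shift[OF w])
    also have "\<dots> \<le> K * rho h * n3 w * n3 w"
      by (intro mult_right_mono n3_increment_rho[OF vp L K] n3_nonneg)
    finally show ?thesis by (simp add: mult_ac)
  qed
  from dvp_rho_integrable(2)[OF Gp this, of i m] show ?thesis
    unfolding transport_antisymmetric[OF v w] by (simp add: G_def)
qed

text \<open>In the antisymmetrized integrand write \<open>w (x - h) = w x + (w (x - h) - w x)\<close>. The second part carries two increments and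
  tends to zero by the decay of the kernel against \<open>rho\<close> times a vanishing function. The first part, summed over
  \<open>i\<close>, contains the divergence of the mollified velocity and is zero.\<close>

lemma transport_limit:
  assumes v: "\<And>i. PL 3 (v i)" and w: "PL 3 w" and K: "K \<ge> 0"
    and L: "\<And>i h. n3 (\<lambda>x. v i (x - h) - v i x) \<le> K * norm h"
    and div: "\<And>m x. (\<Sum>i\<in>UNIV. conv (dvp i m) (v i) x) = 0"
  shows "(\<lambda>m. \<Sum>i\<in>UNIV. LINT x|torus. v i x * w x * conv (dvp i m) w x) \<longlonglongrightarrow> 0"
proof -
  have vp: "pborel (v i)" for i using v by (auto simp: PL_def)
  have wp: "pborel w" using w by (auto simp: PL_def)
  define G1 where "G1 = (\<lambda>i h. LINT x|torus. (v i (x - h) - v i x) * w x * (w (x - h) - w x))"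
  define Q where "Q = (\<lambda>i h. LINT x|torus. w x * w x * v i (x - h))"
  define H where "H = (\<lambda>h. K * n3 w * n3 (\<lambda>x. w (x - h) - w x))"
  have nw: "n3 (\<lambda>x. w (x - h) - w x) \<le> 18 * (n3 w + 1)" for h
  proof (rule n3_le)
    have "(LINT x|torus. \<bar>w (x - h) - w x\<bar> ^ 3) \<le> (LINT x|torus. 3 ^ 3 * (\<bar>w (x - h)\<bar> ^ 3 + \<bar>w x\<bar> ^ 3 + \<bar>0\<bar> ^ 3))"
      using abs_power_add3[of "w (_ - h)" "- w _" 0 3] w PL_shift(1)[OF w] PL_diff[OF PL_shift(1)[OF w] w]
      by (intro integral_mono) (auto simp: PL_def)
    also have "\<dots> = 54 * n3 w ^ 3"
      using w PL_shift(1)[OF w, of h] PL_shift(2)[OF w, of h] by (simp add: PL_def n3_cube)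
    also have "\<dots> \<le> (18 * (n3 w + 1)) ^ 3"
    proof -
      have "n3 w ^ 3 \<le> (n3 w + 1) ^ 3" using n3_nonneg[of w] by (intro power_mono) auto
      moreover have "0 \<le> (n3 w + 1) ^ 3" using n3_nonneg[of w] by simp
      moreover have "(18 * (n3 w + 1)) ^ 3 = 5832 * (n3 w + 1) ^ 3" by (simp only: power_mult_distrib) simp
      ultimately show ?thesis by linarith
    qed
    finally show "(LINT x|torus. \<bar>w (x - h) - w x\<bar> ^ 3) \<le> (18 * (n3 w + 1)) ^ 3" .
  qed (use n3_nonneg[of w] in simp)
  have Hp: "pborel H"
  proof -
    have "pborel (\<lambda>h. LINT x|torus. \<bar>w (x - h) - w x\<bar> ^ 3)"
    proof (rule pborel_integral[of "\<lambda>x h. \<bar>w (x - h) - w x\<bar> ^ 3"])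
      show "(\<lambda>p. \<bar>w (fst p - snd p) - w (fst p)\<bar> ^ 3) \<in> borel_measurable (borel \<Otimes>\<^sub>M borel)"
        by (rule borel_pair_diff3(3)[of w w w]) (use wp in auto)
      fix x show "periodic (\<lambda>h. \<bar>w (x - h) - w x\<bar> ^ 3)"
        by (rule periodic_comp[where g="\<lambda>z. \<bar>z - w x\<bar> ^ 3"], rule periodic_shift_arg) (use wp in auto)
    qed
    then show ?thesis unfolding H_def n3_def by (rule pborel_comp) measurable
  qed
  have Hv: "vanishing H"
  proof (rule vanishingI[OF Hp _ _ w])
    show "\<bar>H h\<bar> \<le> K * n3 w * n3 (\<lambda>x. w (x - h) - w x)" for h
      using K n3_nonneg unfolding H_def by simp
    show "\<bar>H h\<bar> \<le> K * n3 w * (18 * (n3 w + 1))" for h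
      using K n3_nonneg[of w] n3_nonneg[of "\<lambda>x. w (x - h) - w x"] nw[of h] unfolding H_def
      by (simp add: mult_left_mono)
  qed (use K n3_nonneg in simp)
  have G1p: "pborel (G1 i)" for i unfolding G1_def
  proof (rule pborel_integral[of "\<lambda>x h. (v i (x - h) - v i x) * w x * (w (x - h) - w x)"])
    fix x show "periodic (\<lambda>h. (v i (x - h) - v i x) * w x * (w (x - h) - w x))"
      by (rule periodic_comp2[where F="\<lambda>a b. (a - v i x) * w x * (b - w x)"]) (use vp wp in \<open>auto intro: periodic_shift_arg\<close>)
  qed (rule borel_pair_diff3; use vp wp in auto)
  have G1b: "\<bar>G1 i h\<bar> \<le> rho h * \<bar>H h\<bar>" for i h
  proof -
    have "\<bar>G1 i h\<bar> \<le> n3 (\<lambda>x. v i (x - h) - v i x) * n3 w * n3 (\<lambda>x. w (x - h) - w x)"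
      unfolding G1_def by (rule holder3'[OF PL_diff[OF PL_shift(1)[OF v] v] w PL_diff[OF PL_shift(1)[OF w] w]])
    also have "\<dots> \<le> K * rho h * n3 w * n3 (\<lambda>x. w (x - h) - w x)"
      by (intro mult_right_mono n3_increment_rho[OF vp L K] n3_nonneg)
    also have "\<dots> = rho h * \<bar>H h\<bar>" using K n3_nonneg unfolding H_def by (simp add: mult_ac)
    finally show ?thesis .
  qed
  have lim: "(\<lambda>m. \<Sum>i\<in>UNIV. LINT h|torus. dvp i m h * G1 i h) \<longlonglongrightarrow> (\<Sum>i\<in>(UNIV::3 set). 0)"
    by (intro tendsto_sum dvp_approx[OF Hv G1p G1b])
  have e: "(LINT x|torus. v i x * w x * conv (dvp i m) w x)
      = - (LINT h|torus. dvp i m h * G1 i h) / 2 - (LINT x|torus. w x * w x * conv (dvp i m) (v i) x) / 2" for i m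
  proof -
    let ?S = "dvp i m"
    obtain M where M: "M > 0" "\<And>x. \<bar>?S x\<bar> \<le> M" using smooth_periodic_bounded[OF dvp_smooth_periodic] by metis
    have Qp: "pborel (Q i)" unfolding Q_def by (rule corr_pborel[OF w w v])
    have Qb: "\<bar>Q i h\<bar> \<le> n3 w * n3 w * n3 (v i)" for h unfolding Q_def by (rule corr_bound[OF w w v])
    have s: "(LINT x|torus. (v i (x - h) - v i x) * w x * w (x - h)) = G1 i h + Q i h - Q i 0" for h
    proof -
      have D: "PL 3 (\<lambda>x. v i (x - h) - v i x)" by (rule PL_diff[OF PL_shift(1)[OF v] v])
      have "G1 i h + (Q i h - Q i 0) = (LINT x|torus. (v i (x - h) - v i x) * w x * (w (x - h) - w x) + w x * w x * (v i (x - h) - v i x))"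
        unfolding G1_def Q_def using corr_diff[OF w w v, of i h] integrable_mult3[OF D w PL_diff[OF PL_shift(1)[OF w] w, of h]]
          integrable_mult3[OF w w D] by simp
      also have "\<dots> = (LINT x|torus. (v i (x - h) - v i x) * w x * w (x - h))"
        by (rule Bochner_Integration.integral_cong) (auto simp: algebra_simps)
      finally show ?thesis by simp
    qed
    have "(LINT h|torus. ?S h * (G1 i h + Q i h - Q i 0)) = (LINT h|torus. ?S h * G1 i h) + (LINT h|torus. ?S h * Q i h) - (LINT h|torus. ?S h * Q i 0)"
    proof -
      have "integrable torus (\<lambda>h. ?S h * Q i h)" by (rule bounded_mult_integrable[OF dvp_pborel M(2) Qp Qb])
      moreover have "integrable torus (\<lambda>h. ?S h * Q i 0)" by (rule bounded_mult_integrable[OF dvp_pborel M(2) pborel_const Qb])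
      moreover have "integrable torus (\<lambda>h. ?S h * G1 i h)"
      proof -
        obtain C where C: "\<And>h. \<bar>H h\<bar> \<le> C" using Hv unfolding vanishing_def by blast
        have "\<bar>G1 i h\<bar> \<le> 3 * C" for h
          using order_trans[OF G1b[of i h] mult_mono[OF rho_le[of h] C[of h]]] by simp
        then show ?thesis by (rule bounded_mult_integrable[OF dvp_pborel M(2) G1p])
      qed
      ultimately show ?thesis by (simp add: distrib_left right_diff_distrib)
    qed
    moreover have "(LINT h|torus. ?S h * Q i 0) = 0"
      using odd_integral[OF dvp_pborel dvp_odd pborel_const[of "Q i 0"], of i m] by simp
    moreover have "(LINT h|torus. ?S h * Q i h) = (LINT x|torus. w x * w x * conv ?S (v i) x)"
      unfolding Q_def by (rule conv3(1)[OF dvp_smooth_periodic w w v, symmetric])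
    ultimately show ?thesis
      unfolding transport_antisymmetric[OF v w] s by simp
  qed
  have z: "(\<Sum>i\<in>UNIV. LINT x|torus. w x * w x * conv (dvp i m) (v i) x) = 0" for m
  proof -
    have "(\<Sum>i\<in>UNIV. LINT x|torus. w x * w x * conv (dvp i m) (v i) x)
        = (LINT x|torus. (\<Sum>i\<in>UNIV. w x * w x * conv (dvp i m) (v i) x))"
      by (rule Bochner_Integration.integral_sum[symmetric]) (rule conv3(2)[OF dvp_smooth_periodic w w v])
    also have "\<dots> = 0" using div by (simp flip: sum_distrib_left)
    finally show ?thesis .
  qed
  have "(\<Sum>i\<in>UNIV. LINT x|torus. v i x * w x * conv (dvp i m) w x) = - (\<Sum>i\<in>UNIV. LINT h|torus. dvp i m h * G1 i h) / 2" for m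
  proof -
    have "(\<Sum>i\<in>UNIV. LINT x|torus. v i x * w x * conv (dvp i m) w x)
      = - (\<Sum>i\<in>UNIV. LINT h|torus. dvp i m h * G1 i h) / 2 - (\<Sum>i\<in>UNIV. LINT x|torus. w x * w x * conv (dvp i m) (v i) x) / 2"
      unfolding e sum_3 by (simp add: field_simps)
    then show ?thesis unfolding z by simp
  qed
  then show ?thesis using tendsto_divide[OF tendsto_minus[OF lim] tendsto_const[of 2]] by simp
qed

section \<open>Cubic integrability of weak derivatives\<close>

lemma conv_pborel:
  assumes "pborel S" "pborel w" shows "pborel (conv S w)"
proof -
  have [measurable]: "S \<in> borel_measurable borel" "w \<in> borel_measurable borel" using assms by auto
  have "pborel (\<lambda>x. LINT y|torus. S (x - y) * w y)"
  proof (rule pborel_integral[of "\<lambda>y x. S (x - y) * w y"])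
    fix y show "periodic (\<lambda>x. S (x - y) * w y)"
      by (rule periodic_comp[where g="\<lambda>z. z * w y"], rule periodic_shift_diff) (use assms in auto)
  qed measurable
  then show ?thesis by (simp add: conv_def[abs_def])
qed

lemma smooth_line_derivative:
  assumes S: "smooth S"
  shows "((\<lambda>s. S (z + s *\<^sub>R e)) has_real_derivative dderiv e S (z + s *\<^sub>R e)) (at s)"
proof -
  have "((\<lambda>s. z + s *\<^sub>R e) has_derivative (\<lambda>r. r *\<^sub>R e)) (at s)" by (auto intro!: derivative_eq_intros)
  from has_derivative_compose[OF this smooth_has_derivative[OF S]]
  have "((\<lambda>s. S (z + s *\<^sub>R e)) has_derivative (\<lambda>r. dderiv (r *\<^sub>R e) S (z + s *\<^sub>R e))) (at s)" .
  moreover have "(\<lambda>r. dderiv (r *\<^sub>R e) S (z + s *\<^sub>R e)) = (*) (dderiv e S (z + s *\<^sub>R e))"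
    by (simp add: fun_eq_iff linear_scale[OF dderiv_linear[OF S]] mult.commute)
  ultimately show ?thesis
    unfolding has_field_derivative_def by simp
qed

lemma difference_quotient_bound:
  fixes S :: "vec3 \<Rightarrow> real"
  assumes S: "smooth S" and M: "\<And>x. \<bar>dderiv e S x\<bar> \<le> M" and t: "t > 0"
  shows "\<bar>(S (z + t *\<^sub>R e) - S z) / t\<bar> \<le> M"
proof -
  obtain c where "S (z + t *\<^sub>R e) - S (z + 0 *\<^sub>R e) = (t - 0) * dderiv e S (z + c *\<^sub>R e)"
    using MVT2[OF t smooth_line_derivative[OF S, of z e]] by metis
  then show ?thesis using M[of "z + c *\<^sub>R e"] t by (simp add: abs_mult)
qed

lemma difference_quotient_limit:
  fixes S :: "vec3 \<Rightarrow> real"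
  assumes S: "smooth S"
  shows "(\<lambda>n. (S (z + (1 / real (Suc n)) *\<^sub>R e) - S z) / (1 / real (Suc n))) \<longlonglongrightarrow> dderiv e S z"
proof -
  have "(\<lambda>t. (S (z + t *\<^sub>R e) - S z) / t) \<midarrow>0\<rightarrow> dderiv e S z"
    using smooth_line_derivative[OF S, of z e 0] unfolding DERIV_def by simp
  moreover have "filterlim (\<lambda>n. 1 / real (Suc n)) (at 0) sequentially"
    unfolding filterlim_at using LIMSEQ_inverse_real_of_nat by (auto simp: inverse_eq_divide)
  ultimately show ?thesis by (rule filterlim_compose)
qed

lemma conv_translate:
  assumes "pborel S" "pborel u"
  shows "conv S (\<lambda>y. u (y - h)) x = conv S u (x - h)"
  unfolding conv_commute[OF assms(1) pborel_shift_diff[OF assms(2)]] conv_commute[OF assms]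
  by (intro Bochner_Integration.integral_cong refl) (simp add: algebra_simps)

text \<open>The difference quotient is moved from \<open>u\<close> to the smooth kernel, where it stays bounded and converges pointwise.\<close>

lemma conv_difference_quotient:
  assumes S: "smooth_periodic S" and u: "PL 1 u"
  shows "(\<lambda>n. conv S (\<lambda>y. real (Suc n) * (u (y - (- (1 / real (Suc n))) *\<^sub>R e) - u y)) x) \<longlonglongrightarrow> conv (dderiv e S) u x"
    and "\<exists>B. \<forall>n x. \<bar>conv S (\<lambda>y. real (Suc n) * (u (y - (- (1 / real (Suc n))) *\<^sub>R e) - u y)) x\<bar> \<le> B"
proof -
  have Ss: "smooth S" and Sp: "pborel S" using S smooth_periodic_pborel by (auto simp: smooth_periodic_def)
  have up: "pborel u" and ui: "integrable torus u" by (rule PL_pborel[OF u], rule PL_integrable[OF u])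
  obtain M where M: "M > 0" "\<And>x. \<bar>dderiv e S x\<bar> \<le> M" using smooth_periodic_bounded[OF smooth_periodic_dderiv[OF S]] by metis
  obtain M' where M': "M' > 0" "\<And>x. \<bar>S x\<bar> \<le> M'" using smooth_periodic_bounded[OF S] by metis
  let ?q = "\<lambda>n z. (S (z + (1 / real (Suc n)) *\<^sub>R e) - S z) / (1 / real (Suc n))"
  have Sb [measurable]: "S \<in> borel_measurable borel" "u \<in> borel_measurable borel" using Sp up by auto
  have Si: "integrable torus (\<lambda>y. S (z - y) * w y)" if w: "integrable torus w" "w \<in> borel_measurable borel" for z w
  proof (rule Bochner_Integration.integrable_bound)
    show "integrable torus (\<lambda>y. M' * \<bar>w y\<bar>)" using w by simp
    show "(\<lambda>y. S (z - y) * w y) \<in> borel_measurable torus" by (rule measurable_torus) (use w in measurable)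
    show "AE y in torus. norm (S (z - y) * w y) \<le> norm (M' * \<bar>w y\<bar>)"
      using M' by (intro AE_I2) (auto simp: abs_mult intro: mult_right_mono)
  qed
  have e: "conv S (\<lambda>y. real (Suc n) * (u (y - (- (1 / real (Suc n))) *\<^sub>R e) - u y)) x = (LINT y|torus. ?q n (x - y) * u y)" for n x
  proof -
    let ?h = "(- (1 / real (Suc n))) *\<^sub>R e"
    have i: "integrable torus (\<lambda>y. S (x - y) * u (y - ?h))" "integrable torus (\<lambda>y. S (x - y) * u y)" "integrable torus (\<lambda>y. S (x - ?h - y) * u y)"
      by (intro Si ui torus_shift_diff(1)[OF up, THEN iffD2] Sb(2); measurable)+
    have "conv S (\<lambda>y. real (Suc n) * (u (y - ?h) - u y)) x = (LINT y|torus. real (Suc n) * (S (x - y) * u (y - ?h) - S (x - y) * u y))"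
      unfolding conv_def by (rule Bochner_Integration.integral_cong[OF refl]) (simp only: right_diff_distrib mult.left_commute)
    also have "\<dots> = real (Suc n) * (conv S (\<lambda>y. u (y - ?h)) x - conv S u x)"
      unfolding conv_def integral_mult_right_zero Bochner_Integration.integral_diff[OF i(1,2)] ..
    also have "\<dots> = real (Suc n) * (conv S u (x - ?h) - conv S u x)" by (simp only: conv_translate[OF Sp up])
    also have "\<dots> = (LINT y|torus. real (Suc n) * (S (x - ?h - y) * u y - S (x - y) * u y))"
      unfolding conv_def integral_mult_right_zero Bochner_Integration.integral_diff[OF i(3,2)] ..
    also have "\<dots> = (LINT y|torus. ?q n (x - y) * u y)"
    proof (rule Bochner_Integration.integral_cong[OF refl])
      fix y
      have eq: "x - ?h - y = x - y + (1 / real (Suc n)) *\<^sub>R e" by (simp add: algebra_simps)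
      show "real (Suc n) * (S (x - ?h - y) * u y - S (x - y) * u y) = ?q n (x - y) * u y"
        unfolding eq by (simp add: algebra_simps del: of_nat_Suc)
    qed
    finally show ?thesis .
  qed
  have qb: "\<bar>?q n z\<bar> \<le> M" for n z by (rule difference_quotient_bound[OF Ss M(2)]) simp
  have qm: "(\<lambda>y. ?q n (x - y) * u y) \<in> borel_measurable torus" for n x
    by (rule measurable_torus) measurable
  have dm: "(\<lambda>y. dderiv e S (x - y) * u y) \<in> borel_measurable torus" for x
  proof (rule measurable_torus)
    have [measurable]: "dderiv e S \<in> borel_measurable borel"
      using smooth_periodic_pborel[OF smooth_periodic_dderiv[OF S]] by auto
    show "(\<lambda>y. dderiv e S (x - y) * u y) \<in> borel_measurable borel" by measurable
  qed
  have qd: "\<bar>?q n z * u y\<bar> \<le> M * \<bar>u y\<bar>" for n z y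
    unfolding abs_mult by (intro mult_right_mono qb) simp
  show "(\<lambda>n. conv S (\<lambda>y. real (Suc n) * (u (y - (- (1 / real (Suc n))) *\<^sub>R e) - u y)) x) \<longlonglongrightarrow> conv (dderiv e S) u x"
    unfolding e conv_def[of "dderiv e S"]
  proof (rule integral_dominated_convergence[where w="\<lambda>y. M * \<bar>u y\<bar>", OF dm qm])
    show "integrable torus (\<lambda>y. M * \<bar>u y\<bar>)" using ui by simp
    show "AE y in torus. (\<lambda>n. ?q n (x - y) * u y) \<longlonglongrightarrow> dderiv e S (x - y) * u y"
      by (intro AE_I2 tendsto_mult_right difference_quotient_limit[OF Ss])
    show "AE y in torus. norm (?q n (x - y) * u y) \<le> M * \<bar>u y\<bar>" for n
      unfolding real_norm_def by (intro AE_I2 qd)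
  qed
  have "\<bar>LINT y|torus. ?q n (x - y) * u y\<bar> \<le> (LINT y|torus. M * \<bar>u y\<bar>)" for n x
  proof (rule integral_abs_le[OF _ _ qd])
    show "integrable torus (\<lambda>y. M * \<bar>u y\<bar>)" using ui by simp
    then show "integrable torus (\<lambda>y. ?q n (x - y) * u y)"
      by (rule Bochner_Integration.integrable_bound[OF _ qm]) (intro AE_I2, unfold real_norm_def, rule order_trans[OF qd abs_ge_self])
  qed
  then show "\<exists>B. \<forall>n x. \<bar>conv S (\<lambda>y. real (Suc n) * (u (y - (- (1 / real (Suc n))) *\<^sub>R e) - u y)) x\<bar> \<le> B"
    unfolding e by blast
qed

text \<open>Duality against \<open>sgn D * min \<bar>D\<bar> R\<^sup>2\<close>: the difference quotients of \<open>u\<close> have cubic norm at most \<open>K\<close>, and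
  this bound passes to the limit after mollification.\<close>

lemma weak_deriv_L3:
  assumes u: "PL 3 u" and D: "PL 1 D" and K: "K \<ge> 0"
    and L: "\<And>h. n3 (\<lambda>x. u (x - h) - u x) \<le> K * norm h"
    and e: "norm e = 1"
    and wd: "\<And>m x. conv (vp m) D x = conv (dderiv e (vp m)) u x"
  shows "PL 3 D" "n3 D \<le> K"
proof -
  have Dp: "pborel D" using D by (simp add: PL_def)
  have u1: "PL 1 u" by (rule PL_mono[OF u]) simp
  define mR where "mR = (\<lambda>R::nat. \<lambda>x. min \<bar>D x\<bar> (real R))"
  \<comment> \<open>The truncation keeps the dual function bounded, since the cubic integrability of \<open>D\<close> is still unknown.\<close>
  define sR where "sR = (\<lambda>R x. sgn (D x) * mR R x)"
  have mp: "pborel (mR R)" "pborel (sR R)" for R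
    unfolding mR_def sR_def by (rule pborel_comp[OF Dp], measurable)+
  have mb: "\<bar>mR R x\<bar> \<le> real R" "\<bar>sR R x\<bar> \<le> real R" "0 \<le> mR R x" "mR R x \<le> \<bar>D x\<bar>" for R x
    by (auto simp: mR_def sR_def abs_mult abs_sgn_eq)
  have mPL: "PL n (mR R)" "PL n (sR R)" for n R by (rule PL_bounded[OF mp(1) mb(1)], rule PL_bounded[OF mp(2) mb(2)])
  have ns: "n3 (sR R) \<le> n3 (mR R)" for R
  proof (rule n3_le)
    show "(LINT x|torus. \<bar>sR R x\<bar> ^ 3) \<le> n3 (mR R) ^ 3"
      unfolding n3_cube using mPL[of 3 R] mb(3)[of R]
      by (intro integral_mono) (auto simp: PL_def sR_def abs_mult abs_sgn_eq intro!: power_mono)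
  qed (rule n3_nonneg)
  have bnd: "\<bar>LINT x|torus. (sR R x * mR R x) * conv (vp m) D x\<bar> \<le> n3 (mR R) * n3 (mR R) * K" for R m
  proof -
    let ?q = "\<lambda>n y. real (Suc n) * (u (y - (- (1 / real (Suc n))) *\<^sub>R e) - u y)"
    have qPL: "PL 3 (?q n)" for n by (rule PL_cmult[OF PL_diff[OF PL_shift(1)[OF u] u]])
    have qn: "n3 (?q n) \<le> K" for n
    proof -
      have "n3 (?q n) \<le> real (Suc n) * (K * norm ((- (1 / real (Suc n))) *\<^sub>R e))"
        unfolding n3_cmult by (simp only: abs_of_nat) (intro mult_left_mono L, simp)
      also have "\<dots> = K" using e by simp
      finally show ?thesis .
    qed
    obtain B where B: "\<And>n x. \<bar>conv (vp m) (?q n) x\<bar> \<le> B"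
      using conv_difference_quotient(2)[OF vp_smooth_periodic u1, of m e] by blast
    have "(\<lambda>n. LINT x|torus. (sR R x * mR R x) * conv (vp m) (?q n) x) \<longlonglongrightarrow> (LINT x|torus. (sR R x * mR R x) * conv (dderiv e (vp m)) u x)"
    proof (rule integral_dominated_convergence[where w="\<lambda>_. real R * real R * B"])
      have dp: "pborel (dderiv e (vp m))" by (rule smooth_periodic_pborel[OF smooth_periodic_dderiv[OF vp_smooth_periodic]])
      show "(\<lambda>x. (sR R x * mR R x) * conv (dderiv e (vp m)) u x) \<in> borel_measurable torus"
        using pborel_mult[OF pborel_mult[OF mp(2) mp(1)] conv_pborel[OF dp]] u by (intro measurable_torus) (auto simp: PL_def)
      show "(\<lambda>x. (sR R x * mR R x) * conv (vp m) (?q n) x) \<in> borel_measurable torus" for n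
        using pborel_mult[OF pborel_mult[OF mp(2) mp(1)] conv_pborel[OF vp_pborel PL_pborel[OF qPL]]] by (intro measurable_torus) blast
      show "AE x in torus. (\<lambda>n. (sR R x * mR R x) * conv (vp m) (?q n) x) \<longlonglongrightarrow> (sR R x * mR R x) * conv (dderiv e (vp m)) u x"
        by (intro AE_I2 tendsto_mult_left conv_difference_quotient(1)[OF vp_smooth_periodic u1])
      show "AE x in torus. norm ((sR R x * mR R x) * conv (vp m) (?q n) x) \<le> real R * real R * B" for n
        unfolding real_norm_def abs_mult by (intro AE_I2 mult_mono mb B) auto
    qed simp
    then have "(\<lambda>n. \<bar>LINT x|torus. (sR R x * mR R x) * conv (vp m) (?q n) x\<bar>) \<longlonglongrightarrow> \<bar>LINT x|torus. (sR R x * mR R x) * conv (vp m) D x\<bar>"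
      unfolding wd by (rule tendsto_rabs)
    then show ?thesis
    proof (rule LIMSEQ_le_const2)
      have "\<bar>LINT x|torus. (sR R x * mR R x) * conv (vp m) (?q n) x\<bar> \<le> n3 (mR R) * n3 (mR R) * K" for n
      proof -
        have "\<bar>LINT x|torus. (sR R x * mR R x) * conv (vp m) (?q n) x\<bar> \<le> n3 (sR R) * n3 (mR R) * n3 (?q n)"
          by (rule vp_conv_bound[OF mPL(2) mPL(1) qPL])
        also have "\<dots> \<le> n3 (mR R) * n3 (mR R) * K"
          by (intro mult_mono ns qn mult_nonneg_nonneg n3_nonneg order_refl)
        finally show ?thesis .
      qed
      then show "\<exists>N. \<forall>n\<ge>N. \<bar>LINT x|torus. (sR R x * mR R x) * conv (vp m) (?q n) x\<bar> \<le> n3 (mR R) * n3 (mR R) * K" by blast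
    qed
  qed
  have mK: "n3 (mR R) \<le> K" for R
  proof (cases "n3 (mR R) = 0")
    case False
    then have pos: "n3 (mR R) > 0" using n3_nonneg[of "mR R"] by simp
    have bb: "\<bar>sR R x * mR R x\<bar> \<le> real R * real R" for x
      unfolding abs_mult by (intro mult_mono mb) auto
    have "(\<lambda>m. LINT x|torus. (sR R x * mR R x) * conv (vp m) D x) \<longlonglongrightarrow> (LINT x|torus. (sR R x * mR R x) * D x)"
      by (rule vp_conv_limit_bounded[OF pborel_mult[OF mp(2) mp(1)] bb D])
    then have "(LINT x|torus. (sR R x * mR R x) * D x) \<le> n3 (mR R) * n3 (mR R) * K"
      by (rule LIMSEQ_le_const2) (use bnd[of R] in \<open>auto simp: abs_le_iff\<close>)
    \<comment> \<open>Two factors of the truncated norm cancel after comparison with the cube.\<close>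
    moreover have "n3 (mR R) ^ 3 \<le> (LINT x|torus. (sR R x * mR R x) * D x)"
      unfolding n3_cube
    proof (rule integral_mono)
      show "integrable torus (\<lambda>x. \<bar>mR R x\<bar> ^ 3)" using mPL(1) by (simp add: PL_def)
      show "integrable torus (\<lambda>x. (sR R x * mR R x) * D x)"
      proof (rule Bochner_Integration.integrable_bound)
        show "integrable torus (\<lambda>x. real R * real R * \<bar>D x\<bar>)" using D by (simp add: PL_def)
        show "(\<lambda>x. (sR R x * mR R x) * D x) \<in> borel_measurable torus"
          using pborel_mult[OF pborel_mult[OF mp(2) mp(1)] Dp] by (intro measurable_torus) blast
        show "AE x in torus. norm ((sR R x * mR R x) * D x) \<le> norm (real R * real R * \<bar>D x\<bar>)"
          using bb by (intro AE_I2) (auto simp: abs_mult intro!: mult_right_mono)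
      qed
      fix x
      have "\<bar>mR R x\<bar> ^ 3 = mR R x * mR R x * mR R x" using mb(3)[of R x] by (simp add: power3_eq_cube)
      also have "\<dots> \<le> mR R x * mR R x * \<bar>D x\<bar>" using mb(3,4)[of R x] by (intro mult_left_mono) auto
      also have "\<dots> = (sR R x * mR R x) * D x" by (simp add: sR_def abs_sgn mult_ac)
      finally show "\<bar>mR R x\<bar> ^ 3 \<le> (sR R x * mR R x) * D x" .
    qed
    ultimately have "n3 (mR R) * n3 (mR R) * n3 (mR R) \<le> n3 (mR R) * n3 (mR R) * K" by (simp add: power3_eq_cube)
    then show ?thesis using pos by simp
  qed (use K in simp)
  have mI: "(LINT x|torus. \<bar>mR R x\<bar> ^ 3) \<le> K ^ 3" for R
    unfolding n3_cube[symmetric] using mK by (intro power_mono n3_nonneg)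
  have mono: "\<bar>mR R x\<bar> ^ 3 \<le> \<bar>mR R' x\<bar> ^ 3" if "R \<le> R'" for R R' x
    using that by (intro power_mono) (auto simp: mR_def)
  have inc: "incseq (\<lambda>R. LINT x|torus. \<bar>mR R x\<bar> ^ 3)"
    using mPL(1) mono by (auto simp: incseq_def PL_def intro!: integral_mono)
  then obtain l where l: "(\<lambda>R. LINT x|torus. \<bar>mR R x\<bar> ^ 3) \<longlonglongrightarrow> l"
    using incseq_convergent[OF inc] mI by metis
  have lK: "l \<le> K ^ 3" using l by (rule LIMSEQ_le_const2) (use mI in auto)
  have ptl: "(\<lambda>R. \<bar>mR R x\<bar> ^ 3) \<longlonglongrightarrow> \<bar>D x\<bar> ^ 3" for x
  proof (rule tendsto_eventually)
    obtain N where N: "\<bar>D x\<bar> \<le> real N" using real_arch_simple by blast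
    then have "\<bar>mR R x\<bar> ^ 3 = \<bar>D x\<bar> ^ 3" if "R \<ge> N" for R using that by (simp add: mR_def min_def)
    then show "\<forall>\<^sub>F R in sequentially. \<bar>mR R x\<bar> ^ 3 = \<bar>D x\<bar> ^ 3" by (auto simp: eventually_sequentially)
  qed
  have Dm: "(\<lambda>x. \<bar>D x\<bar> ^ 3) \<in> borel_measurable torus" using pborel_power_abs[OF Dp] by (intro measurable_torus) blast
  have i1: "\<And>i. integrable torus (\<lambda>x. \<bar>mR i x\<bar> ^ 3)" using mPL(1) by (simp add: PL_def)
  have i2: "AE x in torus. mono (\<lambda>n. \<bar>mR n x\<bar> ^ 3)" using mono by (auto simp: mono_def)
  have i3: "AE x in torus. (\<lambda>i. \<bar>mR i x\<bar> ^ 3) \<longlonglongrightarrow> \<bar>D x\<bar> ^ 3" using ptl by simp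
  show "PL 3 D" unfolding PL_def using Dp integrable_monotone_convergence[OF i1 i2 i3 l Dm] by blast
  show "n3 D \<le> K" by (rule n3_le[OF _ K]) (use integral_monotone_convergence[OF i1 i2 i3 l Dm] lK in simp)
qed

section \<open>From higher differences to a Lipschitz bound\<close>

lemma n3_mono:
  assumes f: "PL 3 f" and g: "PL 3 g" and le: "\<And>x. \<bar>f x\<bar> \<le> \<bar>g x\<bar>"
  shows "n3 f \<le> n3 g"
proof (rule n3_le[OF _ n3_nonneg])
  show "(LINT x|torus. \<bar>f x\<bar> ^ 3) \<le> n3 g ^ 3"
    unfolding n3_cube using f g le by (intro integral_mono power_mono) (auto simp: PL_def)
qed

text \<open>Minkowski's inequality, from \<open>(f + g)\<^sup>3 = f (f + g)\<^sup>2 + g (f + g)\<^sup>2\<close> and Hoelder's inequality.\<close>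

lemma minkowski3:
  assumes f: "PL 3 f" and g: "PL 3 g"
  shows "n3 (\<lambda>x. f x + g x) \<le> n3 f + n3 g"
proof -
  let ?s = "\<lambda>x. f x + g x"
  have s: "PL 3 ?s" by (rule PL_add[OF f g])
  have "n3 ?s ^ 3 \<le> (n3 f + n3 g) * (n3 ?s * n3 ?s)"
  proof -
    have "(LINT x|torus. \<bar>?s x\<bar> ^ 3) \<le> (LINT x|torus. \<bar>f x * ?s x * ?s x\<bar> + \<bar>g x * ?s x * ?s x\<bar>)"
    proof (rule integral_mono)
      show "integrable torus (\<lambda>x. \<bar>?s x\<bar> ^ 3)" using s by (simp add: PL_def)
      show "integrable torus (\<lambda>x. \<bar>f x * ?s x * ?s x\<bar> + \<bar>g x * ?s x * ?s x\<bar>)"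
        by (intro Bochner_Integration.integrable_add integrable_abs integrable_mult3 f g s)
      fix x
      have "\<bar>?s x\<bar> ^ 3 = \<bar>f x * ?s x * ?s x + g x * ?s x * ?s x\<bar>"
        by (simp add: power3_eq_cube abs_mult flip: distrib_right)
      then show "\<bar>?s x\<bar> ^ 3 \<le> \<bar>f x * ?s x * ?s x\<bar> + \<bar>g x * ?s x * ?s x\<bar>" by linarith
    qed
    also have "\<dots> = (LINT x|torus. \<bar>f x * ?s x * ?s x\<bar>) + (LINT x|torus. \<bar>g x * ?s x * ?s x\<bar>)"
      by (intro Bochner_Integration.integral_add integrable_abs integrable_mult3 f g s)
    also have "\<dots> \<le> n3 f * n3 ?s * n3 ?s + n3 g * n3 ?s * n3 ?s"
      by (intro add_mono holder3 f g s)
    finally show ?thesis unfolding n3_cube by (simp add: algebra_simps)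
  qed
  then have "n3 ?s * (n3 ?s * n3 ?s) \<le> (n3 f + n3 g) * (n3 ?s * n3 ?s)" by (simp add: power3_eq_cube mult_ac)
  then show ?thesis
    using n3_nonneg[of f] n3_nonneg[of g] n3_nonneg[of ?s] by (cases "n3 ?s = 0") (auto simp: mult_le_cancel_right)
qed

text \<open>Vector fields are kept whole here, since the Besov seminorm is taken of the vector and not of its components.\<close>

definition L3_field :: "(vec3 \<Rightarrow> vec3) \<Rightarrow> bool" where
  "L3_field g \<longleftrightarrow> periodic g \<and> g \<in> borel_measurable borel \<and> integrable torus (\<lambda>x. norm (g x) ^ 3)"

definition L3_norm :: "(vec3 \<Rightarrow> vec3) \<Rightarrow> real" where
  "L3_norm g = n3 (\<lambda>x. norm (g x))"

lemma L3_field_PL: "L3_field g \<Longrightarrow> PL 3 (\<lambda>x. norm (g x))"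
  by (auto simp: L3_field_def PL_def pborel_def intro: periodic_comp)

lemma L3_norm_nonneg: "0 \<le> L3_norm g"
  by (simp add: L3_norm_def n3_nonneg)

lemma PL_dominated:
  assumes "pborel f" "PL 3 g" "\<And>x. \<bar>f x\<bar> \<le> \<bar>g x\<bar>" shows "PL 3 f"
  unfolding PL_def
proof
  show "integrable torus (\<lambda>x. \<bar>f x\<bar> ^ 3)"
  proof (rule Bochner_Integration.integrable_bound)
    show "integrable torus (\<lambda>x. \<bar>g x\<bar> ^ 3)" using assms by (simp add: PL_def)
    show "(\<lambda>x. \<bar>f x\<bar> ^ 3) \<in> borel_measurable torus" using pborel_power_abs[OF assms(1)] by (intro measurable_torus) auto
    show "AE x in torus. norm (\<bar>f x\<bar> ^ 3) \<le> norm (\<bar>g x\<bar> ^ 3)" using assms(3) by (auto intro: power_mono)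
  qed
qed fact

lemma L3_field_I: "periodic g \<Longrightarrow> g \<in> borel_measurable borel \<Longrightarrow> PL 3 (\<lambda>x. norm (g x)) \<Longrightarrow> L3_field g"
  by (simp add: L3_field_def PL_def)

lemma L3_field_add:
  assumes a: "L3_field a" and b: "L3_field b"
  shows "L3_field (\<lambda>x. a x + b x)" "L3_norm (\<lambda>x. a x + b x) \<le> L3_norm a + L3_norm b"
proof -
  have p: "periodic (\<lambda>x. a x + b x)" "(\<lambda>x. a x + b x) \<in> borel_measurable borel"
    using a b by (auto simp: L3_field_def intro: periodic_comp2)
  have s: "PL 3 (\<lambda>x. norm (a x) + norm (b x))" by (rule PL_add[OF L3_field_PL[OF a] L3_field_PL[OF b]])
  have l: "\<bar>norm (a x + b x)\<bar> \<le> \<bar>norm (a x) + norm (b x)\<bar>" for x using norm_triangle_ineq[of "a x" "b x"] by simp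
  have q: "PL 3 (\<lambda>x. norm (a x + b x))"
    by (rule PL_dominated[OF _ s l]) (use p in \<open>auto simp: pborel_def intro: periodic_comp\<close>)
  show "L3_field (\<lambda>x. a x + b x)" by (rule L3_field_I[OF p q])
  show "L3_norm (\<lambda>x. a x + b x) \<le> L3_norm a + L3_norm b"
    unfolding L3_norm_def using n3_mono[OF q s l] minkowski3[OF L3_field_PL[OF a] L3_field_PL[OF b]] by linarith
qed

lemma L3_field_scale:
  assumes a: "L3_field a" shows "L3_field (\<lambda>x. c *\<^sub>R a x)" "L3_norm (\<lambda>x. c *\<^sub>R a x) = \<bar>c\<bar> * L3_norm a"
proof -
  have p: "periodic (\<lambda>x. c *\<^sub>R a x)" "(\<lambda>x. c *\<^sub>R a x) \<in> borel_measurable borel"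
    using a by (auto simp: L3_field_def intro: periodic_comp)
  have "PL 3 (\<lambda>x. \<bar>c\<bar> * norm (a x))" by (rule PL_cmult[OF L3_field_PL[OF a]])
  then show "L3_field (\<lambda>x. c *\<^sub>R a x)" using p by (intro L3_field_I) auto
  show "L3_norm (\<lambda>x. c *\<^sub>R a x) = \<bar>c\<bar> * L3_norm a"
    unfolding L3_norm_def using n3_cmult[of "\<bar>c\<bar>" "\<lambda>x. norm (a x)"] by simp
qed

lemma L3_field_shift:
  assumes a: "L3_field a" shows "L3_field (\<lambda>x. a (x + h))" "L3_norm (\<lambda>x. a (x + h)) = L3_norm a"
proof -
  have p: "periodic (\<lambda>x. a (x + h))" using a by (auto simp: L3_field_def intro: periodic_shift)
  have m: "(\<lambda>x. a (x + h)) \<in> borel_measurable borel"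
    using a by (auto simp: L3_field_def intro: measurable_compose[where f="\<lambda>x. x + h" and g=a])
  have q: "PL 3 (\<lambda>x. norm (a (x + h)))" using PL_shift(1)[OF L3_field_PL[OF a], of "-h"] by simp
  show "L3_field (\<lambda>x. a (x + h))" by (rule L3_field_I[OF p m q])
  show "L3_norm (\<lambda>x. a (x + h)) = L3_norm a" unfolding L3_norm_def using n3_shift[OF L3_field_PL[OF a], of "-h"] by simp
qed

lemma L3_field_diff:
  assumes a: "L3_field a" and b: "L3_field b"
  shows "L3_field (\<lambda>x. a x - b x)" "L3_norm (\<lambda>x. a x - b x) \<le> L3_norm a + L3_norm b"
  using L3_field_add[OF a L3_field_scale(1)[OF b, of "-1"]] L3_field_scale(2)[OF b, of "-1"] by simp_all

lemma L3_field_difference: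
  assumes a: "L3_field a" shows "L3_field (difference h a)" "L3_norm (difference h a) \<le> 2 * L3_norm a"
  using L3_field_diff[OF L3_field_shift(1)[OF a, of h] a] L3_field_shift(2)[OF a, of h] by (simp_all add: difference_def[abs_def])

lemma L3_field_difference_funpow:
  assumes a: "L3_field a" shows "L3_field ((difference h ^^ n) a)" "L3_norm ((difference h ^^ n) a) \<le> 2 ^ n * L3_norm a"
proof -
  have "L3_field ((difference h ^^ n) a) \<and> L3_norm ((difference h ^^ n) a) \<le> 2 ^ n * L3_norm a"
  proof (induction n)
    case (Suc n)
    then show ?case using L3_field_difference[of "(difference h ^^ n) a" h] by auto
  qed (use a in simp)
  then show "L3_field ((difference h ^^ n) a)" "L3_norm ((difference h ^^ n) a) \<le> 2 ^ n * L3_norm a" by auto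
qed

definition summed :: "vec3 \<Rightarrow> (vec3 \<Rightarrow> vec3) \<Rightarrow> vec3 \<Rightarrow> vec3" where
  "summed h g x = g (x + h) + g x"

lemma L3_field_summed:
  assumes a: "L3_field a" shows "L3_field (summed h a)" "L3_norm (summed h a) \<le> 2 * L3_norm a"
  using L3_field_add[OF L3_field_shift(1)[OF a, of h] a] L3_field_shift(2)[OF a, of h] by (simp_all add: summed_def[abs_def])

lemma difference_double: "difference (2 *\<^sub>R h) g = summed h (difference h g)"
  by (auto simp: difference_def summed_def scaleR_2 add.assoc)

lemma difference_summed: "difference h (summed h g) = summed h (difference h g)"
  by (auto simp: difference_def summed_def)

lemma difference_summed_funpow: "difference h ((summed h ^^ n) g) = (summed h ^^ n) (difference h g)"
  by (induction n) (simp_all add: difference_summed)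

lemma difference_double_funpow: "(difference (2 *\<^sub>R h) ^^ n) g = (summed h ^^ n) ((difference h ^^ n) g)"
proof (induction n)
  case (Suc n)
  have "(difference (2 *\<^sub>R h) ^^ Suc n) g = summed h (difference h ((summed h ^^ n) ((difference h ^^ n) g)))"
    by (simp add: Suc difference_double)
  then show ?case by (simp add: difference_summed_funpow)
qed simp

text \<open>The operator \<open>summed h\<close> equals twice the identity plus \<open>difference h\<close>, so its powers differ from powers of two by
  terms that contain a difference.\<close>

lemma summed_funpow_approx:
  assumes g: "L3_field g"
  shows "L3_field ((summed h ^^ n) g) \<and> L3_norm (\<lambda>x. (summed h ^^ n) g x - 2 ^ n *\<^sub>R g x) \<le> real n * 2 ^ n / 2 * L3_norm (difference h g)"
proof (induction n)
  case 0
  have "L3_norm (\<lambda>x. 0) = 0" by (simp add: L3_norm_def n3_def)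
  then show ?case using g by simp
next
  case (Suc n)
  let ?r = "\<lambda>x. (summed h ^^ n) g x - 2 ^ n *\<^sub>R g x"
  have r: "L3_field ?r" by (rule L3_field_diff[OF _ L3_field_scale(1)[OF g]]) (use Suc in simp)
  have "(summed h ^^ Suc n) g x - 2 ^ Suc n *\<^sub>R g x = summed h ?r x + 2 ^ n *\<^sub>R difference h g x" for x
  proof -
    have "2 ^ Suc n *\<^sub>R g x = 2 ^ n *\<^sub>R g x + 2 ^ n *\<^sub>R g x" by (simp add: scaleR_2 flip: scaleR_scaleR)
    then show ?thesis by (simp add: summed_def difference_def scaleR_diff_right)
  qed
  then have "L3_norm (\<lambda>x. (summed h ^^ Suc n) g x - 2 ^ Suc n *\<^sub>R g x) = L3_norm (\<lambda>x. summed h ?r x + 2 ^ n *\<^sub>R difference h g x)" by simp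
  also have "\<dots> \<le> L3_norm (summed h ?r) + L3_norm (\<lambda>x. 2 ^ n *\<^sub>R difference h g x)"
    by (rule L3_field_add(2)[OF L3_field_summed(1)[OF r] L3_field_scale(1)[OF L3_field_difference(1)[OF g]]])
  also have "\<dots> \<le> 2 * (real n * 2 ^ n / 2 * L3_norm (difference h g)) + 2 ^ n * L3_norm (difference h g)"
    using L3_field_summed(2)[OF r, of h] Suc L3_field_scale(2)[OF L3_field_difference(1)[OF g], of "2 ^ n" h] by simp
  also have "\<dots> = real (Suc n) * 2 ^ Suc n / 2 * L3_norm (difference h g)" by (simp add: algebra_simps)
  finally show ?case using L3_field_summed(1)[of "(summed h ^^ n) g" h] Suc by simp
qed

text \<open>A difference with step \<open>2 *\<^sub>R h\<close> factors as \<open>summed h\<close> after \<open>difference h\<close>. Expanding the power of \<open>summed h\<close> around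
  \<open>2 ^ n\<close> trades a difference of order \<open>n\<close> for one with a doubled step and one of higher order.\<close>

lemma difference_recursion:
  assumes g: "L3_field g"
  shows "L3_norm ((difference h ^^ n) g) \<le> L3_norm ((difference (2 *\<^sub>R h) ^^ n) g) / 2 ^ n + real n / 2 * L3_norm ((difference h ^^ Suc n) g)"
proof -
  let ?d = "(difference h ^^ n) g"
  have d: "L3_field ?d" by (rule L3_field_difference_funpow(1)[OF g])
  let ?s = "(summed h ^^ n) ?d"
  have s: "L3_field ?s" "L3_norm (\<lambda>x. ?s x - 2 ^ n *\<^sub>R ?d x) \<le> real n * 2 ^ n / 2 * L3_norm (difference h ?d)"
    using summed_funpow_approx[OF d] by auto
  have "2 ^ n * L3_norm ?d = L3_norm (\<lambda>x. 2 ^ n *\<^sub>R ?d x)" using L3_field_scale(2)[OF d, of "2 ^ n"] by simp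
  also have "\<dots> = L3_norm (\<lambda>x. ?s x - (?s x - 2 ^ n *\<^sub>R ?d x))" by simp
  also have "\<dots> \<le> L3_norm ?s + L3_norm (\<lambda>x. ?s x - 2 ^ n *\<^sub>R ?d x)"
    by (rule L3_field_diff(2)[OF s(1) L3_field_diff(1)[OF s(1) L3_field_scale(1)[OF d]]])
  also have "\<dots> \<le> L3_norm ((difference (2 *\<^sub>R h) ^^ n) g) + real n * 2 ^ n / 2 * L3_norm ((difference h ^^ Suc n) g)"
    using s(2) by (simp add: difference_double_funpow)
  finally have "2 ^ n * L3_norm ?d / 2 ^ n \<le> (L3_norm ((difference (2 *\<^sub>R h) ^^ n) g) + real n * 2 ^ n / 2 * L3_norm ((difference h ^^ Suc n) g)) / 2 ^ n"
    by (rule divide_right_mono) simp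
  then show ?thesis by (simp add: add_divide_distrib)
qed

text \<open>Doubling a small vector finitely often makes its norm at least one. The Marchaud estimates run this recursion
  backwards from the scale where they are trivial.\<close>

lemma doubling_induct [consumes 1, case_names large small]:
  fixes h :: vec3
  assumes h: "h \<noteq> 0" and large: "\<And>h. norm h \<ge> 1 \<Longrightarrow> P h"
    and small: "\<And>h. h \<noteq> 0 \<Longrightarrow> norm h < 1 \<Longrightarrow> P (2 *\<^sub>R h) \<Longrightarrow> P h"
  shows "P h"
proof -
  have "1 \<le> 2 ^ k * norm h \<Longrightarrow> h \<noteq> 0 \<Longrightarrow> P h" for k h
  proof (induction k arbitrary: h)
    case (Suc k)
    show ?case
    proof (cases "norm h \<ge> 1")
      case False
      have "P (2 *\<^sub>R h)" by (rule Suc.IH) (use Suc.prems in \<open>simp_all add: mult_ac\<close>)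
      then show ?thesis using small False Suc.prems by simp
    qed (rule large)
  qed (use large in simp)
  moreover obtain k :: nat where "1 / norm h < 2 ^ k" using real_arch_pow[of 2 "1 / norm h"] by auto
  then have "1 \<le> 2 ^ k * norm h" using h by (simp add: field_simps)
  ultimately show ?thesis using h by blast
qed

text \<open>Each doubling multiplies the bound by \<open>2 powr \<sigma> / 2 ^ n\<close>, at most 3/4 for \<open>n \<ge> 2\<close> and \<open>\<sigma> \<le> 3 / 2\<close>, and the source term is
  absorbed in the remaining quarter.\<close>

lemma marchaud_step:
  assumes n: "n \<ge> 2" and \<sigma>: "1 < \<sigma>" "\<sigma> \<le> 3 / 2" and A: "A \<ge> 0" and B: "B \<ge> 0"
    and b: "\<And>h. \<omega> h \<le> A" and b': "\<And>h. \<omega>' h \<le> B * norm h powr \<sigma>"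
    and r: "\<And>h. \<omega> h \<le> \<omega> (2 *\<^sub>R h) / 2 ^ n + real n / 2 * \<omega>' h"
    and h: "h \<noteq> 0"
  shows "\<omega> h \<le> (A + 2 * real n * B) * norm (h::vec3) powr \<sigma>"
  using h
proof (induction h rule: doubling_induct)
  case (large h)
  have "\<omega> h \<le> A * 1" using b by simp
  also have "\<dots> \<le> (A + 2 * real n * B) * norm h powr \<sigma>"
    using A B large \<sigma> by (intro mult_mono) (auto intro: ge_one_powr_ge_zero)
  finally show ?case .
next
  case (small h)
  let ?C = "A + 2 * real n * B"
  have C: "?C \<ge> 0" using A B by simp
  have q: "2 powr \<sigma> / 2 ^ n \<le> (3 / 4 :: real)"
  proof -
    have "2 powr \<sigma> \<le> 2 powr (3 / 2 :: real)" using \<sigma> by simp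
    also have "\<dots> = 2 * sqrt 2" using powr_add[of 2 1 "1 / 2 :: real"] by (simp add: powr_half_sqrt)
    also have "sqrt 2 \<le> 3 / 2" by (rule real_le_lsqrt) (simp_all add: power2_eq_square)
    then have "2 * sqrt 2 \<le> 3" by simp
    finally have "2 powr \<sigma> \<le> 3" .
    moreover have "(2::real) ^ 2 \<le> 2 ^ n" using n by (intro power_increasing) auto
    ultimately have "2 powr \<sigma> / 2 ^ n \<le> 3 / 2 ^ 2" by (intro frac_le) auto
    then show ?thesis by simp
  qed
  have "\<omega> h \<le> (?C * norm (2 *\<^sub>R h) powr \<sigma>) / 2 ^ n + real n / 2 * (B * norm h powr \<sigma>)"
    by (rule order_trans[OF r]) (intro add_mono divide_right_mono mult_left_mono small.IH b'; simp)
  also have "\<dots> = ?C * norm h powr \<sigma> * (2 powr \<sigma> / 2 ^ n) + real n / 2 * B * norm h powr \<sigma>"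
    by (simp add: powr_mult mult_ac)
  also have "\<dots> \<le> ?C * norm h powr \<sigma> * (3 / 4) + real n / 2 * B * norm h powr \<sigma>"
    using q C by (intro add_right_mono mult_left_mono) auto
  also have "\<dots> = (?C * (3 / 4) + real n / 2 * B) * norm h powr \<sigma>" by (simp add: algebra_simps)
  also have "\<dots> \<le> ?C * norm h powr \<sigma>"
    using A by (intro mult_right_mono) (simp_all add: algebra_simps)
  finally show ?case .
qed

text \<open>For first differences the factor \<open>2 / 2\<close> does not contract, and the sum of the source terms converges only because
  \<open>\<sigma> > 1\<close>. The induction therefore proves the stronger bound \<open>C * norm h - c * norm h powr \<sigma>\<close>, whose correction pays for
  the source at each step.\<close>

lemma marchaud_last:
  assumes \<sigma>: "1 < \<sigma>" "\<sigma> \<le> 3 / 2" and A: "A \<ge> 0" and B: "B \<ge> 0"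
    and b: "\<And>h. \<omega> h \<le> A" and b': "\<And>h. \<omega>' h \<le> B * norm h powr \<sigma>"
    and r: "\<And>h. \<omega> h \<le> \<omega> (2 *\<^sub>R h) / 2 + \<omega>' h / 2"
    and h: "h \<noteq> 0"
  shows "\<omega> h \<le> (A + 4 * (B / (2 powr \<sigma> - 2))) * norm (h::vec3)"
proof -
  define c where "c = B / (2 powr \<sigma> - 2)"
  have s2: "2 powr \<sigma> > 2" using powr_less_mono[of 1 \<sigma> 2] \<sigma> by simp
  have s4: "2 powr \<sigma> \<le> 4" using powr_mono[of \<sigma> 2 2] \<sigma> by simp
  have c: "c \<ge> 0" using B s2 by (simp add: c_def)
  have cB: "c * 2 powr \<sigma> = B + 2 * c" using s2 by (simp add: c_def field_simps)
  let ?C = "A + 4 * c"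
  have "norm h \<le> 2 \<longrightarrow> \<omega> h \<le> ?C * norm h - c * norm h powr \<sigma>"
    using h
  proof (induction h rule: doubling_induct)
    case (large h)
    show ?case
    proof
      assume h2: "norm h \<le> 2"
      have "c * norm h powr \<sigma> \<le> c * 2 powr \<sigma>" using c h2 \<sigma> by (intro mult_left_mono powr_mono2) auto
      also have "\<dots> \<le> c * 4" using c s4 by (intro mult_left_mono) auto
      finally have "c * norm h powr \<sigma> \<le> 4 * c" by simp
      moreover have "?C * 1 \<le> ?C * norm h" using A c large by (intro mult_left_mono) auto
      ultimately show "\<omega> h \<le> ?C * norm h - c * norm h powr \<sigma>" using b[of h] by simp
    qed
  next
    case (small h)
    have i: "\<omega> (2 *\<^sub>R h) \<le> ?C * (2 * norm h) - c * (2 * norm h) powr \<sigma>" using small by simp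
    have "\<omega> h \<le> (?C * (2 * norm h) - c * (2 * norm h) powr \<sigma>) / 2 + (B * norm h powr \<sigma>) / 2"
      by (rule order_trans[OF r]) (intro add_mono divide_right_mono i b'; simp)
    also have "\<dots> = ?C * norm h - (c * 2 powr \<sigma> - B) / 2 * norm h powr \<sigma>"
      by (simp add: powr_mult field_simps)
    also have "\<dots> = ?C * norm h - c * norm h powr \<sigma>" unfolding cB by simp
    finally show ?case by simp
  qed
  then show ?thesis
  proof (cases "norm h \<le> 2")
    case True
    then show ?thesis using \<open>norm h \<le> 2 \<longrightarrow> _\<close> c by (simp add: c_def[symmetric]) (smt (verit) mult_nonneg_nonneg powr_ge_zero)
  next
    case False
    have "\<omega> h \<le> ?C * 1" using b[of h] c by simp
    also have "\<dots> \<le> ?C * norm h" using A c False by (intro mult_left_mono) auto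
    finally show ?thesis by (simp add: c_def)
  qed
qed

lemma marchaud_descend:
  assumes \<sigma>: "1 < \<sigma>" "\<sigma> \<le> 3 / 2" and n: "n \<ge> 2"
  shows "\<exists>c\<ge>0. \<forall>g Q. L3_field g \<longrightarrow> Q \<ge> 0 \<longrightarrow> (\<forall>h. L3_norm ((difference h ^^ (n + j)) g) \<le> Q * norm h powr \<sigma>) \<longrightarrow>
     (\<forall>h. L3_norm ((difference h ^^ n) g) \<le> c * (Q + L3_norm g) * norm h powr \<sigma>)"
proof (induction j)
  case 0
  have "L3_norm ((difference h ^^ n) g) \<le> 1 * (Q + L3_norm g) * norm h powr \<sigma>"
    if "\<forall>h. L3_norm ((difference h ^^ (n + 0)) g) \<le> Q * norm h powr \<sigma>" for g Q h
  proof -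
    have "L3_norm ((difference h ^^ n) g) \<le> Q * norm h powr \<sigma>" using that[rule_format, of h] by simp
    also have "\<dots> \<le> 1 * (Q + L3_norm g) * norm h powr \<sigma>" using L3_norm_nonneg[of g] by (intro mult_right_mono) auto
    finally show ?thesis .
  qed
  then show ?case by (intro exI[of _ 1] conjI allI impI) simp_all
next
  case (Suc j)
  then obtain c where c: "c \<ge> 0" "\<And>g Q h. L3_field g \<Longrightarrow> Q \<ge> 0 \<Longrightarrow> (\<forall>h. L3_norm ((difference h ^^ (n + j)) g) \<le> Q * norm h powr \<sigma>) \<Longrightarrow>
     L3_norm ((difference h ^^ n) g) \<le> c * (Q + L3_norm g) * norm h powr \<sigma>" by blast
  let ?k = "n + j"
  let ?d = "2 * real ?k + 2 ^ ?k + 1"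
  show ?case
  proof (intro exI[of _ "c * ?d"] conjI allI impI)
    show "0 \<le> c * ?d" using c by simp
    fix g Q h assume g: "L3_field g" and Q: "Q \<ge> 0" and a: "\<forall>h. L3_norm ((difference h ^^ (n + Suc j)) g) \<le> Q * norm h powr \<sigma>"
    let ?Q = "2 ^ ?k * L3_norm g + 2 * real ?k * Q"
    have Q': "?Q \<ge> 0" using Q L3_norm_nonneg[of g] by simp
    have "L3_norm ((difference h ^^ ?k) g) \<le> ?Q * norm h powr \<sigma>" for h
    proof (cases "h = 0")
      case True
      have z: "difference 0 g' = (\<lambda>x. 0)" for g' :: "vec3 \<Rightarrow> vec3" by (simp add: difference_def fun_eq_iff)
      have "?k = Suc (?k - 1)" using n by simp
      then have "(difference 0 ^^ ?k) g = (\<lambda>x. 0)" by (metis funpow.simps(2) o_apply z)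
      then have "L3_norm ((difference h ^^ ?k) g) = 0" using True by (simp add: L3_norm_def n3_def)
      then show ?thesis using Q' by simp
    next
      case False
      show ?thesis
      proof (rule marchaud_step[where \<omega>="\<lambda>h. L3_norm ((difference h ^^ ?k) g)" and \<omega>'="\<lambda>h. L3_norm ((difference h ^^ Suc ?k) g)", OF _ \<sigma> _ Q])
        show "L3_norm ((difference h ^^ Suc ?k) g) \<le> Q * norm h powr \<sigma>" for h using a[rule_format, of h] by simp
        show "L3_norm ((difference h ^^ ?k) g) \<le> L3_norm ((difference (2 *\<^sub>R h) ^^ ?k) g) / 2 ^ ?k + real ?k / 2 * L3_norm ((difference h ^^ Suc ?k) g)" for h
          by (rule difference_recursion[OF g])
      qed (use n False L3_norm_nonneg[of g] L3_field_difference_funpow(2)[OF g] in auto)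
    qed
    then have "L3_norm ((difference h ^^ n) g) \<le> c * (?Q + L3_norm g) * norm h powr \<sigma>" by (intro c(2)[OF g Q']) blast
    also have "\<dots> \<le> c * (?d * (Q + L3_norm g)) * norm h powr \<sigma>"
    proof (intro mult_right_mono mult_left_mono c(1))
      have "0 \<le> (2 ^ ?k + 1) * Q + 2 * real ?k * L3_norm g" using Q L3_norm_nonneg[of g] by simp
      then show "?Q + L3_norm g \<le> ?d * (Q + L3_norm g)" by (simp add: algebra_simps)
    qed simp
    finally show "L3_norm ((difference h ^^ n) g) \<le> c * ?d * (Q + L3_norm g) * norm h powr \<sigma>" by (simp add: mult_ac)
  qed
qed

text \<open>Lower the order of the difference one by one down to two, with exponent \<open>min s (3 / 2)\<close>, and then pass from second to
  first differences.\<close>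

lemma marchaud:
  assumes s: "s > 1"
  obtains K where "K \<ge> 0" "\<And>g Q h. L3_field g \<Longrightarrow> Q \<ge> 0 \<Longrightarrow>
     (\<And>h. h \<noteq> 0 \<Longrightarrow> L3_norm ((difference h ^^ (nat \<lfloor>s\<rfloor> + 1)) g) \<le> Q * norm h powr s) \<Longrightarrow>
     L3_norm (difference h g) \<le> K * (Q + L3_norm g) * norm h"
proof -
  \<comment> \<open>The exponent is lowered to at most 3/2: second differences of exponent 2 or more would break the contraction.\<close>
  define \<sigma> where "\<sigma> = min s (3 / 2)"
  have \<sigma>: "1 < \<sigma>" "\<sigma> \<le> 3 / 2" "\<sigma> \<le> s" using s by (auto simp: \<sigma>_def)
  define m where "m = nat \<lfloor>s\<rfloor> + 1"
  have m: "m \<ge> 2" using s unfolding m_def by linarith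
  obtain c where c: "c \<ge> 0" "\<And>g Q h. L3_field g \<Longrightarrow> Q \<ge> 0 \<Longrightarrow> (\<forall>h. L3_norm ((difference h ^^ m) g) \<le> Q * norm h powr \<sigma>) \<Longrightarrow>
     L3_norm ((difference h ^^ 2) g) \<le> c * (Q + L3_norm g) * norm h powr \<sigma>"
  proof -
    \<comment> \<open>The descent stops at second differences; the last step needs a different argument.\<close>
    have "2 + (m - 2) = m" using m by simp
    then show thesis using marchaud_descend[OF \<sigma>(1,2), of 2 "m - 2"] that by (simp only: order_refl simp_thms) blast
  qed
  have s2: "2 powr \<sigma> > 2" using powr_less_mono[of 1 \<sigma> 2] \<sigma> by simp
  let ?e = "4 * (c * (2 ^ m + 1) / (2 powr \<sigma> - 2))"
  have e0: "?e \<ge> 0" using c s2 by simp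
  show thesis
  proof (rule that[of "2 + ?e"])
    show "2 + ?e \<ge> 0" using e0 by linarith
    fix g Q h assume g: "L3_field g" and Q: "Q \<ge> 0"
      and a: "\<And>h. h \<noteq> 0 \<Longrightarrow> L3_norm ((difference h ^^ (nat \<lfloor>s\<rfloor> + 1)) g) \<le> Q * norm h powr s"
    let ?Q = "Q + 2 ^ m * L3_norm g"
    have Q': "?Q \<ge> 0" using Q L3_norm_nonneg[of g] by simp
    have z: "difference 0 g' = (\<lambda>x. 0)" for g' :: "vec3 \<Rightarrow> vec3" by (simp add: difference_def fun_eq_iff)
    have nz: "L3_norm (\<lambda>x. 0) = 0" by (simp add: L3_norm_def n3_def)
    have mS: "m = Suc (m - 1)" using m by simp
    have 1: "L3_norm ((difference h ^^ m) g) \<le> ?Q * norm h powr \<sigma>" for h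
    proof (cases "h = 0")
      case True
      have "(difference 0 ^^ m) g = (\<lambda>x. 0)" using mS by (metis funpow.simps(2) o_apply z)
      then show ?thesis using True nz Q' by simp
    next
      case False
      show ?thesis
      proof (cases "norm h \<le> 1")
        case True
        have "L3_norm ((difference h ^^ m) g) \<le> Q * norm h powr s" using a[OF False] by (simp add: m_def)
        also have "\<dots> \<le> ?Q * norm h powr \<sigma>"
          using Q L3_norm_nonneg[of g] True False \<sigma>(3) by (intro mult_mono powr_mono') auto
        finally show ?thesis .
      next
        case h1: False
        have "L3_norm ((difference h ^^ m) g) \<le> (2 ^ m * L3_norm g) * 1" using L3_field_difference_funpow(2)[OF g] by simp
        also have "\<dots> \<le> ?Q * norm h powr \<sigma>"
          using Q L3_norm_nonneg[of g] h1 \<sigma> by (intro mult_mono) (auto intro: ge_one_powr_ge_zero)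
        finally show ?thesis .
      qed
    qed
    show "L3_norm (difference h g) \<le> (2 + ?e) * (Q + L3_norm g) * norm h"
    proof (cases "h = 0")
      case True
      then show ?thesis using nz z by simp
    next
      case False
      let ?B = "c * (?Q + L3_norm g)"
      have B: "?B \<ge> 0" using c(1) Q' L3_norm_nonneg[of g] by simp
      have "L3_norm (difference h g) \<le> (2 * L3_norm g + 4 * (?B / (2 powr \<sigma> - 2))) * norm h"
      proof (rule marchaud_last[where \<omega>="\<lambda>h. L3_norm (difference h g)" and \<omega>'="\<lambda>h. L3_norm ((difference h ^^ 2) g)", OF \<sigma>(1,2) _ B])
        show "L3_norm ((difference h ^^ 2) g) \<le> ?B * norm h powr \<sigma>" for h using c(2)[OF g Q'] 1 by blast
        show "L3_norm (difference h g) \<le> L3_norm (difference (2 *\<^sub>R h) g) / 2 + L3_norm ((difference h ^^ 2) g) / 2" for h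
          using difference_recursion[OF g, of 1 h] by (simp add: numeral_2_eq_2)
      qed (use False L3_norm_nonneg[of g] L3_field_difference(2)[OF g] in auto)
      also have "\<dots> \<le> ((2 + ?e) * (Q + L3_norm g)) * norm h"
      proof (rule mult_right_mono)
        have "?Q + L3_norm g \<le> (2 ^ m + 1) * (Q + L3_norm g)" using Q L3_norm_nonneg[of g] by (simp add: algebra_simps)
        then have "?B \<le> c * (2 ^ m + 1) * (Q + L3_norm g)" using c(1) by (simp add: mult.assoc mult_left_mono)
        then have "?B / (2 powr \<sigma> - 2) \<le> c * (2 ^ m + 1) * (Q + L3_norm g) / (2 powr \<sigma> - 2)"
          using s2 by (intro divide_right_mono) auto
        then have "4 * (?B / (2 powr \<sigma> - 2)) \<le> ?e * (Q + L3_norm g)" by simp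
        moreover have "2 * L3_norm g \<le> 2 * (Q + L3_norm g)" using Q by simp
        ultimately show "2 * L3_norm g + 4 * (?B / (2 powr \<sigma> - 2)) \<le> (2 + ?e) * (Q + L3_norm g)" by (simp only: distrib_right)
      qed simp
      finally show ?thesis .
    qed
  qed
qed

section \<open>Absolutely continuous functions of time\<close>

text \<open>Iterated derivatives of \<open>exp (- c / x)\<close> on the positive axis are of the form below, with a polynomial in \<open>1 / x\<close>.\<close>

definition bump_term :: "real \<Rightarrow> real poly \<Rightarrow> real \<Rightarrow> real" where
  "bump_term c p x = (if x > 0 then poly p (1 / x) * exp (- c / x) else 0)"

lemma poly_exp_tendsto_0:
  fixes c :: real and p :: "real poly"
  assumes "c > 0" shows "((\<lambda>y. poly p y * exp (- c * y)) \<longlongrightarrow> 0) at_top"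
proof -
  have "((\<lambda>y. (c * y) ^ k / exp (c * y)) \<longlongrightarrow> 0) at_top" for k
    by (rule filterlim_compose[OF tendsto_power_div_exp_0])
       (rule filterlim_tendsto_pos_mult_at_top[OF tendsto_const assms filterlim_ident])
  then have "((\<lambda>y. coeff p k / c ^ k * ((c * y) ^ k / exp (c * y))) \<longlongrightarrow> coeff p k / c ^ k * 0) at_top" for k
    by (intro tendsto_mult tendsto_const)
  then have "((\<lambda>y. \<Sum>k\<le>degree p. coeff p k / c ^ k * ((c * y) ^ k / exp (c * y))) \<longlongrightarrow> (\<Sum>k\<le>degree p. coeff p k / c ^ k * 0)) at_top"
    by (intro tendsto_sum)
  moreover have "(\<Sum>k\<le>degree p. coeff p k / c ^ k * ((c * y) ^ k / exp (c * y))) = poly p y * exp (- c * y)" for y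
    using assms by (simp add: poly_altdef sum_distrib_right exp_minus power_mult_distrib divide_simps)
  ultimately show ?thesis by simp
qed

lemma bump_term_quotient_tendsto:
  assumes "c > 0" shows "((\<lambda>x. bump_term c p x / x) \<longlongrightarrow> 0) (at 0)"
proof -
  have l: "((\<lambda>x. bump_term c p x / x) \<longlongrightarrow> 0) (at_left 0)"
  proof (rule tendsto_eventually)
    show "\<forall>\<^sub>F x in at_left 0. bump_term c p x / x = 0"
      unfolding eventually_at_left_field by (intro exI[of _ "-1"]) (auto simp: bump_term_def)
  qed
  have "((\<lambda>x. poly (pCons 0 p) (inverse x) * exp (- c * inverse x)) \<longlongrightarrow> 0) (at_right (0::real))"
    by (rule filterlim_compose[OF poly_exp_tendsto_0[OF assms] filterlim_inverse_at_top_right])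
  then have r: "((\<lambda>x. bump_term c p x / x) \<longlongrightarrow> 0) (at_right 0)"
  proof (rule Lim_transform_eventually)
    show "\<forall>\<^sub>F x in at_right 0. poly (pCons 0 p) (inverse x) * exp (- c * inverse x) = bump_term c p x / x"
      unfolding eventually_at_right_field by (intro exI[of _ 1]) (auto simp: bump_term_def inverse_eq_divide)
  qed
  show ?thesis using l r by (simp add: filterlim_split_at)
qed

lemma bump_term_derivative:
  assumes c: "c > 0"
  shows "(bump_term c p has_real_derivative bump_term c ([:0, 0, 1:] * (smult c p - pderiv p)) x) (at x)"
proof -
  consider "x > 0" | "x < 0" | "x = 0" by linarith
  then show ?thesis
  proof cases
    case 1
    have "((\<lambda>x. poly p (1 / x) * exp (- c / x)) has_real_derivative
       (poly (pderiv p) (1 / x) * (- 1 / x\<^sup>2) * exp (- c / x) + exp (- c / x) * (c / x\<^sup>2) * poly p (1 / x))) (at x)"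
    proof (rule DERIV_mult)
      show "((\<lambda>x. poly p (1 / x)) has_real_derivative (poly (pderiv p) (1 / x) * (- 1 / x\<^sup>2))) (at x)"
        by (rule DERIV_chain2[OF poly_DERIV]) (use 1 in \<open>auto intro!: derivative_eq_intros simp: power2_eq_square\<close>)
      show "((\<lambda>x. exp (- c / x)) has_real_derivative (exp (- c / x) * (c / x\<^sup>2))) (at x)"
        by (rule DERIV_chain2[OF DERIV_exp]) (use 1 in \<open>auto intro!: derivative_eq_intros simp: power2_eq_square\<close>)
    qed
    then have "((\<lambda>x. poly p (1 / x) * exp (- c / x)) has_real_derivative bump_term c ([:0, 0, 1:] * (smult c p - pderiv p)) x) (at x)"
      by (rule DERIV_cong) (use 1 in \<open>simp add: bump_term_def field_simps power2_eq_square\<close>)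
    then show ?thesis
      by (rule has_field_derivative_transform_within_open[of _ _ _ "{0<..}"]) (use 1 in \<open>auto simp: bump_term_def\<close>)
  next
    case 2
    have "((\<lambda>x. 0) has_real_derivative 0) (at x)" by simp
    then have "(bump_term c p has_real_derivative 0) (at x)"
      by (rule has_field_derivative_transform_within_open[of _ _ _ "{..<0}"]) (use 2 in \<open>auto simp: bump_term_def\<close>)
    then show ?thesis using 2 by (simp add: bump_term_def)
  next
    case 3
    then show ?thesis
      using bump_term_quotient_tendsto[OF c, of p] unfolding DERIV_def 3 by (simp add: bump_term_def)
  qed
qed

lemma smooth_real_coinduct:
  fixes f :: "real \<Rightarrow> real"
  assumes "f \<in> C" and "\<And>g. g \<in> C \<Longrightarrow> \<exists>g'\<in>C. \<forall>x. (g has_real_derivative g' x) (at x)"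
    and "\<And>g c. g \<in> C \<Longrightarrow> (\<lambda>x. c * g x) \<in> C"
  shows "smooth f"
proof (rule smooth_coinduct[where C=C])
  fix g :: "real \<Rightarrow> real" and v :: real
  assume g: "g \<in> C"
  then obtain g' where g': "g' \<in> C" "\<And>x. (g has_real_derivative g' x) (at x)" using assms(2) by blast
  have h: "(g has_derivative (*) (g' x)) (at x)" for x using g'(2) by (simp add: has_field_derivative_def)
  show "g differentiable_on UNIV" by (rule differentiable_UNIV_I[OF h])
  have "dderiv v g = (\<lambda>x. v * g' x)"
  proof
    fix x show "dderiv v g x = v * g' x" using dderiv_eq[OF h, of v x] by (simp add: mult.commute)
  qed
  then show "dderiv v g \<in> C" using assms(3)[OF g'(1)] by simp
qed fact

lemma smooth_bump_affine:
  assumes c: "c > 0" shows "smooth (\<lambda>t. bump_term c p (a * t + b))"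
proof (rule smooth_real_coinduct[where C="{\<lambda>t. k * bump_term c p (a * t + b) |k p. True}"])
  show "(\<lambda>t. bump_term c p (a * t + b)) \<in> {\<lambda>t. k * bump_term c p (a * t + b) |k p. True}"
    by (auto intro!: exI[of _ 1] exI[of _ p])
  fix g assume "g \<in> {\<lambda>t. k * bump_term c p (a * t + b) |k p. True}"
  then obtain k p where g: "g = (\<lambda>t. k * bump_term c p (a * t + b))" by blast
  let ?p = "[:0, 0, 1:] * (smult c p - pderiv p)"
  have "(g has_real_derivative (k * a) * bump_term c ?p (a * t + b)) (at t)" for t
  proof -
    have "((\<lambda>t. a * t + b) has_real_derivative a) (at t)" by (auto intro!: derivative_eq_intros)
    from DERIV_cmult[OF DERIV_chain2[OF bump_term_derivative[OF c] this], of k p]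
    show ?thesis unfolding g by (simp add: mult_ac)
  qed
  then show "\<exists>g'\<in>{\<lambda>t. k * bump_term c p (a * t + b) |k p. True}. \<forall>x. (g has_real_derivative g' x) (at x)"
    by (intro bexI[of _ "\<lambda>t. (k * a) * bump_term c ?p (a * t + b)"]) blast+
  show "(\<lambda>x. c' * g x) \<in> {\<lambda>t. k * bump_term c p (a * t + b) |k p. True}" for c'
    unfolding g by (auto intro!: exI[of _ "c' * k"] exI[of _ p])
qed

definition test_time :: "real \<Rightarrow> (real \<Rightarrow> real) \<Rightarrow> bool" where
  "test_time T \<eta> \<longleftrightarrow> smooth \<eta> \<and> (\<exists>a b. 0 < a \<and> b < T \<and> (\<forall>t. t \<notin> {a..b} \<longrightarrow> \<eta> t = 0))"

text \<open>The parameter \<open>c\<close> sharpens the flanks: for \<open>c\<close> tending to zero the bumps increase to the indicator of the open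
  interval, which is how test functions reach intervals.\<close>

definition bump :: "real \<Rightarrow> real \<Rightarrow> real \<Rightarrow> real \<Rightarrow> real" where
  "bump c a b t = bump_term c 1 (t - a) * bump_term c 1 (b - t)"

lemma bump_smooth: "c > 0 \<Longrightarrow> smooth (bump c a b)"
  using smooth_mult[OF smooth_bump_affine[of c 1 1 "-a"] smooth_bump_affine[of c 1 "-1" b]]
  by (simp add: bump_def[abs_def])

lemma bump_test: "c > 0 \<Longrightarrow> 0 < a \<Longrightarrow> b < T \<Longrightarrow> test_time T (bump c a b)"
  unfolding test_time_def
  by (rule conjI[OF bump_smooth], assumption, rule exI[of _ a], rule exI[of _ b]) (auto simp: bump_def bump_term_def)

lemma bump_bounds: "c > 0 \<Longrightarrow> 0 \<le> bump c a b t \<and> bump c a b t \<le> 1"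
  unfolding bump_def bump_term_def by (auto intro!: mult_le_one)

lemma bump_tendsto: "(\<lambda>n. bump (1 / real (Suc n)) a b t) \<longlonglongrightarrow> (if a < t \<and> t < b then 1 else 0)"
proof (cases "a < t \<and> t < b")
  case True
  have l: "(\<lambda>n. exp (- (1 / real (Suc n) / x))) \<longlonglongrightarrow> exp (- (0 / x))" if "x > 0" for x :: real
    by (intro tendsto_intros LIMSEQ_Suc[OF lim_1_over_n]) (use that in simp)
  have "(\<lambda>n. exp (- (1 / real (Suc n) / (t - a))) * exp (- (1 / real (Suc n) / (b - t)))) \<longlonglongrightarrow> exp (- (0 / (t - a))) * exp (- (0 / (b - t)))"
    by (intro tendsto_mult l) (use True in auto)
  then show ?thesis using True by (simp add: bump_def bump_term_def)
qed (auto simp: bump_def bump_term_def)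

text \<open>The primitive is written as an integral over the whole interval, so that Fubini's theorem and dominated convergence
  apply to a fixed measure space.\<close>

definition indef :: "real \<Rightarrow> (real \<Rightarrow> real) \<Rightarrow> real \<Rightarrow> real" where
  "indef T f t = (LINT s|time T. (if s < t then f s else 0))"

lemma finite_measure_time: "finite_measure (time T)"
proof (rule finite_measureI)
  have "{0<..<T} \<in> sets lebesgue" by simp
  moreover have "emeasure lebesgue {0<..<T} < \<infinity>"
    using emeasure_bounded_finite[of "{0<..<T}"] by simp
  ultimately show "emeasure (time T) (space (time T)) \<noteq> \<infinity>"
    by (simp add: emeasure_restrict_space)
qed

lemma measurable_time: "f \<in> borel_measurable borel \<Longrightarrow> f \<in> borel_measurable (time T)"
  by (intro measurable_restrict_space1 measurable_completion) simp

lemma time_pair: "pair_sigma_finite (time T) (time T)"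
  by (simp add: pair_sigma_finite_def finite_measure_time finite_measure.axioms(1))

lemma AE_time_neq: "AE s in time T. s \<noteq> (t::real)"
proof -
  have "{t} \<in> null_sets lebesgue" by (simp add: null_sets_completionI)
  then have "AE s in lebesgue. s \<noteq> t" by (rule AE_I') auto
  then show ?thesis by (subst AE_restrict_space_iff) auto
qed

lemma integrable_if_less:
  fixes f :: "real \<Rightarrow> real"
  assumes f: "integrable (time T) f"
  shows "integrable (time T) (\<lambda>s. if s < t then f s else 0)" "integrable (time T) (\<lambda>s. if t < s then f s else 0)"
proof -
  have fm: "f \<in> borel_measurable (time T)" by (rule borel_measurable_integrable[OF f])
  have m: "(\<lambda>s. if s < t then 1 else 0 :: real) \<in> borel_measurable borel" "(\<lambda>s. if t < s then 1 else 0 :: real) \<in> borel_measurable borel"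
    by simp_all
  have e: "(\<lambda>s. (if s < t then 1 else 0) * f s) = (\<lambda>s. if s < t then f s else 0)" "(\<lambda>s. (if t < s then 1 else 0) * f s) = (\<lambda>s. if t < s then f s else 0)"
    by (simp_all add: fun_eq_iff)
  show "integrable (time T) (\<lambda>s. if s < t then f s else 0)"
    by (rule Bochner_Integration.integrable_bound[OF f borel_measurable_times[OF measurable_time[OF m(1)] fm, unfolded e]]) simp
  show "integrable (time T) (\<lambda>s. if t < s then f s else 0)"
    by (rule Bochner_Integration.integrable_bound[OF f borel_measurable_times[OF measurable_time[OF m(2)] fm, unfolded e]]) simp
qed

lemma indef_add:
  assumes f: "integrable (time T) f" and g: "integrable (time T) g"
  shows "indef T (\<lambda>s. f s + g s) t = indef T f t + indef T g t"
proof -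
  have "(\<lambda>s. if s < t then f s + g s else 0) = (\<lambda>s. (if s < t then f s else 0) + (if s < t then g s else 0))"
    by (simp add: fun_eq_iff)
  then show ?thesis
    unfolding indef_def by (simp only: Bochner_Integration.integral_add[OF integrable_if_less(1)[OF f] integrable_if_less(1)[OF g]])
qed

lemma indef_cmult: "indef T (\<lambda>s. c * f s) t = c * indef T f t"
proof -
  have "(\<lambda>s. if s < t then c * f s else 0) = (\<lambda>s. c * (if s < t then f s else 0))"
    by (simp add: fun_eq_iff)
  then show ?thesis unfolding indef_def by (simp only: integral_mult_right_zero)
qed

lemma indef_bound: "integrable (time T) f \<Longrightarrow> \<bar>indef T f t\<bar> \<le> (LINT s|time T. \<bar>f s\<bar>)"
  unfolding indef_def by (rule integral_abs_le[OF integrable_if_less(1) integrable_abs]) auto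

lemma indef_measurable: 
  assumes f: "integrable (time T) f" shows "indef T f \<in> borel_measurable (time T)"
proof -
  interpret finite_measure "time T" by (rule finite_measure_time)
  have [measurable]: "f \<in> borel_measurable (time T)" using f by simp
  have [measurable]: "(\<lambda>x. x) \<in> borel_measurable (time T)" by (rule measurable_time) simp
  have "(\<lambda>p. if snd p < fst p then f (snd p) else 0) \<in> borel_measurable (time T \<Otimes>\<^sub>M time T)"
  proof -
    have [measurable]: "(\<lambda>p. f (snd p)) \<in> borel_measurable (time T \<Otimes>\<^sub>M time T)"
      by (rule measurable_compose[OF measurable_snd]) measurable
    have [measurable]: "fst \<in> borel_measurable (time T \<Otimes>\<^sub>M time T)"
      by (rule measurable_compose[OF measurable_fst]) measurable
    have [measurable]: "snd \<in> borel_measurable (time T \<Otimes>\<^sub>M time T)"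
      by (rule measurable_compose[OF measurable_snd]) measurable
    show ?thesis by measurable
  qed
  then have "(\<lambda>t. LINT s|time T. (if s < t then f s else 0)) \<in> borel_measurable (time T)"
    by (intro borel_measurable_lebesgue_integral) (simp add: case_prod_beta')
  then show ?thesis by (simp add: indef_def[abs_def])
qed

text \<open>Integration by parts for indefinite integrals: split the square \<open>{..<t}\<^sup>2\<close> along its diagonal.\<close>

lemma indef_mult:
  assumes f: "integrable (time T) f" and g: "integrable (time T) g"
  shows "indef T f t * indef T g t = indef T (\<lambda>s. f s * indef T g s) t + indef T (\<lambda>s. indef T f s * g s) t"
    and "integrable (time T) (\<lambda>s. f s * indef T g s)"
proof -
  interpret finite_measure "time T" by (rule finite_measure_time)
  interpret P: pair_sigma_finite "time T" "time T" by (rule time_pair)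
  have fm [measurable]: "f \<in> borel_measurable (time T)" "g \<in> borel_measurable (time T)" using f g by simp_all
  have int: "integrable (time T) (\<lambda>s. f s * indef T g s)" if f: "integrable (time T) f" and g: "integrable (time T) g" for f g
  proof (rule Bochner_Integration.integrable_bound)
    show "integrable (time T) (\<lambda>s. f s * (LINT s|time T. \<bar>g s\<bar>))" using f by simp
    show "(\<lambda>s. f s * indef T g s) \<in> borel_measurable (time T)"
      using f indef_measurable[OF g] by (intro borel_measurable_times) auto
    show "AE s in time T. norm (f s * indef T g s) \<le> norm (f s * (LINT s|time T. \<bar>g s\<bar>))"
      unfolding real_norm_def abs_mult
      by (intro AE_I2 mult_left_mono order_trans[OF indef_bound[OF g] abs_ge_self] abs_ge_zero)
  qed
  show "integrable (time T) (\<lambda>s. f s * indef T g s)" by (rule int[OF f g])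
  define f1 where "f1 = (\<lambda>s. if s < t then f s else 0)"
  define g1 where "g1 = (\<lambda>s. if s < t then g s else 0)"
  have f1: "integrable (time T) f1" and g1: "integrable (time T) g1"
    unfolding f1_def g1_def by (rule integrable_if_less(1)[OF f], rule integrable_if_less(1)[OF g])
  have fgi: "integrable (time T \<Otimes>\<^sub>M time T) (\<lambda>p. f1 (fst p) * g1 (snd p))"
  proof (rule P.Fubini_integrable)
    have [measurable]: "f1 \<in> borel_measurable (time T)" "g1 \<in> borel_measurable (time T)" using f1 g1 by simp_all
    show "(\<lambda>p. f1 (fst p) * g1 (snd p)) \<in> borel_measurable (time T \<Otimes>\<^sub>M time T)"
      by (intro borel_measurable_times measurable_compose[OF measurable_fst] measurable_compose[OF measurable_snd]) measurable
    show "integrable (time T) (\<lambda>x. LINT y|time T. norm (f1 (fst (x, y)) * g1 (snd (x, y))))"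
      using f1 by (simp add: abs_mult)
    show "AE x in time T. integrable (time T) (\<lambda>y. f1 (fst (x, y)) * g1 (snd (x, y)))"
      using g1 by simp
  qed
  let ?K = "\<lambda>s r. f1 s * (if s < r then g1 r else 0)"
  have Ki: "integrable (time T \<Otimes>\<^sub>M time T) (\<lambda>p. ?K (fst p) (snd p))"
  proof (rule Bochner_Integration.integrable_bound[OF fgi])
    have [measurable]: "(\<lambda>x. x) \<in> borel_measurable (time T)" by (rule measurable_time) simp
    have a [measurable]: "(\<lambda>p. f1 (fst p) * g1 (snd p)) \<in> borel_measurable (time T \<Otimes>\<^sub>M time T)" using fgi by simp
    have [measurable]: "fst \<in> borel_measurable (time T \<Otimes>\<^sub>M time T)"
      by (rule measurable_compose[OF measurable_fst]) measurable
    have [measurable]: "snd \<in> borel_measurable (time T \<Otimes>\<^sub>M time T)"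
      by (rule measurable_compose[OF measurable_snd]) measurable
    have "(\<lambda>p. if fst p < snd p then f1 (fst p) * g1 (snd p) else 0) \<in> borel_measurable (time T \<Otimes>\<^sub>M time T)"
      by measurable
    moreover have "(\<lambda>p. if fst p < snd p then f1 (fst p) * g1 (snd p) else 0) = (\<lambda>p. ?K (fst p) (snd p))" by auto
    ultimately show "(\<lambda>p. ?K (fst p) (snd p)) \<in> borel_measurable (time T \<Otimes>\<^sub>M time T)" by simp
  qed auto
  have split: "integral\<^sup>L (time T) g1 = (LINT r|time T. (if r < s then g1 r else 0)) + (LINT r|time T. (if s < r then g1 r else 0))" for s
  proof -
    have "integral\<^sup>L (time T) g1 = (LINT r|time T. (if r < s then g1 r else 0) + (if s < r then g1 r else 0))"
    proof (rule integral_cong_AE)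
      show "AE r in time T. g1 r = (if r < s then g1 r else 0) + (if s < r then g1 r else 0)"
        using AE_time_neq[of s T] by eventually_elim auto
    qed (use g1 integrable_if_less[OF g1] in auto)
    then show ?thesis using integrable_if_less[OF g1] by simp
  qed
  have "indef T f t * indef T g t = (LINT s|time T. f1 s * integral\<^sup>L (time T) g1)"
    unfolding indef_def f1_def[symmetric] g1_def[symmetric] by simp
  also have "\<dots> = (LINT s|time T. f1 s * (LINT r|time T. (if r < s then g1 r else 0)) + (LINT r|time T. ?K s r))"
  proof (rule Bochner_Integration.integral_cong[OF refl])
    fix s show "f1 s * integral\<^sup>L (time T) g1 = f1 s * (LINT r|time T. (if r < s then g1 r else 0)) + (LINT r|time T. ?K s r)"
      unfolding split[of s] by (simp add: distrib_left)
  qed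
  also have "\<dots> = (LINT s|time T. (if s < t then f s * indef T g s else 0) + (LINT r|time T. ?K s r))"
  proof (rule Bochner_Integration.integral_cong[OF refl])
    fix s
    have "f1 s * (LINT r|time T. (if r < s then g1 r else 0)) = (if s < t then f s * indef T g s else 0)"
    proof (cases "s < t")
      case True
      have "(\<lambda>r. if r < s then g1 r else 0) = (\<lambda>r. if r < s then g r else 0)" using True by (auto simp: g1_def)
      then show ?thesis using True by (simp add: f1_def indef_def)
    qed (simp add: f1_def)
    then show "f1 s * (LINT r|time T. (if r < s then g1 r else 0)) + (LINT r|time T. ?K s r) = (if s < t then f s * indef T g s else 0) + (LINT r|time T. ?K s r)"
      by simp
  qed
  also have "\<dots> = indef T (\<lambda>s. f s * indef T g s) t + (LINT s|time T. LINT r|time T. ?K s r)"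
    unfolding indef_def[of T "\<lambda>s. f s * indef T g s"]
    by (rule Bochner_Integration.integral_add[OF integrable_if_less(1)[OF int[OF f g]]])
       (use P.integrable_fst'[OF Ki] in \<open>simp only: fst_conv snd_conv\<close>)
  also have "(LINT s|time T. LINT r|time T. ?K s r) = (LINT r|time T. LINT s|time T. ?K s r)"
    using P.Fubini_integral[of ?K] Ki by (simp add: case_prod_beta')
  also have "\<dots> = indef T (\<lambda>s. indef T f s * g s) t"
    unfolding indef_def[of T "\<lambda>s. indef T f s * g s"]
  proof (rule Bochner_Integration.integral_cong[OF refl])
    fix r
    have "(LINT s|time T. ?K s r) = (LINT s|time T. (if s < r then f1 s else 0) * g1 r)"
      by (rule Bochner_Integration.integral_cong) auto
    also have "\<dots> = (LINT s|time T. (if s < r then f1 s else 0)) * g1 r" by simp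
    also have "\<dots> = (if r < t then indef T f r * g r else 0)"
    proof (cases "r < t")
      case True
      have "(\<lambda>s. if s < r then f1 s else 0) = (\<lambda>s. if s < r then f s else 0)" using True by (auto simp: f1_def)
      then show ?thesis using True by (simp add: g1_def indef_def)
    qed (simp add: g1_def)
    finally show "(LINT s|time T. ?K s r) = (if r < t then indef T f r * g r else 0)" .
  qed
  finally show "indef T f t * indef T g t = indef T (\<lambda>s. f s * indef T g s) t + indef T (\<lambda>s. indef T f s * g s) t" .
qed

lemma indef_full: "t \<ge> T \<Longrightarrow> indef T f t = integral\<^sup>L (time T) f"
  unfolding indef_def by (rule Bochner_Integration.integral_cong) auto

lemma integrable_mult_bounded:
  fixes h g :: "real \<Rightarrow> real"
  assumes h: "integrable (time T) h" and g: "g \<in> borel_measurable borel" "\<And>t. \<bar>g t\<bar> \<le> (C::real)"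
  shows "integrable (time T) (\<lambda>t. h t * g t)"
proof (rule Bochner_Integration.integrable_bound)
  show "integrable (time T) (\<lambda>t. h t * C)" using h by simp
  show "(\<lambda>t. h t * g t) \<in> borel_measurable (time T)" using h measurable_time[OF g(1)] by (intro borel_measurable_times) auto
  have "\<bar>g t\<bar> \<le> \<bar>C\<bar>" for t using g(2)[of t] by linarith
  then show "AE t in time T. norm (h t * g t) \<le> norm (h t * C)"
    unfolding real_norm_def abs_mult by (intro AE_I2 mult_left_mono abs_ge_zero)
qed

lemma ennreal_eq_uminus: "ennreal a = ennreal (- a) \<Longrightarrow> a = 0"
proof (cases "a \<ge> 0")
  case True
  assume "ennreal a = ennreal (- a)"
  moreover have "ennreal (- a) = 0" using True by (intro ennreal_neg) simp
  ultimately show "a = 0" using True by simp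
next
  case False
  assume "ennreal a = ennreal (- a)"
  moreover have "ennreal a = 0" using False by (intro ennreal_neg) simp
  ultimately show "a = 0" using False by (simp add: ennreal_eq_0_iff)
qed

lemma enn2real_inj: "enn2real A = enn2real B \<Longrightarrow> A < \<infinity> \<Longrightarrow> B < \<infinity> \<Longrightarrow> A = B"
proof -
  assume e: "enn2real A = enn2real B" and f: "A < \<infinity>" "B < \<infinity>"
  have "A = ennreal (enn2real A)" by (rule ennreal_enn2real[symmetric]) (use f in simp)
  also have "\<dots> = ennreal (enn2real B)" by (simp only: e)
  also have "\<dots> = B" by (rule ennreal_enn2real) (use f in simp)
  finally show "A = B" .
qed

text \<open>Half-lines generate the Borel sets. The positive and the negative part of \<open>k\<close> thus have equal finite
  integrals over all of them, hence define the same measure, and \<open>k\<close> equals its negative.\<close>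

lemma AE_zero_if_intervals_zero:
  fixes k :: "real \<Rightarrow> real"
  assumes k: "integrable (time T) k" and T: "T > 0"
    and z: "\<And>a b. 0 < a \<Longrightarrow> b < T \<Longrightarrow> (LINT t|time T. k t * (if a < t \<and> t < b then 1 else 0)) = 0"
  shows "AE t in time T. k t = 0"
proof -
  have zx: "(LINT t|time T. (if x < t then k t else 0)) = 0" for x
  proof -
    define a where "a = (\<lambda>n. max x 0 + 1 / real (Suc n))"
    define b where "b = (\<lambda>n. T - 1 / real (Suc n))"
    have "(\<lambda>n. LINT t|time T. k t * (if a n < t \<and> t < b n then 1 else 0)) \<longlonglongrightarrow> (LINT t|time T. (if x < t then k t else 0))"
    proof (rule integral_dominated_convergence[where w="\<lambda>t. \<bar>k t\<bar>"])
      show "(\<lambda>t. k t * (if a n < t \<and> t < b n then 1 else 0)) \<in> borel_measurable (time T)" for n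
        by (rule borel_measurable_times[OF borel_measurable_integrable[OF k] measurable_time]) simp
      show "AE t in time T. (\<lambda>n. k t * (if a n < t \<and> t < b n then 1 else 0)) \<longlonglongrightarrow> (if x < t then k t else 0)"
      proof (intro AE_I2)
        fix t assume "t \<in> space (time T)"
        then have t: "0 < t" "t < T" by auto
        have al: "a \<longlonglongrightarrow> max x 0 + 0" and bl: "b \<longlonglongrightarrow> T - 0"
          unfolding a_def b_def by (intro tendsto_intros LIMSEQ_Suc[OF lim_1_over_n])+
        show "(\<lambda>n. k t * (if a n < t \<and> t < b n then 1 else 0)) \<longlonglongrightarrow> (if x < t then k t else 0)"
        proof (cases "x < t")
          case True
          have "\<forall>\<^sub>F n in sequentially. a n < t" by (rule order_tendstoD(2)[OF al]) (use True t in auto)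
          moreover have "\<forall>\<^sub>F n in sequentially. t < b n" by (rule order_tendstoD(1)[OF bl]) (use t in auto)
          ultimately have "\<forall>\<^sub>F n in sequentially. k t * (if a n < t \<and> t < b n then 1 else 0) = k t"
            by eventually_elim simp
          then show ?thesis using True by (simp add: tendsto_eventually)
        next
          case False
          have "x \<le> a n" for n
          proof -
            have "0 \<le> 1 / real (Suc n)" by simp
            then show ?thesis unfolding a_def using max.cobounded1[of x 0] by linarith
          qed
          then have "\<not> a n < t" for n using False order_trans[of t x "a n"] by (simp add: not_less)
          then show ?thesis using False by simp
        qed
      qed
    qed (use k integrable_if_less(2)[OF k] in auto)
    moreover have "(LINT t|time T. k t * (if a n < t \<and> t < b n then 1 else 0)) = 0" for n
    proof (rule z)
      have "0 < 1 / real (Suc n)" by simp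
      moreover have "0 \<le> max x 0" by simp
      ultimately show "0 < a n" unfolding a_def by linarith
      show "b n < T" unfolding b_def by simp
    qed
    ultimately show ?thesis by (simp add: LIMSEQ_const_iff)
  qed
  have "(\<lambda>t. if t \<in> {0<..<T} then k t else 0) \<in> borel_measurable lebesgue"
    using k by (intro borel_measurable_if_I) auto
  from completion_ex_borel_measurable_real[OF this]
  obtain k' where k': "k' \<in> borel_measurable borel" "AE t in lborel. (if t \<in> {0<..<T} then k t else 0) = k' t"
    unfolding measurable_lborel2 by blast
  have ik: "integrable lborel (\<lambda>t. k' t)"
  proof -
    have "integrable lebesgue (\<lambda>t. if t \<in> {0<..<T} then k t else 0)"
    proof -
      have "integrable lebesgue (\<lambda>t. indicator {0<..<T} t *\<^sub>R k t)"
        using k by (subst (asm) integrable_restrict_space) simp_all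
      moreover have "(\<lambda>t. indicator {0<..<T} t *\<^sub>R k t) = (\<lambda>t. if t \<in> {0<..<T} then k t else 0)"
        by (simp add: fun_eq_iff indicator_def)
      ultimately show ?thesis by simp
    qed
    then have "integrable lebesgue k'"
      by (rule integrable_cong_AE_imp) (use k'(1) AE_completion[OF k'(2)] in \<open>auto elim: eventually_mono intro: measurable_completion\<close>)
    then show ?thesis using k'(1) by (simp add: integrable_completion)
  qed
  have kz: "(LINT t|lborel. (if x < t then k' t else 0)) = 0" for x
  proof -
    have "(LINT t|lborel. (if x < t then k' t else 0)) = (LINT t|lebesgue. (if x < t then k' t else 0))"
      using k'(1) by (intro integral_completion[symmetric]) simp
    also have "\<dots> = (LINT t|lebesgue. indicator {0<..<T} t *\<^sub>R (if x < t then k t else 0))"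
    proof (rule integral_cong_AE)
      show "AE t in lebesgue. (if x < t then k' t else 0) = indicator {0<..<T} t *\<^sub>R (if x < t then k t else 0)"
        using AE_completion[OF k'(2)] by eventually_elim (auto simp: indicator_def)
      show "(\<lambda>t. if x < t then k' t else 0) \<in> borel_measurable lebesgue"
        using k'(1) by (intro measurable_completion) simp
      show "(\<lambda>t. indicator {0<..<T} t *\<^sub>R (if x < t then k t else 0)) \<in> borel_measurable lebesgue"
        using integrable_if_less(2)[OF k, of x] by (subst (asm) integrable_restrict_space) auto
    qed
    also have "\<dots> = (LINT t|time T. (if x < t then k t else 0))"
      by (rule integral_restrict_space[symmetric]) simp
    finally show ?thesis using zx by simp
  qed
  let ?p = "\<lambda>t. ennreal (k' t)" and ?m = "\<lambda>t. ennreal (- k' t)"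
  have [measurable]: "k' \<in> borel_measurable borel" by (rule k')
  have fin: "integral\<^sup>N lborel ?p < \<infinity>" "integral\<^sup>N lborel ?m < \<infinity>"
    using ik real_integrable_def[of lborel k'] by (auto simp: less_top)
  have em: "emeasure (density lborel ?p) {x<..} = emeasure (density lborel ?m) {x<..}" for x
  proof -
    have i: "integrable lborel (\<lambda>t. if x < t then k' t else 0)"
      by (rule Bochner_Integration.integrable_bound[OF ik]) auto
    have e: "emeasure (density lborel ?p) {x<..} = (\<integral>\<^sup>+t. ennreal (if x < t then k' t else 0) \<partial>lborel)"
      "emeasure (density lborel ?m) {x<..} = (\<integral>\<^sup>+t. ennreal (- (if x < t then k' t else 0)) \<partial>lborel)"
      by (subst emeasure_density; auto intro!: nn_integral_cong simp: indicator_def)+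
    have f: "(\<integral>\<^sup>+t. ennreal (if x < t then k' t else 0) \<partial>lborel) < \<infinity>" "(\<integral>\<^sup>+t. ennreal (- (if x < t then k' t else 0)) \<partial>lborel) < \<infinity>"
      using i real_integrable_def[of lborel "\<lambda>t. if x < t then k' t else 0"] by (auto simp: less_top)
    have "enn2real (\<integral>\<^sup>+t. ennreal (if x < t then k' t else 0) \<partial>lborel) = enn2real (\<integral>\<^sup>+t. ennreal (- (if x < t then k' t else 0)) \<partial>lborel)"
      using kz[of x] real_lebesgue_integral_def[OF i] by simp
    then show ?thesis unfolding e by (rule enn2real_inj[OF _ f])
  qed
  have "density lborel ?p = density lborel ?m"
  proof (rule measure_eqI_lessThan)
    show "emeasure (density lborel ?p) {x<..} < \<infinity>" for x
    proof -
      have "emeasure (density lborel ?p) {x<..} \<le> emeasure (density lborel ?p) UNIV" by (rule emeasure_mono) auto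
      also have "\<dots> = integral\<^sup>N lborel ?p" by (subst emeasure_density) auto
      finally show ?thesis using fin(1) by (rule le_less_trans)
    qed
  qed (use em in auto)
  then have "AE t in lborel. ?p t = ?m t"
    using finite_density_unique[of ?p lborel ?m] fin by (auto simp: less_top)
  then have "AE t in lborel. k' t = 0"
    by eventually_elim (rule ennreal_eq_uminus)
  then have "AE t in lebesgue. k' t = 0" by (rule AE_completion)
  then have "AE t in lebesgue. t \<in> {0<..<T} \<longrightarrow> k t = 0"
    using AE_completion[OF k'(2)] by eventually_elim auto
  then show ?thesis by (subst AE_restrict_space_iff) auto
qed

lemma smooth_real_derivative:
  fixes g :: "real \<Rightarrow> real"
  assumes "smooth g" shows "(g has_real_derivative dderiv 1 g x) (at x)"
proof -
  have "(\<lambda>v. dderiv v g x) = (*) (dderiv 1 g x)"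
  proof
    fix v :: real
    have "dderiv (v *\<^sub>R 1) g x = v *\<^sub>R dderiv 1 g x" by (rule linear_scale[OF dderiv_linear[OF assms]])
    then show "dderiv v g x = dderiv 1 g x * v" by (simp only: real_scaleR_def mult_1_right mult.commute[of v])
  qed
  then show ?thesis using smooth_has_derivative[OF assms, of x] by (simp add: has_field_derivative_def)
qed

lemma dderiv_real: "(g has_real_derivative d) (at x) \<Longrightarrow> dderiv 1 g x = d"
  using dderiv_eq[of g "(*) d" x 1] by (simp add: has_field_derivative_def)

lemma smooth_primitive:
  fixes \<eta> \<beta> :: "real \<Rightarrow> real"
  assumes d: "\<And>t. (\<eta> has_real_derivative \<beta> t) (at t)" and \<beta>: "smooth \<beta>"
  shows "smooth \<eta>"
proof (rule smooth_real_coinduct[where C="{\<lambda>x. k * \<eta> x |k. True} \<union> {g. smooth g}"])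
  show "\<eta> \<in> {\<lambda>x. k * \<eta> x |k. True} \<union> {g. smooth g}" by (auto intro!: exI[of _ 1])
  show "\<exists>g'\<in>{\<lambda>x. k * \<eta> x |k. True} \<union> {g. smooth g}. \<forall>x. (g has_real_derivative g' x) (at x)"
    if "g \<in> {\<lambda>x. k * \<eta> x |k. True} \<union> {g. smooth g}" for g
  proof -
    from that have "(\<exists>k. g = (\<lambda>x. k * \<eta> x)) \<or> smooth g" by auto
    then show ?thesis
    proof (elim disjE exE)
      fix k assume g: "g = (\<lambda>x. k * \<eta> x)"
      have "\<forall>x. (g has_real_derivative k * \<beta> x) (at x)" unfolding g using DERIV_cmult[OF d] by blast
      then show ?thesis by (intro bexI[of _ "\<lambda>x. k * \<beta> x"]) (simp_all add: smooth_cmult[OF \<beta>])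
    next
      assume g: "smooth g"
      show ?thesis
        by (rule bexI[of _ "dderiv 1 g"]) (simp_all add: smooth_real_derivative[OF g] smooth_dderiv[OF g])
    qed
  qed
  show "(\<lambda>x. c * g x) \<in> {\<lambda>x. k * \<eta> x |k. True} \<union> {g. smooth g}"
    if "g \<in> {\<lambda>x. k * \<eta> x |k. True} \<union> {g. smooth g}" for g c
  proof -
    from that have "(\<exists>k. g = (\<lambda>x. k * \<eta> x)) \<or> smooth g" by auto
    then show ?thesis
    proof (elim disjE exE)
      fix k assume "g = (\<lambda>x. k * \<eta> x)"
      then have "(\<lambda>x. c * g x) = (\<lambda>x. (c * k) * \<eta> x)" by (simp add: fun_eq_iff)
      then show ?thesis by blast
    next
      assume "smooth g"
      then show ?thesis using smooth_cmult[of g c] by simp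
    qed
  qed
qed

lemma time_integral_continuous:
  fixes \<beta> :: "real \<Rightarrow> real"
  assumes c: "continuous_on UNIV \<beta>"
  shows "integrable (time T) \<beta>" "integral\<^sup>L (time T) \<beta> = integral {0..T} \<beta>"
proof -
  have "\<beta> absolutely_integrable_on {0..T}"
    by (rule absolutely_integrable_continuous_real[OF continuous_on_subset[OF c]]) simp
  then have "\<beta> absolutely_integrable_on {0<..<T}"
    by (rule set_integrable_subset) auto
  then show i: "integrable (time T) \<beta>"
    by (subst integrable_restrict_space) (auto simp: set_integrable_def)
  have "integral\<^sup>L (time T) \<beta> = integral {0<..<T} \<beta>"
    by (rule lebesgue_integral_eq_integral[OF i]) simp
  then show "integral\<^sup>L (time T) \<beta> = integral {0..T} \<beta>"
    by (simp add: integral_open_interval_real)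
qed

lemma indef_continuous:
  fixes \<beta> :: "real \<Rightarrow> real"
  assumes c: "continuous_on UNIV \<beta>" and t: "t \<le> T"
  shows "indef T \<beta> t = integral {0..t} \<beta>"
proof -
  have i: "integrable (time T) (\<lambda>s. if s < t then \<beta> s else 0)"
    by (rule integrable_if_less(1)[OF time_integral_continuous(1)[OF c]])
  have "indef T \<beta> t = integral {0<..<T} (\<lambda>s. if s < t then \<beta> s else 0)"
    unfolding indef_def by (rule lebesgue_integral_eq_integral[OF i]) simp
  also have "\<dots> = integral ({..<t} \<inter> {0<..<T}) \<beta>"
    using integral_restrict_Int[of "{0<..<T}" "{..<t}" \<beta>] by (simp add: lessThan_def)
  also have "{..<t} \<inter> {0<..<T} = {0<..<t}" using t by auto
  finally show ?thesis by (simp add: integral_open_interval_real)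
qed

lemma integral_derivative:
  fixes \<eta> :: "real \<Rightarrow> real"
  assumes "\<And>t. (\<eta> has_real_derivative \<beta> t) (at t)" "0 \<le> t"
  shows "integral {0..t} \<beta> = \<eta> t - \<eta> 0"
  by (intro integral_unique fundamental_theorem_of_calculus assms(2))
     (use assms(1) in \<open>auto simp: has_real_derivative_iff_has_vector_derivative intro: has_vector_derivative_at_within\<close>)

text \<open>A bump minus a suitable multiple of a fixed bump has mean zero, so its primitive is a test function. The hypothesis then
  says that \<open>h - c\<close> is orthogonal to all bumps, with \<open>c\<close> the average of \<open>h\<close> against the fixed bump.\<close>

lemma du_Bois_Reymond:
  assumes h: "integrable (time T) h" and T: "T > 0"
    and z: "\<And>\<eta>. test_time T \<eta> \<Longrightarrow> (LINT t|time T. h t * dderiv 1 \<eta> t) = 0"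
  shows "\<exists>c. AE t in time T. h t = c"
proof -
  define \<zeta> where "\<zeta> = bump 1 (T / 3) (2 * T / 3)"
  have bs: "smooth (bump c a b)" if "c > 0" for c a b using bump_smooth[OF that] .
  have bc: "continuous_on UNIV (bump c a b)" if "c > 0" for c a b by (rule smooth_continuous[OF bs[OF that]])
  define Z where "Z = integral {0..T} \<zeta>"
  have Z: "Z \<noteq> 0"
  proof
    assume "Z = 0"
    moreover have "\<zeta> (T / 2) > 0" using T by (simp add: \<zeta>_def bump_def bump_term_def)
    moreover have "\<forall>t\<in>{0..T}. \<zeta> t = 0"
    proof -
      have zc: "continuous_on {0..T} \<zeta>" unfolding \<zeta>_def by (rule continuous_on_subset[OF bc]) simp_all
      have "0 \<le> \<zeta> t" for t unfolding \<zeta>_def using bump_bounds[of 1] by simp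
      then show ?thesis using integral_eq_0_iff[OF zc] T \<open>Z = 0\<close> by (simp add: Z_def)
    qed
    ultimately show False using T by simp
  qed
  define c where "c = (LINT t|time T. h t * \<zeta> t) / Z"
  have main: "(LINT t|time T. (h t - c) * bump k a b t) = 0" if k: "k > 0" and a: "0 < a" and b: "b < T" for k a b
  proof -
    define \<beta> where "\<beta> = bump k a b"
    define r where "r = integral {0..T} \<beta> / Z"
    define \<gamma> where "\<gamma> = (\<lambda>t. \<beta> t + (- r) * \<zeta> t)"
    have \<gamma>s: "smooth \<gamma>" unfolding \<gamma>_def \<beta>_def \<zeta>_def by (intro smooth_add smooth_cmult bs k zero_less_one)
    have \<gamma>c: "continuous_on A \<gamma>" for A by (rule smooth_continuous[OF \<gamma>s])
    define a' where "a' = min a (T / 3)"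
    define b' where "b' = max b (2 * T / 3)"
    have ab: "0 < a'" "a' < T" "b' < T" "0 < b'" using a b T by (auto simp: a'_def b'_def)
    have \<gamma>0: "\<gamma> t = 0" if "t \<le> a' \<or> b' \<le> t" for t
      using that unfolding \<gamma>_def \<beta>_def \<zeta>_def bump_def bump_term_def a'_def b'_def by auto
    define \<eta> where "\<eta> = (\<lambda>t. integral {0..t} \<gamma>)"
    have \<eta>0: "\<eta> t = 0" if "t \<le> a'" for t
    proof -
      have "\<eta> t = integral {0..t} (\<lambda>_. 0)" unfolding \<eta>_def by (rule Henstock_Kurzweil_Integration.integral_cong) (use that \<gamma>0 in auto)
      then show ?thesis by simp
    qed
    have \<eta>d: "(\<eta> has_real_derivative \<gamma> t) (at t)" for t
    proof (cases "t < a'")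
      case True
      have "((\<lambda>_. 0) has_real_derivative \<gamma> t) (at t)" using \<gamma>0[of t] True by simp
      then show ?thesis
        by (rule has_field_derivative_transform_within_open[of _ _ _ "{..<a'}"]) (use True \<eta>0 in auto)
    next
      case False
      have "((\<lambda>x. integral {0..x} \<gamma>) has_real_derivative \<gamma> t) (at t within {0..t + 1})"
        by (rule integral_has_real_derivative[OF \<gamma>c]) (use False ab in auto)
      then show ?thesis unfolding \<eta>_def
        using at_within_Icc_at[of 0 t "t + 1"] False ab by simp
    qed
    have tot: "integral {0..T} \<gamma> = 0"
    proof -
      have i: "\<beta> integrable_on {0..T}" "\<zeta> integrable_on {0..T}"
        unfolding \<beta>_def \<zeta>_def by (intro integrable_continuous_real continuous_on_subset[OF bc] k zero_less_one subset_UNIV)+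
      have "(\<lambda>t. (- r) * \<zeta> t) integrable_on {0..T}"
        using integrable_cmul[OF i(2), of "- r"] by simp
      then have "integral {0..T} \<gamma> = integral {0..T} \<beta> + (- r) * integral {0..T} \<zeta>"
        unfolding \<gamma>_def by (simp only: Henstock_Kurzweil_Integration.integral_add[OF i(1)] Henstock_Kurzweil_Integration.integral_mult_right)
      then show ?thesis using Z by (simp add: r_def Z_def)
    qed
    have \<eta>1: "\<eta> t = 0" if "b' \<le> t" for t
    proof -
      have i: "\<gamma> integrable_on {0..max t T}" by (rule integrable_continuous_real[OF \<gamma>c])
      have "integral {0..s} \<gamma> = integral {0..b'} \<gamma>" if "b' \<le> s" for s
      proof -
        have "integral {0..b'} \<gamma> + integral {b'..s} \<gamma> = integral {0..s} \<gamma>"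
          by (rule Henstock_Kurzweil_Integration.integral_combine[OF _ _ integrable_continuous_real[OF \<gamma>c]]) (use ab that in simp_all)
        moreover have "integral {b'..s} \<gamma> = integral {b'..s} (\<lambda>_. 0)"
          by (rule Henstock_Kurzweil_Integration.integral_cong) (use \<gamma>0 in auto)
        ultimately show ?thesis by simp
      qed
      from this[OF that] this[of T] show ?thesis using tot ab by (simp add: \<eta>_def)
    qed
    have "test_time T \<eta>"
      unfolding test_time_def
    proof
      show "smooth \<eta>" by (rule smooth_primitive[OF \<eta>d \<gamma>s])
      show "\<exists>a b. 0 < a \<and> b < T \<and> (\<forall>t. t \<notin> {a..b} \<longrightarrow> \<eta> t = 0)"
        by (rule exI[of _ a'], rule exI[of _ b']) (use ab \<eta>0 \<eta>1 in auto)
    qed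
    from z[OF this] have "(LINT t|time T. h t * \<gamma> t) = 0" unfolding dderiv_real[OF \<eta>d] .
    moreover have hb: "integrable (time T) (\<lambda>t. h t * bump k a b t)" if "k > 0" for k a b
      by (rule integrable_mult_bounded[OF h borel_measurable_continuous_onI[OF bc[OF that]], where C=1])
         (use bump_bounds[OF that, of a b] in \<open>simp add: abs_le_iff\<close>)
    moreover have "(LINT t|time T. h t * \<gamma> t) = (LINT t|time T. h t * \<beta> t) - r * (LINT t|time T. h t * \<zeta> t)"
    proof -
      have "(LINT t|time T. h t * \<gamma> t) = (LINT t|time T. h t * \<beta> t - r * (h t * \<zeta> t))"
        by (rule Bochner_Integration.integral_cong) (auto simp: \<gamma>_def algebra_simps)
      then show ?thesis using hb[OF k, of a b] hb[of 1 "T / 3" "2 * T / 3"] by (simp add: \<beta>_def \<zeta>_def)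
    qed
    moreover have "r * (LINT t|time T. h t * \<zeta> t) = c * integral {0..T} \<beta>" by (simp add: r_def c_def)
    moreover have "integral\<^sup>L (time T) \<beta> = integral {0..T} \<beta>" "integrable (time T) \<beta>"
      unfolding \<beta>_def by (rule time_integral_continuous[OF bc[OF k]])+
    ultimately show ?thesis using hb[OF k, of a b] by (simp add: left_diff_distrib \<beta>_def)
  qed
  have hc: "integrable (time T) (\<lambda>t. h t - c)"
    using h finite_measure.integrable_const[OF finite_measure_time, of T c] by simp
  have "AE t in time T. h t - c = 0"
  proof (rule AE_zero_if_intervals_zero[OF hc T])
    fix a b :: real assume ab: "0 < a" "b < T"
    let ?b = "\<lambda>n. bump (1 / real (Suc n)) a b"
    have "(\<lambda>n. LINT t|time T. (h t - c) * ?b n t) \<longlonglongrightarrow> (LINT t|time T. (h t - c) * (if a < t \<and> t < b then 1 else 0))"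
    proof (rule integral_dominated_convergence[where w="\<lambda>t. \<bar>h t - c\<bar>"])
      have hm: "(\<lambda>t. h t - c) \<in> borel_measurable (time T)" by (rule borel_measurable_integrable[OF hc])
      show "(\<lambda>t. (h t - c) * (if a < t \<and> t < b then 1 else 0)) \<in> borel_measurable (time T)"
        by (rule borel_measurable_times[OF hm measurable_time]) simp
      show "(\<lambda>t. (h t - c) * ?b n t) \<in> borel_measurable (time T)" for n
        by (rule borel_measurable_times[OF hm measurable_time[OF borel_measurable_continuous_onI[OF bc]]]) simp
      show "integrable (time T) (\<lambda>t. \<bar>h t - c\<bar>)" by (rule integrable_abs[OF hc])
      show "AE t in time T. (\<lambda>n. (h t - c) * ?b n t) \<longlonglongrightarrow> (h t - c) * (if a < t \<and> t < b then 1 else 0)"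
        by (intro AE_I2 tendsto_mult_left bump_tendsto)
      have "\<bar>?b n t\<bar> \<le> 1" for n t using bump_bounds[of "1 / real (Suc n)" a b t] by simp
      then have "\<bar>h t - c\<bar> * \<bar>?b n t\<bar> \<le> \<bar>h t - c\<bar> * 1" for n t by (intro mult_left_mono abs_ge_zero)
      then show "AE t in time T. norm ((h t - c) * ?b n t) \<le> \<bar>h t - c\<bar>" for n
        unfolding real_norm_def abs_mult by simp
    qed
    moreover have "(LINT t|time T. (h t - c) * ?b n t) = 0" for n by (rule main[OF _ ab]) simp
    ultimately show "(LINT t|time T. (h t - c) * (if a < t \<and> t < b then 1 else 0)) = 0"
      by (simp add: LIMSEQ_const_iff)
  qed
  then show ?thesis by auto
qed

text \<open>A function with weak derivative \<open>g\<close> agrees almost everywhere with an indefinite integral of \<open>g\<close>, so its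
  square can be differentiated by the product rule.\<close>

lemma weak_derivative_square:
  assumes f: "integrable (time T) f" and g: "integrable (time T) g" and T: "T > 0"
    and fg: "integrable (time T) (\<lambda>t. f t * g t)"
    and z: "\<And>\<eta>. test_time T \<eta> \<Longrightarrow> (LINT t|time T. f t * dderiv 1 \<eta> t + g t * \<eta> t) = 0"
  shows "\<exists>c. AE t in time T. (f t)\<^sup>2 = c + 2 * indef T (\<lambda>s. f s * g s) t"
proof -
  let ?G = "indef T g"
  have Gi: "integrable (time T) ?G"
    by (rule finite_measure.integrable_const_bound[OF finite_measure_time _ indef_measurable[OF g]])
       (use indef_bound[OF g] in auto)
  have hi: "integrable (time T) (\<lambda>t. f t - ?G t)" using f Gi by simp
  have "\<exists>c. AE t in time T. f t - ?G t = c"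
  proof (rule du_Bois_Reymond[OF hi T])
    fix \<eta> assume t: "test_time T \<eta>"
    then have s: "smooth \<eta>" by (simp add: test_time_def)
    obtain a b where ab: "0 < a" "b < T" "\<And>t. t \<notin> {a..b} \<Longrightarrow> \<eta> t = 0" using t unfolding test_time_def by blast
    let ?\<eta>' = "dderiv 1 \<eta>"
    have d: "(\<eta> has_real_derivative ?\<eta>' x) (at x)" for x by (rule smooth_real_derivative[OF s])
    have c': "continuous_on UNIV ?\<eta>'" by (rule smooth_continuous[OF smooth_dderiv[OF s]])
    have i: "indef T ?\<eta>' x = \<eta> x" if "0 \<le> x" "x \<le> T" for x
      using indef_continuous[OF c' that(2)] integral_derivative[OF d that(1)] ab by simp
    have bd: "\<exists>C. \<forall>t\<in>{0..T}. \<bar>F t\<bar> \<le> C" if "smooth F" for F :: "real \<Rightarrow> real"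
    proof -
      have "compact (F ` {0..T})" by (rule compact_continuous_image[OF smooth_continuous[OF that]]) simp
      then show ?thesis by (auto dest!: compact_imp_bounded simp: bounded_iff)
    qed
    have im: "integrable (time T) (\<lambda>t. u t * F t)" if u: "integrable (time T) u" and F: "smooth F" for u F :: "real \<Rightarrow> real"
    proof -
      obtain C where C: "\<And>t. t \<in> {0..T} \<Longrightarrow> \<bar>F t\<bar> \<le> C" using bd[OF F] by blast
      show ?thesis
      proof (rule Bochner_Integration.integrable_bound)
        show "integrable (time T) (\<lambda>t. u t * C)" using u by simp
        show "(\<lambda>t. u t * F t) \<in> borel_measurable (time T)"
          by (rule borel_measurable_times[OF borel_measurable_integrable[OF u] measurable_time[OF borel_measurable_continuous_onI[OF smooth_continuous[OF F]]]])
        show "AE t in time T. norm (u t * F t) \<le> norm (u t * C)"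
          unfolding real_norm_def abs_mult
          by (intro AE_I2 mult_left_mono order_trans[OF C abs_ge_self] abs_ge_zero) auto
      qed
    qed
    have "0 = indef T ?\<eta>' T * indef T g T" using i[of T] ab T by simp
    also have "\<dots> = (LINT t|time T. ?\<eta>' t * ?G t) + (LINT t|time T. indef T ?\<eta>' t * g t)"
      unfolding indef_mult(1)[OF time_integral_continuous(1)[OF c'] g] by (simp add: indef_full)
    also have "(LINT t|time T. indef T ?\<eta>' t * g t) = (LINT t|time T. g t * \<eta> t)"
      by (rule Bochner_Integration.integral_cong) (auto simp: i)
    finally have "(LINT t|time T. ?G t * ?\<eta>' t) = - (LINT t|time T. g t * \<eta> t)" by (simp add: mult.commute)
    moreover have "(LINT t|time T. f t * ?\<eta>' t) + (LINT t|time T. g t * \<eta> t) = 0"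
      using z[OF t] im[OF f smooth_dderiv[OF s]] im[OF g s] by simp
    ultimately show "(LINT t|time T. (f t - ?G t) * ?\<eta>' t) = 0"
      using im[OF f smooth_dderiv[OF s]] im[OF Gi smooth_dderiv[OF s]] by (simp add: left_diff_distrib)
  qed
  then obtain c where c: "AE t in time T. f t - ?G t = c" by blast
  have e: "indef T (\<lambda>s. f s * g s) t = c * ?G t + indef T (\<lambda>s. g s * ?G s) t" for t
  proof -
    have gG: "integrable (time T) (\<lambda>s. g s * ?G s)" by (rule indef_mult(2)[OF g g])
    have "indef T (\<lambda>s. f s * g s) t = indef T (\<lambda>s. c * g s + g s * ?G s) t"
      unfolding indef_def[of T "\<lambda>s. f s * g s"] indef_def[of T "\<lambda>s. c * g s + g s * ?G s"]
    proof (rule integral_cong_AE)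
      show "AE s in time T. (if s < t then f s * g s else 0) = (if s < t then c * g s + g s * ?G s else 0)"
        using c
      proof eventually_elim
        case (elim s)
        then have "f s = c + ?G s" by linarith
        then show ?case by (simp add: algebra_simps)
      qed
    qed (use integrable_if_less(1)[OF fg, of t] integrable_if_less(1)[OF Bochner_Integration.integrable_add[OF integrable_mult_right[OF g, of c] gG], of t] in auto)
    then show ?thesis using g gG by (simp add: indef_add indef_cmult)
  qed
  have sq: "(?G t)\<^sup>2 = 2 * indef T (\<lambda>s. g s * ?G s) t" for t
    using indef_mult(1)[OF g g, of t] by (simp add: power2_eq_square mult.commute)
  show ?thesis
  proof (intro exI[of _ "c\<^sup>2"])
    show "AE t in time T. (f t)\<^sup>2 = c\<^sup>2 + 2 * indef T (\<lambda>s. f s * g s) t"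
      using c
    proof eventually_elim
      case (elim t)
      then have "f t = c + ?G t" by linarith
      then have "(f t)\<^sup>2 = c\<^sup>2 + 2 * (c * ?G t) + (?G t)\<^sup>2" by (simp add: power2_eq_square algebra_simps)
      then show ?case unfolding e sq by simp
    qed
  qed
qed

section \<open>The energy and its flux at a fixed time\<close>

definition bounded_pborel :: "(vec3 \<Rightarrow> real) \<Rightarrow> bool" where
  "bounded_pborel c \<longleftrightarrow> pborel c \<and> (\<exists>C. \<forall>x. \<bar>c x\<bar> \<le> C)"

lemma bounded_pborel_smooth_periodic: "smooth_periodic S \<Longrightarrow> bounded_pborel S"
  unfolding bounded_pborel_def using smooth_periodic_pborel smooth_periodic_bounded by metis

lemma integrable_mult_bounded_pborel:
  assumes f: "PL 1 f" and c: "bounded_pborel c"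
  shows "integrable torus (\<lambda>x. f x * c x)"
proof -
  obtain C where C: "\<And>x. \<bar>c x\<bar> \<le> C" and cp: "pborel c" using c unfolding bounded_pborel_def by blast
  show ?thesis
  proof (rule Bochner_Integration.integrable_bound)
    show "integrable torus (\<lambda>x. \<bar>f x\<bar> * C)" using f by (simp add: PL_def)
    show "(\<lambda>x. f x * c x) \<in> borel_measurable torus"
      by (rule measurable_torus[OF pborelD(2)[OF pborel_mult[OF PL_pborel[OF f] cp]]])
    show "AE x in torus. norm (f x * c x) \<le> norm (\<bar>f x\<bar> * C)"
      unfolding real_norm_def abs_mult abs_abs by (intro AE_I2 mult_left_mono order_trans[OF C abs_ge_self] abs_ge_zero)
  qed
qed

lemma abs_mult_le_squares: "\<bar>a * b\<bar> \<le> \<bar>a\<bar> ^ 2 + \<bar>b\<bar> ^ 2" for a b :: real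
proof -
  have "x * y \<le> x\<^sup>2 + y\<^sup>2" if "0 \<le> x" "0 \<le> y" for x y :: real
    using sum_squares_bound[of x y] mult_nonneg_nonneg[OF that] by simp
  from this[of "\<bar>a\<bar>" "\<bar>b\<bar>"] show ?thesis unfolding abs_mult by simp
qed

lemma PL_mult2:
  assumes a: "PL 2 a" and b: "PL 2 b" shows "PL 1 (\<lambda>x. a x * b x)"
proof -
  have p: "pborel (\<lambda>x. a x * b x)" by (rule pborel_mult[OF PL_pborel[OF a] PL_pborel[OF b]])
  have "integrable torus (\<lambda>x. a x * b x)"
  proof (rule Bochner_Integration.integrable_bound)
    show "integrable torus (\<lambda>x. \<bar>a x\<bar> ^ 2 + \<bar>b x\<bar> ^ 2)" using a b unfolding PL_def by (intro Bochner_Integration.integrable_add) blast+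
    show "(\<lambda>x. a x * b x) \<in> borel_measurable torus" by (rule measurable_torus[OF pborelD(2)[OF p]])
    show "AE x in torus. norm (a x * b x) \<le> norm (\<bar>a x\<bar> ^ 2 + \<bar>b x\<bar> ^ 2)"
      unfolding real_norm_def by (intro AE_I2 order_trans[OF abs_mult_le_squares abs_ge_self])
  qed
  then have "integrable torus (\<lambda>x. \<bar>a x * b x\<bar> ^ 1)" unfolding power_one_right by (rule integrable_abs)
  then show ?thesis unfolding PL_def using p by blast
qed

lemma integrable2_bounded_pborel: "PL 2 a \<Longrightarrow> PL 2 b \<Longrightarrow> bounded_pborel c \<Longrightarrow> integrable torus (\<lambda>x. a x * b x * c x)"
  by (rule integrable_mult_bounded_pborel[OF PL_mult2])

lemma conv_bounded_pborel:
  assumes S: "smooth_periodic S" and w: "PL 1 w" shows "bounded_pborel (conv S w)"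
proof -
  obtain M where M: "M > 0" "\<And>x. \<bar>S x\<bar> \<le> M" using smooth_periodic_bounded[OF S] by metis
  have "\<bar>conv S w x\<bar> \<le> (LINT y|torus. M * \<bar>w y\<bar>)" for x
    unfolding conv_def
  proof (rule integral_abs_le)
    show "integrable torus (\<lambda>y. S (x - y) * w y)"
      using integrable_mult_bounded_pborel[OF w bounded_pborel_smooth_periodic[OF smooth_periodic_reflect[OF S, of x]]] by (simp add: mult.commute)
    show "integrable torus (\<lambda>y. M * \<bar>w y\<bar>)" using w by (simp add: PL_def)
    show "\<bar>S (x - y) * w y\<bar> \<le> M * \<bar>w y\<bar>" for y
      unfolding abs_mult by (intro mult_right_mono M) simp
  qed
  then show ?thesis unfolding bounded_pborel_def using conv_pborel[OF smooth_periodic_pborel[OF S] PL_pborel[OF w]] by blast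
qed

text \<open>The test field has direction \<open>j\<close> and enters through its value and its first and second derivatives, as separate arguments:
  for a convolved field the derivatives are available in different forms.\<close>

definition spatial_part :: "real \<Rightarrow> (3 \<Rightarrow> vec3 \<Rightarrow> real) \<Rightarrow> (3 \<Rightarrow> 3 \<Rightarrow> vec3 \<Rightarrow> real) \<Rightarrow> (vec3 \<Rightarrow> real) \<Rightarrow> 3 \<Rightarrow>
    (vec3 \<Rightarrow> real) \<Rightarrow> (3 \<Rightarrow> vec3 \<Rightarrow> real) \<Rightarrow> (3 \<Rightarrow> 3 \<Rightarrow> vec3 \<Rightarrow> real) \<Rightarrow> vec3 \<Rightarrow> real" where
  "spatial_part \<alpha> v D q j \<phi> d\<phi> dd\<phi> x =
      (\<Sum>i\<in>UNIV. v i x * v j x * d\<phi> i x)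
    + \<alpha>\<^sup>2 * (\<Sum>i\<in>UNIV. \<Sum>k\<in>UNIV. D k i x * D k j x * d\<phi> i x)
    + \<alpha>\<^sup>2 * (\<Sum>i\<in>UNIV. \<Sum>k\<in>UNIV. v i x * D k j x * dd\<phi> i k x)
    - (\<Sum>l\<in>UNIV. v l x * D j l x * \<phi> x)
    - \<alpha>\<^sup>2 * (\<Sum>l\<in>UNIV. \<Sum>k\<in>UNIV. D k l x * D j l x * d\<phi> k x)
    + \<alpha>\<^sup>2 / 2 * (\<Sum>l\<in>UNIV. \<Sum>k\<in>UNIV. D k l x * D k l x * d\<phi> j x)
    + q x * d\<phi> j x"

text \<open>The data of a solution at a fixed time: components of the velocity, of its weak gradient, and the pressure.\<close>

definition state :: "(3 \<Rightarrow> vec3 \<Rightarrow> real) \<Rightarrow> (3 \<Rightarrow> 3 \<Rightarrow> vec3 \<Rightarrow> real) \<Rightarrow> (vec3 \<Rightarrow> real) \<Rightarrow> bool" where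
  "state v D q \<longleftrightarrow> (\<forall>j. PL 2 (v j)) \<and> (\<forall>k j. PL 2 (D k j)) \<and> PL 1 q \<and>
     (\<forall>k j \<phi>. smooth_periodic \<phi> \<longrightarrow> (LINT x|torus. v j x * dderiv (axis k 1) \<phi> x) = - (LINT x|torus. D k j x * \<phi> x))"

lemma stateD:
  assumes "state v D q"
  shows "PL 2 (v j)" "PL 2 (D k j)" "PL 1 q" "PL 1 (v j)" "PL 1 (D k j)"
    "smooth_periodic \<phi> \<Longrightarrow> (LINT x|torus. v j x * dderiv (axis k 1) \<phi> x) = - (LINT x|torus. D k j x * \<phi> x)"
  using assms PL_mono[of 2 "v j" 1] PL_mono[of 2 "D k j" 1] unfolding state_def by simp_all

lemma spatial_part_integral:
  assumes s: "state v D q" and b: "bounded_pborel \<phi>" "\<And>i. bounded_pborel (d\<phi> i)" "\<And>i k. bounded_pborel (dd\<phi> i k)"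
  shows "integrable torus (spatial_part \<alpha> v D q j \<phi> d\<phi> dd\<phi>)"
    and "(LINT x|torus. spatial_part \<alpha> v D q j \<phi> d\<phi> dd\<phi> x) =
      (\<Sum>i\<in>UNIV. LINT x|torus. v i x * v j x * d\<phi> i x)
    + \<alpha>\<^sup>2 * (\<Sum>i\<in>UNIV. \<Sum>k\<in>UNIV. LINT x|torus. D k i x * D k j x * d\<phi> i x)
    + \<alpha>\<^sup>2 * (\<Sum>i\<in>UNIV. \<Sum>k\<in>UNIV. LINT x|torus. v i x * D k j x * dd\<phi> i k x)
    - (\<Sum>l\<in>UNIV. LINT x|torus. v l x * D j l x * \<phi> x)
    - \<alpha>\<^sup>2 * (\<Sum>l\<in>UNIV. \<Sum>k\<in>UNIV. LINT x|torus. D k l x * D j l x * d\<phi> k x)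
    + \<alpha>\<^sup>2 / 2 * (\<Sum>l\<in>UNIV. \<Sum>k\<in>UNIV. LINT x|torus. D k l x * D k l x * d\<phi> j x)
    + (LINT x|torus. q x * d\<phi> j x)"
proof -
  note S = stateD[OF s]
  have i1: "integrable torus (\<lambda>x. \<Sum>i\<in>UNIV. v i x * v j x * d\<phi> i x)"
    and e1: "(LINT x|torus. (\<Sum>i\<in>UNIV. v i x * v j x * d\<phi> i x)) = (\<Sum>i\<in>UNIV. LINT x|torus. v i x * v j x * d\<phi> i x)"
    by (intro Bochner_Integration.integrable_sum integrable2_bounded_pborel S b, intro Bochner_Integration.integral_sum integrable2_bounded_pborel S b)
  have i4: "integrable torus (\<lambda>x. \<Sum>l\<in>UNIV. v l x * D j l x * \<phi> x)"
    and e4: "(LINT x|torus. (\<Sum>l\<in>UNIV. v l x * D j l x * \<phi> x)) = (\<Sum>l\<in>UNIV. LINT x|torus. v l x * D j l x * \<phi> x)"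
    by (intro Bochner_Integration.integrable_sum integrable2_bounded_pborel S b, intro Bochner_Integration.integral_sum integrable2_bounded_pborel S b)
  have dbl: "integrable torus (\<lambda>x. \<Sum>i\<in>UNIV. \<Sum>k\<in>UNIV. F i k x)"
    "(LINT x|torus. (\<Sum>i\<in>UNIV. \<Sum>k\<in>UNIV. F i k x)) = (\<Sum>i\<in>UNIV. \<Sum>k\<in>UNIV. LINT x|torus. F i k x)"
    if F: "\<And>i k. integrable torus (F i k)" for F :: "3 \<Rightarrow> 3 \<Rightarrow> vec3 \<Rightarrow> real"
    by (intro Bochner_Integration.integrable_sum F)
       (subst Bochner_Integration.integral_sum, intro Bochner_Integration.integrable_sum F, intro sum.cong refl Bochner_Integration.integral_sum F)
  have a2: "integrable torus (\<lambda>x. D k i x * D k j x * d\<phi> i x)" for i k by (intro integrable2_bounded_pborel S b)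
  have a3: "integrable torus (\<lambda>x. v i x * D k j x * dd\<phi> i k x)" for i k by (intro integrable2_bounded_pborel S b)
  have a5: "integrable torus (\<lambda>x. D k l x * D j l x * d\<phi> k x)" for l k by (intro integrable2_bounded_pborel S b)
  have a6: "integrable torus (\<lambda>x. D k l x * D k l x * d\<phi> j x)" for l k by (intro integrable2_bounded_pborel S b)
  have a7: "integrable torus (\<lambda>x. q x * d\<phi> j x)" by (intro integrable_mult_bounded_pborel S b)
  note d2 = dbl[of "\<lambda>i k x. D k i x * D k j x * d\<phi> i x", OF a2] and d3 = dbl[of "\<lambda>i k x. v i x * D k j x * dd\<phi> i k x", OF a3]
    and d5 = dbl[of "\<lambda>l k x. D k l x * D j l x * d\<phi> k x", OF a5] and d6 = dbl[of "\<lambda>l k x. D k l x * D k l x * d\<phi> j x", OF a6]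
  show "integrable torus (spatial_part \<alpha> v D q j \<phi> d\<phi> dd\<phi>)"
    unfolding spatial_part_def[abs_def]
    by (intro Bochner_Integration.integrable_add Bochner_Integration.integrable_diff integrable_mult_right i1 i4 d2 d3 d5 d6 a7)
  have has: "has_bochner_integral torus (spatial_part \<alpha> v D q j \<phi> d\<phi> dd\<phi>)
      ((\<Sum>i\<in>UNIV. LINT x|torus. v i x * v j x * d\<phi> i x)
    + \<alpha>\<^sup>2 * (\<Sum>i\<in>UNIV. \<Sum>k\<in>UNIV. LINT x|torus. D k i x * D k j x * d\<phi> i x)
    + \<alpha>\<^sup>2 * (\<Sum>i\<in>UNIV. \<Sum>k\<in>UNIV. LINT x|torus. v i x * D k j x * dd\<phi> i k x)
    - (\<Sum>l\<in>UNIV. LINT x|torus. v l x * D j l x * \<phi> x)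
    - \<alpha>\<^sup>2 * (\<Sum>l\<in>UNIV. \<Sum>k\<in>UNIV. LINT x|torus. D k l x * D j l x * d\<phi> k x)
    + \<alpha>\<^sup>2 / 2 * (\<Sum>l\<in>UNIV. \<Sum>k\<in>UNIV. LINT x|torus. D k l x * D k l x * d\<phi> j x)
    + (LINT x|torus. q x * d\<phi> j x))"
    unfolding spatial_part_def[abs_def] e1[symmetric] e4[symmetric] d2(2)[symmetric] d3(2)[symmetric] d5(2)[symmetric] d6(2)[symmetric]
    by (intro has_bochner_integral_add has_bochner_integral_diff has_bochner_integral_mult_right
        has_bochner_integral_integrable i1 i4 d2(1) d3(1) d5(1) d6(1) a7)
  show "(LINT x|torus. spatial_part \<alpha> v D q j \<phi> d\<phi> dd\<phi> x) =
      (\<Sum>i\<in>UNIV. LINT x|torus. v i x * v j x * d\<phi> i x)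
    + \<alpha>\<^sup>2 * (\<Sum>i\<in>UNIV. \<Sum>k\<in>UNIV. LINT x|torus. D k i x * D k j x * d\<phi> i x)
    + \<alpha>\<^sup>2 * (\<Sum>i\<in>UNIV. \<Sum>k\<in>UNIV. LINT x|torus. v i x * D k j x * dd\<phi> i k x)
    - (\<Sum>l\<in>UNIV. LINT x|torus. v l x * D j l x * \<phi> x)
    - \<alpha>\<^sup>2 * (\<Sum>l\<in>UNIV. \<Sum>k\<in>UNIV. LINT x|torus. D k l x * D j l x * d\<phi> k x)
    + \<alpha>\<^sup>2 / 2 * (\<Sum>l\<in>UNIV. \<Sum>k\<in>UNIV. LINT x|torus. D k l x * D k l x * d\<phi> j x)
    + (LINT x|torus. q x * d\<phi> j x)"
    by (rule has_bochner_integral_integral_eq[OF has])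
qed

text \<open>For \<open>S\<close> the Dirac mass at the lattice this would be the square of the \<open>H1\<close> norm; here one factor is mollified.\<close>

definition energy :: "real \<Rightarrow> (vec3 \<Rightarrow> real) \<Rightarrow> (3 \<Rightarrow> vec3 \<Rightarrow> real) \<Rightarrow> (3 \<Rightarrow> 3 \<Rightarrow> vec3 \<Rightarrow> real) \<Rightarrow> real" where
  "energy \<alpha> S v D = (\<Sum>j\<in>UNIV. LINT x|torus. v j x * conv S (v j) x)
     + \<alpha>\<^sup>2 * (\<Sum>k\<in>UNIV. \<Sum>j\<in>UNIV. LINT x|torus. D k j x * conv S (D k j) x)"

text \<open>The nonlinear terms tested with \<open>conv S (v j)\<close>. First derivatives of the test field fall on \<open>v\<close> and become convolutions of the
  gradient; in second derivatives one derivative stays on the kernel.\<close>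

definition flux :: "real \<Rightarrow> (vec3 \<Rightarrow> real) \<Rightarrow> (3 \<Rightarrow> vec3 \<Rightarrow> real) \<Rightarrow> (3 \<Rightarrow> 3 \<Rightarrow> vec3 \<Rightarrow> real) \<Rightarrow> (vec3 \<Rightarrow> real) \<Rightarrow> real" where
  "flux \<alpha> S v D q = (\<Sum>j\<in>UNIV. LINT x|torus. spatial_part \<alpha> v D q j (conv S (v j)) (\<lambda>i. conv S (D i j))
      (\<lambda>i k. conv (dderiv (axis i 1) S) (D k j)) x)"

lemma conv_weak_derivative:
  assumes s: "state v D q" and S: "smooth_periodic S"
  shows "conv S (D k j) x = conv (dderiv (axis k 1) S) (v j) x"
proof -
  have "smooth S" using S by (simp add: smooth_periodic_def)
  then show ?thesis
    using stateD(6)[OF s smooth_periodic_reflect[OF S, of x], of j k]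
    by (simp add: smooth_reflect(2) conv_def mult.commute)
qed

lemma conv_add:
  assumes "smooth_periodic S" "smooth_periodic S'" "PL 1 w"
  shows "conv (\<lambda>h. S h + S' h) w x = conv S w x + conv S' w x"
proof -
  have "integrable torus (\<lambda>y. S (x - y) * w y)" if "smooth_periodic S" for S
    using integrable_mult_bounded_pborel[OF assms(3) bounded_pborel_smooth_periodic[OF smooth_periodic_reflect[OF that, of x]]] by (simp add: mult.commute)
  from this[OF assms(1)] this[OF assms(2)] show ?thesis by (simp add: conv_def distrib_right)
qed

lemma conv_cmult: "conv (\<lambda>h. c * S h) w x = c * conv S w x"
  unfolding conv_def by (simp add: mult.assoc)

lemma flux_add:
  assumes s: "state v D q" and S: "smooth_periodic S" and S': "smooth_periodic S'"
  shows "flux \<alpha> (\<lambda>h. S h + S' h) v D q = flux \<alpha> S v D q + flux \<alpha> S' v D q"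
    and "energy \<alpha> (\<lambda>h. S h + S' h) v D = energy \<alpha> S v D + energy \<alpha> S' v D"
proof -
  note P = stateD[OF s]
  have sm: "smooth S" "smooth S'" using S S' by (auto simp: smooth_periodic_def)
  have d: "dderiv w (\<lambda>h. S h + S' h) = (\<lambda>h. dderiv w S h + dderiv w S' h)" for w by (rule dderiv_add[OF sm])
  have i: "integrable torus (spatial_part \<alpha> v D q j (conv R (v j)) (\<lambda>i. conv R (D i j)) (\<lambda>i k. conv (dderiv (axis i 1) R) (D k j)))"
    if "smooth_periodic R" for R j
    by (intro spatial_part_integral(1)[OF s] conv_bounded_pborel smooth_periodic_dderiv that P)
  define G where "G = (\<lambda>R j. spatial_part \<alpha> v D q j (conv R (v j)) (\<lambda>i. conv R (D i j)) (\<lambda>i k. conv (dderiv (axis i 1) R) (D k j)))"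
  have fG: "flux \<alpha> R v D q = (\<Sum>j\<in>UNIV. LINT x|torus. G R j x)" for R by (simp add: flux_def G_def)
  have iG: "integrable torus (G R j)" if "smooth_periodic R" for R j unfolding G_def by (rule i[OF that])
  have e: "G (\<lambda>h. S h + S' h) j x = G S j x + G S' j x" for j x
    unfolding G_def spatial_part_def d conv_add[OF S S' P(4)] conv_add[OF S S' P(5)]
      conv_add[OF smooth_periodic_dderiv[OF S] smooth_periodic_dderiv[OF S'] P(5)]
    by (simp only: distrib_left sum.distrib)
  have "(LINT x|torus. G (\<lambda>h. S h + S' h) j x) = (LINT x|torus. G S j x) + (LINT x|torus. G S' j x)" for j
    unfolding e by (rule Bochner_Integration.integral_add[OF iG[OF S] iG[OF S']])
  then show "flux \<alpha> (\<lambda>h. S h + S' h) v D q = flux \<alpha> S v D q + flux \<alpha> S' v D q"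
    unfolding fG by (simp only: sum.distrib)
  have a: "integrable torus (\<lambda>x. v j x * conv R (v j) x)" "integrable torus (\<lambda>x. D k j x * conv R (D k j) x)" if "smooth_periodic R" for R k j
    by (intro integrable_mult_bounded_pborel conv_bounded_pborel that P)+
  show "energy \<alpha> (\<lambda>h. S h + S' h) v D = energy \<alpha> S v D + energy \<alpha> S' v D"
    unfolding energy_def conv_add[OF S S' P(4)] conv_add[OF S S' P(5)]
    by (simp add: distrib_left a[OF S] a[OF S'] sum.distrib)
qed

lemma flux_cmult:
  assumes S: "smooth_periodic S"
  shows "flux \<alpha> (\<lambda>h. c * S h) v D q = c * flux \<alpha> S v D q"
    and "energy \<alpha> (\<lambda>h. c * S h) v D = c * energy \<alpha> S v D"
proof -
  have sm: "smooth S" using S by (auto simp: smooth_periodic_def)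
  define G where "G = (\<lambda>R j. spatial_part \<alpha> v D q j (conv R (v j)) (\<lambda>i. conv R (D i j)) (\<lambda>i k. conv (dderiv (axis i 1) R) (D k j)))"
  have fG: "flux \<alpha> R v D q = (\<Sum>j\<in>UNIV. LINT x|torus. G R j x)" for R by (simp add: flux_def G_def)
  have e: "G (\<lambda>h. c * S h) j x = c * G S j x" for j x
    unfolding G_def spatial_part_def dderiv_cmult[OF sm] conv_cmult
    by (simp only: mult.left_commute[of _ c] sum_distrib_left[symmetric] distrib_left right_diff_distrib)
  show "flux \<alpha> (\<lambda>h. c * S h) v D q = c * flux \<alpha> S v D q"
    unfolding fG e integral_mult_right_zero sum_distrib_left ..
  show "energy \<alpha> (\<lambda>h. c * S h) v D = c * energy \<alpha> S v D"
    unfolding energy_def conv_cmult by (simp add: mult.left_commute[of _ c] distrib_left flip: sum_distrib_left)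
qed

text \<open>Incompressibility removes the pressure and the quadratic gradient term, leaving 9 + 9 terms
  bounded by \<open>b ^ 3\<close> and, with factor \<open>\<alpha>\<^sup>2\<close>, 27 + 27 terms bounded by \<open>b ^ 3\<close> and 27 transport terms bounded by \<open>30 * b ^ 3\<close>.
  This gives the constant \<open>18 + 864 * \<alpha>\<^sup>2\<close>, rounded up. In the limit the terms bounded by \<open>b ^ 3\<close> cancel in pairs after
  renaming summation indices.\<close>

lemma vp_flux_estimates:
  assumes s: "state v D q" and b: "b \<ge> 0"
    and v3: "\<And>j. PL 3 (v j)" "\<And>j. n3 (v j) \<le> b" and D3: "\<And>k j. PL 3 (D k j)" "\<And>k j. n3 (D k j) \<le> b"
    and L: "\<And>i h. n3 (\<lambda>x. v i (x - h) - v i x) \<le> b * norm h"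
    and div: "\<And>m x. (\<Sum>j\<in>UNIV. conv (vp m) (D j j) x) = 0"
  shows "\<bar>flux \<alpha> (vp m) v D q\<bar> \<le> (18 + 900 * \<alpha>\<^sup>2) * b ^ 3"
    and "(\<lambda>m. flux \<alpha> (vp m) v D q) \<longlonglongrightarrow> 0"
    and "(\<lambda>m. energy \<alpha> (vp m) v D) \<longlonglongrightarrow> (\<Sum>j\<in>UNIV. LINT x|torus. v j x * v j x) + \<alpha>\<^sup>2 * (\<Sum>k\<in>UNIV. \<Sum>j\<in>UNIV. LINT x|torus. D k j x * D k j x)"
proof -
  note P = stateD[OF s]
  have div': "(\<Sum>i\<in>UNIV. conv (dvp i m) (v i) x) = 0" for m x
    using div[of m x] conv_weak_derivative[OF s vp_smooth_periodic] by (simp add: dderiv_vp)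
  have zero: "(\<Sum>j\<in>UNIV. LINT x|torus. f x * conv (vp m) (D j j) x) = 0" if f: "PL 1 f" for f m
  proof -
    have "(\<Sum>j\<in>UNIV. LINT x|torus. f x * conv (vp m) (D j j) x) = (LINT x|torus. (\<Sum>j\<in>UNIV. f x * conv (vp m) (D j j) x))"
      by (rule Bochner_Integration.integral_sum[symmetric]) (intro integrable_mult_bounded_pborel conv_bounded_pborel vp_smooth_periodic f P)
    also have "\<dots> = 0" using div by (simp flip: sum_distrib_left)
    finally show ?thesis .
  qed
  define F where "F = (\<lambda>m. (\<Sum>j\<in>UNIV. \<Sum>i\<in>UNIV. LINT x|torus. v i x * v j x * conv (vp m) (D i j) x)
    + \<alpha>\<^sup>2 * (\<Sum>j\<in>UNIV. \<Sum>i\<in>UNIV. \<Sum>k\<in>UNIV. LINT x|torus. D k i x * D k j x * conv (vp m) (D i j) x)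
    + \<alpha>\<^sup>2 * (\<Sum>j\<in>UNIV. \<Sum>k\<in>UNIV. \<Sum>i\<in>UNIV. LINT x|torus. v i x * D k j x * conv (dvp i m) (D k j) x)
    - (\<Sum>j\<in>UNIV. \<Sum>l\<in>UNIV. LINT x|torus. v l x * D j l x * conv (vp m) (v j) x)
    - \<alpha>\<^sup>2 * (\<Sum>j\<in>UNIV. \<Sum>l\<in>UNIV. \<Sum>k\<in>UNIV. LINT x|torus. D k l x * D j l x * conv (vp m) (D k j) x))"
  have flux: "flux \<alpha> (vp m) v D q = F m" for m
  proof -
    have g: "(LINT x|torus. spatial_part \<alpha> v D q j (conv (vp m) (v j)) (\<lambda>i. conv (vp m) (D i j)) (\<lambda>i k. conv (dderiv (axis i 1) (vp m)) (D k j)) x) =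
      (\<Sum>i\<in>UNIV. LINT x|torus. v i x * v j x * conv (vp m) (D i j) x)
    + \<alpha>\<^sup>2 * (\<Sum>i\<in>UNIV. \<Sum>k\<in>UNIV. LINT x|torus. D k i x * D k j x * conv (vp m) (D i j) x)
    + \<alpha>\<^sup>2 * (\<Sum>i\<in>UNIV. \<Sum>k\<in>UNIV. LINT x|torus. v i x * D k j x * conv (dvp i m) (D k j) x)
    - (\<Sum>l\<in>UNIV. LINT x|torus. v l x * D j l x * conv (vp m) (v j) x)
    - \<alpha>\<^sup>2 * (\<Sum>l\<in>UNIV. \<Sum>k\<in>UNIV. LINT x|torus. D k l x * D j l x * conv (vp m) (D k j) x)
    + \<alpha>\<^sup>2 / 2 * (\<Sum>l\<in>UNIV. \<Sum>k\<in>UNIV. LINT x|torus. D k l x * D k l x * conv (vp m) (D j j) x)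
    + (LINT x|torus. q x * conv (vp m) (D j j) x)" for j
      unfolding dderiv_vp
      by (rule spatial_part_integral(2)[OF s]) (intro conv_bounded_pborel vp_smooth_periodic dvp_smooth_periodic P)+
    have "(\<Sum>j\<in>UNIV. \<Sum>l\<in>UNIV. \<Sum>k\<in>UNIV. LINT x|torus. D k l x * D k l x * conv (vp m) (D j j) x)
       = (\<Sum>l\<in>UNIV. \<Sum>k\<in>UNIV. \<Sum>j\<in>UNIV. LINT x|torus. D k l x * D k l x * conv (vp m) (D j j) x)"
      by (rule trans[OF sum.swap sum.cong[OF refl sum.swap]])
    also have "\<dots> = 0" by (intro sum.neutral ballI zero PL_mult2 P)
    finally have z6: "(\<Sum>j\<in>UNIV. \<Sum>l\<in>UNIV. \<Sum>k\<in>UNIV. LINT x|torus. D k l x * D k l x * conv (vp m) (D j j) x) = 0" .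
    have sw: "(\<Sum>i\<in>UNIV. \<Sum>k\<in>UNIV. LINT x|torus. v i x * D k j x * conv (dvp i m) (D k j) x)
      = (\<Sum>k\<in>UNIV. \<Sum>i\<in>UNIV. LINT x|torus. v i x * D k j x * conv (dvp i m) (D k j) x)" for j by (rule sum.swap)
    show ?thesis
      unfolding flux_def g sum.distrib sum_subtractf sum_distrib_left[symmetric] z6 zero[OF P(3)] F_def sw by simp
  qed
  have p3: "x * y * z \<le> b ^ 3" if "0 \<le> x" "x \<le> b" "0 \<le> y" "y \<le> b" "0 \<le> z" "z \<le> b" for x y z :: real
    unfolding power3_eq_cube using that b by (intro mult_mono) auto
  have B: "\<bar>LINT x|torus. f x * g x * conv (vp m) h x\<bar> \<le> b ^ 3"
    if "PL 3 f" "PL 3 g" "PL 3 h" "n3 f \<le> b" "n3 g \<le> b" "n3 h \<le> b" for f g h m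
    by (rule order_trans[OF vp_conv_bound[OF that(1-3)] p3[OF n3_nonneg that(4) n3_nonneg that(5) n3_nonneg that(6)]])
  have Tb: "\<bar>LINT x|torus. v i x * D k j x * conv (dvp i m) (D k j) x\<bar> \<le> 30 * b ^ 3" for i k j m
    using transport_bound[OF v3(1) D3(1) L b, of i k j i m] p3[of b "n3 (D k j)" "n3 (D k j)"] D3(2)[of k j] n3_nonneg[of "D k j"] b by linarith
  have sum1: "\<bar>\<Sum>i\<in>(UNIV::3 set). f i\<bar> \<le> 3 * c" if "\<And>i. \<bar>f i\<bar> \<le> c" for f :: "3 \<Rightarrow> real" and c
    using that[of 1] that[of 2] that[of 3] unfolding sum_3 by linarith
  have b1: "\<bar>\<Sum>j\<in>UNIV. \<Sum>i\<in>UNIV. LINT x|torus. v i x * v j x * conv (vp m) (D i j) x\<bar> \<le> 3 * (3 * b ^ 3)" for m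
    by (intro sum1 B v3 D3)
  have b2: "\<bar>\<Sum>j\<in>UNIV. \<Sum>i\<in>UNIV. \<Sum>k\<in>UNIV. LINT x|torus. D k i x * D k j x * conv (vp m) (D i j) x\<bar> \<le> 3 * (3 * (3 * b ^ 3))" for m
    by (intro sum1 B v3 D3)
  have b3: "\<bar>\<Sum>j\<in>UNIV. \<Sum>k\<in>UNIV. \<Sum>i\<in>UNIV. LINT x|torus. v i x * D k j x * conv (dvp i m) (D k j) x\<bar> \<le> 3 * (3 * (3 * (30 * b ^ 3)))" for m
    by (intro sum1 Tb)
  have b4: "\<bar>\<Sum>j\<in>UNIV. \<Sum>l\<in>UNIV. LINT x|torus. v l x * D j l x * conv (vp m) (v j) x\<bar> \<le> 3 * (3 * b ^ 3)" for m
    by (intro sum1 B v3 D3)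
  have b5: "\<bar>\<Sum>j\<in>UNIV. \<Sum>l\<in>UNIV. \<Sum>k\<in>UNIV. LINT x|torus. D k l x * D j l x * conv (vp m) (D k j) x\<bar> \<le> 3 * (3 * (3 * b ^ 3))" for m
    by (intro sum1 B v3 D3)
  have sc: "\<bar>\<alpha>\<^sup>2 * y\<bar> \<le> \<alpha>\<^sup>2 * c" if "\<bar>y\<bar> \<le> c" for y c
    unfolding abs_mult using that by (simp add: mult_left_mono)
  have Fb: "\<bar>F m\<bar> \<le> 9 * b ^ 3 + \<alpha>\<^sup>2 * (27 * b ^ 3) + \<alpha>\<^sup>2 * (810 * b ^ 3) + 9 * b ^ 3 + \<alpha>\<^sup>2 * (27 * b ^ 3)" for m
    using b1[of m] sc[OF b2[of m]] sc[OF b3[of m]] b4[of m] sc[OF b5[of m]] unfolding F_def by linarith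
  have nn: "0 \<le> \<alpha>\<^sup>2 * b ^ 3" using b by simp
  have c1: "(18 + 900 * \<alpha>\<^sup>2) * b ^ 3 = 18 * b ^ 3 + 900 * (\<alpha>\<^sup>2 * b ^ 3)" by (simp only: distrib_right mult.assoc)
  have c2: "\<alpha>\<^sup>2 * (27 * b ^ 3) = 27 * (\<alpha>\<^sup>2 * b ^ 3)" by (rule mult.left_commute)
  have c3: "\<alpha>\<^sup>2 * (810 * b ^ 3) = 810 * (\<alpha>\<^sup>2 * b ^ 3)" by (rule mult.left_commute)
  show "\<bar>flux \<alpha> (vp m) v D q\<bar> \<le> (18 + 900 * \<alpha>\<^sup>2) * b ^ 3"
    unfolding flux using Fb[of m] nn unfolding c1 c2 c3 by linarith
  have lim: "F \<longlonglongrightarrow> (\<Sum>j\<in>UNIV. \<Sum>i\<in>UNIV. LINT x|torus. v i x * v j x * D i j x)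
    + \<alpha>\<^sup>2 * (\<Sum>j\<in>UNIV. \<Sum>i\<in>UNIV. \<Sum>k\<in>UNIV. LINT x|torus. D k i x * D k j x * D i j x)
    + \<alpha>\<^sup>2 * (\<Sum>j\<in>(UNIV::3 set). \<Sum>k\<in>(UNIV::3 set). 0)
    - (\<Sum>j\<in>UNIV. \<Sum>l\<in>UNIV. LINT x|torus. v l x * D j l x * v j x)
    - \<alpha>\<^sup>2 * (\<Sum>j\<in>UNIV. \<Sum>l\<in>UNIV. \<Sum>k\<in>UNIV. LINT x|torus. D k l x * D j l x * D k j x)"
    unfolding F_def
    by (intro tendsto_add tendsto_diff tendsto_mult tendsto_const tendsto_sum vp_conv_limit v3 D3
        transport_limit[OF v3(1) D3(1) b L div'])
  have r1: "(\<Sum>j\<in>UNIV. \<Sum>l\<in>UNIV. LINT x|torus. v l x * D j l x * v j x) = (\<Sum>j\<in>UNIV. \<Sum>i\<in>UNIV. LINT x|torus. v i x * v j x * D i j x)"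
    by (rule trans[OF sum.swap]) (simp only: mult_ac)
  have r2: "(\<Sum>j\<in>UNIV. \<Sum>l\<in>UNIV. \<Sum>k\<in>UNIV. LINT x|torus. D k l x * D j l x * D k j x)
     = (\<Sum>j\<in>UNIV. \<Sum>i\<in>UNIV. \<Sum>k\<in>UNIV. LINT x|torus. D k i x * D k j x * D i j x)"
    by (rule trans[OF sum.swap]) (simp only: mult_ac)
  show "(\<lambda>m. flux \<alpha> (vp m) v D q) \<longlonglongrightarrow> 0"
    using lim unfolding flux r1 r2 by simp
  have c1: "(\<lambda>m. LINT x|torus. w x * conv (vp m) w x) \<longlonglongrightarrow> (LINT x|torus. w x * w x)" if "PL 3 w" for w
    using vp_conv_limit[OF that PL_one that] by simp
  show "(\<lambda>m. energy \<alpha> (vp m) v D) \<longlonglongrightarrow> (\<Sum>j\<in>UNIV. LINT x|torus. v j x * v j x) + \<alpha>\<^sup>2 * (\<Sum>k\<in>UNIV. \<Sum>j\<in>UNIV. LINT x|torus. D k j x * D k j x)"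
    unfolding energy_def by (intro tendsto_add tendsto_mult tendsto_const tendsto_sum c1 v3 D3)
qed

section \<open>Completeness of Lebesgue measure and the Cauchy-Schwarz inequality\<close>

lemma lebesgue_on_measurable_AE:
  fixes f g :: "'a::euclidean_space \<Rightarrow> 'b::topological_space"
  assumes S: "S \<in> sets lebesgue" and f: "f \<in> borel_measurable (lebesgue_on S)"
    and ae: "AE x in lebesgue_on S. f x = g x"
  shows "g \<in> borel_measurable (lebesgue_on S)"
proof (rule measurableI)
  let ?M = "lebesgue_on S"
  obtain N where N: "N \<in> null_sets ?M" "{x \<in> space ?M. f x \<noteq> g x} \<subseteq> N"
    using ae unfolding eventually_ae_filter by blast
  have NS: "N \<subseteq> space ?M" using N(1) by (intro sets.sets_into_space null_setsD2)
  have S': "S \<inter> space lebesgue \<in> sets lebesgue" using S by simp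
  have sub: "B \<in> sets ?M" if "B \<subseteq> N" for B
  proof -
    have "N \<in> null_sets lebesgue" "N \<subseteq> S" using N(1) null_sets_restrict_space[OF S] by auto
    then have "B \<in> null_sets lebesgue" "B \<subseteq> S" using that completion.complete2 by blast+
    then show ?thesis using null_sets_restrict_space[OF S, of B] null_setsD2 by blast
  qed
  fix A :: "'b set" assume A: "A \<in> sets borel"
  have "g -` A \<inter> space ?M = (f -` A \<inter> space ?M - N) \<union> (g -` A \<inter> N)" 
  proof (rule set_eqI)
    fix x
    have "f x = g x" if "x \<in> space ?M" "x \<notin> N" using N(2) that by blast
    then show "x \<in> g -` A \<inter> space ?M \<longleftrightarrow> x \<in> (f -` A \<inter> space ?M - N) \<union> (g -` A \<inter> N)"
      using NS by (cases "x \<in> N"; cases "x \<in> space ?M") (simp_all only: Int_iff Un_iff Diff_iff vimage_eq simp_thms subset_iff)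
  qed
  moreover have "f -` A \<inter> space ?M - N \<in> sets ?M" by (rule sets.Diff[OF measurable_sets[OF f A] null_setsD2[OF N(1)]])
  moreover have "g -` A \<inter> N \<in> sets ?M" by (rule sub) blast
  ultimately show "g -` A \<inter> space ?M \<in> sets ?M" by simp
qed simp

text \<open>By completeness, measurability passes from one function to the other. If neither function is measurable, both
  integrals have the default value zero.\<close>

lemma lebesgue_on_integral_AE:
  fixes f g :: "'a::euclidean_space \<Rightarrow> real"
  assumes S: "S \<in> sets lebesgue" and ae: "AE x in lebesgue_on S. f x = g x"
  shows "integrable (lebesgue_on S) f \<longleftrightarrow> integrable (lebesgue_on S) g"
    and "integral\<^sup>L (lebesgue_on S) f = integral\<^sup>L (lebesgue_on S) g"
proof -
  have ae': "AE x in lebesgue_on S. g x = f x" using ae by eventually_elim simp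
  have m: "f \<in> borel_measurable (lebesgue_on S) \<longleftrightarrow> g \<in> borel_measurable (lebesgue_on S)"
    using lebesgue_on_measurable_AE[OF S _ ae] lebesgue_on_measurable_AE[OF S _ ae'] by blast
  show i: "integrable (lebesgue_on S) f \<longleftrightarrow> integrable (lebesgue_on S) g"
  proof (cases "f \<in> borel_measurable (lebesgue_on S)")
    case True
    with m show ?thesis by (intro integrable_cong_AE ae) auto
  next
    case False
    with m show ?thesis using borel_measurable_integrable by blast
  qed
  show "integral\<^sup>L (lebesgue_on S) f = integral\<^sup>L (lebesgue_on S) g"
  proof (cases "f \<in> borel_measurable (lebesgue_on S)")
    case True
    with m show ?thesis by (intro integral_cong_AE ae) auto
  next
    case False
    with m have "\<not> integrable (lebesgue_on S) f" "\<not> integrable (lebesgue_on S) g"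
      using borel_measurable_integrable by blast+
    then show ?thesis by (simp add: not_integrable_integral_eq)
  qed
qed

lemma torus_integral_AE:
  fixes f g :: "vec3 \<Rightarrow> real"
  assumes "AE x in torus. f x = g x"
  shows "integrable torus f \<longleftrightarrow> integrable torus g" "integral\<^sup>L torus f = integral\<^sup>L torus g"
  by (rule lebesgue_on_integral_AE[OF _ assms], simp)+

lemma time_integral_AE:
  fixes f g :: "real \<Rightarrow> real"
  assumes "AE t in time T. f t = g t"
  shows "integrable (time T) f \<longleftrightarrow> integrable (time T) g" "integral\<^sup>L (time T) f = integral\<^sup>L (time T) g"
  by (rule lebesgue_on_integral_AE[OF _ assms], simp)+

definition L2 :: "(vec3 \<Rightarrow> real) \<Rightarrow> bool" where
  "L2 f \<longleftrightarrow> f \<in> borel_measurable torus \<and> integrable torus (\<lambda>x. (f x)\<^sup>2)"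

definition L2_norm :: "(vec3 \<Rightarrow> real) \<Rightarrow> real" where
  "L2_norm f = sqrt (LINT x|torus. (f x)\<^sup>2)"

lemma L2_norm_nonneg: "0 \<le> L2_norm f"
  unfolding L2_norm_def by (intro real_sqrt_ge_zero integral_nonneg_AE) simp

lemma L2_norm_square: "(L2_norm f)\<^sup>2 = (LINT x|torus. (f x)\<^sup>2)"
  unfolding L2_norm_def by (intro real_sqrt_pow2 integral_nonneg_AE) simp

lemma L2_mult: assumes "L2 f" "L2 g" shows "integrable torus (\<lambda>x. f x * g x)"
proof (rule Bochner_Integration.integrable_bound)
  show "integrable torus (\<lambda>x. (f x)\<^sup>2 + (g x)\<^sup>2)" using assms by (simp add: L2_def)
  show "(\<lambda>x. f x * g x) \<in> borel_measurable torus" using assms unfolding L2_def by (intro borel_measurable_times) blast+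
  show "AE x in torus. norm (f x * g x) \<le> norm ((f x)\<^sup>2 + (g x)\<^sup>2)"
  proof (rule AE_I2)
    fix x show "norm (f x * g x) \<le> norm ((f x)\<^sup>2 + (g x)\<^sup>2)"
      using abs_mult_le_squares[of "f x" "g x"] by simp
  qed
qed

lemma L2_linear:
  assumes f: "L2 f" and g: "L2 g"
  shows "L2 (\<lambda>x. a * f x + b * g x)"
    and "(LINT x|torus. (a * f x + b * g x)\<^sup>2) = a\<^sup>2 * (LINT x|torus. (f x)\<^sup>2) + 2 * a * b * (LINT x|torus. f x * g x) + b\<^sup>2 * (LINT x|torus. (g x)\<^sup>2)"
proof -
  have e: "(a * f x + b * g x)\<^sup>2 = a\<^sup>2 * (f x)\<^sup>2 + 2 * a * b * (f x * g x) + b\<^sup>2 * (g x)\<^sup>2" for x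
    by (simp add: power2_eq_square algebra_simps)
  have i: "integrable torus (\<lambda>x. (f x)\<^sup>2)" "integrable torus (\<lambda>x. (g x)\<^sup>2)" using f g by (auto simp: L2_def)
  note i3 = L2_mult[OF f g]
  have "(\<lambda>x. a * f x + b * g x) \<in> borel_measurable torus"
    using f g unfolding L2_def by (intro borel_measurable_add borel_measurable_times borel_measurable_const) blast+
  moreover have "integrable torus (\<lambda>x. (a * f x + b * g x)\<^sup>2)"
    unfolding e by (intro Bochner_Integration.integrable_add integrable_mult_right i i3)
  ultimately show "L2 (\<lambda>x. a * f x + b * g x)" unfolding L2_def by blast
  have "has_bochner_integral torus (\<lambda>x. (a * f x + b * g x)\<^sup>2) (a\<^sup>2 * (LINT x|torus. (f x)\<^sup>2) + 2 * a * b * (LINT x|torus. f x * g x) + b\<^sup>2 * (LINT x|torus. (g x)\<^sup>2))"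
    unfolding e by (intro has_bochner_integral_add has_bochner_integral_mult_right has_bochner_integral_integrable i i3)
  then show "(LINT x|torus. (a * f x + b * g x)\<^sup>2) = a\<^sup>2 * (LINT x|torus. (f x)\<^sup>2) + 2 * a * b * (LINT x|torus. f x * g x) + b\<^sup>2 * (LINT x|torus. (g x)\<^sup>2)"
    by (rule has_bochner_integral_integral_eq)
qed

lemma L2_diff: "L2 f \<Longrightarrow> L2 g \<Longrightarrow> L2 (\<lambda>x. f x - g x)"
  using L2_linear(1)[of f g 1 "-1"] by simp

text \<open>Nonnegativity of the quadratic form \<open>LINT x|torus. (a * f x + b * g x)\<^sup>2\<close>, evaluated at the coefficients that make it
  smallest, with a separate choice when \<open>g\<close> vanishes almost everywhere.\<close>

lemma cauchy_schwarz_torus: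
  assumes f: "L2 f" and g: "L2 g" shows "\<bar>LINT x|torus. f x * g x\<bar> \<le> L2_norm f * L2_norm g"
proof -
  define A where "A = (LINT x|torus. (f x)\<^sup>2)"
  define B where "B = (LINT x|torus. (g x)\<^sup>2)"
  define I where "I = (LINT x|torus. f x * g x)"
  have nn: "0 \<le> A" "0 \<le> B" unfolding A_def B_def by (auto intro: integral_nonneg_AE)
  have q: "0 \<le> a\<^sup>2 * A + 2 * a * b * I + b\<^sup>2 * B" for a b
    unfolding A_def B_def I_def L2_linear(2)[OF f g, symmetric] by (rule integral_nonneg_AE) simp
  have "I\<^sup>2 \<le> A * B"
  proof (cases "B = 0")
    case False
    have "B\<^sup>2 * A + 2 * B * (- I) * I + (- I)\<^sup>2 * B = B * (A * B - I\<^sup>2)" by (simp add: power2_eq_square algebra_simps)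
    then have "0 \<le> B * (A * B - I\<^sup>2)" using q[of B "- I"] by simp
    then show ?thesis using False nn(2) by (simp add: zero_le_mult_iff)
  next
    case True
    have "I = 0"
    proof (rule ccontr)
      assume "I \<noteq> 0"
      then have "1\<^sup>2 * A + 2 * 1 * (- (A + 1) / (2 * I)) * I + (- (A + 1) / (2 * I))\<^sup>2 * B = - 1" using True by (simp add: field_simps)
      then show False using q[of 1 "- (A + 1) / (2 * I)"] by simp
    qed
    then show ?thesis using True by simp
  qed
  then have "sqrt (I\<^sup>2) \<le> sqrt (A * B)" by (rule real_sqrt_le_mono)
  then show ?thesis by (simp add: real_sqrt_mult L2_norm_def A_def B_def I_def)
qed

lemma L2_abs: "L2 f \<Longrightarrow> L2 (\<lambda>x. \<bar>f x\<bar>)" "L2_norm (\<lambda>x. \<bar>f x\<bar>) = L2_norm f"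
  by (auto simp: L2_def L2_norm_def)

lemma integrable_mult_bounded_torus:
  assumes f: "integrable torus f" and c: "c \<in> borel_measurable torus" "\<And>x. \<bar>c x\<bar> \<le> (M::real)"
  shows "integrable torus (\<lambda>x. f x * c x)"
proof (rule Bochner_Integration.integrable_bound)
  show "integrable torus (\<lambda>x. \<bar>f x\<bar> * M)" using f by simp
  show "(\<lambda>x. f x * c x) \<in> borel_measurable torus"
    by (intro borel_measurable_times borel_measurable_integrable[OF f] c(1))
  show "AE x in torus. norm (f x * c x) \<le> norm (\<bar>f x\<bar> * M)"
    unfolding real_norm_def abs_mult abs_abs by (intro AE_I2 mult_left_mono order_trans[OF c(2) abs_ge_self] abs_ge_zero)
qed

lemma bounded_pborelD:
  assumes "bounded_pborel c" shows "c \<in> borel_measurable torus" "\<exists>M\<ge>0. \<forall>x. \<bar>c x\<bar> \<le> M"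
proof -
  obtain M where M: "\<And>x. \<bar>c x\<bar> \<le> M" "pborel c" using assms unfolding bounded_pborel_def by blast
  then show "c \<in> borel_measurable torus" by (blast intro: measurable_torus)
  have "0 \<le> M" using M(1)[of 0] by simp
  then show "\<exists>M\<ge>0. \<forall>x. \<bar>c x\<bar> \<le> M" using M(1) by blast
qed

lemma L2_mult_bounded_pborel:
  assumes f: "L2 f" and g: "L2 g" and c: "bounded_pborel c"
  shows "integrable torus (\<lambda>x. f x * g x * c x)"
  using bounded_pborelD[OF c] integrable_mult_bounded_torus[OF L2_mult[OF f g], of c] by blast

lemma cauchy_schwarz_bounded_pborel:
  assumes c: "c \<in> borel_measurable torus" "\<And>x. \<bar>c x\<bar> \<le> (M::real)" and f: "L2 f" and g: "L2 g"
  shows "\<bar>LINT x|torus. f x * g x * c x\<bar> \<le> M * (L2_norm f * L2_norm g)"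
proof -
  have M: "0 \<le> M" using c(2)[of 0] by simp
  have i: "integrable torus (\<lambda>x. \<bar>f x\<bar> * \<bar>g x\<bar>)" by (rule L2_mult[OF L2_abs(1)[OF f] L2_abs(1)[OF g]])
  have "\<bar>LINT x|torus. f x * g x * c x\<bar> \<le> (LINT x|torus. M * (\<bar>f x\<bar> * \<bar>g x\<bar>))"
  proof (rule integral_abs_le)
    show "integrable torus (\<lambda>x. f x * g x * c x)" by (rule integrable_mult_bounded_torus[OF L2_mult[OF f g] c])
    show "integrable torus (\<lambda>x. M * (\<bar>f x\<bar> * \<bar>g x\<bar>))" by (rule integrable_mult_right[OF i])
    show "\<bar>f x * g x * c x\<bar> \<le> M * (\<bar>f x\<bar> * \<bar>g x\<bar>)" for x
      using mult_left_mono[OF c(2)[of x], of "\<bar>f x\<bar> * \<bar>g x\<bar>"] by (simp add: abs_mult mult_ac)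
  qed
  also have "\<dots> = M * (LINT x|torus. \<bar>f x\<bar> * \<bar>g x\<bar>)" by (rule integral_mult_right_zero)
  also have "\<dots> \<le> M * (L2_norm f * L2_norm g)"
    using cauchy_schwarz_torus[OF L2_abs(1)[OF f] L2_abs(1)[OF g]] M unfolding L2_abs(2) by (intro mult_left_mono) auto
  finally show ?thesis .
qed

section \<open>Representatives and weak derivatives\<close>

lemma Lp_1_iff: "(f :: vec3 \<Rightarrow> real) \<in> Lp 1 \<longleftrightarrow> periodic f \<and> integrable torus f"
  unfolding Lp_def using integrable_norm_cancel[of torus f] integrable_norm[of torus f] borel_measurable_integrable[of torus f] by auto

lemma powr_two: "0 \<le> x \<Longrightarrow> x powr 2 = (x::real)\<^sup>2"
  by (cases "x = 0") (auto simp: powr_numeral)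

lemma powr_three: "0 \<le> x \<Longrightarrow> x powr 3 = (x::real) ^ 3"
  by (cases "x = 0") (auto simp: powr_numeral)

lemma Lp_2_iff: "(f :: vec3 \<Rightarrow> real) \<in> Lp 2 \<longleftrightarrow> periodic f \<and> L2 f"
  unfolding Lp_def L2_def by (simp add: powr_two)

text \<open>The exceptional set is null in the whole space, not only in the cube, so that the relation survives translations.\<close>

definition rep :: "(vec3 \<Rightarrow> real) \<Rightarrow> (vec3 \<Rightarrow> real) \<Rightarrow> bool" where
  "rep f g \<longleftrightarrow> pborel g \<and> (\<exists>N\<in>null_sets lborel. \<forall>x. x \<notin> N \<longrightarrow> f x = g x)"

lemma rep_exists: "periodic f \<Longrightarrow> f \<in> borel_measurable torus \<Longrightarrow> \<exists>g. rep f g"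
  unfolding rep_def by (metis borel_representative)

lemma rep_AE: assumes "rep f g" shows "AE x in torus. f x = g x"
proof -
  obtain N where N: "N \<in> null_sets lborel" "\<And>x. x \<notin> N \<Longrightarrow> f x = g x" using assms unfolding rep_def by blast
  show ?thesis using null_AE_torus[OF N(1), of 0] by eventually_elim (use N(2) in simp)
qed

lemma rep_PL: assumes r: "rep f g" and i: "integrable torus (\<lambda>x. \<bar>f x\<bar> ^ n)" shows "PL n g"
proof -
  have "AE x in torus. \<bar>f x\<bar> ^ n = \<bar>g x\<bar> ^ n" using rep_AE[OF r] by eventually_elim simp
  from torus_integral_AE(1)[OF this] show ?thesis using r i unfolding PL_def rep_def by blast
qed

lemma integrable_mult_smooth:
  assumes f: "integrable torus f" and \<phi>: "smooth_periodic \<phi>" shows "integrable torus (\<lambda>x. f x * \<phi> x)"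
  using bounded_pborelD[OF bounded_pborel_smooth_periodic[OF \<phi>]] integrable_mult_bounded_torus[OF f, of \<phi>] by blast

lemma is_weak_derivD:
  assumes "is_weak_deriv k f g"
  shows "periodic f" "integrable torus f" "periodic g" "integrable torus g"
    "smooth_periodic \<phi> \<Longrightarrow> (LINT x|torus. f x * dderiv (axis k 1) \<phi> x) = - (LINT x|torus. g x * \<phi> x)"
  using assms unfolding is_weak_deriv_def Lp_1_iff smooth_periodic_def by auto

lemma is_weak_deriv_diff:
  assumes a: "is_weak_deriv k f g" and b: "is_weak_deriv k f' g'"
  shows "is_weak_deriv k (\<lambda>x. f x - f' x) (\<lambda>x. g x - g' x)"
proof -
  note A = is_weak_derivD[OF a] and B = is_weak_derivD[OF b]
  have "(LINT x|torus. (f x - f' x) * dderiv (axis k 1) \<phi> x) = - (LINT x|torus. (g x - g' x) * \<phi> x)" if p: "smooth_periodic \<phi>" for \<phi>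
  proof -
    note p' = smooth_periodic_dderiv[OF p]
    have "(LINT x|torus. (f x - f' x) * dderiv (axis k 1) \<phi> x) = (LINT x|torus. f x * dderiv (axis k 1) \<phi> x) - (LINT x|torus. f' x * dderiv (axis k 1) \<phi> x)"
      unfolding left_diff_distrib by (rule Bochner_Integration.integral_diff[OF integrable_mult_smooth[OF A(2) p'] integrable_mult_smooth[OF B(2) p']])
    moreover have "(LINT x|torus. (g x - g' x) * \<phi> x) = (LINT x|torus. g x * \<phi> x) - (LINT x|torus. g' x * \<phi> x)"
      unfolding left_diff_distrib by (rule Bochner_Integration.integral_diff[OF integrable_mult_smooth[OF A(4) p] integrable_mult_smooth[OF B(4) p]])
    ultimately show ?thesis using A(5)[OF p] B(5)[OF p] by simp
  qed
  then show ?thesis unfolding is_weak_deriv_def Lp_1_iff smooth_periodic_def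
    using A(1-4) B(1-4) periodic_comp2[of f f' "(-)"] periodic_comp2[of g g' "(-)"] by simp
qed

text \<open>The weak derivatives of a field in \<open>H1\<close> are chosen by Hilbert's operator; uniqueness makes every such choice
  agree almost everywhere with a square integrable one.\<close>

lemma weak_deriv_unique:
  assumes a: "is_weak_deriv k f g" and b: "is_weak_deriv k f g'" shows "AE x in torus. g x = g' x"
proof -
  let ?h = "\<lambda>x. g x - g' x"
  note d = is_weak_derivD[OF is_weak_deriv_diff[OF a b]]
  obtain r where r: "rep ?h r" using rep_exists[OF d(3) borel_measurable_integrable[OF d(4)]] by blast
  have p: "PL 1 r" by (rule rep_PL[OF r]) (use d(4) in simp)
  have "(LINT x|torus. r x * \<phi> x) = 0" if \<phi>: "smooth_periodic \<phi>" for \<phi>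
  proof -
    have "AE x in torus. ?h x * \<phi> x = r x * \<phi> x" using rep_AE[OF r] by eventually_elim simp
    from torus_integral_AE(2)[OF this] show ?thesis using d(5)[OF \<phi>] by simp
  qed
  then have "AE x in torus. r x = 0" by (rule fundamental_lemma[OF p])
  with rep_AE[OF r] show ?thesis by eventually_elim simp
qed

lemma H1_D:
  assumes f: "f \<in> H1"
  shows "periodic f" "f \<in> borel_measurable torus" "integrable torus (\<lambda>x. (norm (f x))\<^sup>2)" "L2 (\<lambda>x. f x $ j)"
    "is_weak_deriv k (\<lambda>x. f x $ j) (weak_deriv k j f)" "L2 (weak_deriv k j f)" "periodic (weak_deriv k j f)"
proof -
  show p: "periodic f" and m: "f \<in> borel_measurable torus" and i: "integrable torus (\<lambda>x. (norm (f x))\<^sup>2)"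
    using f unfolding H1_def Lp_def by (simp_all add: powr_two)
  have mj: "(\<lambda>x. f x $ j) \<in> borel_measurable torus" by (rule measurable_compose[OF m], intro borel_measurable_continuous_onI continuous_intros)
  have "integrable torus (\<lambda>x. (f x $ j)\<^sup>2)"
  proof (rule Bochner_Integration.integrable_bound[OF i])
    show "(\<lambda>x. (f x $ j)\<^sup>2) \<in> borel_measurable torus" using mj by simp
    show "AE x in torus. norm ((f x $ j)\<^sup>2) \<le> norm ((norm (f x))\<^sup>2)"
    proof (rule AE_I2)
      fix x show "norm ((f x $ j)\<^sup>2) \<le> norm ((norm (f x))\<^sup>2)"
        using power_mono[OF component_le_norm_cart[of "f x" j] abs_ge_zero, of 2] by simp
    qed
  qed
  then show "L2 (\<lambda>x. f x $ j)" using mj by (simp add: L2_def)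
  obtain g where g: "g \<in> Lp 2" "is_weak_deriv k (\<lambda>x. f x $ j) g" using f unfolding H1_def by blast
  show w: "is_weak_deriv k (\<lambda>x. f x $ j) (weak_deriv k j f)" unfolding weak_deriv_def by (rule someI[of "is_weak_deriv k (\<lambda>x. f x $ j)", OF g(2)])
  have "AE x in torus. (g x)\<^sup>2 = (weak_deriv k j f x)\<^sup>2" using weak_deriv_unique[OF g(2) w] by eventually_elim simp
  from torus_integral_AE(1)[OF this] show "L2 (weak_deriv k j f)"
    using g(1) borel_measurable_integrable[OF is_weak_derivD(4)[OF w]] unfolding Lp_2_iff L2_def by blast
  show "periodic (weak_deriv k j f)" by (rule is_weak_derivD(3)[OF w])
qed

lemma H1_norm_square:
  assumes f: "f \<in> H1"
  shows "(H1_norm \<alpha> f)\<^sup>2 = (\<Sum>j\<in>UNIV. LINT x|torus. (f x $ j)\<^sup>2) + \<alpha>\<^sup>2 * (\<Sum>k\<in>UNIV. \<Sum>j\<in>UNIV. LINT x|torus. (weak_deriv k j f x)\<^sup>2)"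
    and "0 \<le> H1_norm \<alpha> f"
proof -
  have i: "integrable torus (\<lambda>x. (f x $ j)\<^sup>2)" "integrable torus (\<lambda>x. (weak_deriv k j f x)\<^sup>2)" for k j
    using H1_D(4,6)[OF f] unfolding L2_def by blast+
  have n: "(norm (f x))\<^sup>2 = (\<Sum>j\<in>UNIV. (f x $ j)\<^sup>2)" for x
    unfolding norm_vec_def L2_set_def by (simp add: sum_nonneg)
  have e1: "(LINT x|torus. (norm (f x))\<^sup>2) = (\<Sum>j\<in>UNIV. LINT x|torus. (f x $ j)\<^sup>2)"
    unfolding n by (rule Bochner_Integration.integral_sum[OF i(1)])
  have e2: "(LINT x|torus. (\<Sum>k\<in>UNIV. \<Sum>j\<in>UNIV. (weak_deriv k j f x)\<^sup>2)) = (\<Sum>k\<in>UNIV. \<Sum>j\<in>UNIV. LINT x|torus. (weak_deriv k j f x)\<^sup>2)"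
    by (subst Bochner_Integration.integral_sum, intro Bochner_Integration.integrable_sum i, intro sum.cong refl Bochner_Integration.integral_sum i)
  have "0 \<le> (\<Sum>j\<in>UNIV. LINT x|torus. (f x $ j)\<^sup>2) + \<alpha>\<^sup>2 * (\<Sum>k\<in>UNIV. \<Sum>j\<in>UNIV. LINT x|torus. (weak_deriv k j f x)\<^sup>2)"
    by (intro add_nonneg_nonneg mult_nonneg_nonneg sum_nonneg integral_nonneg_AE) auto
  then show "(H1_norm \<alpha> f)\<^sup>2 = (\<Sum>j\<in>UNIV. LINT x|torus. (f x $ j)\<^sup>2) + \<alpha>\<^sup>2 * (\<Sum>k\<in>UNIV. \<Sum>j\<in>UNIV. LINT x|torus. (weak_deriv k j f x)\<^sup>2)"
    "0 \<le> H1_norm \<alpha> f"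
    unfolding H1_norm_def e1 e2 by (rule real_sqrt_pow2, rule real_sqrt_ge_zero)
qed

lemma H1_norm_component:
  assumes f: "f \<in> H1" and \<alpha>: "\<alpha> > 0"
  shows "L2_norm (\<lambda>x. f x $ j) \<le> H1_norm \<alpha> f" "L2_norm (weak_deriv k j f) \<le> 1 / \<alpha> * H1_norm \<alpha> f"
proof -
  define a where "a j = (LINT x|torus. (f x $ j)\<^sup>2)" for j
  define b where "b k j = (LINT x|torus. (weak_deriv k j f x)\<^sup>2)" for k j
  have nn: "0 \<le> a j" "0 \<le> b k j" for k j unfolding a_def b_def by (auto intro: integral_nonneg_AE)
  have N: "(H1_norm \<alpha> f)\<^sup>2 = sum a UNIV + \<alpha>\<^sup>2 * (\<Sum>k\<in>UNIV. sum (b k) UNIV)"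
    unfolding H1_norm_square(1)[OF f] a_def b_def ..
  have s: "a j \<le> sum a UNIV" "b k j \<le> sum (b k) UNIV" "sum (b k) UNIV \<le> (\<Sum>k\<in>UNIV. sum (b k) UNIV)"
    by (rule member_le_sum; simp add: nn sum_nonneg)+
  have s0: "0 \<le> sum a UNIV" by (simp add: nn sum_nonneg)
  have s1: "0 \<le> (\<Sum>k\<in>UNIV. sum (b k) UNIV)" by (simp add: nn sum_nonneg)
  have "(L2_norm (\<lambda>x. f x $ j))\<^sup>2 \<le> (H1_norm \<alpha> f)\<^sup>2"
    unfolding L2_norm_square a_def[symmetric] N using s(1) mult_nonneg_nonneg[OF zero_le_power2 s1, of \<alpha>] by linarith
  then show "L2_norm (\<lambda>x. f x $ j) \<le> H1_norm \<alpha> f" by (rule power2_le_imp_le[OF _ H1_norm_square(2)[OF f]])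
  have "(\<alpha> * L2_norm (weak_deriv k j f))\<^sup>2 \<le> (H1_norm \<alpha> f)\<^sup>2"
    unfolding power_mult_distrib L2_norm_square b_def[symmetric] N
    using mult_left_mono[OF order_trans[OF s(2) s(3)] zero_le_power2[of \<alpha>]] s0 by linarith
  then have "\<alpha> * L2_norm (weak_deriv k j f) \<le> H1_norm \<alpha> f" by (rule power2_le_imp_le[OF _ H1_norm_square(2)[OF f]])
  then show "L2_norm (weak_deriv k j f) \<le> 1 / \<alpha> * H1_norm \<alpha> f" using \<alpha> by (simp add: field_simps)
qed

lemma H1_diff:
  assumes f: "f \<in> H1" and g: "g \<in> H1"
  shows "(\<lambda>x. f x - g x) \<in> H1"
    and "AE x in torus. weak_deriv k j (\<lambda>x. f x - g x) x = weak_deriv k j f x - weak_deriv k j g x"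
proof -
  note F = H1_D[OF f] and G = H1_D[OF g]
  have w: "is_weak_deriv k (\<lambda>x. (f x - g x) $ j) (\<lambda>x. weak_deriv k j f x - weak_deriv k j g x)" for k j
    using is_weak_deriv_diff[OF F(5) G(5)] by simp
  have p: "periodic (\<lambda>x. f x - g x)" by (rule periodic_comp2[OF F(1) G(1)])
  have m: "(\<lambda>x. f x - g x) \<in> borel_measurable torus" by (rule borel_measurable_diff[OF F(2) G(2)])
  have "integrable torus (\<lambda>x. (norm (f x - g x))\<^sup>2)"
  proof (rule Bochner_Integration.integrable_bound)
    show "integrable torus (\<lambda>x. 2 * ((norm (f x))\<^sup>2 + (norm (g x))\<^sup>2))" using F(3) G(3) by simp
    show "(\<lambda>x. (norm (f x - g x))\<^sup>2) \<in> borel_measurable torus" using m by simp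
    show "AE x in torus. norm ((norm (f x - g x))\<^sup>2) \<le> norm (2 * ((norm (f x))\<^sup>2 + (norm (g x))\<^sup>2))"
    proof (rule AE_I2)
      fix x
      have "(norm (f x - g x))\<^sup>2 \<le> (norm (f x) + norm (g x))\<^sup>2" by (intro power_mono norm_triangle_ineq4 norm_ge_zero)
      also have "\<dots> \<le> 2 * ((norm (f x))\<^sup>2 + (norm (g x))\<^sup>2)"
        using sum_squares_bound[of "norm (f x)" "norm (g x)"] by (simp add: power2_sum)
      finally show "norm ((norm (f x - g x))\<^sup>2) \<le> norm (2 * ((norm (f x))\<^sup>2 + (norm (g x))\<^sup>2))" by simp
    qed
  qed
  then have "(\<lambda>x. f x - g x) \<in> Lp 2" using p m unfolding Lp_def by (simp add: powr_two)
  moreover have "(\<lambda>x. weak_deriv k j f x - weak_deriv k j g x) \<in> Lp 2" for k j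
    unfolding Lp_2_iff using L2_diff[OF F(6) G(6)] periodic_comp2[OF F(7) G(7)] by blast
  ultimately show h: "(\<lambda>x. f x - g x) \<in> H1" unfolding H1_def using w by blast
  show "AE x in torus. weak_deriv k j (\<lambda>x. f x - g x) x = weak_deriv k j f x - weak_deriv k j g x"
    by (rule weak_deriv_unique[OF H1_D(5)[OF h] w])
qed

section \<open>Measurability in time\<close>

text \<open>Composing the simple approximants with a continuous functional gives simple real functions converging almost
  everywhere; completeness of Lebesgue measure does the rest.\<close>

lemma strongly_measurable_functional:
  fixes \<Phi> :: "('a \<Rightarrow> 'b::ab_group_add) \<Rightarrow> real"
  assumes f: "strongly_measurable T X N f"
    and c: "\<And>g s. g \<in> X \<Longrightarrow> (\<And>n. s n \<in> X) \<Longrightarrow> (\<lambda>n. N (\<lambda>x. s n x - g x)) \<longlonglongrightarrow> 0 \<Longrightarrow> (\<lambda>n. \<Phi> (s n)) \<longlonglongrightarrow> \<Phi> g"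
  shows "(\<lambda>t. \<Phi> (f t)) \<in> borel_measurable (time T)"
proof -
  obtain s where s: "\<And>n. simple_function (time T) (s n)" "\<And>n. s n ` {0<..<T} \<subseteq> X"
      "AE t in time T. (\<lambda>n. N (\<lambda>x. s n t x - f t x)) \<longlonglongrightarrow> 0" and X: "AE t in time T. f t \<in> X"
    using f unfolding strongly_measurable_def by blast
  have m: "(\<lambda>t. lim (\<lambda>n. \<Phi> (s n t))) \<in> borel_measurable (time T)"
    by (intro borel_measurable_lim_metric borel_measurable_simple_function simple_function_compose1[OF s(1)])
  have "AE t in time T. t \<in> {0<..<T}" by (rule AE_I2) simp
  then have "AE t in time T. lim (\<lambda>n. \<Phi> (s n t)) = \<Phi> (f t)"
    using s(3) X
  proof eventually_elim
    case (elim t)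
    show ?case
      by (rule limI, rule c[OF elim(3) _ elim(2)]) (use s(2) elim(1) in blast)
  qed
  then show ?thesis by (rule lebesgue_on_measurable_AE[OF _ m, rotated]) simp
qed

text \<open>The coefficients of the mode equations are sums and products of such functions of time; closure under these operations
  replaces separate integrability proofs.\<close>

definition Linf_time :: "real \<Rightarrow> (real \<Rightarrow> real) \<Rightarrow> bool" where
  "Linf_time T f \<longleftrightarrow> f \<in> borel_measurable (time T) \<and> (\<exists>C. AE t in time T. \<bar>f t\<bar> \<le> C)"

lemma Linf_time_integrable: "Linf_time T f \<Longrightarrow> integrable (time T) f"
proof -
  assume f: "Linf_time T f"
  then obtain C where "AE t in time T. \<bar>f t\<bar> \<le> C" unfolding Linf_time_def by blast
  then show ?thesis using f unfolding Linf_time_def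
    by (intro finite_measure.integrable_const_bound[OF finite_measure_time, where B=C]) (simp_all only: real_norm_def)
qed

lemma Linf_time_const: "Linf_time T (\<lambda>t. c)"
  unfolding Linf_time_def by auto

lemma Linf_time_add: assumes "Linf_time T f" "Linf_time T g" shows "Linf_time T (\<lambda>t. f t + g t)"
proof -
  obtain C D where CD: "AE t in time T. \<bar>f t\<bar> \<le> C" "AE t in time T. \<bar>g t\<bar> \<le> D" using assms unfolding Linf_time_def by blast
  then have "AE t in time T. \<bar>f t + g t\<bar> \<le> C + D" by eventually_elim linarith
  then show ?thesis using assms unfolding Linf_time_def by (blast intro: borel_measurable_add)
qed

lemma Linf_time_mult: assumes "Linf_time T f" "Linf_time T g" shows "Linf_time T (\<lambda>t. f t * g t)"
proof -
  obtain C D where CD: "AE t in time T. \<bar>f t\<bar> \<le> C" "AE t in time T. \<bar>g t\<bar> \<le> D" using assms unfolding Linf_time_def by blast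
  then have "AE t in time T. \<bar>f t * g t\<bar> \<le> C * D" by eventually_elim (simp add: abs_mult mult_mono')
  then show ?thesis using assms unfolding Linf_time_def by (blast intro: borel_measurable_times)
qed

lemma Linf_time_diff: "Linf_time T f \<Longrightarrow> Linf_time T g \<Longrightarrow> Linf_time T (\<lambda>t. f t - g t)"
  using Linf_time_add[OF _ Linf_time_mult[OF Linf_time_const[of T "-1"]], of f g] by simp

lemma Linf_time_sum: "(\<And>i. i \<in> I \<Longrightarrow> Linf_time T (f i)) \<Longrightarrow> Linf_time T (\<lambda>t. \<Sum>i\<in>I. f i t)"
  by (induction I rule: infinite_finite_induct) (auto simp: Linf_time_const intro: Linf_time_add)

lemma Linf_time_AE: assumes "Linf_time T f" "AE t in time T. f t = g t" shows "Linf_time T g"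
proof -
  obtain C where C: "AE t in time T. \<bar>f t\<bar> \<le> C" using assms unfolding Linf_time_def by blast
  have "AE t in time T. \<bar>g t\<bar> \<le> C" using C assms(2) by eventually_elim simp
  moreover have "g \<in> borel_measurable (time T)"
    by (rule lebesgue_on_measurable_AE[OF _ _ assms(2)]) (use assms(1) in \<open>simp_all add: Linf_time_def\<close>)
  ultimately show ?thesis unfolding Linf_time_def by blast
qed

text \<open>The integral of a product of two Lipschitz maps into the square integrable functions is a continuous functional on
  \<open>H1\<close>, so its value along a strongly measurable path is measurable.\<close>

definition H1_lipschitz :: "real \<Rightarrow> ((vec3 \<Rightarrow> vec3) \<Rightarrow> vec3 \<Rightarrow> real) \<Rightarrow> bool" where
  "H1_lipschitz \<alpha> A \<longleftrightarrow> (\<exists>K\<ge>0. \<forall>f\<in>H1. L2 (A f) \<and> L2_norm (A f) \<le> K * (1 + H1_norm \<alpha> f) \<and>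
     (\<forall>g\<in>H1. L2_norm (\<lambda>x. A f x - A g x) \<le> K * H1_norm \<alpha> (\<lambda>x. f x - g x)))"

lemma H1_lipschitz_const: "H1_lipschitz \<alpha> (\<lambda>f x. 1)"
proof -
  have "L2 (\<lambda>x. 1)" "L2_norm (\<lambda>x. 1) = 1" "L2_norm (\<lambda>x. 1 - 1) = 0" using measure_torus by (simp_all add: L2_def L2_norm_def)
  then show ?thesis unfolding H1_lipschitz_def by (intro exI[of _ 1]) (simp add: H1_norm_square(2) H1_diff(1))
qed

lemma H1_lipschitz_component: "\<alpha> > 0 \<Longrightarrow> H1_lipschitz \<alpha> (\<lambda>f x. f x $ j)"
  unfolding H1_lipschitz_def
proof (intro exI[of _ 1] conjI ballI)
  assume a: "\<alpha> > 0"
  fix f :: "vec3 \<Rightarrow> vec3" assume f: "f \<in> H1"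
  show "L2 (\<lambda>x. f x $ j)" by (rule H1_D(4)[OF f])
  show "L2_norm (\<lambda>x. f x $ j) \<le> 1 * (1 + H1_norm \<alpha> f)" using H1_norm_component(1)[OF f a, of j] by simp
  fix g :: "vec3 \<Rightarrow> vec3" assume g: "g \<in> H1"
  show "L2_norm (\<lambda>x. f x $ j - g x $ j) \<le> 1 * H1_norm \<alpha> (\<lambda>x. f x - g x)"
    using H1_norm_component(1)[OF H1_diff(1)[OF f g] a, of j] by simp
qed simp

lemma H1_lipschitz_weak_deriv: "\<alpha> > 0 \<Longrightarrow> H1_lipschitz \<alpha> (\<lambda>f. weak_deriv k j f)"
  unfolding H1_lipschitz_def
proof (intro exI[of _ "1 / \<alpha>"] conjI ballI)
  assume a: "\<alpha> > 0"
  then show "0 \<le> 1 / \<alpha>" by simp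
  fix f :: "vec3 \<Rightarrow> vec3" assume f: "f \<in> H1"
  show "L2 (weak_deriv k j f)" by (rule H1_D(6)[OF f])
  have "1 / \<alpha> * (1 + H1_norm \<alpha> f) = 1 / \<alpha> * H1_norm \<alpha> f + 1 / \<alpha>" by (simp add: distrib_left)
  moreover have "0 < 1 / \<alpha>" using a by simp
  ultimately show "L2_norm (weak_deriv k j f) \<le> 1 / \<alpha> * (1 + H1_norm \<alpha> f)" using H1_norm_component(2)[OF f a, of k j] by linarith
  fix g :: "vec3 \<Rightarrow> vec3" assume g: "g \<in> H1"
  have "AE x in torus. (weak_deriv k j (\<lambda>x. f x - g x) x)\<^sup>2 = (weak_deriv k j f x - weak_deriv k j g x)\<^sup>2"
    using H1_diff(2)[OF f g, of k j] by eventually_elim simp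
  from torus_integral_AE(2)[OF this] have "L2_norm (weak_deriv k j (\<lambda>x. f x - g x)) = L2_norm (\<lambda>x. weak_deriv k j f x - weak_deriv k j g x)"
    unfolding L2_norm_def by simp
  then show "L2_norm (\<lambda>x. weak_deriv k j f x - weak_deriv k j g x) \<le> 1 / \<alpha> * H1_norm \<alpha> (\<lambda>x. f x - g x)"
    using H1_norm_component(2)[OF H1_diff(1)[OF f g] a, of k j] by simp
qed

lemma Linf_time_quadratic:
  assumes u: "u \<in> Bochner_Linf T H1 (H1_norm \<alpha>)" and A: "H1_lipschitz \<alpha> A" and B: "H1_lipschitz \<alpha> B" and c: "bounded_pborel c"
  shows "Linf_time T (\<lambda>t. LINT x|torus. A (u t) x * B (u t) x * c x)"
proof -
  obtain K where K: "K \<ge> 0" "\<And>f. f \<in> H1 \<Longrightarrow> L2 (A f)" "\<And>f. f \<in> H1 \<Longrightarrow> L2_norm (A f) \<le> K * (1 + H1_norm \<alpha> f)"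
    "\<And>f g. f \<in> H1 \<Longrightarrow> g \<in> H1 \<Longrightarrow> L2_norm (\<lambda>x. A f x - A g x) \<le> K * H1_norm \<alpha> (\<lambda>x. f x - g x)"
    using A unfolding H1_lipschitz_def by blast
  obtain L where L: "L \<ge> 0" "\<And>f. f \<in> H1 \<Longrightarrow> L2 (B f)" "\<And>f. f \<in> H1 \<Longrightarrow> L2_norm (B f) \<le> L * (1 + H1_norm \<alpha> f)"
    "\<And>f g. f \<in> H1 \<Longrightarrow> g \<in> H1 \<Longrightarrow> L2_norm (\<lambda>x. B f x - B g x) \<le> L * H1_norm \<alpha> (\<lambda>x. f x - g x)"
    using B unfolding H1_lipschitz_def by blast
  obtain M where M: "M \<ge> 0" "\<And>x. \<bar>c x\<bar> \<le> M" and cm: "c \<in> borel_measurable torus" using bounded_pborelD[OF c] by blast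
  note cs = cauchy_schwarz_bounded_pborel[OF cm M(2)]
  define \<Phi> where "\<Phi> = (\<lambda>f. LINT x|torus. A f x * B f x * c x)"
  have lim: "(\<lambda>n. \<Phi> (s n)) \<longlonglongrightarrow> \<Phi> g"
    if g: "g \<in> H1" and s: "\<And>n. s n \<in> H1" and z: "(\<lambda>n. H1_norm \<alpha> (\<lambda>x. s n x - g x)) \<longlonglongrightarrow> 0" for g s
  proof -
    define a where "a n = (\<lambda>x. A (s n) x - A g x)" for n
    define b where "b n = (\<lambda>x. B (s n) x - B g x)" for n
    have a: "L2 (a n)" and b: "L2 (b n)" for n unfolding a_def b_def by (intro L2_diff K(2) L(2) s g)+
    have a0: "(\<lambda>n. L2_norm (a n)) \<longlonglongrightarrow> 0"
    proof (rule tendsto_sandwich[OF _ _ tendsto_const])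
      show "(\<lambda>n. K * H1_norm \<alpha> (\<lambda>x. s n x - g x)) \<longlonglongrightarrow> 0" by (rule tendsto_mult_right_zero[OF z])
    qed (auto simp: a_def L2_norm_nonneg K(4) s g)
    have b0: "(\<lambda>n. L2_norm (b n)) \<longlonglongrightarrow> 0"
    proof (rule tendsto_sandwich[OF _ _ tendsto_const])
      show "(\<lambda>n. L * H1_norm \<alpha> (\<lambda>x. s n x - g x)) \<longlonglongrightarrow> 0" by (rule tendsto_mult_right_zero[OF z])
    qed (auto simp: b_def L2_norm_nonneg L(4) s g)
    have bd: "\<bar>\<Phi> (s n) - \<Phi> g\<bar> \<le> M * (L2_norm (a n) * L2_norm (b n)) + M * (L2_norm (a n) * L2_norm (B g)) + M * (L2_norm (A g) * L2_norm (b n))" for n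
    proof -
      have i: "integrable torus (\<lambda>x. a n x * b n x * c x)" "integrable torus (\<lambda>x. a n x * B g x * c x)" "integrable torus (\<lambda>x. A g x * b n x * c x)"
        "integrable torus (\<lambda>x. A g x * B g x * c x)"
        by (intro L2_mult_bounded_pborel a b K(2) L(2) g c)+
      have e: "A (s n) x * B (s n) x * c x = a n x * b n x * c x + a n x * B g x * c x + A g x * b n x * c x + A g x * B g x * c x" for x
        unfolding a_def b_def by (simp add: algebra_simps)
      have "has_bochner_integral torus (\<lambda>x. A (s n) x * B (s n) x * c x)
         ((LINT x|torus. a n x * b n x * c x) + (LINT x|torus. a n x * B g x * c x) + (LINT x|torus. A g x * b n x * c x) + (LINT x|torus. A g x * B g x * c x))"
        unfolding e by (intro has_bochner_integral_add has_bochner_integral_integrable i)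
      then have "\<Phi> (s n) = (LINT x|torus. a n x * b n x * c x) + (LINT x|torus. a n x * B g x * c x) + (LINT x|torus. A g x * b n x * c x) + \<Phi> g"
        unfolding \<Phi>_def by (rule has_bochner_integral_integral_eq)
      then show ?thesis using cs[OF a[of n] b[of n]] cs[OF a[of n] L(2)[OF g]] cs[OF K(2)[OF g] b[of n]] by linarith
    qed
    have "(\<lambda>n. M * (L2_norm (a n) * L2_norm (b n)) + M * (L2_norm (a n) * L2_norm (B g)) + M * (L2_norm (A g) * L2_norm (b n))) \<longlonglongrightarrow>
       M * (0 * 0) + M * (0 * L2_norm (B g)) + M * (L2_norm (A g) * 0)"
      by (intro tendsto_intros a0 b0)
    then have "(\<lambda>n. M * (L2_norm (a n) * L2_norm (b n)) + M * (L2_norm (a n) * L2_norm (B g)) + M * (L2_norm (A g) * L2_norm (b n))) \<longlonglongrightarrow> 0" by simp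
    then have "(\<lambda>n. \<Phi> (s n) - \<Phi> g) \<longlonglongrightarrow> 0" by (rule Lim_null_comparison[rotated]) (simp add: bd)
    then show ?thesis by (rule LIM_zero_cancel)
  qed
  obtain C where sm: "strongly_measurable T H1 (H1_norm \<alpha>) u" and C: "AE t in time T. H1_norm \<alpha> (u t) \<le> C"
    using u unfolding Bochner_Linf_def by blast
  have m: "(\<lambda>t. \<Phi> (u t)) \<in> borel_measurable (time T)" by (rule strongly_measurable_functional[OF sm lim])
  have "AE t in time T. u t \<in> H1" using sm unfolding strongly_measurable_def by blast
  then have "AE t in time T. \<bar>\<Phi> (u t)\<bar> \<le> M * ((K * (1 + C)) * (L * (1 + C)))"
    using C
  proof eventually_elim
    case (elim t)
    have "L2_norm (A (u t)) \<le> K * (1 + C)" "L2_norm (B (u t)) \<le> L * (1 + C)"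
      using K(3)[OF elim(1)] L(3)[OF elim(1)] mult_left_mono[OF elim(2) K(1)] mult_left_mono[OF elim(2) L(1)] by (simp_all add: distrib_left)
    then have "M * (L2_norm (A (u t)) * L2_norm (B (u t))) \<le> M * ((K * (1 + C)) * (L * (1 + C)))"
      by (intro mult_left_mono mult_mono' M L2_norm_nonneg)
    then show ?case using cs[OF K(2)[OF elim(1)] L(2)[OF elim(1)]] unfolding \<Phi>_def by linarith
  qed
  then show ?thesis using m unfolding Linf_time_def \<Phi>_def by blast
qed

lemma Linf_time_pressure:
  assumes p: "p \<in> Bochner_Linf T (Lp 1) (Lp_norm 1)" and c: "bounded_pborel c"
  shows "Linf_time T (\<lambda>t. LINT x|torus. p t x * c x)"
proof -
  obtain M where M: "M \<ge> 0" "\<And>x. \<bar>c x\<bar> \<le> M" and cm: "c \<in> borel_measurable torus" using bounded_pborelD[OF c] by blast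
  have N: "Lp_norm 1 f = (LINT x|torus. \<bar>f x\<bar>)" for f :: "vec3 \<Rightarrow> real"
    unfolding Lp_norm_def by (simp add: integral_nonneg_AE)
  have i: "integrable torus (\<lambda>x. f x * c x)" if "integrable torus f" for f
    by (rule integrable_mult_bounded_torus[OF that cm M(2)])
  have b: "\<bar>LINT x|torus. f x * c x\<bar> \<le> M * Lp_norm 1 f" if f: "integrable torus f" for f
  proof -
    have "\<bar>LINT x|torus. f x * c x\<bar> \<le> (LINT x|torus. M * \<bar>f x\<bar>)"
    proof (rule integral_abs_le[OF i[OF f]])
      show "integrable torus (\<lambda>x. M * \<bar>f x\<bar>)" using f by simp
      show "\<bar>f x * c x\<bar> \<le> M * \<bar>f x\<bar>" for x using mult_right_mono[OF M(2)[of x] abs_ge_zero[of "f x"]] by (simp add: abs_mult mult.commute)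
    qed
    then show ?thesis unfolding N by simp
  qed
  obtain C where sm: "strongly_measurable T (Lp 1) (Lp_norm 1) p" and C: "AE t in time T. Lp_norm 1 (p t) \<le> C"
    using p unfolding Bochner_Linf_def by blast
  have m: "(\<lambda>t. LINT x|torus. p t x * c x) \<in> borel_measurable (time T)"
  proof (rule strongly_measurable_functional[OF sm])
    fix g :: "vec3 \<Rightarrow> real" and s assume g: "g \<in> Lp 1" and s: "\<And>n::nat. s n \<in> Lp 1" and z: "(\<lambda>n. Lp_norm 1 (\<lambda>x. s n x - g x)) \<longlonglongrightarrow> 0"
    have gi: "integrable torus g" and si: "integrable torus (s n)" for n using g s unfolding Lp_1_iff by blast+
    have bd: "\<bar>(LINT x|torus. s n x * c x) - (LINT x|torus. g x * c x)\<bar> \<le> M * Lp_norm 1 (\<lambda>x. s n x - g x)" for n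
      using b[OF Bochner_Integration.integrable_diff[OF si[of n] gi]]
      unfolding left_diff_distrib Bochner_Integration.integral_diff[OF i[OF si[of n]] i[OF gi]] .
    have "(\<lambda>n. (LINT x|torus. s n x * c x) - (LINT x|torus. g x * c x)) \<longlonglongrightarrow> 0"
      by (rule Lim_null_comparison[OF _ tendsto_mult_right_zero[OF z, of M]]) (simp add: bd)
    then show "(\<lambda>n. LINT x|torus. s n x * c x) \<longlonglongrightarrow> (LINT x|torus. g x * c x)" by (rule LIM_zero_cancel)
  qed
  have "AE t in time T. p t \<in> Lp 1" using sm unfolding strongly_measurable_def by blast
  then have "AE t in time T. \<bar>LINT x|torus. p t x * c x\<bar> \<le> M * C"
    using C
  proof eventually_elim
    case (elim t)
    then have "integrable torus (p t)" unfolding Lp_1_iff by blast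
    then show ?case using b[of "p t"] mult_left_mono[OF elim(2) M(1)] by linarith
  qed
  then show ?thesis using m unfolding Linf_time_def by blast
qed

section \<open>Fourier modes\<close>

definition mode :: "vec3 \<Rightarrow> real \<Rightarrow> vec3 \<Rightarrow> real" where
  "mode k a = (\<lambda>x. cos (a + 2 * pi * (k \<bullet> x)))"

lemma mode_smooth_periodic: "k \<in> int_vec \<Longrightarrow> smooth_periodic (mode k a)"
  unfolding mode_def by (rule smooth_periodic_cos)

lemma dderiv_mode: "dderiv (axis i 1) (mode k a) = (\<lambda>x. (2 * pi * k $ i) * mode k (a + pi / 2) x)"
  using dderiv_cos_inner[of "axis i 1" 1 a "(2 * pi) *\<^sub>R k"] by (simp add: mode_def inner_axis)

lemma dderiv_mode2:
  assumes k: "k \<in> int_vec"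
  shows "dderiv (axis l 1) (dderiv (axis i 1) (mode k a)) = (\<lambda>x. (2 * pi * k $ i) * ((2 * pi * k $ l) * mode k (a + pi / 2 + pi / 2) x))"
  unfolding dderiv_mode using dderiv_cmult[of "mode k (a + pi / 2)" "axis l 1" "2 * pi * k $ i"] mode_smooth_periodic[OF k]
  by (simp add: smooth_periodic_def dderiv_mode)

lemma mode_half_turn: "mode k (a + pi / 2 + pi / 2) x = - mode k a x" "mode k (pi / 2) x = - mode k (- pi / 2) x"
  using cos_add[of "a + 2 * pi * (k \<bullet> x)" pi] cos_add[of "- pi / 2 + 2 * pi * (k \<bullet> x)" pi] by (simp_all add: mode_def algebra_simps)

text \<open>The addition theorem for the cosine of a difference; a phase shift by \<open>pi / 2\<close> stands for the sine.\<close>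

lemma conv_mode:
  assumes w: "PL 1 w" and k: "k \<in> int_vec"
  shows "conv (mode k b) w x = mode k b x * (LINT y|torus. w y * mode k 0 y) + mode k (b - pi / 2) x * (LINT y|torus. w y * mode k (- pi / 2) y)"
proof -
  have e: "mode k b (x - y) * w y = mode k b x * (w y * mode k 0 y) + mode k (b - pi / 2) x * (w y * mode k (- pi / 2) y)" for y
  proof -
    have "cos (z - pi / 2) = sin z" "cos (- pi / 2 + z) = sin z" for z :: real
      by (simp_all add: cos_diff cos_add)
    from this(1)[of "b + 2 * pi * (k \<bullet> x)"] this(2)[of "2 * pi * (k \<bullet> y)"]
    have m: "mode k (b - pi / 2) x = sin (b + 2 * pi * (k \<bullet> x))" "mode k (- pi / 2) y = sin (2 * pi * (k \<bullet> y))"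
      by (simp_all add: mode_def algebra_simps)
    have "mode k b (x - y) = cos ((b + 2 * pi * (k \<bullet> x)) - 2 * pi * (k \<bullet> y))"
      by (simp add: mode_def algebra_simps inner_diff_right)
    also have "\<dots> = mode k b x * mode k 0 y + mode k (b - pi / 2) x * mode k (- pi / 2) y"
      unfolding m cos_diff by (simp add: mode_def)
    finally show ?thesis by (simp add: algebra_simps)
  qed
  have i: "integrable torus (\<lambda>y. w y * mode k a y)" for a
    by (rule integrable_mult_smooth[OF PL_integrable[OF w] mode_smooth_periodic[OF k]])
  show ?thesis unfolding conv_def e
    by (subst Bochner_Integration.integral_add[OF integrable_mult_right[OF i] integrable_mult_right[OF i]]) (simp only: integral_mult_right_zero)
qed

lemma spatial_part_linear:
  "spatial_part \<alpha> v D q j (\<lambda>x. c * \<phi> x + d * \<phi>' x) (\<lambda>i x. c * d\<phi> i x + d * d\<phi>' i x) (\<lambda>i k x. c * dd\<phi> i k x + d * dd\<phi>' i k x) x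
   = c * spatial_part \<alpha> v D q j \<phi> d\<phi> dd\<phi> x + d * spatial_part \<alpha> v D q j \<phi>' d\<phi>' dd\<phi>' x"
  unfolding spatial_part_def
  by (simp only: mult.left_commute[of _ c] mult.left_commute[of _ d] distrib_left right_diff_distrib sum.distrib sum_distrib_left[symmetric])

text \<open>Half the time derivative of the weighted square of a mode is the mode times this rate.\<close>

definition mode_rate :: "real \<Rightarrow> (3 \<Rightarrow> vec3 \<Rightarrow> real) \<Rightarrow> (3 \<Rightarrow> 3 \<Rightarrow> vec3 \<Rightarrow> real) \<Rightarrow> (vec3 \<Rightarrow> real) \<Rightarrow> vec3 \<Rightarrow> real \<Rightarrow> 3 \<Rightarrow> real" where
  "mode_rate \<alpha> v D q k a j = (LINT x|torus. spatial_part \<alpha> v D q j (mode k a) (\<lambda>i. dderiv (axis i 1) (mode k a))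
     (\<lambda>i l. dderiv (axis i 1) (dderiv (axis l 1) (mode k a))) x)"

text \<open>The symbol of \<open>1 - \<alpha>\<^sup>2 \<Delta>\<close> at frequency \<open>k\<close>.\<close>

definition mode_weight :: "real \<Rightarrow> vec3 \<Rightarrow> real" where
  "mode_weight \<alpha> k = 1 + \<alpha>\<^sup>2 * (\<Sum>l\<in>UNIV. (2 * pi * k $ l)\<^sup>2)"

lemma mode_weight_pos: "0 < mode_weight \<alpha> k"
proof -
  have "0 \<le> \<alpha>\<^sup>2 * (\<Sum>l\<in>UNIV. (2 * pi * k $ l)\<^sup>2)" by (intro mult_nonneg_nonneg sum_nonneg) auto
  then show ?thesis unfolding mode_weight_def by linarith
qed

text \<open>Differentiation exchanges the cosine and the sine coefficient up to the factor \<open>2 * pi * k $ l\<close>, so the gradient contributes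
  the same sum of squares with that factor squared.\<close>

lemma energy_mode:
  assumes s: "state v D q" and k: "k \<in> int_vec"
  shows "energy \<alpha> (mode k 0) v D = (\<Sum>j\<in>UNIV. mode_weight \<alpha> k * (LINT x|torus. v j x * mode k 0 x)\<^sup>2
     + mode_weight \<alpha> k * (LINT x|torus. v j x * mode k (- pi / 2) x)\<^sup>2)"
proof -
  note P = stateD[OF s]
  define c where "c j = (LINT x|torus. v j x * mode k 0 x)" for j
  define d where "d j = (LINT x|torus. v j x * mode k (- pi / 2) x)" for j
  have w: "(LINT x|torus. w x * conv (mode k 0) w x) = (LINT x|torus. w x * mode k 0 x)\<^sup>2 + (LINT x|torus. w x * mode k (- pi / 2) x)\<^sup>2"
    if "PL 1 w" for w
  proof -
    have i: "integrable torus (\<lambda>y. w y * mode k a y)" for a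
      by (rule integrable_mult_smooth[OF PL_integrable[OF that] mode_smooth_periodic[OF k]])
    have e: "w x * conv (mode k 0) w x = (w x * mode k 0 x) * (LINT x|torus. w x * mode k 0 x) + (w x * mode k (- pi / 2) x) * (LINT x|torus. w x * mode k (- pi / 2) x)" for x
      unfolding conv_mode[OF that k] by (simp add: algebra_simps)
    show ?thesis unfolding e
      by (subst Bochner_Integration.integral_add[OF integrable_mult_left[OF i] integrable_mult_left[OF i]]) (simp only: integral_mult_left_zero power2_eq_square)
  qed
  have D: "(LINT x|torus. D l j x * mode k a x) = - ((2 * pi * k $ l) * (LINT x|torus. v j x * mode k (a + pi / 2) x))" for l j a
    using P(6)[OF mode_smooth_periodic[OF k, of a], of j l] unfolding dderiv_mode mult.left_commute[of "v j _" "2 * pi * k $ l"] integral_mult_right_zero by linarith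
  have D0: "(LINT x|torus. D l j x * mode k 0 x) = (2 * pi * k $ l) * d j" for l j
    using D[of l j 0] by (simp add: mode_half_turn(2) d_def)
  have D1: "(LINT x|torus. D l j x * mode k (- pi / 2) x) = - ((2 * pi * k $ l) * c j)" for l j
    using D[of l j "- pi / 2"] by (simp add: c_def)
  have "energy \<alpha> (mode k 0) v D = (\<Sum>j\<in>UNIV. (c j)\<^sup>2 + (d j)\<^sup>2) + \<alpha>\<^sup>2 * (\<Sum>l\<in>UNIV. \<Sum>j\<in>UNIV. (2 * pi * k $ l)\<^sup>2 * ((c j)\<^sup>2 + (d j)\<^sup>2))"
    unfolding energy_def w[OF P(4)] w[OF P(5)] D0 D1 c_def[symmetric] d_def[symmetric] power2_minus power_mult_distrib[of "2 * pi * k $ _"]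
    by (simp only: distrib_left add.commute)
  also have "(\<Sum>l\<in>UNIV. \<Sum>j\<in>UNIV. (2 * pi * k $ l)\<^sup>2 * ((c j)\<^sup>2 + (d j)\<^sup>2)) = (\<Sum>l\<in>UNIV. (2 * pi * k $ l)\<^sup>2) * (\<Sum>j\<in>UNIV. (c j)\<^sup>2 + (d j)\<^sup>2)"
    by (rule sum_product[symmetric])
  also have "(\<Sum>j\<in>UNIV. (c j)\<^sup>2 + (d j)\<^sup>2) + \<alpha>\<^sup>2 * ((\<Sum>l\<in>UNIV. (2 * pi * k $ l)\<^sup>2) * (\<Sum>j\<in>UNIV. (c j)\<^sup>2 + (d j)\<^sup>2))
      = mode_weight \<alpha> k * (\<Sum>j\<in>UNIV. (c j)\<^sup>2 + (d j)\<^sup>2)"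
    unfolding mode_weight_def by (simp only: distrib_right mult_1 mult.assoc)
  also have "\<dots> = (\<Sum>j\<in>UNIV. mode_weight \<alpha> k * (c j)\<^sup>2 + mode_weight \<alpha> k * (d j)\<^sup>2)"
    by (simp only: sum_distrib_left distrib_left)
  finally show ?thesis unfolding c_def d_def .
qed

text \<open>The convolution of the velocity by a cosine kernel is a combination of the cosine and the sine mode, and so are its
  derivatives, with the same coefficients. The flux is linear in the test field.\<close>

lemma flux_mode:
  assumes s: "state v D q" and k: "k \<in> int_vec"
  shows "flux \<alpha> (mode k 0) v D q = (\<Sum>j\<in>UNIV. (LINT x|torus. v j x * mode k 0 x) * mode_rate \<alpha> v D q k 0 j
     + (LINT x|torus. v j x * mode k (- pi / 2) x) * mode_rate \<alpha> v D q k (- pi / 2) j)"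
proof -
  note P = stateD[OF s] and sp = mode_smooth_periodic[OF k]
  define G where "G a j = spatial_part \<alpha> v D q j (mode k a) (\<lambda>i. dderiv (axis i 1) (mode k a)) (\<lambda>i l. dderiv (axis i 1) (dderiv (axis l 1) (mode k a)))" for a j
  have iG: "integrable torus (G a j)" for a j
    unfolding G_def by (intro spatial_part_integral(1)[OF s] bounded_pborel_smooth_periodic smooth_periodic_dderiv sp)
  have "(LINT x|torus. spatial_part \<alpha> v D q j (conv (mode k 0) (v j)) (\<lambda>i. conv (mode k 0) (D i j)) (\<lambda>i l. conv (dderiv (axis i 1) (mode k 0)) (D l j)) x)
     = (LINT x|torus. v j x * mode k 0 x) * mode_rate \<alpha> v D q k 0 j + (LINT x|torus. v j x * mode k (- pi / 2) x) * mode_rate \<alpha> v D q k (- pi / 2) j" for j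
  proof -
    define c where "c = (LINT x|torus. v j x * mode k 0 x)"
    define d where "d = (LINT x|torus. v j x * mode k (- pi / 2) x)"
    note cm = conv_mode[OF P(4)[of j] k, folded c_def d_def]
    \<comment> \<open>Velocity, gradient and the remaining second derivatives all have coefficients \<open>c\<close> and \<open>d\<close>.\<close>
    have e1: "conv (mode k 0) (v j) = (\<lambda>x. c * mode k 0 x + d * mode k (- pi / 2) x)"
      by (rule ext) (simp add: cm mult.commute)
    have e2: "conv (mode k 0) (D i j) = (\<lambda>x. c * dderiv (axis i 1) (mode k 0) x + d * dderiv (axis i 1) (mode k (- pi / 2)) x)" for i
      by (rule ext) (simp add: conv_weak_derivative[OF s sp] dderiv_mode conv_cmult cm algebra_simps)
    have e3: "conv (dderiv (axis i 1) (mode k 0)) (D l j) = (\<lambda>x. c * dderiv (axis i 1) (dderiv (axis l 1) (mode k 0)) x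
        + d * dderiv (axis i 1) (dderiv (axis l 1) (mode k (- pi / 2))) x)" for i l
    proof
      fix x
      have "conv (dderiv (axis i 1) (mode k 0)) (D l j) x = (2 * pi * k $ i) * ((2 * pi * k $ l) * (mode k (0 + pi / 2 + pi / 2) x * c + mode k (0 + pi / 2 + pi / 2 - pi / 2) x * d))"
        unfolding conv_weak_derivative[OF s smooth_periodic_dderiv[OF sp]] dderiv_mode2[OF k] conv_cmult cm ..
      moreover have "0 + pi / 2 + pi / 2 - pi / 2 = - pi / 2 + pi / 2 + pi / 2" by simp
      ultimately show "conv (dderiv (axis i 1) (mode k 0)) (D l j) x = c * dderiv (axis i 1) (dderiv (axis l 1) (mode k 0)) x
        + d * dderiv (axis i 1) (dderiv (axis l 1) (mode k (- pi / 2))) x"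
        unfolding dderiv_mode2[OF k] by (simp only: distrib_left mult_ac)
    qed
    have "(LINT x|torus. c * G 0 j x + d * G (- pi / 2) j x) = c * (LINT x|torus. G 0 j x) + d * (LINT x|torus. G (- pi / 2) j x)"
      by (subst Bochner_Integration.integral_add[OF integrable_mult_right[OF iG] integrable_mult_right[OF iG]]) (simp only: integral_mult_right_zero)
    then show ?thesis
      unfolding e1 e2 e3 spatial_part_linear mode_rate_def c_def[symmetric] d_def[symmetric] G_def .
  qed
  then show ?thesis unfolding flux_def by (simp only:)
qed

lemma divergence_mode:
  assumes s: "state v D q" and k: "k \<in> int_vec"
    and z: "\<And>a. a \<in> {0, - pi / 2} \<Longrightarrow> (\<Sum>i\<in>UNIV. LINT x|torus. v i x * dderiv (axis i 1) (mode k (a - pi / 2)) x) = 0"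
  shows "(\<Sum>j\<in>UNIV. conv (mode k 0) (D j j) x) = 0"
proof -
  note P = stateD[OF s] and sp = mode_smooth_periodic[OF k]
  have z': "(\<Sum>i\<in>UNIV. (2 * pi * k $ i) * (LINT x|torus. v i x * mode k a x)) = 0" if "a \<in> {0, - pi / 2}" for a
    using z[OF that] unfolding dderiv_mode mult.left_commute[of "v _ _" "2 * pi * k $ _"] integral_mult_right_zero by simp
  have "conv (mode k 0) (D j j) x = mode k (0 + pi / 2) x * ((2 * pi * k $ j) * (LINT x|torus. v j x * mode k 0 x))
      + mode k (0 + pi / 2 - pi / 2) x * ((2 * pi * k $ j) * (LINT x|torus. v j x * mode k (- pi / 2) x))" for j
    unfolding conv_weak_derivative[OF s sp] dderiv_mode conv_cmult conv_mode[OF P(4) k] by (simp only: distrib_left mult_ac)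
  moreover have "(\<Sum>i\<in>UNIV. (2 * pi * k $ i) * (LINT x|torus. v i x * mode k 0 x)) = 0"
    "(\<Sum>i\<in>UNIV. (2 * pi * k $ i) * (LINT x|torus. v i x * mode k (- pi / 2) x)) = 0" by (rule z', simp)+
  ultimately show ?thesis by (simp only: sum.distrib sum_distrib_left[symmetric] mult_zero_right add_0)
qed

section \<open>Product test functions\<close>

text \<open>A scalar test function is the case \<open>e = 1\<close>.\<close>

definition product_field :: "'b::real_normed_vector \<Rightarrow> (real \<Rightarrow> real) \<Rightarrow> (vec3 \<Rightarrow> real) \<Rightarrow> vec3 \<times> real \<Rightarrow> 'b" where
  "product_field e \<eta> \<phi> = (\<lambda>z. (\<eta> (snd z) * \<phi> (fst z)) *\<^sub>R e)"

lemma product_field_smooth: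
  assumes \<eta>: "smooth \<eta>" and \<phi>: "smooth \<phi>"
  shows "smooth (product_field e \<eta> \<phi>)" "dt (product_field e \<eta> \<phi>) = product_field e (dderiv 1 \<eta>) \<phi>"
    "dx i (product_field e \<eta> \<phi>) = product_field e \<eta> (dderiv (axis i 1) \<phi>)"
proof -
  have s: "smooth (\<lambda>z::vec3 \<times> real. \<eta> (snd z) * \<phi> (fst z))"
    by (rule smooth_mult[OF smooth_snd(1)[OF \<eta>] smooth_fst(1)[OF \<phi>]])
  show "smooth (product_field e \<eta> \<phi>)" unfolding product_field_def by (rule smooth_scaleR[OF s])
  have z: "dderiv 0 f x = 0" if "smooth f" for f :: "'c::euclidean_space \<Rightarrow> real" and x
    by (rule linear_0[OF dderiv_linear[OF that]])
  have d: "dderiv w (product_field e \<eta> \<phi>) = (\<lambda>z. (\<eta> (snd z) * dderiv (fst w) \<phi> (fst z) + dderiv (snd w) \<eta> (snd z) * \<phi> (fst z)) *\<^sub>R e)" for w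
    unfolding product_field_def dderiv_scaleR[OF s] dderiv_mult[OF smooth_snd(1)[OF \<eta>] smooth_fst(1)[OF \<phi>]] smooth_snd(2)[OF \<eta>] smooth_fst(2)[OF \<phi>] ..
  show "dt (product_field e \<eta> \<phi>) = product_field e (dderiv 1 \<eta>) \<phi>"
    unfolding dt_def d unfolding fst_conv snd_conv z[OF \<phi>] product_field_def by simp
  show "dx i (product_field e \<eta> \<phi>) = product_field e \<eta> (dderiv (axis i 1) \<phi>)"
    unfolding dx_def d unfolding fst_conv snd_conv z[OF \<eta>] product_field_def by simp
qed

lemma product_field_test:
  assumes \<eta>: "test_time T \<eta>" and \<phi>: "smooth_periodic \<phi>"
  shows "product_field e \<eta> \<phi> \<in> test_functions T"
proof -
  obtain a b where ab: "0 < a" "b < T" "\<And>t. t \<notin> {a..b} \<Longrightarrow> \<eta> t = 0" and s: "smooth \<eta>"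
    using \<eta> unfolding test_time_def by blast
  have "periodic (\<lambda>x. product_field e \<eta> \<phi> (x, t))" for t
    using \<phi> unfolding product_field_def smooth_periodic_def by (simp add: periodic_def)
  moreover have "\<exists>K. compact K \<and> K \<subseteq> {0<..<T} \<and> (\<forall>x t. t \<notin> K \<longrightarrow> product_field e \<eta> \<phi> (x, t) = 0)"
    by (rule exI[of _ "{a..b}"]) (use ab in \<open>auto simp: product_field_def\<close>)
  ultimately show ?thesis
    using product_field_smooth(1)[OF s] \<phi> unfolding test_functions_def smooth_periodic_def by blast
qed

lemma sum_single: "(\<And>i. i \<noteq> j \<Longrightarrow> F i = 0) \<Longrightarrow> sum F (UNIV :: 'a::finite set) = (F j :: real)"
  by (simp add: sum.remove[of UNIV j])

text \<open>Only the component \<open>j\<close> of the test field is nonzero, which collapses one sum in each term; time derivatives and spatial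
  derivatives separate because the test field is a product.\<close>

lemma weak_integrand_product:
  assumes \<eta>: "smooth \<eta>" and \<phi>: "smooth \<phi>"
  shows "weak_integrand \<alpha> u p (product_field (axis j 1) \<eta> \<phi>) t x =
    dderiv 1 \<eta> t * (u t x $ j * \<phi> x + \<alpha>\<^sup>2 * (\<Sum>l\<in>UNIV. weak_deriv l j (u t) x * dderiv (axis l 1) \<phi> x))
    + \<eta> t * spatial_part \<alpha> (\<lambda>i x. u t x $ i) (\<lambda>l i. weak_deriv l i (u t)) (p t) j \<phi> (\<lambda>i. dderiv (axis i 1) \<phi>)
        (\<lambda>i l. dderiv (axis i 1) (dderiv (axis l 1) \<phi>)) x"
proof -
  define U where "U i = u t x $ i" for i
  define D where "D l i = weak_deriv l i (u t) x" for l i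
  have \<phi>': "smooth (dderiv (axis l 1) \<phi>)" for l by (rule smooth_dderiv[OF \<phi>])
  have \<eta>': "smooth (dderiv 1 \<eta>)" by (rule smooth_dderiv[OF \<eta>])
  note f = product_field_smooth(2,3)[OF \<eta> \<phi>] product_field_smooth(3)[OF \<eta> \<phi>'] product_field_smooth(3)[OF \<eta>' \<phi>]
  have c: "product_field (axis j 1) h g (x, t) $ i = (if i = j then h t * g x else 0)" for h g i
    by (simp add: product_field_def axis_def)
  have s1: "(\<Sum>i\<in>UNIV. A i * (if i = j then c else 0)) = A j * c" for A :: "3 \<Rightarrow> real" and c
    by (subst sum_single[of j]) auto
  have s2: "(\<Sum>i\<in>UNIV. \<Sum>l\<in>UNIV. A i l * (if l = j then c i else 0)) = (\<Sum>i\<in>UNIV. A i j * c i)" for A :: "3 \<Rightarrow> 3 \<Rightarrow> real" and c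
    by (simp only: s1)
  have s3: "(\<Sum>i\<in>UNIV. \<Sum>l\<in>UNIV. \<Sum>k\<in>UNIV. A i l k * (if l = j then c i k else 0)) = (\<Sum>i\<in>UNIV. \<Sum>k\<in>UNIV. A i j k * c i k)" for A :: "3 \<Rightarrow> 3 \<Rightarrow> 3 \<Rightarrow> real" and c
    by (rule sum.cong[OF refl], subst sum_single[of j]) auto
  have s4: "(\<Sum>i\<in>UNIV. \<Sum>l\<in>UNIV. A i l * (if i = j then c else 0)) = (\<Sum>l\<in>UNIV. A j l * c)" for A :: "3 \<Rightarrow> 3 \<Rightarrow> real" and c
    by (subst sum_single[of j]) auto
  have s5: "(\<Sum>i\<in>UNIV. \<Sum>l\<in>UNIV. \<Sum>k\<in>UNIV. A i l k * (if i = j then c i l k else 0)) = (\<Sum>l\<in>UNIV. \<Sum>k\<in>UNIV. A j l k * c j l k)" for A c :: "3 \<Rightarrow> 3 \<Rightarrow> 3 \<Rightarrow> real"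
    by (subst sum_single[of j]) auto
  have s6: "(\<Sum>i\<in>UNIV. if i = j then c i else 0) = c j" for c :: "3 \<Rightarrow> real"
    by (subst sum_single[of j]) auto
  have "weak_integrand \<alpha> u p (product_field (axis j 1) \<eta> \<phi>) t x =
      U j * (dderiv 1 \<eta> t * \<phi> x)
     + \<alpha>\<^sup>2 * (\<Sum>l\<in>UNIV. D l j * (dderiv 1 \<eta> t * dderiv (axis l 1) \<phi> x))
     + (\<Sum>i\<in>UNIV. U i * U j * (\<eta> t * dderiv (axis i 1) \<phi> x))
     + \<alpha>\<^sup>2 * (\<Sum>i\<in>UNIV. \<Sum>l\<in>UNIV. D l i * D l j * (\<eta> t * dderiv (axis i 1) \<phi> x))
     + \<alpha>\<^sup>2 * (\<Sum>i\<in>UNIV. \<Sum>l\<in>UNIV. U i * D l j * (\<eta> t * dderiv (axis i 1) (dderiv (axis l 1) \<phi>) x))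
     - (\<Sum>i\<in>UNIV. U i * D j i * (\<eta> t * \<phi> x))
     - \<alpha>\<^sup>2 * (\<Sum>i\<in>UNIV. \<Sum>l\<in>UNIV. D l i * D j i * (\<eta> t * dderiv (axis l 1) \<phi> x))
     + 1 / 2 * \<alpha>\<^sup>2 * (\<Sum>i\<in>UNIV. \<Sum>l\<in>UNIV. D l i * D l i * (\<eta> t * dderiv (axis j 1) \<phi> x))
     + p t x * (\<eta> t * dderiv (axis j 1) \<phi> x)"
    unfolding weak_integrand_def Let_def f c s1 s2 s3 s4 s5 s6 U_def[symmetric] D_def[symmetric] ..
  also have "\<dots> = dderiv 1 \<eta> t * (U j * \<phi> x + \<alpha>\<^sup>2 * (\<Sum>l\<in>UNIV. D l j * dderiv (axis l 1) \<phi> x))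
    + \<eta> t * ((\<Sum>i\<in>UNIV. U i * U j * dderiv (axis i 1) \<phi> x)
     + \<alpha>\<^sup>2 * (\<Sum>i\<in>UNIV. \<Sum>l\<in>UNIV. D l i * D l j * dderiv (axis i 1) \<phi> x)
     + \<alpha>\<^sup>2 * (\<Sum>i\<in>UNIV. \<Sum>l\<in>UNIV. U i * D l j * dderiv (axis i 1) (dderiv (axis l 1) \<phi>) x)
     - (\<Sum>i\<in>UNIV. U i * D j i * \<phi> x)
     - \<alpha>\<^sup>2 * (\<Sum>i\<in>UNIV. \<Sum>l\<in>UNIV. D l i * D j i * dderiv (axis l 1) \<phi> x)
     + \<alpha>\<^sup>2 / 2 * (\<Sum>i\<in>UNIV. \<Sum>l\<in>UNIV. D l i * D l i * dderiv (axis j 1) \<phi> x)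
     + p t x * dderiv (axis j 1) \<phi> x)"
    unfolding mult.left_commute[of _ "\<eta> t"] mult.left_commute[of _ "dderiv 1 \<eta> t"] sum_distrib_left[symmetric]
    by (simp add: algebra_simps)
  finally show ?thesis unfolding spatial_part_def U_def D_def .
qed

section \<open>Borel representatives of the solution\<close>

definition representative :: "(vec3 \<Rightarrow> real) \<Rightarrow> vec3 \<Rightarrow> real" where
  "representative f = (SOME g. rep f g)"

lemma representative: "periodic f \<Longrightarrow> f \<in> borel_measurable torus \<Longrightarrow> rep f (representative f)"
  unfolding representative_def by (rule someI_ex[OF rep_exists])

definition velocity :: "(vec3 \<Rightarrow> vec3) \<Rightarrow> 3 \<Rightarrow> vec3 \<Rightarrow> real" where
  "velocity f j = representative (\<lambda>x. f x $ j)"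

definition gradient :: "(vec3 \<Rightarrow> vec3) \<Rightarrow> 3 \<Rightarrow> 3 \<Rightarrow> vec3 \<Rightarrow> real" where
  "gradient f k j = representative (weak_deriv k j f)"

lemma H1_rep:
  assumes f: "f \<in> H1"
  shows "rep (\<lambda>x. f x $ j) (velocity f j)" "rep (weak_deriv k j f) (gradient f k j)"
proof -
  show "rep (\<lambda>x. f x $ j) (velocity f j)" unfolding velocity_def
    by (rule representative[OF periodic_comp[OF H1_D(1)[OF f]]]) (use H1_D(4)[OF f, of j] in \<open>simp add: L2_def\<close>)
  show "rep (weak_deriv k j f) (gradient f k j)" unfolding gradient_def
    by (rule representative[OF H1_D(7)[OF f]]) (use H1_D(6)[OF f, of k j] in \<open>simp add: L2_def\<close>)
qed

lemma Lp_1_rep: "q \<in> Lp 1 \<Longrightarrow> rep q (representative q)"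
  unfolding Lp_1_iff by (blast intro: representative borel_measurable_integrable)

lemma H1_AE:
  assumes f: "f \<in> H1"
  shows "AE x in torus. \<forall>i. f x $ i = velocity f i x" "AE x in torus. \<forall>k j. weak_deriv k j f x = gradient f k j x"
  unfolding AE_all_countable using rep_AE[OF H1_rep(1)[OF f]] rep_AE[OF H1_rep(2)[OF f]] by blast+

lemma H1_state:
  assumes f: "f \<in> H1" and q: "q \<in> Lp 1"
  shows "state (velocity f) (gradient f) (representative q)"
  unfolding state_def
proof (intro conjI allI impI)
  fix k j
  show "PL 2 (velocity f j)" by (rule rep_PL[OF H1_rep(1)[OF f]]) (use H1_D(4)[OF f, of j] in \<open>simp add: L2_def\<close>)
  show "PL 2 (gradient f k j)" by (rule rep_PL[OF H1_rep(2)[OF f]]) (use H1_D(6)[OF f, of k j] in \<open>simp add: L2_def\<close>)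
  show "PL 1 (representative q)" by (rule rep_PL[OF Lp_1_rep[OF q]]) (use q in \<open>simp add: Lp_1_iff\<close>)
  fix \<phi> :: "vec3 \<Rightarrow> real" assume \<phi>: "smooth_periodic \<phi>"
  have a: "AE x in torus. f x $ j * dderiv (axis k 1) \<phi> x = velocity f j x * dderiv (axis k 1) \<phi> x"
    using rep_AE[OF H1_rep(1)[OF f, of j]] by eventually_elim simp
  have b: "AE x in torus. weak_deriv k j f x * \<phi> x = gradient f k j x * \<phi> x"
    using rep_AE[OF H1_rep(2)[OF f, of k j]] by eventually_elim simp
  show "(LINT x|torus. velocity f j x * dderiv (axis k 1) \<phi> x) = - (LINT x|torus. gradient f k j x * \<phi> x)"
    using is_weak_derivD(5)[OF H1_D(5)[OF f] \<phi>, of j k] unfolding torus_integral_AE(2)[OF a] torus_integral_AE(2)[OF b] .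
qed

lemma solution_AE:
  assumes "euler_alpha_weak_solution \<alpha> T u p" shows "AE t in time T. u t \<in> H1 \<and> p t \<in> Lp 1"
proof -
  have "AE t in time T. u t \<in> H1" "AE t in time T. p t \<in> Lp 1"
    using assms unfolding euler_alpha_weak_solution_def Bochner_Linf_def strongly_measurable_def by blast+
  then show ?thesis by eventually_elim blast
qed

lemma Linf_time_spatial_part:
  assumes sol: "euler_alpha_weak_solution \<alpha> T u p" and \<alpha>: "\<alpha> > 0"
    and b: "bounded_pborel \<phi>" "\<And>i. bounded_pborel (d\<phi> i)" "\<And>i k. bounded_pborel (dd\<phi> i k)"
  shows "Linf_time T (\<lambda>t. LINT x|torus. velocity (u t) j x * \<phi> x)"
    and "Linf_time T (\<lambda>t. LINT x|torus. spatial_part \<alpha> (velocity (u t)) (gradient (u t)) (representative (p t)) j \<phi> d\<phi> dd\<phi> x)"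
proof -
  have uL: "u \<in> Bochner_Linf T H1 (H1_norm \<alpha>)" and pL: "p \<in> Bochner_Linf T (Lp 1) (Lp_norm 1)"
    using sol unfolding euler_alpha_weak_solution_def by blast+
  note good = solution_AE[OF sol]
  note comp = H1_lipschitz_component[OF \<alpha>] and wd = H1_lipschitz_weak_deriv[OF \<alpha>] and one = H1_lipschitz_const
  have tr: "Linf_time T (\<lambda>t. LINT x|torus. G t x)"
    if "Linf_time T (\<lambda>t. LINT x|torus. F t x)" "\<And>t. u t \<in> H1 \<Longrightarrow> p t \<in> Lp 1 \<Longrightarrow> AE x in torus. F t x = G t x" for F G :: "real \<Rightarrow> vec3 \<Rightarrow> real"
  proof (rule Linf_time_AE[OF that(1)])
    show "AE t in time T. (LINT x|torus. F t x) = (LINT x|torus. G t x)"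
      using good by eventually_elim (rule torus_integral_AE(2)[OF that(2)], auto)
  qed
  show "Linf_time T (\<lambda>t. LINT x|torus. velocity (u t) j x * \<phi> x)"
  proof (rule tr[OF Linf_time_quadratic[OF uL comp one b(1)]])
    fix t assume "u t \<in> H1"
    from H1_AE(1)[OF this] show "AE x in torus. u t x $ j * 1 * \<phi> x = velocity (u t) j x * \<phi> x" by eventually_elim simp
  qed
  have vv: "Linf_time T (\<lambda>t. LINT x|torus. velocity (u t) i x * velocity (u t) j x * c x)" if "bounded_pborel c" for i j c
  proof (rule tr[OF Linf_time_quadratic[OF uL comp comp that]])
    fix t assume "u t \<in> H1"
    from H1_AE(1)[OF this] show "AE x in torus. u t x $ i * u t x $ j * c x = velocity (u t) i x * velocity (u t) j x * c x" by eventually_elim simp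
  qed
  have vD: "Linf_time T (\<lambda>t. LINT x|torus. velocity (u t) i x * gradient (u t) k j x * c x)" if "bounded_pborel c" for i j k c
  proof (rule tr[OF Linf_time_quadratic[OF uL comp wd that]])
    fix t assume "u t \<in> H1"
    from H1_AE[OF this] show "AE x in torus. u t x $ i * weak_deriv k j (u t) x * c x = velocity (u t) i x * gradient (u t) k j x * c x" by eventually_elim simp
  qed
  have DD: "Linf_time T (\<lambda>t. LINT x|torus. gradient (u t) l i x * gradient (u t) k j x * c x)" if "bounded_pborel c" for i j k l c
  proof (rule tr[OF Linf_time_quadratic[OF uL wd wd that]])
    fix t assume "u t \<in> H1"
    from H1_AE(2)[OF this] show "AE x in torus. weak_deriv l i (u t) x * weak_deriv k j (u t) x * c x = gradient (u t) l i x * gradient (u t) k j x * c x" by eventually_elim simp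
  qed
  have q: "Linf_time T (\<lambda>t. LINT x|torus. representative (p t) x * c x)" if "bounded_pborel c" for c
  proof (rule tr[OF Linf_time_pressure[OF pL that]])
    fix t assume "p t \<in> Lp 1"
    from rep_AE[OF Lp_1_rep[OF this]] show "AE x in torus. p t x * c x = representative (p t) x * c x" by eventually_elim simp
  qed
  show "Linf_time T (\<lambda>t. LINT x|torus. spatial_part \<alpha> (velocity (u t)) (gradient (u t)) (representative (p t)) j \<phi> d\<phi> dd\<phi> x)"
  proof (rule Linf_time_AE)
    show "AE t in time T. 
      (\<Sum>i\<in>UNIV. LINT x|torus. velocity (u t) i x * velocity (u t) j x * d\<phi> i x)
    + \<alpha>\<^sup>2 * (\<Sum>i\<in>UNIV. \<Sum>k\<in>UNIV. LINT x|torus. gradient (u t) k i x * gradient (u t) k j x * d\<phi> i x)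
    + \<alpha>\<^sup>2 * (\<Sum>i\<in>UNIV. \<Sum>k\<in>UNIV. LINT x|torus. velocity (u t) i x * gradient (u t) k j x * dd\<phi> i k x)
    - (\<Sum>l\<in>UNIV. LINT x|torus. velocity (u t) l x * gradient (u t) j l x * \<phi> x)
    - \<alpha>\<^sup>2 * (\<Sum>l\<in>UNIV. \<Sum>k\<in>UNIV. LINT x|torus. gradient (u t) k l x * gradient (u t) j l x * d\<phi> k x)
    + \<alpha>\<^sup>2 / 2 * (\<Sum>l\<in>UNIV. \<Sum>k\<in>UNIV. LINT x|torus. gradient (u t) k l x * gradient (u t) k l x * d\<phi> j x)
    + (LINT x|torus. representative (p t) x * d\<phi> j x)
     = (LINT x|torus. spatial_part \<alpha> (velocity (u t)) (gradient (u t)) (representative (p t)) j \<phi> d\<phi> dd\<phi> x)"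
      using good
    proof eventually_elim
      case (elim t)
      show ?case by (rule spatial_part_integral(2)[OF H1_state b, symmetric]) (use elim in blast)+
    qed
  qed (intro Linf_time_add Linf_time_diff Linf_time_mult Linf_time_const Linf_time_sum vv vD DD q b)
qed

section \<open>The energy budget of a mode\<close>

text \<open>The balance \<open>e(t) = c + 2 \<integral> f\<close> for almost every time; the rate is integrable, so that the relation is linear in
  \<open>(e, f)\<close>.\<close>

definition budget :: "real \<Rightarrow> (real \<Rightarrow> real) \<Rightarrow> (real \<Rightarrow> real) \<Rightarrow> bool" where
  "budget T e f \<longleftrightarrow> integrable (time T) f \<and> (\<exists>c. AE t in time T. e t = c + 2 * indef T f t)"

lemma budget_add:
  assumes a: "budget T e f" and b: "budget T e' f'" shows "budget T (\<lambda>t. e t + e' t) (\<lambda>t. f t + f' t)"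
proof -
  obtain c c' where c: "AE t in time T. e t = c + 2 * indef T f t" "AE t in time T. e' t = c' + 2 * indef T f' t"
    and i: "integrable (time T) f" "integrable (time T) f'"
    using a b unfolding budget_def by blast
  have "AE t in time T. e t + e' t = (c + c') + 2 * indef T (\<lambda>t. f t + f' t) t"
    using c by eventually_elim (simp add: indef_add[OF i])
  then show ?thesis using Bochner_Integration.integrable_add[OF i] unfolding budget_def by blast
qed

lemma budget_cmult:
  assumes a: "budget T e f" shows "budget T (\<lambda>t. r * e t) (\<lambda>t. r * f t)"
proof -
  obtain c where c: "AE t in time T. e t = c + 2 * indef T f t" and i: "integrable (time T) f"
    using a unfolding budget_def by blast
  have "AE t in time T. r * e t = r * c + 2 * indef T (\<lambda>t. r * f t) t"
    using c by eventually_elim (simp add: indef_cmult algebra_simps)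
  then show ?thesis using integrable_mult_right[OF i] unfolding budget_def by blast
qed

lemma budget_sum:
  assumes "\<And>j. budget T (e j) (f j)" shows "budget T (\<lambda>t. \<Sum>j\<in>(UNIV::3 set). e j t) (\<lambda>t. \<Sum>j\<in>UNIV. f j t)"
  unfolding sum_3 by (intro budget_add assms)

lemma budget_AE:
  assumes a: "budget T e f" and e: "AE t in time T. e t = e' t" and f: "AE t in time T. f t = f' t" shows "budget T e' f'"
proof -
  obtain c where c: "AE t in time T. e t = c + 2 * indef T f t" and i: "integrable (time T) f"
    using a unfolding budget_def by blast
  have ie: "indef T f t = indef T f' t" for t
    unfolding indef_def by (rule time_integral_AE(2)) (use f in eventually_elim, simp)
  have "AE t in time T. e' t = c + 2 * indef T f' t" using c e by eventually_elim (simp add: ie)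
  moreover have "integrable (time T) f'" using i time_integral_AE(1)[OF f] by blast
  ultimately show ?thesis unfolding budget_def by blast
qed

text \<open>Integrating the weak formulation in space, and moving the derivatives of the gradient terms onto the mode, identifies
  \<open>mode_rate\<close> as the weak time derivative of the mode times \<open>mode_weight\<close>.\<close>

lemma mode_budget:
  assumes sol: "euler_alpha_weak_solution \<alpha> T u p" and \<alpha>: "\<alpha> > 0" and T: "T > 0" and k: "k \<in> int_vec"
  shows "budget T (\<lambda>t. mode_weight \<alpha> k * (LINT x|torus. velocity (u t) j x * mode k a x)\<^sup>2)
    (\<lambda>t. (LINT x|torus. velocity (u t) j x * mode k a x) * mode_rate \<alpha> (velocity (u t)) (gradient (u t)) (representative (p t)) k a j)"
proof -
  note sp = mode_smooth_periodic[OF k]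
  have sm: "smooth (mode k a)" using sp by (simp add: smooth_periodic_def)
  define r where "r = mode_weight \<alpha> k"
  define f where "f t = (LINT x|torus. velocity (u t) j x * mode k a x)" for t
  define g where "g t = mode_rate \<alpha> (velocity (u t)) (gradient (u t)) (representative (p t)) k a j" for t
  have bps: "bounded_pborel (mode k a)" "\<And>i. bounded_pborel (dderiv (axis i 1) (mode k a))" "\<And>i l. bounded_pborel (dderiv (axis i 1) (dderiv (axis l 1) (mode k a)))"
    by (intro bounded_pborel_smooth_periodic smooth_periodic_dderiv sp)+
  have fL: "Linf_time T f" and gL: "Linf_time T g"
    unfolding f_def g_def mode_rate_def by (rule Linf_time_spatial_part[OF sol \<alpha> bps])+
  have weak: "(LINT t|time T. (r * f t) * dderiv 1 \<eta> t + g t * \<eta> t) = 0" if \<eta>: "test_time T \<eta>" for \<eta>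
  proof -
    have sm\<eta>: "smooth \<eta>" using \<eta> by (simp add: test_time_def)
    have "(LINT t|time T. LINT x|torus. weak_integrand \<alpha> u p (product_field (axis j 1) \<eta> (mode k a)) t x) = 0"
      using sol product_field_test[OF \<eta> sp, of "axis j 1" a] unfolding euler_alpha_weak_solution_def by blast
    moreover have ae': "AE t in time T. (LINT x|torus. weak_integrand \<alpha> u p (product_field (axis j 1) \<eta> (mode k a)) t x) = (r * f t) * dderiv 1 \<eta> t + g t * \<eta> t"
      using solution_AE[OF sol]
    proof eventually_elim
      case (elim t)
      then have H: "u t \<in> H1" and q: "p t \<in> Lp 1" by blast+
      define v where "v = velocity (u t)"
      define D where "D = gradient (u t)"
      define Q where "Q = representative (p t)"
      have s: "state v D Q" unfolding v_def D_def Q_def by (rule H1_state[OF H q])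
      note P = stateD[OF s]
      define G where "G = spatial_part \<alpha> v D Q j (mode k a) (\<lambda>i. dderiv (axis i 1) (mode k a)) (\<lambda>i l. dderiv (axis i 1) (dderiv (axis l 1) (mode k a)))"
      define A where "A x = v j x * mode k a x + \<alpha>\<^sup>2 * (\<Sum>l\<in>UNIV. D l j x * dderiv (axis l 1) (mode k a) x)" for x
      have ae: "AE x in torus. weak_integrand \<alpha> u p (product_field (axis j 1) \<eta> (mode k a)) t x = dderiv 1 \<eta> t * A x + \<eta> t * G x"
        using H1_AE(1)[OF H] H1_AE(2)[OF H] rep_AE[OF Lp_1_rep[OF q]]
      proof eventually_elim
        case (elim x)
        show ?case
          unfolding weak_integrand_product[OF sm\<eta> sm] A_def G_def spatial_part_def v_def D_def Q_def
          using elim by simp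
      qed
      have iG: "integrable torus G" unfolding G_def by (rule spatial_part_integral(1)[OF s bps])
      have i1: "integrable torus (\<lambda>x. v j x * mode k a x)" by (rule integrable_mult_bounded_pborel[OF P(4) bps(1)])
      have i2: "integrable torus (\<lambda>x. D l j x * dderiv (axis l 1) (mode k a) x)" for l by (rule integrable_mult_bounded_pborel[OF P(5) bps(2)])
      have iA: "integrable torus A"
        unfolding A_def[abs_def] by (intro Bochner_Integration.integrable_add integrable_mult_right Bochner_Integration.integrable_sum i1 i2)
      have w: "(LINT x|torus. D l j x * dderiv (axis l 1) (mode k a) x) = (2 * pi * k $ l)\<^sup>2 * f t" for l
        using P(6)[OF smooth_periodic_dderiv[OF sp], of j l "axis l 1" a]
        unfolding dderiv_mode2[OF k] mode_half_turn(1) f_def v_def[symmetric] power2_eq_square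
        by (simp add: mult.left_commute[of "v j _"] mult.assoc)
      have "integral\<^sup>L torus A = f t + \<alpha>\<^sup>2 * (\<Sum>l\<in>UNIV. (2 * pi * k $ l)\<^sup>2 * f t)"
      proof -
        have "has_bochner_integral torus A (f t + \<alpha>\<^sup>2 * (\<Sum>l\<in>UNIV. LINT x|torus. D l j x * dderiv (axis l 1) (mode k a) x))"
          unfolding A_def[abs_def] f_def v_def[symmetric]
          by (intro has_bochner_integral_add has_bochner_integral_mult_right has_bochner_integral_sum has_bochner_integral_integrable i1 i2)
        then show ?thesis unfolding w by (rule has_bochner_integral_integral_eq)
      qed
      also have "\<dots> = r * f t" unfolding r_def mode_weight_def sum_distrib_right[symmetric] by (simp add: algebra_simps)
      finally have A: "integral\<^sup>L torus A = r * f t" .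
      have "(LINT x|torus. dderiv 1 \<eta> t * A x + \<eta> t * G x) = dderiv 1 \<eta> t * integral\<^sup>L torus A + \<eta> t * integral\<^sup>L torus G"
        by (subst Bochner_Integration.integral_add[OF integrable_mult_right[OF iA] integrable_mult_right[OF iG]]) (simp only: integral_mult_right_zero)
      also have "integral\<^sup>L torus G = g t" unfolding G_def g_def mode_rate_def v_def D_def Q_def ..
      finally show ?case using torus_integral_AE(2)[OF ae] A by (simp add: mult.commute)
    qed
    ultimately show ?thesis unfolding time_integral_AE(2)[OF ae'] by simp
  qed
  \<comment> \<open>The product rule applies to the weighted mode \<open>r * f\<close>; one factor \<open>r\<close> is divided out again.\<close>
  have r: "r > 0" unfolding r_def by (rule mode_weight_pos)
  have rf: "Linf_time T (\<lambda>t. r * f t)" by (rule Linf_time_mult[OF Linf_time_const fL])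
  obtain c where c: "AE t in time T. (r * f t)\<^sup>2 = c + 2 * indef T (\<lambda>s. (r * f s) * g s) t"
    using weak_derivative_square[OF Linf_time_integrable[OF rf] Linf_time_integrable[OF gL] T Linf_time_integrable[OF Linf_time_mult[OF rf gL]] weak] by blast
  then have "budget T (\<lambda>t. (r * f t)\<^sup>2) (\<lambda>t. (r * f t) * g t)"
    unfolding budget_def using Linf_time_integrable[OF Linf_time_mult[OF rf gL]] by blast
  from budget_cmult[OF this, of "1 / r"] have "budget T (\<lambda>t. 1 / r * (r * f t)\<^sup>2) (\<lambda>t. 1 / r * ((r * f t) * g t))" .
  moreover have "1 / r * (r * f t)\<^sup>2 = r * (f t)\<^sup>2" "1 / r * ((r * f t) * g t) = f t * g t" for t
    using r by (simp_all add: power2_eq_square)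
  ultimately show ?thesis unfolding r_def f_def g_def by simp
qed

text \<open>Energy and flux are linear in the kernel, and for a single cosine they are sums over the cosine and sine modes of
  each component.\<close>

lemma trig_budget:
  assumes sol: "euler_alpha_weak_solution \<alpha> T u p" and \<alpha>: "\<alpha> > 0" and T: "T > 0" and S: "trig S"
  shows "budget T (\<lambda>t. energy \<alpha> S (velocity (u t)) (gradient (u t))) (\<lambda>t. flux \<alpha> S (velocity (u t)) (gradient (u t)) (representative (p t)))"
  using S
proof induction
  case (trig_cos k)
  have e: "(\<lambda>h. cos (2 * pi * (k \<bullet> h))) = mode k 0" by (simp add: mode_def)
  show ?case unfolding e
  proof (rule budget_AE[OF budget_sum[OF budget_add[OF mode_budget[OF sol \<alpha> T trig_cos, where a=0] mode_budget[OF sol \<alpha> T trig_cos, where a="- pi / 2"]]]])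
    show "AE t in time T. (\<Sum>j\<in>UNIV. mode_weight \<alpha> k * (LINT x|torus. velocity (u t) j x * mode k 0 x)\<^sup>2
        + mode_weight \<alpha> k * (LINT x|torus. velocity (u t) j x * mode k (- pi / 2) x)\<^sup>2) = energy \<alpha> (mode k 0) (velocity (u t)) (gradient (u t))"
      using solution_AE[OF sol]
    proof eventually_elim
      case (elim t)
      then show ?case by (intro energy_mode[OF H1_state trig_cos, symmetric]) blast+
    qed
    show "AE t in time T. (\<Sum>j\<in>UNIV. (LINT x|torus. velocity (u t) j x * mode k 0 x) * mode_rate \<alpha> (velocity (u t)) (gradient (u t)) (representative (p t)) k 0 j
        + (LINT x|torus. velocity (u t) j x * mode k (- pi / 2) x) * mode_rate \<alpha> (velocity (u t)) (gradient (u t)) (representative (p t)) k (- pi / 2) j)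
       = flux \<alpha> (mode k 0) (velocity (u t)) (gradient (u t)) (representative (p t))"
      using solution_AE[OF sol]
    proof eventually_elim
      case (elim t)
      then show ?case by (intro flux_mode[OF H1_state trig_cos, symmetric]) blast+
    qed
  qed
next
  case (trig_add S S')
  note sp = trig_smooth_periodic[OF trig_add(1)] trig_smooth_periodic[OF trig_add(2)]
  show ?case
  proof (rule budget_AE[OF budget_add[OF trig_add(3,4)]])
    show "AE t in time T. energy \<alpha> S (velocity (u t)) (gradient (u t)) + energy \<alpha> S' (velocity (u t)) (gradient (u t)) = energy \<alpha> (\<lambda>h. S h + S' h) (velocity (u t)) (gradient (u t))"
      using solution_AE[OF sol]
    proof eventually_elim
      case (elim t)
      then have "state (velocity (u t)) (gradient (u t)) (representative (p t))" by (intro H1_state) blast+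
      from flux_add(2)[OF this sp] show ?case by simp
    qed
    show "AE t in time T. flux \<alpha> S (velocity (u t)) (gradient (u t)) (representative (p t)) + flux \<alpha> S' (velocity (u t)) (gradient (u t)) (representative (p t))
       = flux \<alpha> (\<lambda>h. S h + S' h) (velocity (u t)) (gradient (u t)) (representative (p t))"
      using solution_AE[OF sol]
    proof eventually_elim
      case (elim t)
      then have "state (velocity (u t)) (gradient (u t)) (representative (p t))" by (intro H1_state) blast+
      from flux_add(1)[OF this sp] show ?case by simp
    qed
  qed
next
  case (trig_cmult S c)
  show ?case
    unfolding flux_cmult[OF trig_smooth_periodic[OF trig_cmult(1)]] by (rule budget_cmult[OF trig_cmult(2)])
qed

text \<open>Bumps with sharpening flanks are test functions that converge boundedly to indicators of intervals.\<close>

lemma AE_zero_if_test_zero: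
  assumes h: "integrable (time T) h" and T: "T > 0"
    and z: "\<And>\<eta>. test_time T \<eta> \<Longrightarrow> (LINT t|time T. h t * \<eta> t) = 0"
  shows "AE t in time T. h t = 0"
proof (rule AE_zero_if_intervals_zero[OF h T])
  fix a b :: real assume ab: "0 < a" "b < T"
  let ?s = "\<lambda>n t. h t * bump (1 / real (Suc n)) a b t"
  have m: "bump (1 / real (Suc n)) a b \<in> borel_measurable borel" for n
    by (intro borel_measurable_continuous_onI smooth_continuous bump_smooth) simp
  have "(\<lambda>n. LINT t|time T. ?s n t) \<longlonglongrightarrow> (LINT t|time T. h t * (if a < t \<and> t < b then 1 else 0))"
  proof (rule integral_dominated_convergence[where w="\<lambda>t. \<bar>h t\<bar>"])
    have "(\<lambda>t. if a < t \<and> t < b then 1 else 0 :: real) \<in> borel_measurable borel" by measurable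
    then show "(\<lambda>t. h t * (if a < t \<and> t < b then 1 else 0)) \<in> borel_measurable (time T)"
      by (intro borel_measurable_times borel_measurable_integrable[OF h] measurable_time)
    show "?s n \<in> borel_measurable (time T)" for n
      by (intro borel_measurable_times borel_measurable_integrable[OF h] measurable_time m)
    show "integrable (time T) (\<lambda>t. \<bar>h t\<bar>)" using h by simp
    show "AE t in time T. (\<lambda>n. ?s n t) \<longlonglongrightarrow> h t * (if a < t \<and> t < b then 1 else 0)"
      by (intro AE_I2 tendsto_mult tendsto_const bump_tendsto)
    show "AE t in time T. norm (?s n t) \<le> \<bar>h t\<bar>" for n
    proof (rule AE_I2)
      fix t
      have "\<bar>bump (1 / real (Suc n)) a b t\<bar> \<le> 1" using bump_bounds[of "1 / real (Suc n)" a b t] by simp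
      from mult_left_mono[OF this abs_ge_zero[of "h t"]] show "norm (?s n t) \<le> \<bar>h t\<bar>" by (simp add: abs_mult)
    qed
  qed
  moreover have "(LINT t|time T. ?s n t) = 0" for n by (rule z[OF bump_test]) (use ab in auto)
  ultimately have "(\<lambda>n. 0) \<longlonglongrightarrow> (LINT t|time T. h t * (if a < t \<and> t < b then 1 else 0))" by (simp only:)
  then show "(LINT t|time T. h t * (if a < t \<and> t < b then 1 else 0)) = 0" by (simp add: LIMSEQ_const_iff)
qed

lemma solution_divergence_mode:
  assumes sol: "euler_alpha_weak_solution \<alpha> T u p" and \<alpha>: "\<alpha> > 0" and T: "T > 0" and \<phi>: "smooth_periodic \<phi>"
  shows "AE t in time T. (\<Sum>i\<in>UNIV. LINT x|torus. velocity (u t) i x * dderiv (axis i 1) \<phi> x) = 0"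
proof (rule AE_zero_if_test_zero[OF _ T])
  note b = bounded_pborel_smooth_periodic[OF smooth_periodic_dderiv[OF \<phi>]]
  show "integrable (time T) (\<lambda>t. \<Sum>i\<in>UNIV. LINT x|torus. velocity (u t) i x * dderiv (axis i 1) \<phi> x)"
    by (intro Linf_time_integrable Linf_time_sum Linf_time_spatial_part(1)[OF sol \<alpha> b b b])
  fix \<eta> assume \<eta>: "test_time T \<eta>"
  have sm: "smooth \<eta>" "smooth \<phi>" using \<eta> \<phi> by (auto simp: test_time_def smooth_periodic_def)
  have "(LINT t|time T. LINT x|torus. (\<Sum>i\<in>UNIV. u t x $ i * dx i (product_field (1::real) \<eta> \<phi>) (x, t))) = 0"
    using sol product_field_test[OF \<eta> \<phi>, of "1::real"] unfolding euler_alpha_weak_solution_def by blast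
  moreover have ae: "AE t in time T. (LINT x|torus. (\<Sum>i\<in>UNIV. u t x $ i * dx i (product_field (1::real) \<eta> \<phi>) (x, t)))
     = (\<Sum>i\<in>UNIV. LINT x|torus. velocity (u t) i x * dderiv (axis i 1) \<phi> x) * \<eta> t"
    using solution_AE[OF sol]
  proof eventually_elim
    case (elim t)
    then have H: "u t \<in> H1" and q: "p t \<in> Lp 1" by blast+
    note P = stateD[OF H1_state[OF H q]]
    have ae: "AE x in torus. (\<Sum>i\<in>UNIV. u t x $ i * dx i (product_field (1::real) \<eta> \<phi>) (x, t))
       = (\<Sum>i\<in>UNIV. velocity (u t) i x * dderiv (axis i 1) \<phi> x) * \<eta> t"
      using H1_AE(1)[OF H]
    proof eventually_elim
      case (elim x)
      have d: "dx i (product_field (1::real) \<eta> \<phi>) (x, t) = \<eta> t * dderiv (axis i 1) \<phi> x" for i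
        unfolding product_field_smooth(3)[OF sm] by (simp add: product_field_def)
      show ?case unfolding d sum_distrib_right
        by (intro sum.cong refl) (simp add: elim[rule_format] mult_ac)
    qed
    have "(LINT x|torus. (\<Sum>i\<in>UNIV. velocity (u t) i x * dderiv (axis i 1) \<phi> x)) = (\<Sum>i\<in>UNIV. LINT x|torus. velocity (u t) i x * dderiv (axis i 1) \<phi> x)"
      by (intro Bochner_Integration.integral_sum integrable_mult_bounded_pborel P b)
    then show ?case unfolding torus_integral_AE(2)[OF ae] integral_mult_left_zero by simp
  qed
  ultimately show "(LINT t|time T. (\<Sum>i\<in>UNIV. LINT x|torus. velocity (u t) i x * dderiv (axis i 1) \<phi> x) * \<eta> t) = 0"
    unfolding time_integral_AE(2)[OF ae] by simp
qed

text \<open>Proved by induction over the kernel, so that each kernel has its own null set of times; only the countably many kernels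
  \<open>vp m\<close> are used later.\<close>

lemma trig_divergence:
  assumes sol: "euler_alpha_weak_solution \<alpha> T u p" and \<alpha>: "\<alpha> > 0" and T: "T > 0" and S: "trig S"
  shows "AE t in time T. \<forall>x. (\<Sum>j\<in>UNIV. conv S (gradient (u t) j j) x) = 0"
  using S
proof induction
  case (trig_cos k)
  have e: "(\<lambda>h. cos (2 * pi * (k \<bullet> h))) = mode k 0" by (simp add: mode_def)
  note dm = solution_divergence_mode[OF sol \<alpha> T mode_smooth_periodic[OF trig_cos]]
  show ?case unfolding e
    using solution_AE[OF sol] dm[of "0 - pi / 2"] dm[of "- pi / 2 - pi / 2"]
  proof eventually_elim
    case (elim t)
    have "(\<Sum>j\<in>UNIV. conv (mode k 0) (gradient (u t) j j) x) = 0" for x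
    proof (rule divergence_mode[OF H1_state trig_cos])
      fix a :: real assume "a \<in> {0, - pi / 2}"
      then show "(\<Sum>i\<in>UNIV. LINT x|torus. velocity (u t) i x * dderiv (axis i 1) (mode k (a - pi / 2)) x) = 0"
        using elim(2,3) by blast
    qed (use elim(1) in blast)+
    then show ?case by blast
  qed
next
  case (trig_add S S')
  note sp = trig_smooth_periodic[OF trig_add(1)] trig_smooth_periodic[OF trig_add(2)]
  show ?case using solution_AE[OF sol] trig_add(3,4)
  proof eventually_elim
    case (elim t)
    then have "state (velocity (u t)) (gradient (u t)) (representative (p t))" by (intro H1_state) blast+
    note P = stateD(5)[OF this]
    show ?case unfolding conv_add[OF sp P] sum.distrib using elim(2,3) by simp
  qed
next
  case (trig_cmult S c)
  show ?case using trig_cmult(2)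
  proof eventually_elim
    case (elim t)
    then show ?case unfolding conv_cmult sum_distrib_left[symmetric] by simp
  qed
qed

section \<open>Besov bounds at a fixed time\<close>

definition equal_off_null :: "(vec3 \<Rightarrow> vec3) \<Rightarrow> (vec3 \<Rightarrow> vec3) \<Rightarrow> bool" where
  "equal_off_null f g \<longleftrightarrow> (\<exists>N\<in>null_sets lborel. \<forall>x. x \<notin> N \<longrightarrow> f x = g x)"

lemma equal_off_null_difference: assumes "equal_off_null f g" shows "equal_off_null (difference h f) (difference h g)"
proof -
  obtain N where N: "N \<in> null_sets lborel" "\<And>x. x \<notin> N \<Longrightarrow> f x = g x" using assms unfolding equal_off_null_def by blast
  have "{x. x + h \<in> N} \<in> null_sets lborel" using null_sets_translation[OF N(1), of "-h"] by simp
  then have "N \<union> {x. x + h \<in> N} \<in> null_sets lborel" using N(1) by blast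
  moreover have "difference h f x = difference h g x" if "x \<notin> N \<union> {x. x + h \<in> N}" for x
    using that N(2)[of x] N(2)[of "x + h"] by (simp add: difference_def)
  ultimately show ?thesis unfolding equal_off_null_def by blast
qed

lemma equal_off_null_funpow: "equal_off_null f g \<Longrightarrow> equal_off_null ((difference h ^^ n) f) ((difference h ^^ n) g)"
  by (induction n) (auto intro: equal_off_null_difference)

lemma equal_off_null_AE: assumes "equal_off_null f g" shows "AE x in torus. f x = g x"
proof -
  obtain N where N: "N \<in> null_sets lborel" "\<And>x. x \<notin> N \<Longrightarrow> f x = g x" using assms unfolding equal_off_null_def by blast
  show ?thesis using null_AE_torus[OF N(1), of 0] by eventually_elim (use N(2) in simp)
qed

lemma Lp_norm_L3_norm: assumes "equal_off_null f g" shows "Lp_norm 3 f = L3_norm g"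
proof -
  have ae: "AE x in torus. norm (f x) powr 3 = \<bar>norm (g x)\<bar> ^ 3"
    using equal_off_null_AE[OF assms] by eventually_elim (simp add: powr_three)
  have nn: "0 \<le> (LINT x|torus. \<bar>norm (g x)\<bar> ^ 3)" by (rule integral_nonneg_AE) simp
  have r: "y powr (1 / 3) = root 3 y" if "0 \<le> y" for y :: real
    using that root_powr_inverse[of 3 y] by (cases "y = 0") auto
  show ?thesis unfolding Lp_norm_def torus_integral_AE(2)[OF ae] r[OF nn] L3_norm_def n3_def ..
qed

text \<open>The Besov norm is computed from the Borel representatives, which agree with the field off a null set together with all
  higher differences. The factor of the norm is uniform in the field, hence in time.\<close>

lemma besov_bounds:
  assumes s: "s > 1"
  obtains K where "K \<ge> 0" "\<And>f. f \<in> H1 \<Longrightarrow> f \<in> Besov_inf s 3 \<Longrightarrow> 0 \<le> Besov_inf_norm s 3 f \<and> (\<forall>j. PL 3 (velocity f j) \<and> n3 (velocity f j) \<le> K * Besov_inf_norm s 3 f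
     \<and> (\<forall>h. n3 (\<lambda>x. velocity f j (x - h) - velocity f j x) \<le> K * Besov_inf_norm s 3 f * norm h))"
proof -
  obtain K where K: "K \<ge> 0" "\<And>g Q h. L3_field g \<Longrightarrow> Q \<ge> 0 \<Longrightarrow>
     (\<And>h. h \<noteq> 0 \<Longrightarrow> L3_norm ((difference h ^^ (nat \<lfloor>s\<rfloor> + 1)) g) \<le> Q * norm h powr s) \<Longrightarrow>
     L3_norm (difference h g) \<le> K * (Q + L3_norm g) * norm h" using marchaud[OF s] by blast
  have main: "0 \<le> Besov_inf_norm s 3 f \<and> (\<forall>j. PL 3 (velocity f j) \<and> n3 (velocity f j) \<le> (K + 1) * Besov_inf_norm s 3 f
     \<and> (\<forall>h. n3 (\<lambda>x. velocity f j (x - h) - velocity f j x) \<le> (K + 1) * Besov_inf_norm s 3 f * norm h))"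
    if f: "f \<in> H1" and B: "f \<in> Besov_inf s 3" for f
  proof -
    define g :: "vec3 \<Rightarrow> vec3" where "g x = (\<chi> j. velocity f j x)" for x
    have gj: "g x $ j = velocity f j x" for x j by (simp add: g_def)
    have pb: "pborel (velocity f j)" for j using H1_rep(1)[OF f, of j] unfolding rep_def by blast
    have "\<exists>N\<in>null_sets lborel. \<forall>x. x \<notin> N \<longrightarrow> f x $ j = velocity f j x" for j using H1_rep(1)[OF f, of j] unfolding rep_def by blast
    then obtain N where N: "\<And>j. N j \<in> null_sets lborel" "\<And>j x. x \<notin> N j \<Longrightarrow> f x $ j = velocity f j x" by metis
    have "N 1 \<union> N 2 \<union> N 3 \<in> null_sets lborel" using N(1) by blast
    moreover have "f x = g x" if "x \<notin> N 1 \<union> N 2 \<union> N 3" for x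
      using that N(2)[of x 1] N(2)[of x 2] N(2)[of x 3] by (simp add: vec_eq_iff forall_3 gj)
    ultimately have eq: "equal_off_null f g" unfolding equal_off_null_def by blast
    have gp: "periodic g" using pb unfolding pborel_def periodic_def g_def by simp
    have gm: "g \<in> borel_measurable borel"
    proof (subst borel_measurable_euclidean_space, rule ballI)
      fix i :: vec3 assume "i \<in> Basis"
      then obtain j where "i = axis j 1" by (auto simp: Basis_vec_def)
      then show "(\<lambda>x. g x \<bullet> i) \<in> borel_measurable borel" using pb[of j] by (simp add: inner_axis gj pborel_def)
    qed
    have ae: "AE x in torus. norm (f x) powr 3 = norm (g x) ^ 3"
      using equal_off_null_AE[OF eq] by eventually_elim (simp add: powr_three)
    have "integrable torus (\<lambda>x. norm (g x) ^ 3)"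
      using B torus_integral_AE(1)[OF ae] unfolding Besov_inf_def Lp_def by blast
    then have L3_field: "L3_field g" using gp gm unfolding L3_field_def by blast
    define Q where "Q = (SUP h\<in>- {0}. besov_quotient s 3 f h)"
    have bdd: "bdd_above (besov_quotient s 3 f ` (- {0}))" using B unfolding Besov_inf_def by simp
    have q0: "0 \<le> besov_quotient s 3 f h" for h unfolding besov_quotient_def Lp_norm_def by simp
    have qQ: "besov_quotient s 3 f h \<le> Q" if "h \<noteq> 0" for h
      unfolding Q_def by (rule cSUP_upper[OF _ bdd]) (use that in simp)
    have "axis 1 1 \<noteq> (0 :: vec3)" by simp
    from order_trans[OF q0 qQ[OF this]] have Q: "Q \<ge> 0" .
    have NQ: "Besov_inf_norm s 3 f = Q + L3_norm g" unfolding Besov_inf_norm_def Q_def Lp_norm_L3_norm[OF eq] by simp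
    define b where "b = Besov_inf_norm s 3 f"
    have b0: "0 \<le> b" "L3_norm g \<le> b" using Q L3_norm_nonneg[of g] unfolding b_def NQ by auto
    have d: "L3_norm (difference h g) \<le> K * b * norm h" for h
      unfolding b_def NQ
    proof (rule K(2)[OF L3_field Q])
      fix h :: vec3 assume h: "h \<noteq> 0"
      have e: "Lp_norm 3 ((difference h ^^ (nat \<lfloor>s\<rfloor> + 1)) f) = L3_norm ((difference h ^^ (nat \<lfloor>s\<rfloor> + 1)) g)"
        by (rule Lp_norm_L3_norm[OF equal_off_null_funpow[OF eq]])
      have "L3_norm ((difference h ^^ (nat \<lfloor>s\<rfloor> + 1)) g) = besov_quotient s 3 f h * norm h powr s"
        unfolding besov_quotient_def e using h by simp
      also have "\<dots> \<le> Q * norm h powr s" by (rule mult_right_mono[OF qQ[OF h]]) simp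
      finally show "L3_norm ((difference h ^^ (nat \<lfloor>s\<rfloor> + 1)) g) \<le> Q * norm h powr s" .
    qed
    have PLv: "PL 3 (velocity f j)" for j
      by (rule PL_dominated[OF pb L3_field_PL[OF L3_field]]) (use component_le_norm_cart[of "g _" j] in \<open>simp add: gj\<close>)
    have nvj: "n3 (velocity f j) \<le> L3_norm g" for j
      unfolding L3_norm_def by (rule n3_mono[OF PLv L3_field_PL[OF L3_field]]) (use component_le_norm_cart[of "g _" j] in \<open>simp add: gj\<close>)
    have ndj: "n3 (\<lambda>x. velocity f j (x - h) - velocity f j x) \<le> L3_norm (difference (- h) g)" for j h
      unfolding L3_norm_def
    proof (rule n3_mono[OF _ L3_field_PL[OF L3_field_difference(1)[OF L3_field]]])
      show "PL 3 (\<lambda>x. velocity f j (x - h) - velocity f j x)" by (rule PL_diff[OF PL_shift(1)[OF PLv] PLv])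
      show "\<bar>velocity f j (x - h) - velocity f j x\<bar> \<le> \<bar>norm (difference (- h) g x)\<bar>" for x
        using component_le_norm_cart[of "difference (- h) g x" j] by (simp add: difference_def gj)
    qed
    have "n3 (velocity f j) \<le> (K + 1) * b" for j
      using nvj[of j] b0 mult_nonneg_nonneg[OF K(1) b0(1)] by (simp add: distrib_right)
    moreover have "n3 (\<lambda>x. velocity f j (x - h) - velocity f j x) \<le> (K + 1) * b * norm h" for j h
    proof -
      have "n3 (\<lambda>x. velocity f j (x - h) - velocity f j x) \<le> K * b * norm h"
        using order_trans[OF ndj[of j h] d[of "- h"]] by simp
      moreover have "0 \<le> b * norm h" using b0(1) by simp
      ultimately show ?thesis by (simp add: distrib_right)
    qed
    ultimately show ?thesis using PLv b0 unfolding b_def by blast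
  qed
  \<comment> \<open>The summand 1 covers the norm of the field itself, \<open>K\<close> its increments.\<close>
  show thesis by (rule that[of "K + 1"]) (use K(1) main in auto)
qed

section \<open>Conservation of energy\<close>

lemma H1_norm_velocity:
  assumes f: "f \<in> H1"
  shows "(H1_norm \<alpha> f)\<^sup>2 = (\<Sum>j\<in>UNIV. LINT x|torus. velocity f j x * velocity f j x)
     + \<alpha>\<^sup>2 * (\<Sum>k\<in>UNIV. \<Sum>j\<in>UNIV. LINT x|torus. gradient f k j x * gradient f k j x)"
proof -
  have v: "AE x in torus. (f x $ j)\<^sup>2 = velocity f j x * velocity f j x" for j
    using rep_AE[OF H1_rep(1)[OF f, of j]] by eventually_elim (simp add: power2_eq_square)
  have D: "AE x in torus. (weak_deriv k j f x)\<^sup>2 = gradient f k j x * gradient f k j x" for k j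
    using rep_AE[OF H1_rep(2)[OF f, of k j]] by eventually_elim (simp add: power2_eq_square)
  show ?thesis unfolding H1_norm_square(1)[OF f] torus_integral_AE(2)[OF v] torus_integral_AE(2)[OF D] ..
qed

text \<open>The Lipschitz bound on increments makes the weak gradient cubically integrable with the same constant \<open>b\<close>, so velocity and
  gradient enter the flux estimates with one bound.\<close>

lemma regularized_balance:
  assumes f: "f \<in> H1" and q: "q \<in> Lp 1" and b: "b \<ge> 0"
    and v: "\<And>j. PL 3 (velocity f j)" "\<And>j. n3 (velocity f j) \<le> b"
    and L: "\<And>j h. n3 (\<lambda>x. velocity f j (x - h) - velocity f j x) \<le> b * norm h"
    and div: "\<And>m x. (\<Sum>j\<in>UNIV. conv (vp m) (gradient f j j) x) = 0"
  shows "\<bar>flux \<alpha> (vp m) (velocity f) (gradient f) (representative q)\<bar> \<le> (18 + 900 * \<alpha>\<^sup>2) * b ^ 3"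
    and "(\<lambda>m. flux \<alpha> (vp m) (velocity f) (gradient f) (representative q)) \<longlonglongrightarrow> 0"
    and "(\<lambda>m. energy \<alpha> (vp m) (velocity f) (gradient f)) \<longlonglongrightarrow> (H1_norm \<alpha> f)\<^sup>2"
proof -
  note s = H1_state[OF f q]
  have wd: "conv (vp m) (gradient f k j) x = conv (dderiv (axis k 1) (vp m)) (velocity f j) x" for k j m x
    by (rule conv_weak_derivative[OF s vp_smooth_periodic])
  have e: "norm (axis k 1 :: vec3) = 1" for k by simp
  note D = weak_deriv_L3[OF v(1) stateD(5)[OF s] b L e wd]
  note R = vp_flux_estimates[OF s b v D L div]
  show "\<bar>flux \<alpha> (vp m) (velocity f) (gradient f) (representative q)\<bar> \<le> (18 + 900 * \<alpha>\<^sup>2) * b ^ 3" by (rule R(1))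
  show "(\<lambda>m. flux \<alpha> (vp m) (velocity f) (gradient f) (representative q)) \<longlonglongrightarrow> 0" by (rule R(2))
  show "(\<lambda>m. energy \<alpha> (vp m) (velocity f) (gradient f)) \<longlonglongrightarrow> (H1_norm \<alpha> f)\<^sup>2"
    unfolding H1_norm_velocity[OF f] by (rule R(3))
qed

theorem theorem3p7:
  fixes \<alpha> T s :: real
    and u :: "real \<Rightarrow> real ^ 3 \<Rightarrow> real ^ 3"
    and p :: "real \<Rightarrow> real ^ 3 \<Rightarrow> real"
  assumes "\<alpha> > 0" and "T > 0" and "s > 1"
    and "euler_alpha_weak_solution \<alpha> T u p"
    and "u \<in> Bochner_Lp 3 T (Besov_inf s 3) (Besov_inf_norm s 3)"
  shows "AE t\<^sub>1 in time T. AE t\<^sub>2 in time T. H1_norm \<alpha> (u t\<^sub>1) = H1_norm \<alpha> (u t\<^sub>2)"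
proof -
  note \<alpha> = assms(1) and T = assms(2) and sol = assms(4)
  obtain K where K: "K \<ge> 0" "\<And>f. f \<in> H1 \<Longrightarrow> f \<in> Besov_inf s 3 \<Longrightarrow> 0 \<le> Besov_inf_norm s 3 f \<and> (\<forall>j. PL 3 (velocity f j) \<and> n3 (velocity f j) \<le> K * Besov_inf_norm s 3 f
     \<and> (\<forall>h. n3 (\<lambda>x. velocity f j (x - h) - velocity f j x) \<le> K * Besov_inf_norm s 3 f * norm h))"
    using besov_bounds[OF assms(3)] by blast
  define N where "N t = Besov_inf_norm s 3 (u t)" for t
  have Ni: "integrable (time T) (\<lambda>t. N t powr 3)" and B: "AE t in time T. u t \<in> Besov_inf s 3"
    using assms(5) unfolding Bochner_Lp_def strongly_measurable_def N_def by blast+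
  define F where "F m t = flux \<alpha> (vp m) (velocity (u t)) (gradient (u t)) (representative (p t))" for m t
  define E where "E m t = energy \<alpha> (vp m) (velocity (u t)) (gradient (u t))" for m t
  have bud: "budget T (E m) (F m)" for m
    unfolding E_def[abs_def] F_def[abs_def] by (rule trig_budget[OF sol \<alpha> T trig_vp])
  then have Fi: "integrable (time T) (F m)" for m unfolding budget_def by blast
  have "\<exists>c. AE t in time T. E m t = c + 2 * indef T (F m) t" for m using bud[of m] unfolding budget_def by blast
  then obtain c where c: "\<And>m. AE t in time T. E m t = c m + 2 * indef T (F m) t" by metis
  have "AE t in time T. \<forall>x. (\<Sum>j\<in>UNIV. conv (vp m) (gradient (u t) j j) x) = 0" for m
    by (rule trig_divergence[OF sol \<alpha> T trig_vp])
  then have div: "AE t in time T. \<forall>m x. (\<Sum>j\<in>UNIV. conv (vp m) (gradient (u t) j j) x) = 0"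
    unfolding AE_all_countable by blast
  have lim: "AE t in time T. (\<forall>m. \<bar>F m t\<bar> \<le> (18 + 900 * \<alpha>\<^sup>2) * K ^ 3 * (N t powr 3)) \<and> (\<lambda>m. F m t) \<longlonglongrightarrow> 0
      \<and> (\<lambda>m. E m t) \<longlonglongrightarrow> (H1_norm \<alpha> (u t))\<^sup>2"
    using solution_AE[OF sol] B div
  proof eventually_elim
    case (elim t)
    then have H: "u t \<in> H1" and q: "p t \<in> Lp 1" by blast+
    note k = K(2)[OF H elim(2), folded N_def]
    have b: "0 \<le> K * N t" using K(1) k by simp
    have e: "(18 + 900 * \<alpha>\<^sup>2) * (K * N t) ^ 3 = (18 + 900 * \<alpha>\<^sup>2) * K ^ 3 * (N t powr 3)"
      using k by (simp add: powr_three power_mult_distrib)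
    have k': "\<And>j. PL 3 (velocity (u t) j)" "\<And>j. n3 (velocity (u t) j) \<le> K * N t"
      "\<And>j h. n3 (\<lambda>x. velocity (u t) j (x - h) - velocity (u t) j x) \<le> K * N t * norm h" using k by blast+
    have d: "\<And>m x. (\<Sum>j\<in>UNIV. conv (vp m) (gradient (u t) j j) x) = 0" using elim(3) by blast
    note R = regularized_balance[OF H q b k' d, of \<alpha>]
    show ?case unfolding F_def E_def e[symmetric] using R by blast
  qed
  \<comment> \<open>The dominating function is the cube of the Besov norm, integrable by the hypothesis on \<open>u\<close>.\<close>
  have I0: "(\<lambda>m. LINT t|time T. \<bar>F m t\<bar>) \<longlonglongrightarrow> (LINT t|time T. 0)"
  proof (rule integral_dominated_convergence[where w="\<lambda>t. (18 + 900 * \<alpha>\<^sup>2) * K ^ 3 * (N t powr 3)"])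
    show "integrable (time T) (\<lambda>t. (18 + 900 * \<alpha>\<^sup>2) * K ^ 3 * (N t powr 3))" by (rule integrable_mult_right[OF Ni])
    show "(\<lambda>t. \<bar>F m t\<bar>) \<in> borel_measurable (time T)" for m using Fi[of m] by simp
    show "AE t in time T. (\<lambda>m. \<bar>F m t\<bar>) \<longlonglongrightarrow> 0" using lim by eventually_elim (simp add: tendsto_rabs_zero_iff)
    show "AE t in time T. norm \<bar>F m t\<bar> \<le> (18 + 900 * \<alpha>\<^sup>2) * K ^ 3 * (N t powr 3)" for m using lim by eventually_elim simp
  qed simp
  have "AE t in time T. \<forall>m. E m t = c m + 2 * indef T (F m) t" unfolding AE_all_countable using c by blast
  then have good: "AE t in time T. u t \<in> H1 \<and> (\<forall>m. E m t = c m + 2 * indef T (F m) t) \<and> (\<lambda>m. E m t) \<longlonglongrightarrow> (H1_norm \<alpha> (u t))\<^sup>2"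
    using lim solution_AE[OF sol] by eventually_elim blast
  have eq: "H1_norm \<alpha> (u t1) = H1_norm \<alpha> (u t2)"
    if t1: "u t1 \<in> H1 \<and> (\<forall>m. E m t1 = c m + 2 * indef T (F m) t1) \<and> (\<lambda>m. E m t1) \<longlonglongrightarrow> (H1_norm \<alpha> (u t1))\<^sup>2"
      and t2: "u t2 \<in> H1 \<and> (\<forall>m. E m t2 = c m + 2 * indef T (F m) t2) \<and> (\<lambda>m. E m t2) \<longlonglongrightarrow> (H1_norm \<alpha> (u t2))\<^sup>2" for t1 t2
  proof -
    \<comment> \<open>The constants \<open>c m\<close> need not converge; they cancel in the difference of two times.\<close>
    have b: "\<bar>E m t1 - E m t2\<bar> \<le> 4 * (LINT t|time T. \<bar>F m t\<bar>)" for m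
      using indef_bound[OF Fi[of m], of t1] indef_bound[OF Fi[of m], of t2] spec[OF conjunct1[OF conjunct2[OF t1]], of m] spec[OF conjunct1[OF conjunct2[OF t2]], of m] by linarith
    have z: "(\<lambda>m. 4 * (LINT t|time T. \<bar>F m t\<bar>)) \<longlonglongrightarrow> 0" using tendsto_mult_left[OF I0, of 4] by simp
    have "(\<lambda>m. E m t1 - E m t2) \<longlonglongrightarrow> 0" by (rule Lim_null_comparison[OF _ z]) (simp add: b)
    moreover have "(\<lambda>m. E m t1 - E m t2) \<longlonglongrightarrow> (H1_norm \<alpha> (u t1))\<^sup>2 - (H1_norm \<alpha> (u t2))\<^sup>2" using t1 t2 by (intro tendsto_diff) blast+
    ultimately have "(H1_norm \<alpha> (u t1))\<^sup>2 - (H1_norm \<alpha> (u t2))\<^sup>2 = 0" by (rule LIMSEQ_unique[symmetric])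
    then show ?thesis using H1_norm_square(2) t1 t2 by (simp add: power2_eq_iff_nonneg)
  qed
  show ?thesis
    using good
  proof eventually_elim
    case (elim t1)
    show ?case using good by eventually_elim (rule eq[OF elim])
  qed
qed

end
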